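(* For every positive integer $n$, there exists a finitely presented group $\Gamma_n$ whose residual finiteness depth is $\mathrm{Depth}_{RF}(\Gamma_n)=\omega\cdot n$, and a finitely presented group $M_n$ whose residual finiteness depth is $\mathrm{Depth}_{RF}(M_n)=\omega\cdot n+1$.
   Context: Let $\alpha$ be an ordinal. A group $G$ is $\alpha$-residually finite if there exist subgroups $\{G_\beta\}_{\beta\le\alpha}$ of $G$ such that: $G_0=G$ and $G_\alpha=\{1\}$; $G_\gamma\le G_\beta$ whenever $\gamma>\beta$; the index $[G_\beta:G_{\beta+1}]$ is finite for all $\beta<\alpha$; and $G_\lambda=\bigcap_{\beta<\lambda}G_\beta$ for all limit ordinals $\lambda\le\alpha$. If $\alpha$ is the least ordinal such that $G$ is $\alpha$-residually finite, then the residual finiteness depth of $G$ is $\mathrm{Depth}_{RF}(G):=\alpha$ (the depth is undefined if no such $\alpha$ exists). Here $\omega$ is the first infinite ordinal, and sums and products are ordinal sums and products. *)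

theory Defs
  imports "HOL-Algebra.Algebra"
begin

section \<open>Ordinals\<close>

text \<open>
  An ordinal is represented by a well-order relation, up to \<^const>\<open>ordIso\<close>; ordinals are compared
  by \<^const>\<open>ordLeq\<close>.  The ordinal \<open>\<omega>\<close> is \<^const>\<open>natLeq\<close>, and the finite ordinal \<open>n\<close> is
  \<^term>\<open>natLeq_on n\<close>.
\<close>

definition ord_plus :: "'a rel \<Rightarrow> 'b rel \<Rightarrow> ('a + 'b) rel" where
  "ord_plus r s =
     {(Inl x, Inl y) | x y. (x, y) \<in> r} \<union>
     {(Inr x, Inr y) | x y. (x, y) \<in> s} \<union>
     {(Inl x, Inr y) | x y. x \<in> Field r \<and> y \<in> Field s}"

text \<open>\<open>r \<cdot> s\<close> consists of \<open>s\<close> copies of \<open>r\<close>: the second coordinate is the most significant one.\<close>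

definition ord_times :: "'a rel \<Rightarrow> 'b rel \<Rightarrow> ('a \<times> 'b) rel" where
  "ord_times r s =
     {((x, u), (y, v)) | x u y v.
        x \<in> Field r \<and> y \<in> Field r \<and> (u, v) \<in> s \<and> (u = v \<longrightarrow> (x, y) \<in> r)}"

lemma Well_orderI:
  assumes "Refl r" "trans r" "antisym r" "Total r"
    and "wf (r - Id)"
  shows "Well_order r"
  using assms unfolding order_on_defs by (auto simp: FieldI1 FieldI2)

lemma Well_order_ord_plus:
  assumes "Well_order r" "Well_order s"
  shows "Well_order (ord_plus r s)"
proof (rule Well_orderI)
  interpret r: wo_rel r using assms by (simp add: wo_rel_def)
  interpret s: wo_rel s using assms by (simp add: wo_rel_def)
  have F: "Field (ord_plus r s) = Inl ` Field r \<union> Inr ` Field s"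
  proof
    show "Field (ord_plus r s) \<subseteq> Inl ` Field r \<union> Inr ` Field s"
      by (auto simp: ord_plus_def Field_def)
    have "(Inl x, Inl x) \<in> ord_plus r s" if "x \<in> Field r" for x
      using that r.REFL by (simp add: ord_plus_def refl_on_def)
    moreover have "(Inr x, Inr x) \<in> ord_plus r s" if "x \<in> Field s" for x
      using that s.REFL by (simp add: ord_plus_def refl_on_def)
    ultimately show "Inl ` Field r \<union> Inr ` Field s \<subseteq> Field (ord_plus r s)"
      by (auto intro: FieldI1)
  qed
  show "Refl (ord_plus r s)"
    unfolding refl_on_def F using r.REFL s.REFL by (auto simp: ord_plus_def refl_on_def)
  show "trans (ord_plus r s)"
    using r.TRANS s.TRANS unfolding trans_def ord_plus_def
    by (auto intro: FieldI1 FieldI2)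
  show "antisym (ord_plus r s)"
    using r.ANTISYM s.ANTISYM unfolding antisym_def ord_plus_def by auto
  show "Total (ord_plus r s)"
    unfolding total_on_def F
  proof (intro ballI impI)
    fix p q assume "p \<in> Inl ` Field r \<union> Inr ` Field s" "q \<in> Inl ` Field r \<union> Inr ` Field s"
    then show "(p, q) \<in> ord_plus r s \<or> (q, p) \<in> ord_plus r s"
      using r.TOTALS s.TOTALS by (cases p; cases q) (auto simp: ord_plus_def)
  qed
  show "wf (ord_plus r s - Id)"
  proof (rule wfI_min)
    fix x :: "'a + 'b" and Q assume "x \<in> Q"
    show "\<exists>z\<in>Q. \<forall>y. (y, z) \<in> ord_plus r s - Id \<longrightarrow> y \<notin> Q"
    proof (cases "\<exists>a. Inl a \<in> Q")
      case True
      then obtain a where "a \<in> Inl -` Q" by auto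
      then obtain z where "z \<in> Inl -` Q" "\<And>y. (y, z) \<in> r - Id \<Longrightarrow> y \<notin> Inl -` Q"
        using wfE_min[OF r.WF] by metis
      then show ?thesis by (intro bexI[of _ "Inl z"]) (auto simp: ord_plus_def)
    next
      case False
      then obtain a where "a \<in> Inr -` Q" using \<open>x \<in> Q\<close> by (cases x) auto
      then obtain z where "z \<in> Inr -` Q" "\<And>y. (y, z) \<in> s - Id \<Longrightarrow> y \<notin> Inr -` Q"
        using wfE_min[OF s.WF] by metis
      then show ?thesis using False by (intro bexI[of _ "Inr z"]) (auto simp: ord_plus_def)
    qed
  qed
qed

lemma Well_order_ord_times:
  assumes "Well_order r" "Well_order s"
  shows "Well_order (ord_times r s)"
proof (rule Well_orderI)
  interpret r: wo_rel r using assms by (simp add: wo_rel_def)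
  interpret s: wo_rel s using assms by (simp add: wo_rel_def)
  have F: "Field (ord_times r s) = Field r \<times> Field s"
  proof
    show "Field (ord_times r s) \<subseteq> Field r \<times> Field s"
      by (auto simp: ord_times_def Field_def)
    have "(z, z) \<in> ord_times r s" if "z \<in> Field r \<times> Field s" for z
      using that r.REFL s.REFL by (auto simp: ord_times_def refl_on_def)
    then show "Field r \<times> Field s \<subseteq> Field (ord_times r s)"
      by (meson FieldI1 subsetI)
  qed
  show "Refl (ord_times r s)"
    unfolding refl_on_def F using r.REFL s.REFL by (auto simp: ord_times_def refl_on_def)
  show "trans (ord_times r s)"
  proof (rule transI)
    fix p q t assume "(p, q) \<in> ord_times r s" "(q, t) \<in> ord_times r s"
    then obtain x u y v z w where p: "p = (x, u)" "q = (y, v)" "t = (z, w)"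
      and *: "x \<in> Field r" "z \<in> Field r" "(u, v) \<in> s" "(v, w) \<in> s"
        "u = v \<Longrightarrow> (x, y) \<in> r" "v = w \<Longrightarrow> (y, z) \<in> r"
      unfolding ord_times_def by auto
    have "(u, w) \<in> s" using * s.TRANS by (meson transD)
    moreover have "(x, z) \<in> r" if "u = w"
    proof -
      have "u = v" "v = w" using * that s.ANTISYM by (metis antisymD)+
      then show ?thesis using * r.TRANS by (meson transD)
    qed
    ultimately show "(p, t) \<in> ord_times r s" using * p by (simp add: ord_times_def)
  qed
  show "antisym (ord_times r s)"
  proof (rule antisymI)
    fix p q assume "(p, q) \<in> ord_times r s" "(q, p) \<in> ord_times r s"
    then obtain x u y v where p: "p = (x, u)" "q = (y, v)"
      and *: "(u, v) \<in> s" "(v, u) \<in> s" "u = v \<Longrightarrow> (x, y) \<in> r" "v = u \<Longrightarrow> (y, x) \<in> r"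
      unfolding ord_times_def by auto
    have "u = v" using * s.ANTISYM by (metis antisymD)
    then show "p = q" using * p r.ANTISYM by (metis antisymD)
  qed
  show "Total (ord_times r s)"
    unfolding total_on_def F
  proof (intro ballI impI)
    fix p q assume pq: "p \<in> Field r \<times> Field s" "q \<in> Field r \<times> Field s"
    obtain x u y v where p: "p = (x, u)" "q = (y, v)" by fastforce
    have "(u, v) \<in> s \<or> (v, u) \<in> s" "(x, y) \<in> r \<or> (y, x) \<in> r"
      using pq p r.TOTALS s.TOTALS by auto
    then show "(p, q) \<in> ord_times r s \<or> (q, p) \<in> ord_times r s"
      using pq p by (auto simp: ord_times_def)
  qed
  have "ord_times r s - Id \<subseteq> inv_image ((s - Id) <*lex*> (r - Id)) prod.swap"
    by (auto simp: ord_times_def)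
  then show "wf (ord_times r s - Id)"
    using r.WF s.WF by (meson wf_inv_image wf_lex_prod wf_subset)
qed


section \<open>Residual finiteness depth\<close>

text \<open>
  The ordinals \<open>\<beta> \<le> \<alpha>\<close> correspond to the initial segments of a well-order \<open>r\<close> of type \<open>\<alpha>\<close>
  (\<^term>\<open>ofilter r A\<close>): \<open>0\<close> is \<^term>\<open>{}\<close>, \<open>\<alpha>\<close> is \<^term>\<open>Field r\<close>, and inclusion is the order.
  The pairs \<open>(\<beta>, \<beta> + 1)\<close> with \<open>\<beta> < \<alpha>\<close> are the pairs \<^term>\<open>(underS r x, under r x)\<close> with
  \<^term>\<open>x \<in> Field r\<close>.  A limit ordinal is one that is neither \<open>0\<close> nor a successor.
\<close>

definition limit_segment :: "'b rel \<Rightarrow> 'b set \<Rightarrow> bool" where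
  "limit_segment r A \<longleftrightarrow> ofilter r A \<and> A \<noteq> {} \<and> (\<forall>x\<in>Field r. A \<noteq> under r x)"

definition ord_residually_finite :: "('a, 'm) monoid_scheme \<Rightarrow> 'b rel \<Rightarrow> bool" where
  "ord_residually_finite G r \<longleftrightarrow> Well_order r \<and>
     (\<exists>H :: 'b set \<Rightarrow> 'a set.
        (\<forall>A. ofilter r A \<longrightarrow> subgroup (H A) G) \<and>
        H {} = carrier G \<and>
        H (Field r) = {\<one>\<^bsub>G\<^esub>} \<and>
        (\<forall>A B. ofilter r A \<longrightarrow> ofilter r B \<longrightarrow> A \<subset> B \<longrightarrow> H B \<subseteq> H A) \<and>
        (\<forall>x\<in>Field r. finite (rcosets\<^bsub>G\<lparr>carrier := H (underS r x)\<rparr>\<^esub> (H (under r x)))) \<and>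
        (\<forall>A. limit_segment r A \<longrightarrow> H A = (\<Inter>B\<in>{B. ofilter r B \<and> B \<subset> A}. H B)))"

text \<open>
  Minimality only quantifies over well-orders on the type of \<open>r\<close>; this is no restriction, as every
  ordinal below \<open>r\<close> is the order type of an initial segment of \<open>r\<close>.  See \<open>has_RF_depth_least\<close>.
\<close>

definition has_RF_depth :: "('a, 'm) monoid_scheme \<Rightarrow> 'b rel \<Rightarrow> bool" where
  "has_RF_depth G r \<longleftrightarrow> ord_residually_finite G r \<and>
     (\<forall>s :: 'b rel. ord_residually_finite G s \<longrightarrow> r \<le>o s)"

lemma ord_residually_finite_ordIso:
  assumes "r =o s" "ord_residually_finite G r"
  shows "ord_residually_finite G s"
proof -
  obtain f where W: "Well_order r" "Well_order s" and f: "BNF_Wellorder_Embedding.iso r s f"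
    using assms(1) unfolding ordIso_def by auto
  have bij: "bij_betw f (Field r) (Field s)"
    and ord: "\<And>a b. a \<in> Field r \<Longrightarrow> b \<in> Field r \<Longrightarrow> (a, b) \<in> r \<longleftrightarrow> (f a, f b) \<in> s"
    using f unfolding BNF_Wellorder_Embedding.iso_iff2 by auto
  define g where "g B = {x \<in> Field r. f x \<in> B}" for B
  have inj: "f a = f b \<longleftrightarrow> a = b" if "a \<in> Field r" "b \<in> Field r" for a b
    using bij that unfolding bij_betw_def inj_on_def by blast
  have fin: "f a \<in> Field s" if "a \<in> Field r" for a
    using bij that unfolding bij_betw_def by blast
  have fex: "\<exists>a\<in>Field r. y = f a" if "y \<in> Field s" for y
    using bij that unfolding bij_betw_def by blast
  have fg: "f ` g B = B" if "B \<subseteq> Field s" for B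
    using that fex unfolding g_def by blast
  have gf: "g (f ` A) = A" if "A \<subseteq> Field r" for A
    using that inj unfolding g_def by blast
  have gF: "g (Field s) = Field r" and g0: "g {} = {}"
    using fin unfolding g_def by auto
  have g_under: "g (under s (f x)) = under r x" "g (underS s (f x)) = underS r x"
    if x: "x \<in> Field r" for x
  proof -
    have "a \<in> g (under s (f x)) \<longleftrightarrow> a \<in> under r x" for a
      using x ord[of a x] FieldI1[of a x r] unfolding g_def under_def by auto
    moreover have "a \<in> g (underS s (f x)) \<longleftrightarrow> a \<in> underS r x" for a
      using x ord[of a x] inj[of a x] FieldI1[of a x r] unfolding g_def underS_def by auto
    ultimately show "g (under s (f x)) = under r x" "g (underS s (f x)) = underS r x"
      by blast+
  qed
  have ofg: "ofilter r (g B)" if B: "ofilter s B" for B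
    unfolding ofilter_def
  proof (intro conjI ballI subsetI)
    show "a \<in> Field r" if "a \<in> g B" for a
      using that unfolding g_def by blast
  next
    fix a b assume a: "a \<in> g B" and "b \<in> under r a"
    then have "b \<in> Field r" "(f b, f a) \<in> s"
      using ord[of b a] FieldI1[of b a r] unfolding g_def under_def by auto
    then show "b \<in> g B"
      using a B unfolding g_def ofilter_def under_def by blast
  qed
  have off: "ofilter s (f ` A)" if A: "ofilter r A" for A
    unfolding ofilter_def
  proof (intro conjI ballI subsetI)
    show "y \<in> Field s" if "y \<in> f ` A" for y
      using that A fin unfolding ofilter_def by blast
  next
    fix y z assume "y \<in> f ` A" "z \<in> under s y"
    then obtain a b where "a \<in> A" "y = f a" "b \<in> Field r" "z = f b" "(f b, f a) \<in> s"
      using fex[of z] FieldI1[of z y s] unfolding under_def by blast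
    then show "z \<in> f ` A"
      using A ord unfolding ofilter_def under_def by blast
  qed
  have sub: "B \<subseteq> Field s" if "ofilter s B" for B using that unfolding ofilter_def by blast
  have sub': "A \<subseteq> Field r" if "ofilter r A" for A using that unfolding ofilter_def by blast
  have lim: "limit_segment r (g B)" if B: "limit_segment s B" for B
    unfolding limit_segment_def
  proof (intro conjI ballI)
    show "ofilter r (g B)" using B ofg unfolding limit_segment_def by blast
    have "f ` g B = B" "B \<noteq> {}" using B fg sub unfolding limit_segment_def by auto
    then show "g B \<noteq> {}" by (metis image_is_empty)
    fix x assume "x \<in> Field r"
    show "g B \<noteq> under r x"
    proof
      assume "g B = under r x"
      then have "f ` g B = f ` g (under s (f x))" using g_under \<open>x \<in> Field r\<close> by simp
      moreover have "under s (f x) \<subseteq> Field s" unfolding under_def by (auto intro: FieldI1)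
      ultimately have "B = under s (f x)" using B fg sub unfolding limit_segment_def by simp
      then show False using B fin[OF \<open>x \<in> Field r\<close>] unfolding limit_segment_def by blast
    qed
  qed
  have below: "{A. ofilter r A \<and> A \<subset> g B} = g ` {C. ofilter s C \<and> C \<subset> B}" if "ofilter s B" for B
  proof (intro equalityI subsetI)
    fix A assume "A \<in> {A. ofilter r A \<and> A \<subset> g B}"
    then have A: "ofilter r A" "A \<subset> g B" by auto
    then have "f ` A \<subseteq> B" unfolding g_def by blast
    moreover have "f ` A \<noteq> B" using A gf[OF sub'[OF A(1)]] by blast
    ultimately show "A \<in> g ` {C. ofilter s C \<and> C \<subset> B}"
      using off[OF A(1)] gf[OF sub'[OF A(1)]] by (intro image_eqI[of _ _ "f ` A"]) auto
  next
    fix A assume "A \<in> g ` {C. ofilter s C \<and> C \<subset> B}"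
    then obtain C where C: "A = g C" "ofilter s C" "C \<subset> B" by auto
    have "g C \<subseteq> g B" using C(3) unfolding g_def by blast
    moreover have "g C \<noteq> g B" using C fg[OF sub] that by (metis psubset_eq)
    ultimately show "A \<in> {A. ofilter r A \<and> A \<subset> g B}" using C ofg by blast
  qed
  obtain H where H0: "\<forall>A. ofilter r A \<longrightarrow> subgroup (H A) G"
    "H {} = carrier G" "H (Field r) = {\<one>\<^bsub>G\<^esub>}"
    "\<forall>A B. ofilter r A \<longrightarrow> ofilter r B \<longrightarrow> A \<subset> B \<longrightarrow> H B \<subseteq> H A"
    "\<forall>x\<in>Field r.
       finite (rcosets\<^bsub>G\<lparr>carrier := H (underS r x)\<rparr>\<^esub> (H (under r x)))"
    "\<forall>A. limit_segment r A \<longrightarrow> H A = (\<Inter>B\<in>{B. ofilter r B \<and> B \<subset> A}. H B)"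
    using assms(2) unfolding ord_residually_finite_def by (elim exE conjE) (rule that)
  note H = H0[rule_format]
  show ?thesis
    unfolding ord_residually_finite_def
  proof (intro conjI exI[of _ "\<lambda>B. H (g B)"] allI impI ballI)
    show "H (g B) \<subseteq> H (g A)" if "ofilter s A" "ofilter s B" "A \<subset> B" for A B
    proof (cases "g A = g B")
      case False
      then show ?thesis using that ofg H(4) unfolding g_def by blast
    qed simp
    show "finite (rcosets\<^bsub>G\<lparr>carrier := H (g (underS s y))\<rparr>\<^esub> (H (g (under s y))))"
      if "y \<in> Field s" for y
      using fex[OF that] g_under H(5) by auto
    show "H (g B) = (\<Inter>C\<in>{C. ofilter s C \<and> C \<subset> B}. H (g C))" if "limit_segment s B" for B
    proof -
      have "H (g B) = \<Inter> (H ` {A. ofilter r A \<and> A \<subset> g B})" using H(6)[OF lim[OF that]] .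
      also have "\<dots> = \<Inter> (H ` g ` {C. ofilter s C \<and> C \<subset> B})"
        using below that unfolding limit_segment_def by simp
      finally show ?thesis by (simp add: image_image)
    qed
  qed (use W H(1-3) ofg gF g0 in auto)
qed

lemma has_RF_depth_least:
  fixes r :: "'b rel" and s :: "'c rel"
  assumes "has_RF_depth G r" "ord_residually_finite G s"
  shows "r \<le>o s"
proof (rule ccontr)
  assume nle: "\<not> r \<le>o s"
  have W: "Well_order r" "Well_order s"
    using assms unfolding has_RF_depth_def ord_residually_finite_def by auto
  then have "s <o r"
    using nle by (meson ordLess_or_ordLeq)
  then obtain a where a: "s =o Restr r (underS r a)"
    using W ordLess_iff_ordIso_Restr by blast
  then have "ord_residually_finite G (Restr r (underS r a))"
    using assms(2) ord_residually_finite_ordIso by blast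
  then have "r \<le>o Restr r (underS r a)"
    using assms(1) unfolding has_RF_depth_def by blast
  then show False
    using a nle by (meson ordIso_symmetric ordLeq_ordIso_trans)
qed


section \<open>Finitely presented groups\<close>

text \<open>
  A letter \<open>(x, True)\<close> stands for the generator \<open>x\<close>, and \<open>(x, False)\<close> for its inverse.  Elements of
  the free group are reduced words, multiplied by concatenation followed by cancellation.
\<close>

type_synonym 'x word = "('x \<times> bool) list"

definition inv_letter :: "'x \<times> bool \<Rightarrow> 'x \<times> bool" where
  "inv_letter l = (fst l, \<not> snd l)"

definition reduced :: "'x word \<Rightarrow> bool" where
  "reduced w \<longleftrightarrow> (\<forall>i. Suc i < length w \<longrightarrow> w ! Suc i \<noteq> inv_letter (w ! i))"

fun cons_letter :: "'x \<times> bool \<Rightarrow> 'x word \<Rightarrow> 'x word" where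
  "cons_letter l [] = [l]"
| "cons_letter l (m # w) = (if m = inv_letter l then w else l # m # w)"

definition free_group :: "'x set \<Rightarrow> 'x word monoid" where
  "free_group S =
     \<lparr>carrier = {w. reduced w \<and> fst ` set w \<subseteq> S},
      monoid.mult = foldr cons_letter,
      one = []\<rparr>"

definition normal_closure :: "('a, 'm) monoid_scheme \<Rightarrow> 'a set \<Rightarrow> 'a set" where
  "normal_closure G R = \<Inter>{N. N \<lhd> G \<and> R \<subseteq> N}"

definition presented_group :: "'x set \<Rightarrow> 'x word set \<Rightarrow> 'x word set monoid" where
  "presented_group S R = free_group S Mod normal_closure (free_group S) R"

text \<open>A finite set of generators may be taken to consist of natural numbers.\<close>

definition finitely_presented :: "('a, 'm) monoid_scheme \<Rightarrow> bool" where
  "finitely_presented G \<longleftrightarrow>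
     (\<exists>(S :: nat set) R. finite S \<and> finite R \<and> R \<subseteq> carrier (free_group S) \<and>
        G \<cong> presented_group S R)"

lemma inv_letter_inv [simp]: "inv_letter (inv_letter l) = l"
  by (simp add: inv_letter_def)

lemma fst_inv_letter [simp]: "fst (inv_letter l) = fst l"
  by (simp add: inv_letter_def)

lemma inv_letter_neq [simp]: "inv_letter l \<noteq> l" "l \<noteq> inv_letter l"
  by (cases l; simp add: inv_letter_def)+

lemma reduced_Nil [simp]: "reduced []"
  by (simp add: reduced_def)

lemma reduced_Cons:
  "reduced (l # w) \<longleftrightarrow> reduced w \<and> (w \<noteq> [] \<longrightarrow> hd w \<noteq> inv_letter l)"
  unfolding reduced_def by (cases w) (auto simp: nth_Cons split: nat.splits)

lemma reduced_cons_letter: "reduced w \<Longrightarrow> reduced (cons_letter l w)"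
  by (cases w) (auto simp: reduced_Cons)

lemma cons_letter_cancel:
  assumes "reduced w"
  shows "cons_letter l (cons_letter (inv_letter l) w) = w"
proof (cases w)
  case (Cons m v)
  then show ?thesis using assms by (cases v) (auto simp: reduced_Cons)
qed simp

lemma reduced_foldr: "reduced v \<Longrightarrow> reduced (foldr cons_letter u v)"
  by (induction u) (auto intro: reduced_cons_letter)

lemma set_cons_letter: "set (cons_letter l w) \<subseteq> insert l (set w)"
  by (cases w) auto

lemma set_foldr: "set (foldr cons_letter u v) \<subseteq> set u \<union> set v"
  by (induction u) (use set_cons_letter in fastforce)+

lemma foldr_reduced_Nil: "reduced u \<Longrightarrow> foldr cons_letter u [] = u"
proof (induction u)
  case (Cons l u)
  then show ?case by (cases u) (auto simp: reduced_Cons)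
qed simp

lemma foldr_cons_letter:
  assumes "reduced v" "reduced w"
  shows "foldr cons_letter (cons_letter l v) w = cons_letter l (foldr cons_letter v w)"
  using assms
  by (cases v) (auto simp: reduced_Cons reduced_foldr cons_letter_cancel)

lemma foldr_assoc:
  assumes "reduced v" "reduced w"
  shows "foldr cons_letter (foldr cons_letter u v) w = foldr cons_letter u (foldr cons_letter v w)"
  using assms by (induction u) (auto simp: foldr_cons_letter reduced_foldr)

lemma foldr_inverse:
  "reduced w \<Longrightarrow> foldr cons_letter (rev (map inv_letter u)) (foldr cons_letter u w) = w"
proof (induction u)
  case (Cons l u)
  then show ?case
    using cons_letter_cancel[of "foldr cons_letter u w" "inv_letter l"] by (simp add: reduced_foldr)
qed simp

lemma group_free_group: "group (free_group S)"
proof (rule groupI)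
  fix u assume u: "u \<in> carrier (free_group S)"
  define v where "v = foldr cons_letter (rev (map inv_letter u)) []"
  have "set v \<subseteq> inv_letter ` set u"
    using set_foldr[of "rev (map inv_letter u)" "[]"] by (simp add: v_def)
  then have "fst ` set v \<subseteq> fst ` inv_letter ` set u"
    by (rule image_mono)
  then have "fst ` set v \<subseteq> fst ` set u"
    by (simp add: image_image)
  then have "fst ` set v \<subseteq> S"
    using u by (auto simp: free_group_def)
  moreover have "foldr cons_letter v u = []"
    using u foldr_inverse[of "[]" u] foldr_assoc[of "[]" u "rev (map inv_letter u)"]
    by (simp add: v_def free_group_def foldr_reduced_Nil)
  ultimately show "\<exists>v\<in>carrier (free_group S). v \<otimes>\<^bsub>free_group S\<^esub> u = \<one>\<^bsub>free_group S\<^esub>"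
    by (intro bexI[of _ v]) (auto simp: free_group_def v_def reduced_foldr)
next
  fix u v assume "u \<in> carrier (free_group S)" "v \<in> carrier (free_group S)"
  then show "u \<otimes>\<^bsub>free_group S\<^esub> v \<in> carrier (free_group S)"
    using set_foldr[of u v] by (fastforce simp: free_group_def reduced_foldr)
qed (simp_all add: free_group_def foldr_assoc)

end

theory Submission
  imports Defs "HOL-Library.Countable_Set"
begin

text \<open>
  Let \<open>FR G\<close> be the intersection of the subgroups of finite index of \<open>G\<close>, and \<open>FRn G n\<close> its \<open>n\<close>-th
  iterate.  A countable group \<open>G\<close> has depth \<open>\<omega> \<cdot> n\<close> if \<open>FRn G n\<close> is trivial and \<open>FRn G (n - 1)\<close> is
  infinite, and depth \<open>\<omega> \<cdot> n + 1\<close> if \<open>FRn G n\<close> is finite and nontrivial.  So it is enough to find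
  a finitely presented group \<open>M\<close> with a central involution \<open>f\<close> in \<open>FRn M n\<close> such that
  \<open>FRn (M / \<langle>f\<rangle>) n\<close> is trivial.  This is done by induction, starting with the group of order 2.

  Let \<open>D = \<langle>d\<^sub>i\<rangle>\<close> and \<open>f\<close> be given for \<open>n\<close>.  Let \<open>A\<^sub>1\<close> be generated freely by \<open>a\<^sub>1, t\<^sub>1, b\<^sub>1, c\<^sub>1\<close> up to
  \<open>t\<^sub>1 a\<^sub>1 = a\<^sub>1\<^sup>2 t\<^sub>1\<close>, and \<open>A\<^sub>2\<close> by \<open>a\<^sub>2, t\<^sub>2, b\<^sub>2, c\<^sub>2\<close> up to \<open>t\<^sub>2 b\<^sub>2 = b\<^sub>2\<^sup>2 t\<^sub>2\<close>.  Adjoin \<open>A\<^sub>1 \<times> A\<^sub>2\<close> and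
  letters \<open>u\<^sub>i\<^sub>\<beta>\<close> for \<open>\<beta>\<close> in \<open>(\<int>/2)\<^sup>2\<close> to \<open>D\<close>, and let \<open>a\<^sub>1 a\<^sub>2\<close>, \<open>b\<^sub>1 b\<^sub>2\<close> and \<open>y = c\<^sub>1 c\<^sub>2\<close> commute with
  the \<open>d\<^sub>i\<close> and act on the \<open>u\<^sub>i\<^sub>\<beta>\<close>: the first two flip the bits of \<open>\<beta>\<close>, and \<open>y\<close> maps \<open>u\<^sub>i\<^sub>0\<^sub>0\<close> to
  \<open>u\<^sub>i\<^sub>0\<^sub>0 d\<^sub>i\<close> and fixes the others.  In a finite quotient \<open>a\<^sub>1\<close> and \<open>b\<^sub>2\<close> have odd orders \<open>m\<close> and \<open>m'\<close>, so
  \<open>z = [y, (a\<^sub>1 a\<^sub>2)\<^sup>m] = [c\<^sub>2, a\<^sub>2\<^sup>m]\<close> lies in the image of \<open>A\<^sub>2\<close> and commutes with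
  \<open>(b\<^sub>1 b\<^sub>2)\<^sup>m' = b\<^sub>1\<^sup>m'\<close>, which flips the second bit.  But \<open>z\<close> maps \<open>u\<^sub>i\<^sub>0\<^sub>0\<close> to \<open>u\<^sub>i\<^sub>0\<^sub>0 d\<^sub>i\<close> and fixes
  \<open>u\<^sub>i\<^sub>0\<^sub>1\<close>, so \<open>d\<^sub>i = 1\<close>.  Hence \<open>D\<close> is mapped into the finite residual, and \<open>f\<close> into the iterate
  \<open>n + 1\<close>.  In the other direction, the new group modulo \<open>f\<close> embeds in the wreath product of a free
  product of copies of \<open>D / \<langle>f\<rangle>\<close> and of \<open>\<int>\<close> by the residually finite group \<open>A\<^sub>1 \<times> A\<^sub>2\<close>.
\<close>

section \<open>Finite residuals\<close>

text \<open>The diagonal subgroup \<open>CG\<close> of A_1 x A_2 is free of rank 3, so its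
  generators can act on the letters in any way. The relations t a = a^2 t bind only in finite
  quotients, where an odd power of a diagonal element falls into one of the two factors. Two such
  relations point to different factors so that the resulting elements commute, and the flips have
  order 2 so that an odd power still flips.

  The upper bound meets two obstacles. A free product must not be deeper than its factors; this is
  itself an embedding in a wreath product, of a free product of finite residuals by a residually
  finite free product. And the letters u generate infinite cyclic groups, so that the base of the
  final wreath product has a nontrivial \<open>FRn\<close> at 0 even if D / <f> is trivial. The
  wreath product therefore yields n + 1 only for n > 0. For n = 0 residual finiteness is proved by
  identifying letters modulo a finite index subgroup of A_1 x A_2; this is where it matters that
  \<open>CG\<close> is closed in the profinite topology and that the flips extend to a finite
  quotient of A_1 x A_2.\<close>

definition fin_idx :: "('a, 'm) monoid_scheme \<Rightarrow> 'a set \<Rightarrow> bool" where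
  "fin_idx G K \<longleftrightarrow> subgroup K G \<and> finite (rcosets\<^bsub>G\<^esub> K)"

definition FR :: "('a, 'm) monoid_scheme \<Rightarrow> 'a set" where
  "FR G = {x \<in> carrier G. \<forall>K. fin_idx G K \<longrightarrow> x \<in> K}"

primrec FRn :: "('a, 'm) monoid_scheme \<Rightarrow> nat \<Rightarrow> 'a set" where
  "FRn G 0 = carrier G"
| "FRn G (Suc n) = FR (G\<lparr>carrier := FRn G n\<rparr>)"

lemma RCOSETS_image: "rcosets\<^bsub>G\<^esub> K = (\<lambda>x. K #>\<^bsub>G\<^esub> x) ` carrier G"
  by (auto simp: RCOSETS_def)

text \<open>Finite index is handled through colourings: maps with finitely many values on
  \<open>G\<close> whose classes lie inside right cosets of \<open>K\<close>. Intersections,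
  preimages, images and towers of subgroups then amount to combining colourings.\<close>

lemma fin_idxI:
  fixes G (structure)
  assumes "group G" "subgroup K G" "finite (f ` carrier G)"
    and "\<And>x y. x \<in> carrier G \<Longrightarrow> y \<in> carrier G \<Longrightarrow> f x = f y \<Longrightarrow> x \<otimes>\<^bsub>G\<^esub> inv\<^bsub>G\<^esub> y \<in> K"
  shows "fin_idx G K"
proof -
  interpret group G by fact
  have eq: "K #> x = K #> y" if "x \<in> carrier G" "y \<in> carrier G" "f x = f y" for x y
  proof -
    have "x \<in> K #> y"
      using that assms by (auto intro: subgroup.rcos_module_rev)
    then show ?thesis
      using repr_independence[of x K y] that assms(2) by simp
  qed
  define g where "g = (\<lambda>c. K #> (SOME x. x \<in> carrier G \<and> f x = c))"
  have "rcosets K \<subseteq> g ` f ` carrier G"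
  proof
    fix c assume "c \<in> rcosets K"
    then obtain x where x: "x \<in> carrier G" "c = K #> x"
      unfolding RCOSETS_def by auto
    then have "(SOME y. y \<in> carrier G \<and> f y = f x) \<in> carrier G \<and>
        f (SOME y. y \<in> carrier G \<and> f y = f x) = f x"
      by (intro someI[of "\<lambda>y. y \<in> carrier G \<and> f y = f x" x]) auto
    then have "c = g (f x)"
      unfolding g_def x(2) using x(1) by (intro eq) simp_all
    then show "c \<in> g ` f ` carrier G" using x by blast
  qed
  then have "finite (rcosets K)"
    using assms(3) by (meson finite_imageI finite_subset)
  then show ?thesis
    unfolding fin_idx_def using assms(2) by simp
qed

text \<open>The colouring is the coset map itself, coded by natural numbers.\<close>

lemma fin_idxE:
  fixes G (structure)
  assumes "group G" "fin_idx G K"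
  obtains f :: "'a \<Rightarrow> nat" where "finite (f ` carrier G)"
    and "\<And>x y. x \<in> carrier G \<Longrightarrow> y \<in> carrier G \<Longrightarrow> f x = f y \<Longrightarrow> x \<otimes>\<^bsub>G\<^esub> inv\<^bsub>G\<^esub> y \<in> K"
proof -
  interpret group G by fact
  have fin: "finite (rcosets K)" using assms by (simp add: fin_idx_def)
  then obtain e :: "'a set \<Rightarrow> nat" where e: "inj_on e (rcosets K)"
    using finite_imp_inj_to_nat_seg by metis
  show ?thesis
  proof (rule that[of "\<lambda>x. e (K #> x)"])
    show "finite ((\<lambda>x. e (K #> x)) ` carrier G)"
      using finite_imageI[OF fin, of e] by (simp add: RCOSETS_image image_image)
    fix x y assume xy: "x \<in> carrier G" "y \<in> carrier G" "e (K #> x) = e (K #> y)"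
    have K: "subgroup K G" using assms by (simp add: fin_idx_def)
    have "K #> x = K #> y"
      using e xy by (auto simp: RCOSETS_image dest: inj_onD)
    then have "x \<in> K #> y"
      using rcos_self[OF xy(1) K] by simp
    then show "x \<otimes> inv y \<in> K"
      using subgroup.rcos_module_imp[OF K group_axioms xy(2)] by simp
  qed
qed

lemma fin_idx_subgroup: "fin_idx G K \<Longrightarrow> subgroup K G"
  by (simp add: fin_idx_def)

section \<open>Operations on subgroups of finite index\<close>

lemma fin_idx_preimage:
  fixes G (structure)
  assumes "group_hom G H h" "fin_idx H K"
  shows "fin_idx G {x \<in> carrier G. h x \<in> K}"
proof -
  interpret group_hom G H h by fact
  obtain f :: "_ \<Rightarrow> nat" where f: "finite (f ` carrier H)"
    "\<And>x y. x \<in> carrier H \<Longrightarrow> y \<in> carrier H \<Longrightarrow> f x = f y \<Longrightarrow> x \<otimes>\<^bsub>H\<^esub> inv\<^bsub>H\<^esub> y \<in> K"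
    using fin_idxE[OF H.group_axioms assms(2)] by blast
  interpret K: subgroup K H using assms(2) by (rule fin_idx_subgroup)
  show ?thesis
  proof (rule fin_idxI[where f = "\<lambda>x. f (h x)"])
    show "subgroup {x \<in> carrier G. h x \<in> K} G"
      by (rule G.subgroupI) (auto intro: exI[of _ "\<one>"])
    show "finite ((\<lambda>x. f (h x)) ` carrier G)"
      by (rule finite_subset[OF _ f(1)]) auto
  qed (use f(2) in auto)
qed

lemma fin_idx_Int:
  fixes G (structure)
  assumes "group G" "fin_idx G K" "fin_idx G L"
  shows "fin_idx G (K \<inter> L)"
proof -
  interpret group G by fact
  obtain f :: "_ \<Rightarrow> nat" where f: "finite (f ` carrier G)"
    "\<And>x y. x \<in> carrier G \<Longrightarrow> y \<in> carrier G \<Longrightarrow> f x = f y \<Longrightarrow> x \<otimes> inv y \<in> K"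
    using fin_idxE[OF assms(1,2)] by blast
  obtain g :: "_ \<Rightarrow> nat" where g: "finite (g ` carrier G)"
    "\<And>x y. x \<in> carrier G \<Longrightarrow> y \<in> carrier G \<Longrightarrow> g x = g y \<Longrightarrow> x \<otimes> inv y \<in> L"
    using fin_idxE[OF assms(1,3)] by blast
  show ?thesis
  proof (rule fin_idxI[where f = "\<lambda>x. (f x, g x)"])
    show "subgroup (K \<inter> L) G"
      using assms fin_idx_subgroup subgroups_Inter_pair by blast
    show "finite ((\<lambda>x. (f x, g x)) ` carrier G)"
      by (rule finite_subset[of _ "f ` carrier G \<times> g ` carrier G"]) (use f g in auto)
  qed (use f g assms in auto)
qed

lemma fin_idx_carrier: "group G \<Longrightarrow> fin_idx G (carrier G)"
  by (rule fin_idxI[where f = "\<lambda>_. ()"])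
    (auto simp: group.subgroup_self group.is_monoid intro!: monoid.m_closed)

lemma fin_idx_INT:
  assumes "group G" "finite I" "\<And>i. i \<in> I \<Longrightarrow> fin_idx G (K i)"
  shows "fin_idx G (carrier G \<inter> (\<Inter>i\<in>I. K i))"
  using assms(2,3)
proof (induction I rule: finite_induct)
  case empty
  then show ?case using fin_idx_carrier[OF assms(1)] by simp
next
  case (insert i I)
  have "carrier G \<inter> (\<Inter>i\<in>insert i I. K i) = K i \<inter> (carrier G \<inter> (\<Inter>i\<in>I. K i))"
    by auto
  then show ?case
    using insert fin_idx_Int[OF assms(1)] by auto
qed

lemma fin_idx_trans:
  fixes G (structure)
  assumes "group G" "fin_idx G K" "fin_idx (G\<lparr>carrier := K\<rparr>) L"
  shows "fin_idx G L"
proof -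
  interpret group G by fact
  interpret K: subgroup K G using assms(2) by (rule fin_idx_subgroup)
  have grK: "group (G\<lparr>carrier := K\<rparr>)" by (simp add: K.subgroup_axioms subgroup_imp_group)
  have "subgroup L (G\<lparr>carrier := K\<rparr>)" using assms(3) by (rule fin_idx_subgroup)
  then have L: "subgroup L G" "L \<subseteq> K"
    using incl_subgroup K.subgroup_axioms subgroup.subset by fastforce+
  obtain f :: "_ \<Rightarrow> nat" where f: "finite (f ` carrier G)"
    "\<And>x y. x \<in> carrier G \<Longrightarrow> y \<in> carrier G \<Longrightarrow> f x = f y \<Longrightarrow> x \<otimes> inv y \<in> K"
    using fin_idxE[OF assms(1,2)] by blast
  obtain g :: "_ \<Rightarrow> nat" where g: "finite (g ` K)"
    "\<And>x y. x \<in> K \<Longrightarrow> y \<in> K \<Longrightarrow> g x = g y \<Longrightarrow> x \<otimes> inv y \<in> L"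
    using fin_idxE[OF grK assms(3)] K.subgroup_axioms by auto
  \<comment> \<open>A representative of each colour class. Since \<open>x\<close> and its
    representative differ by an element of \<open>K\<close>, a colouring of that quotient refines
    the first colouring down to cosets of \<open>L\<close>.\<close>
  define r where "r c = (SOME y. y \<in> carrier G \<and> f y = c)" for c
  have r: "r (f x) \<in> carrier G" "f (r (f x)) = f x" if "x \<in> carrier G" for x
    unfolding r_def using someI[of "\<lambda>y. y \<in> carrier G \<and> f y = f x" x] that by auto
  have rK: "x \<otimes> inv (r (f x)) \<in> K" if "x \<in> carrier G" for x
    using r[OF that] f(2)[of x "r (f x)"] that by simp
  show ?thesis
  proof (rule fin_idxI[where f = "\<lambda>x. (f x, g (x \<otimes> inv (r (f x))))"])
    show "finite ((\<lambda>x. (f x, g (x \<otimes> inv (r (f x))))) ` carrier G)"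
      by (rule finite_subset[of _ "f ` carrier G \<times> g ` K"]) (use f(1) g(1) rK in auto)
    fix x y assume xy: "x \<in> carrier G" "y \<in> carrier G"
      "(f x, g (x \<otimes> inv (r (f x)))) = (f y, g (y \<otimes> inv (r (f y))))"
    let ?r = "r (f x)"
    have "x \<otimes> inv y = (x \<otimes> inv ?r) \<otimes> inv (y \<otimes> inv ?r)"
      using xy r(1)[of x] by (simp add: inv_mult_group m_assoc inv_solve_left)
    moreover have "(x \<otimes> inv ?r) \<otimes> inv (y \<otimes> inv ?r) \<in> L"
      using xy rK[of x] rK[of y] by (intro g(2)) auto
    ultimately show "x \<otimes> inv y \<in> L" by simp
  qed (use L in auto)
qed

lemma fin_idx_finite: "group G \<Longrightarrow> finite (carrier G) \<Longrightarrow> subgroup K G \<Longrightarrow> fin_idx G K"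
  by (rule fin_idxI[where f = id]) (auto simp: group.r_inv subgroup.one_closed)

lemma fin_idx_finite_overgroup:
  fixes G (structure)
  assumes "group G" "fin_idx G K" "finite K"
  shows "finite (carrier G)"
proof -
  interpret group G by fact
  interpret K: subgroup K G using assms(2) by (rule fin_idx_subgroup)
  have "\<Union>(rcosets K) = carrier G" using rcosets_part_G K.subgroup_axioms by blast
  moreover have "finite (K #> x)" for x using assms(3) by (simp add: r_coset_def)
  moreover have "finite (rcosets K)" using assms(2) by (simp add: fin_idx_def)
  ultimately show ?thesis
    by (metis (mono_tags, lifting) RCOSETS_image finite_Union imageE)
qed

text \<open>\<open>N\<close> is the kernel of the action of \<open>G\<close> on the right cosets of
  \<open>K\<close> by right multiplication. A finite set has finitely many self-maps, which bounds
  the index, and fixing the coset \<open>K\<close> forces an element into \<open>K\<close>.\<close>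

lemma fin_idx_normal_core:
  fixes G (structure)
  assumes "group G" "fin_idx G K"
  shows "\<exists>N. N \<lhd> G \<and> fin_idx G N \<and> N \<subseteq> K"
proof -
  interpret group G by fact
  interpret K: subgroup K G using assms(2) by (rule fin_idx_subgroup)
  define N where "N = {g \<in> carrier G. \<forall>C\<in>rcosets K. C #> g = C}"
  have fin: "finite (rcosets K)" using assms by (simp add: fin_idx_def)
  have CG: "C \<subseteq> carrier G" if "C \<in> rcosets K" for C
    using that K.rcosets_carrier[OF group_axioms] by blast
  have Cx: "C #> x \<in> rcosets K" if "C \<in> rcosets K" "x \<in> carrier G" for C x
    using that K.subset unfolding RCOSETS_def by (auto simp: coset_mult_assoc)
  have inv: "C #> inv g = C" if "C #> g = C" "C \<in> rcosets K" "g \<in> carrier G" for C g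
  proof -
    have "C #> inv g = (C #> g) #> inv g" using that by simp
    also have "\<dots> = C #> (g \<otimes> inv g)" 
      using that CG[OF that(2)] by (intro coset_mult_assoc) auto
    also have "\<dots> = C" using that CG[OF that(2)] by simp
    finally show ?thesis .
  qed
  have sub: "subgroup N G"
  proof (rule subgroupI)
    show "N \<noteq> {}" using CG unfolding N_def by (auto intro!: exI[of _ "\<one>"])
    show "inv a \<in> N" if "a \<in> N" for a using that inv unfolding N_def by auto
    show "a \<otimes> b \<in> N" if "a \<in> N" "b \<in> N" for a b
      using that CG unfolding N_def by (auto simp: coset_mult_assoc[symmetric])
  qed (auto simp: N_def)
  have norm: "N \<lhd> G"
    unfolding normal_inv_iff
  proof (intro conjI sub ballI)
    fix x h assume x: "x \<in> carrier G" "h \<in> N"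
    have "C #> (x \<otimes> h \<otimes> inv x) = C" if C: "C \<in> rcosets K" for C
    proof -
      have "C #> (x \<otimes> h \<otimes> inv x) = ((C #> x) #> h) #> inv x"
        using x CG[OF C] by (simp add: coset_mult_assoc N_def m_assoc)
      also have "\<dots> = (C #> x) #> inv x" using x Cx[OF C] by (simp add: N_def)
      also have "\<dots> = C" using x CG[OF C] by (simp add: coset_mult_assoc)
      finally show ?thesis .
    qed
    then show "x \<otimes> h \<otimes> inv x \<in> N" using x by (auto simp: N_def)
  qed
  have "fin_idx G N"
  proof (rule fin_idxI[where f = "\<lambda>g. \<lambda>C\<in>rcosets K. C #> g"])
    show "finite ((\<lambda>g. \<lambda>C\<in>rcosets K. C #> g) ` carrier G)"
      by (rule finite_subset[of _ "rcosets K \<rightarrow>\<^sub>E rcosets K"])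
        (use fin Cx in \<open>auto intro: finite_PiE\<close>)
    fix x y assume xy: "x \<in> carrier G" "y \<in> carrier G"
      "(\<lambda>C\<in>rcosets K. C #> x) = (\<lambda>C\<in>rcosets K. C #> y)"
    have "C #> (x \<otimes> inv y) = C" if C: "C \<in> rcosets K" for C
    proof -
      have "C #> x = C #> y" using xy(3) C by (metis restrict_apply')
      then show ?thesis
        using xy(1,2) CG[OF C] by (simp add: coset_mult_assoc[symmetric]) (simp add: coset_mult_assoc)
    qed
    then show "x \<otimes> inv y \<in> N" using xy by (simp add: N_def)
  qed (use sub in auto)
  moreover have "N \<subseteq> K"
  proof
    fix g assume g: "g \<in> N"
    have "K \<in> rcosets K" using K.subgroup_in_rcosets[OF group_axioms] .
    then have "K #> g = K" using g by (simp add: N_def)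
    then show "g \<in> K" using g rcos_self[of g K] K.subgroup_axioms by (auto simp: N_def)
  qed
  ultimately show ?thesis using norm by blast
qed

section \<open>The finite residual and its iterates\<close>

lemma FR_subgroup: "group G \<Longrightarrow> subgroup (FR G) G"
proof -
  assume gr: "group G"
  interpret group G by fact
  show ?thesis
  proof (rule subgroupI)
    have "\<one>\<^bsub>G\<^esub> \<in> FR G"
      using fin_idx_subgroup subgroup.one_closed by (fastforce simp: FR_def)
    then show "FR G \<noteq> {}" by blast
    show "inv\<^bsub>G\<^esub> a \<in> FR G" if "a \<in> FR G" for a
      using that fin_idx_subgroup subgroup.m_inv_closed by (fastforce simp: FR_def)
    show "a \<otimes>\<^bsub>G\<^esub> b \<in> FR G" if "a \<in> FR G" "b \<in> FR G" for a b
      using that fin_idx_subgroup subgroup.m_closed by (fastforce simp: FR_def)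
  qed (auto simp: FR_def)
qed

lemma FR_subset: "FR G \<subseteq> carrier G"
  by (auto simp: FR_def)

text \<open>Preimages of finite index subgroups have finite index, so the finite residual is
  functorial.\<close>

lemma FR_hom:
  fixes G (structure)
  assumes "group_hom G H h" "x \<in> FR G"
  shows "h x \<in> FR H"
proof -
  interpret group_hom G H h by fact
  show ?thesis
    using assms(2) fin_idx_preimage[OF assms(1)] by (auto simp: FR_def)
qed

lemma FRn_subgroup: "group G \<Longrightarrow> subgroup (FRn G n) G"
proof (induction n)
  case (Suc n)
  interpret group G by fact
  have "subgroup (FRn G n) G" using Suc by simp
  moreover from this have "group (G\<lparr>carrier := FRn G n\<rparr>)" by (rule subgroup_imp_group)
  ultimately show ?case using FR_subgroup incl_subgroup by (metis FRn.simps(2))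
qed (simp add: group.subgroup_self)

lemma FRn_group: "group G \<Longrightarrow> group (G\<lparr>carrier := FRn G n\<rparr>)"
  by (simp add: FRn_subgroup group.subgroup_imp_group)

lemma FRn_antimono: "m \<le> n \<Longrightarrow> FRn G n \<subseteq> FRn G m"
proof (induction rule: dec_induct)
  case (step n)
  have "FRn G (Suc n) \<subseteq> FRn G n" using FR_subset[of "G\<lparr>carrier := FRn G n\<rparr>"] by simp
  then show ?case using step by blast
qed simp

lemma FRn_hom:
  fixes G (structure)
  assumes "group_hom G H h" "x \<in> FRn G n"
  shows "h x \<in> FRn H n"
  using assms(2)
proof (induction n arbitrary: x)
  case 0
  then show ?case using assms(1) by (simp add: group_hom.hom_closed)
next
  case (Suc n)
  interpret group_hom G H h by fact
  have sub: "FRn G n \<subseteq> carrier G" using FRn_subgroup[OF G.group_axioms] subgroup.subset by blast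
  have "group_hom (G\<lparr>carrier := FRn G n\<rparr>) (H\<lparr>carrier := FRn H n\<rparr>) h"
    using sub Suc.IH
    by (auto simp: group_hom_def group_hom_axioms_def FRn_group hom_def subset_iff)
  then show ?case using FR_hom Suc.prems by (metis FRn.simps(2))
qed

text \<open>The recursion of \<open>FRn\<close> takes the new residual last. Arguments that start by
  pushing \<open>FR G\<close> into a kernel or a subgroup need it taken first.\<close>

lemma FRn_Suc': "FRn G (Suc n) = FRn (G\<lparr>carrier := FR G\<rparr>) n"
  by (induction n) auto

lemma FRn_one_closed: "group G \<Longrightarrow> \<one>\<^bsub>G\<^esub> \<in> FRn G n"
  using FRn_subgroup subgroup.one_closed by blast

text \<open>For a countable group this bounds the depth by \<omega> \<cdot> n. It passes to
  subgroups, which makes every upper bound below a matter of embeddings.\<close>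

definition rdepth_le :: "nat \<Rightarrow> ('a, 'm) monoid_scheme \<Rightarrow> bool" where
  "rdepth_le n G \<longleftrightarrow> group G \<and> FRn G n = {\<one>\<^bsub>G\<^esub>}"

lemma rdepth_leI:
  assumes "group G" "\<And>x. x \<in> FRn G n \<Longrightarrow> x = \<one>\<^bsub>G\<^esub>"
  shows "rdepth_le n G"
  using assms FRn_one_closed unfolding rdepth_le_def by blast

lemma rdepth_le_group: "rdepth_le n G \<Longrightarrow> group G"
  by (simp add: rdepth_le_def)

lemma rdepth_le_mono: "m \<le> n \<Longrightarrow> rdepth_le m G \<Longrightarrow> rdepth_le n G"
  using FRn_antimono[of m n G] FRn_one_closed[of G n] unfolding rdepth_le_def by auto

lemma rdepth_le_hom:
  assumes "rdepth_le n H" "group_hom G H h" "x \<in> FRn G n"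
  shows "h x = \<one>\<^bsub>H\<^esub>"
  using FRn_hom[OF assms(2,3)] assms(1) by (auto simp: rdepth_le_def)

lemma rdepth_le_inj:
  fixes G (structure)
  assumes "rdepth_le n H" "group_hom G H h" "inj_on h (carrier G)"
  shows "rdepth_le n G"
proof (rule rdepth_leI)
  interpret group_hom G H h by fact
  show "group G" ..
  fix x assume x: "x \<in> FRn G n"
  then have "h x = h \<one>" using rdepth_le_hom[OF assms(1,2)] by simp
  moreover have "x \<in> carrier G" using x FRn_subgroup[OF G.group_axioms] subgroup.subset by blast
  ultimately show "x = \<one>" using assms(3) G.one_closed by (metis inj_onD)
qed

lemma rdepth_le_subgroup:
  assumes "rdepth_le n G" "subgroup K G"
  shows "rdepth_le n (G\<lparr>carrier := K\<rparr>)"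
proof (rule rdepth_le_inj[OF assms(1), where h = "\<lambda>x. x"])
  interpret group G using assms(1) by (simp add: rdepth_le_def)
  show "group_hom (G\<lparr>carrier := K\<rparr>) G (\<lambda>x. x)"
    using assms(2) subgroup.subset
    by (auto simp: group_hom_def group_hom_axioms_def subgroup_imp_group hom_def
        dest: subgroup.mem_carrier)
qed (auto simp: inj_on_def)

lemma rdepth_le_finite:
  assumes "group G" "finite (carrier G)"
  shows "rdepth_le 1 G"
proof (rule rdepth_leI)
  fix x assume "x \<in> FRn G 1"
  then have "x \<in> FR G" by simp
  moreover have "fin_idx G {\<one>\<^bsub>G\<^esub>}"
    using assms group.triv_subgroup fin_idx_finite by blast
  ultimately show "x = \<one>\<^bsub>G\<^esub>" by (auto simp: FR_def)
qed fact

text \<open>\<open>FR G\<close> dies in the residually finite \<open>Q\<close>, so it lies in the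
  kernel, and the remaining n residuals are taken there.\<close>

lemma rdepth_le_extension:
  fixes G (structure)
  assumes "group_hom G Q h" "rdepth_le 1 Q" "rdepth_le n (G\<lparr>carrier := kernel G Q h\<rparr>)"
  shows "rdepth_le (Suc n) G"
proof (rule rdepth_leI)
  interpret group_hom G Q h by fact
  show "group G" ..
  fix x assume x: "x \<in> FRn G (Suc n)"
  let ?K = "kernel G Q h"
  have sub: "FR G \<subseteq> ?K"
    using rdepth_le_hom[OF assms(2,1)] FR_subset[of G] by (auto simp: kernel_def)
  have "group_hom (G\<lparr>carrier := FR G\<rparr>) (G\<lparr>carrier := ?K\<rparr>) (\<lambda>x. x)"
    using sub FR_subgroup[OF G.group_axioms] subgroup_kernel
    by (auto simp: group_hom_def group_hom_axioms_def G.subgroup_imp_group hom_def)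
  then have "x \<in> FRn (G\<lparr>carrier := ?K\<rparr>) n"
    using FRn_hom x unfolding FRn_Suc' by fastforce
  then show "x = \<one>" using assms(3) by (auto simp: rdepth_le_def)
qed

text \<open>A finite index subgroup of \<open>K\<close> has finite index in \<open>G\<close>. Hence
  an element of \<open>FR G\<close> can be tested against homomorphisms that are defined on
  \<open>K\<close> only.\<close>

lemma FR_fin_idx:
  assumes "group G" "fin_idx G K"
  shows "FR G \<subseteq> FR (G\<lparr>carrier := K\<rparr>)"
proof
  fix x assume x: "x \<in> FR G"
  then have "x \<in> K" using assms by (auto simp: FR_def)
  moreover have "x \<in> L" if "fin_idx (G\<lparr>carrier := K\<rparr>) L" for L
    using x fin_idx_trans[OF assms that] by (auto simp: FR_def)
  ultimately show "x \<in> FR (G\<lparr>carrier := K\<rparr>)" by (simp add: FR_def)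
qed

lemma FR_memberI:
  fixes G (structure)
  assumes "group G" "x \<in> carrier G" "\<And>N. N \<lhd> G \<Longrightarrow> fin_idx G N \<Longrightarrow> x \<in> N"
  shows "x \<in> FR G"
  using assms fin_idx_normal_core[OF assms(1)] unfolding FR_def by blast

text \<open>One subgroup for each element of \<open>Y\<close>, intersected, and then the normal
  core.\<close>

lemma residually_finite_normal:
  fixes G (structure)
  assumes "rdepth_le 1 G" "finite Y" "Y \<subseteq> carrier G - {\<one>\<^bsub>G\<^esub>}"
  shows "\<exists>N. N \<lhd> G \<and> fin_idx G N \<and> N \<inter> Y = {}"
proof -
  have gr: "group G" using assms by (simp add: rdepth_le_def)
  have "\<exists>K. fin_idx G K \<and> x \<notin> K" if "x \<in> Y" for x
    using that assms by (auto simp: rdepth_le_def FR_def)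
  then obtain K where K: "\<And>x. x \<in> Y \<Longrightarrow> fin_idx G (K x) \<and> x \<notin> K x" by metis
  have "fin_idx G (carrier G \<inter> (\<Inter>x\<in>Y. K x))"
    using K assms gr by (intro fin_idx_INT) auto
  then obtain N where "N \<lhd> G" "fin_idx G N" "N \<subseteq> carrier G \<inter> (\<Inter>x\<in>Y. K x)"
    using fin_idx_normal_core[OF gr] by blast
  then show ?thesis using K by blast
qed

section \<open>Depth and iterated finite residuals\<close>

text \<open>
  Intersecting subgroups along a well-order makes the conditions on monotonicity and limits
  automatic.
\<close>

lemma ord_residually_finiteI:
  fixes G (structure) and r :: "'b rel" and K :: "'b \<Rightarrow> 'a set"
  assumes "group G" "Well_order r" and K: "\<And>x. x \<in> Field r \<Longrightarrow> subgroup (K x) G"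
  defines "H \<equiv> \<lambda>A. carrier G \<inter> (\<Inter>x\<in>A. K x)"
  assumes fin: "\<And>x. x \<in> Field r \<Longrightarrow> fin_idx (G\<lparr>carrier := H (underS r x)\<rparr>) (H (underS r x) \<inter> K x)"
    and one: "H (Field r) = {\<one>}"
  shows "ord_residually_finite G r"
  unfolding ord_residually_finite_def
proof (intro conjI exI[of _ H] allI impI ballI)
  interpret group G by fact
  have W: "wo_rel r" using assms(2) by (simp add: wo_rel_def)
  note REFL = wo_rel.REFL[OF W]
  show "subgroup (H A) G" if "ofilter r A" for A
  proof -
    have "H A = \<Inter>(insert (carrier G) (K ` A))" by (auto simp: H_def)
    moreover have "subgroup L G" if "L \<in> insert (carrier G) (K ` A)" for L
      using that K \<open>ofilter r A\<close> subgroup_self by (auto simp: ofilter_def)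
    ultimately show ?thesis using subgroups_Inter[of "insert (carrier G) (K ` A)"] by simp
  qed
  show "H {} = carrier G" by (simp add: H_def)
  show "H B \<subseteq> H A" if "A \<subset> B" for A B using that by (auto simp: H_def)
  show "finite (rcosets\<^bsub>G\<lparr>carrier := H (underS r x)\<rparr>\<^esub> H (under r x))" if x: "x \<in> Field r" for x
  proof -
    have "under r x = insert x (underS r x)"
      using x REFL by (auto simp: under_def underS_def refl_on_def)
    then have "H (under r x) = H (underS r x) \<inter> K x" by (auto simp: H_def)
    then show ?thesis using fin[OF x] by (simp add: fin_idx_def)
  qed
  show "H A = (\<Inter>B\<in>{B. ofilter r B \<and> B \<subset> A}. H B)" if A: "limit_segment r A" for A
  proof
    show "H A \<subseteq> (\<Inter>B\<in>{B. ofilter r B \<and> B \<subset> A}. H B)" by (auto simp: H_def)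
    have of: "ofilter r A" "A \<noteq> {}" using A by (auto simp: limit_segment_def)
    have sub: "ofilter r (under r x) \<and> under r x \<subset> A \<and> x \<in> under r x" if "x \<in> A" for x
    proof -
      have x: "x \<in> Field r" using that of(1) by (auto simp: ofilter_def)
      then have "under r x \<noteq> A" using A by (auto simp: limit_segment_def)
      moreover have "under r x \<subseteq> A" using that of(1) by (auto simp: ofilter_def)
      moreover have "x \<in> under r x" using x REFL by (auto simp: under_def refl_on_def)
      ultimately show ?thesis using wo_rel.under_ofilter[OF W] by blast
    qed
    show "(\<Inter>B\<in>{B. ofilter r B \<and> B \<subset> A}. H B) \<subseteq> H A"
    proof
      fix y assume y: "y \<in> (\<Inter>B\<in>{B. ofilter r B \<and> B \<subset> A}. H B)"
      have "y \<in> H (under r x)" if "x \<in> A" for x using y sub[OF that] by blast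
      then have "y \<in> carrier G \<and> y \<in> K x" if "x \<in> A" for x using sub[OF that] that unfolding H_def by blast
      then show "y \<in> H A" using of(2) unfolding H_def by blast
    qed
  qed
qed (use assms(2) one in auto)

text \<open>Countability turns the intersection of all finite index subgroups into that of a
  sequence: one subgroup for each element outside the residual.\<close>

lemma FR_chain:
  fixes G (structure)
  assumes "group G" "countable (carrier G)"
  obtains K :: "nat \<Rightarrow> 'a set" where "\<And>i. fin_idx G (K i)" "(\<Inter>i. K i) = FR G"
proof -
  interpret group G by fact
  have "\<exists>L. fin_idx G L \<and> x \<notin> L" if "x \<in> carrier G - FR G" for x using that by (auto simp: FR_def)
  then obtain L where L: "\<And>x. x \<in> carrier G - FR G \<Longrightarrow> fin_idx G (L x) \<and> x \<notin> L x" by metis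
  define K where "K i = (let x = from_nat_into (carrier G) i in if x \<in> carrier G - FR G then L x else carrier G)" for i
  have K: "fin_idx G (K i)" for i using L fin_idx_carrier[OF assms(1)] by (simp add: K_def Let_def)
  moreover have "(\<Inter>i. K i) = FR G"
  proof
    show "FR G \<subseteq> (\<Inter>i. K i)" using K by (auto simp: FR_def)
    show "(\<Inter>i. K i) \<subseteq> FR G"
    proof
      fix x assume x: "x \<in> (\<Inter>i. K i)"
      then have c: "x \<in> carrier G" using fin_idx_subgroup[OF K] subgroup.subset by blast
      obtain i where i: "from_nat_into (carrier G) i = x" using from_nat_into_surj[OF assms(2) c] by blast
      show "x \<in> FR G"
      proof (rule ccontr)
        assume "x \<notin> FR G"
        then have "K i = L x" "x \<notin> L x" using L[of x] c by (simp_all add: K_def i)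
        then show False using x by blast
      qed
    qed
  qed
  ultimately show ?thesis using that by blast
qed

section \<open>Initial segments of the ordinal omega times n\<close>

abbreviation (input) "omn n \<equiv> ord_times natLeq (natLeq_on n)"

lemma omn_mem: "((a, b), (c, d)) \<in> omn n \<longleftrightarrow> b < n \<and> d < n \<and> b \<le> d \<and> (b = d \<longrightarrow> a \<le> c)"
  by (auto simp: ord_times_def natLeq_def Field_def)

lemma Field_omn: "Field (omn n) = UNIV \<times> {..<n}"
proof (intro equalityI subsetI)
  fix p assume "p \<in> Field (omn n)"
  then obtain q where "(p, q) \<in> omn n \<or> (q, p) \<in> omn n" by (auto simp: Field_def)
  then show "p \<in> UNIV \<times> {..<n}" by (cases p; cases q) (auto simp: omn_mem)
next
  fix p :: "nat \<times> nat" assume "p \<in> UNIV \<times> {..<n}"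
  then have "(p, p) \<in> omn n" by (cases p) (simp add: omn_mem)
  then show "p \<in> Field (omn n)" by (rule FieldI1)
qed

lemma Well_order_omn: "Well_order (omn n)"
  by (rule Well_order_ord_times[OF natLeq_Well_order natLeq_on_Well_order])

text \<open>The initial segment of type \<omega> \<cdot> j + i: the first j copies of \<omega>, and
  i points of the next one.\<close>

definition seg :: "nat \<Rightarrow> nat \<Rightarrow> (nat \<times> nat) set" where
  "seg i j = {(a, b). b < j \<or> b = j \<and> a < i}"

lemma underS_omn: "j < n \<Longrightarrow> underS (omn n) (i, j) = seg i j"
  by (auto simp: underS_def omn_mem seg_def)

lemma seg_Field: "seg 0 n = Field (omn n)"
  by (auto simp: Field_omn seg_def)

lemma fin_idx_restrict:
  fixes G (structure)
  assumes "group G" "subgroup A G" "subgroup B G" "A \<subseteq> B" "fin_idx (G\<lparr>carrier := B\<rparr>) L"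
  shows "fin_idx (G\<lparr>carrier := A\<rparr>) (A \<inter> L)"
proof -
  have "group_hom (G\<lparr>carrier := A\<rparr>) (G\<lparr>carrier := B\<rparr>) (\<lambda>x. x)"
    using assms(1-4) by (auto simp: group_hom_def group_hom_axioms_def subgroup.subgroup_is_group intro!: homI)
  from fin_idx_preimage[OF this assms(5)] show ?thesis by (simp add: Int_def)
qed

text \<open>The j-th block of length \<omega> descends from \<open>FRn G j\<close> to
  \<open>FRn G (Suc j)\<close> by \<open>FR_chain\<close>. Each of its subgroups has finite index in
  \<open>FRn G j\<close>, hence also in the smaller intersection that is already reached.\<close>

lemma residual_chain:
  fixes G (structure)
  assumes "group G" "countable (carrier G)"
  obtains K :: "nat \<times> nat \<Rightarrow> 'a set" where "\<And>p. subgroup (K p) G"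
    "\<And>i j. fin_idx (G\<lparr>carrier := carrier G \<inter> (\<Inter>p\<in>seg i j. K p)\<rparr>) (carrier G \<inter> (\<Inter>p\<in>seg i j. K p) \<inter> K (i, j))"
    "\<And>j. carrier G \<inter> (\<Inter>p\<in>seg 0 j. K p) = FRn G j"
proof -
  interpret group G by fact
  have "\<exists>K :: nat \<Rightarrow> 'a set. (\<forall>i. fin_idx (G\<lparr>carrier := FRn G j\<rparr>) (K i)) \<and> (\<Inter>i. K i) = FRn G (Suc j)" for j
  proof -
    have "FRn G j \<subseteq> carrier G" using FRn_antimono[of 0 j G] by simp
    then have "countable (carrier (G\<lparr>carrier := FRn G j\<rparr>))" using assms(2) countable_subset by auto
    from FR_chain[OF FRn_group[OF assms(1)] this] show ?thesis by (metis FRn.simps(2))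
  qed
  then obtain K' :: "nat \<Rightarrow> nat \<Rightarrow> 'a set" where K': "\<And>i j. fin_idx (G\<lparr>carrier := FRn G j\<rparr>) (K' j i)"
    "\<And>j. (\<Inter>i. K' j i) = FRn G (Suc j)" by metis
  define K where "K p = K' (snd p) (fst p)" for p
  define H where "H A = carrier G \<inter> (\<Inter>p\<in>A. K p)" for A
  have K: "subgroup (K p) G" for p
    using fin_idx_subgroup[OF K'(1)] FRn_subgroup[OF assms(1)] incl_subgroup unfolding K_def by blast
  have Hs: "subgroup (H A) G" for A
  proof -
    have "H A = \<Inter>(insert (carrier G) (K ` A))" by (auto simp: H_def)
    moreover have "subgroup L G" if "L \<in> insert (carrier G) (K ` A)" for L
      using that K subgroup_self by auto
    ultimately show ?thesis using subgroups_Inter[of "insert (carrier G) (K ` A)"] by simp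
  qed
  have H0: "H (seg 0 j) = FRn G j" for j
  proof (induction j)
    case 0
    then show ?case by (simp add: H_def seg_def)
  next
    case (Suc j)
    have "seg 0 (Suc j) = seg 0 j \<union> range (\<lambda>i. (i, j))" by (auto simp: seg_def less_Suc_eq)
    then have "H (seg 0 (Suc j)) = H (seg 0 j) \<inter> (\<Inter>i. K (i, j))" by (auto simp: H_def)
    also have "\<dots> = FRn G j \<inter> FRn G (Suc j)" using Suc K'(2)[of j] by (simp add: K_def)
    finally show ?case using FRn_antimono[of j "Suc j" G] by auto
  qed
  have "fin_idx (G\<lparr>carrier := H (seg i j)\<rparr>) (H (seg i j) \<inter> K (i, j))" for i j
  proof (rule fin_idx_restrict[OF assms(1) Hs FRn_subgroup[OF assms(1)]])
    have "H (seg i j) \<subseteq> H (seg 0 j)" unfolding H_def seg_def by blast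
    then show "H (seg i j) \<subseteq> FRn G j" by (simp add: H0)
    show "fin_idx (G\<lparr>carrier := FRn G j\<rparr>) (K (i, j))" using K'(1) by (simp add: K_def)
  qed
  then show ?thesis using that[of K] K H0 unfolding H_def by blast
qed

lemma ord_residually_finite_omn:
  assumes "group G" "countable (carrier G)" "FRn G n = {\<one>\<^bsub>G\<^esub>}"
  shows "ord_residually_finite G (omn n)"
proof -
  obtain K :: "nat \<times> nat \<Rightarrow> _" where K: "\<And>p. subgroup (K p) G"
    "\<And>i j. fin_idx (G\<lparr>carrier := carrier G \<inter> (\<Inter>p\<in>seg i j. K p)\<rparr>) (carrier G \<inter> (\<Inter>p\<in>seg i j. K p) \<inter> K (i, j))"
    "\<And>j. carrier G \<inter> (\<Inter>p\<in>seg 0 j. K p) = FRn G j"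
    using residual_chain[OF assms(1,2)] by blast
  show ?thesis
  proof (rule ord_residually_finiteI[where K = K])
    show "carrier G \<inter> (\<Inter>p\<in>Field (omn n). K p) = {\<one>\<^bsub>G\<^esub>}"
      using K(3)[of n] assms(3) by (simp add: seg_Field)
    fix x assume "x \<in> Field (omn n)"
    then show "fin_idx (G\<lparr>carrier := carrier G \<inter> (\<Inter>p\<in>underS (omn n) x. K p)\<rparr>)
        (carrier G \<inter> (\<Inter>p\<in>underS (omn n) x. K p) \<inter> K x)"
      using K(2)[of "fst x" "snd x"] underS_omn[of "snd x" n "fst x"] by (auto simp: Field_omn)
  qed (use assms(1) Well_order_omn K(1) in auto)
qed

lemma ord_plus_mem:
  "(Inl x, Inl y) \<in> ord_plus r s \<longleftrightarrow> (x, y) \<in> r" "(Inr x', Inr y') \<in> ord_plus r s \<longleftrightarrow> (x', y') \<in> s"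
  "(Inl x, Inr y') \<in> ord_plus r s \<longleftrightarrow> x \<in> Field r \<and> y' \<in> Field s" "(Inr x', Inl y) \<notin> ord_plus r s"
  by (auto simp: ord_plus_def)

lemma omn_plus_1:
  fixes n :: nat
  defines "r \<equiv> ord_plus (omn n) (natLeq_on 1)"
  shows "Well_order r" "Field r = Inl ` Field (omn n) \<union> {Inr 0}" "underS r (Inl x) = Inl ` underS (omn n) x"
    "underS r (Inr 0) = Inl ` Field (omn n)"
proof -
  define s where "s = natLeq_on 1"
  define t where "t = omn n"
  have s: "(x, y) \<in> s \<longleftrightarrow> x = 0 \<and> y = 0" for x y by (auto simp: s_def)
  have F: "x \<in> Field s \<longleftrightarrow> x = 0" for x by (auto simp: Field_def s)
  have r: "r = ord_plus t s" by (simp add: r_def s_def t_def)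
  show "Well_order r" unfolding r_def by (rule Well_order_ord_plus[OF Well_order_omn natLeq_on_Well_order])
  have "p \<in> Field r \<longleftrightarrow> p \<in> Inl ` Field t \<union> {Inr 0}" for p
  proof
    assume "p \<in> Field r"
    then obtain q where "(p, q) \<in> r \<or> (q, p) \<in> r" by (auto simp: Field_def)
    then show "p \<in> Inl ` Field t \<union> {Inr 0}"
      unfolding r by (cases p; cases q) (auto simp: ord_plus_mem F s intro: FieldI1 FieldI2)
  next
    assume "p \<in> Inl ` Field t \<union> {Inr 0}"
    then have "(p, Inr 0) \<in> r" unfolding r by (cases p) (auto simp: ord_plus_mem F s)
    then show "p \<in> Field r" by (rule FieldI1)
  qed
  then show "Field r = Inl ` Field (omn n) \<union> {Inr 0}" by (auto simp: t_def)
  have "p \<in> underS r (Inl x) \<longleftrightarrow> p \<in> Inl ` underS t x" for p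
    unfolding r by (cases p) (auto simp: ord_plus_mem underS_def)
  then show "underS r (Inl x) = Inl ` underS (omn n) x" by (auto simp: t_def)
  have "p \<in> underS r (Inr 0) \<longleftrightarrow> p \<in> Inl ` Field t" for p
    unfolding r by (cases p) (auto simp: ord_plus_mem underS_def F s)
  then show "underS r (Inr 0) = Inl ` Field (omn n)" by (auto simp: t_def)
qed

text \<open>After \<omega> \<cdot> n the chain stands at the finite group \<open>FRn G n\<close>,
  from which a single step leads to the trivial group.\<close>

lemma ord_residually_finite_omn_plus_1:
  fixes G (structure)
  assumes "group G" "countable (carrier G)" "finite (FRn G n)"
  shows "ord_residually_finite G (ord_plus (omn n) (natLeq_on 1))"
proof -
  interpret group G by fact
  obtain K :: "nat \<times> nat \<Rightarrow> _" where K: "\<And>p. subgroup (K p) G"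
    "\<And>i j. fin_idx (G\<lparr>carrier := carrier G \<inter> (\<Inter>p\<in>seg i j. K p)\<rparr>) (carrier G \<inter> (\<Inter>p\<in>seg i j. K p) \<inter> K (i, j))"
    "\<And>j. carrier G \<inter> (\<Inter>p\<in>seg 0 j. K p) = FRn G j"
    using residual_chain[OF assms(1,2)] by blast
  define L where "L p = (case p of Inl q \<Rightarrow> K q | Inr _ \<Rightarrow> {\<one>})" for p :: "nat \<times> nat + nat"
  have L: "(\<Inter>p\<in>Inl ` A. L p) = (\<Inter>p\<in>A. K p)" for A by (auto simp: L_def)
  show ?thesis
  proof (rule ord_residually_finiteI[where K = L])
    show "subgroup (L p) G" for p using K(1) triv_subgroup by (cases p) (auto simp: L_def)
    have "carrier G \<inter> (\<Inter>p\<in>Field (ord_plus (omn n) (natLeq_on 1)). L p) =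
        carrier G \<inter> (\<Inter>p\<in>Field (omn n). K p) \<inter> {\<one>}"
      unfolding omn_plus_1(2) INT_Un L by (simp add: L_def Int_assoc)
    also have "\<dots> = {\<one>}" using K(3)[of n] FRn_one_closed[OF assms(1)] by (simp add: seg_Field)
    finally show "carrier G \<inter> (\<Inter>p\<in>Field (ord_plus (omn n) (natLeq_on 1)). L p) = {\<one>}" .
    fix x assume "x \<in> Field (ord_plus (omn n) (natLeq_on 1))"
    then consider i j where "x = Inl (i, j)" "j < n" | "x = Inr 0" unfolding omn_plus_1(2) by (auto simp: Field_omn)
    then show "fin_idx (G\<lparr>carrier := carrier G \<inter> (\<Inter>p\<in>underS (ord_plus (omn n) (natLeq_on 1)) x. L p)\<rparr>)
        (carrier G \<inter> (\<Inter>p\<in>underS (ord_plus (omn n) (natLeq_on 1)) x. L p) \<inter> L x)"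
    proof cases
      case (1 i j)
      then show ?thesis using K(2)[of i j] by (simp only: omn_plus_1(3) L underS_omn) (simp add: L_def)
    next
      case 2
      have "FRn G n \<inter> {\<one>} = {\<one>}" using FRn_one_closed[OF assms(1)] by auto
      moreover have "fin_idx (G\<lparr>carrier := FRn G n\<rparr>) {\<one>}"
        using FRn_group[OF assms(1)] group.triv_subgroup[OF FRn_group[OF assms(1)], of n] assms(3)
        by (intro fin_idx_finite) simp_all
      ultimately show ?thesis
        using K(3)[of n] unfolding 2 omn_plus_1(4) L by (simp add: L_def seg_Field)
    qed
  qed (use assms(1) omn_plus_1(1) in auto)
qed

text \<open>The lower bound, for an arbitrary chain \<open>H\<close>. At \<omega> \<cdot> j the
  chain still contains \<open>FRn G j\<close> (\<open>base\<close>), and i steps later its term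
  meets \<open>FRn G j\<close> in a subgroup of finite index (\<open>fin\<close>), which contains
  the next residual; so does the limit of these terms. A chain that is trivial at \<omega> \<cdot> j
  + i thus makes the trivial group one of finite index in \<open>FRn G j\<close>.\<close>

lemma initial_segment_bound:
  fixes G (structure)
  assumes "group G" "wo_rel.ofilter (omn n) A" "ord_residually_finite G (Restr (omn n) A)"
  shows "j < n \<Longrightarrow> A = seg i j \<Longrightarrow> finite (FRn G j)" "A = seg 0 n \<Longrightarrow> FRn G n = {\<one>}"
proof -
  interpret group G by fact
  define r where "r = Restr (omn n) A"
  have A: "A \<subseteq> UNIV \<times> {..<n}" using assms(2) unfolding ofilter_def Field_omn by blast
  have mem: "((a, b), (c, d)) \<in> r \<longleftrightarrow> (a, b) \<in> A \<and> (c, d) \<in> A \<and> (b < d \<or> b = d \<and> a \<le> c)" for a b c d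
    using A by (auto simp: r_def omn_mem)
  have F: "Field r = A"
  proof (intro equalityI subsetI)
    fix p assume "p \<in> A"
    then have "(p, p) \<in> r" by (cases p) (simp add: mem)
    then show "p \<in> Field r" by (rule FieldI1)
  qed (auto simp: r_def Field_def)
  have of: "ofilter r (seg i j)" if "seg i j \<subseteq> A" for i j
    using that unfolding ofilter_def F under_def by (auto simp: mem) (auto simp: seg_def)
  have un: "under r (i, j) = seg (Suc i) j" "underS r (i, j) = seg i j" if "seg (Suc i) j \<subseteq> A" for i j
  proof -
    have "(i, j) \<in> A" using that by (auto simp: seg_def)
    moreover have "p \<in> A" if "p \<in> seg (Suc i) j" for p using that \<open>seg (Suc i) j \<subseteq> A\<close> by blast
    ultimately show "under r (i, j) = seg (Suc i) j" "underS r (i, j) = seg i j"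
      unfolding under_def underS_def by (auto simp: mem seg_def less_Suc_eq_le)
  qed
  obtain H where H0: "\<forall>A. ofilter r A \<longrightarrow> subgroup (H A) G"
    "H {} = carrier G" "H (Field r) = {\<one>}"
    "\<forall>A B. ofilter r A \<longrightarrow> ofilter r B \<longrightarrow> A \<subset> B \<longrightarrow> H B \<subseteq> H A"
    "\<forall>x\<in>Field r. finite (rcosets\<^bsub>G\<lparr>carrier := H (underS r x)\<rparr>\<^esub> (H (under r x)))"
    "\<forall>A. limit_segment r A \<longrightarrow> H A = (\<Inter>B\<in>{B. ofilter r B \<and> B \<subset> A}. H B)"
    using assms(3) unfolding ord_residually_finite_def r_def[symmetric] by (elim exE conjE) (rule that)
  note H = H0[rule_format]
  have mono: "H B \<subseteq> H A" if "ofilter r A" "ofilter r B" "A \<subseteq> B" for A B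
    using that H(4) by (cases "A = B") auto
  have fin: "fin_idx (G\<lparr>carrier := FRn G j\<rparr>) (H (seg i j) \<inter> FRn G j)"
    if "FRn G j \<subseteq> H (seg 0 j)" "seg i j \<subseteq> A" for i j
    using that(2)
  proof (induction i)
    case 0
    have "H (seg 0 j) \<inter> FRn G j = FRn G j" using that(1) by blast
    then show ?case using fin_idx_carrier[OF FRn_group[OF assms(1)], of j] by simp
  next
    case (Suc i)
    have sub: "seg i j \<subseteq> seg (Suc i) j" by (auto simp: seg_def)
    then have "seg i j \<subseteq> A" using Suc.prems by blast
    note of' = of[OF this] of[OF Suc.prems]
    note s = H(1)[OF of'(1)] H(1)[OF of'(2)] FRn_subgroup[OF assms(1), of j]
    have le: "H (seg (Suc i) j) \<subseteq> H (seg i j)" using mono[OF of' sub] .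
    have "(i, j) \<in> Field r" using Suc.prems unfolding F by (auto simp: seg_def)
    then have "fin_idx (G\<lparr>carrier := H (seg i j)\<rparr>) (H (seg (Suc i) j))"
      using H(5)[of "(i, j)"] un[OF Suc.prems] subgroup_incl[OF s(2,1) le] by (simp add: fin_idx_def)
    then have "fin_idx (G\<lparr>carrier := H (seg i j) \<inter> FRn G j\<rparr>) (H (seg i j) \<inter> FRn G j \<inter> H (seg (Suc i) j))"
      using s by (intro fin_idx_restrict[OF assms(1) _ s(1)]) (auto intro: subgroups_Inter_pair)
    moreover have "H (seg i j) \<inter> FRn G j \<inter> H (seg (Suc i) j) = H (seg (Suc i) j) \<inter> FRn G j" using le by blast
    ultimately show ?case
      using fin_idx_trans[OF FRn_group[OF assms(1)] Suc.IH[OF \<open>seg i j \<subseteq> A\<close>]] by simp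
  qed
  have base: "FRn G j \<subseteq> H (seg 0 j)" if "seg 0 j \<subseteq> A" for j
    using that
  proof (induction j)
    case 0
    have "seg 0 0 = {}" by (auto simp: seg_def)
    then show ?case using H(2) by simp
  next
    case (Suc j)
    have sub: "seg a j \<subseteq> seg 0 (Suc j)" for a by (auto simp: seg_def)
    have "limit_segment r (seg 0 (Suc j))"
      unfolding limit_segment_def
    proof (intro conjI ballI)
      show "ofilter r (seg 0 (Suc j))" by (rule of) (rule Suc.prems)
      show "seg 0 (Suc j) \<noteq> {}" by (auto simp: seg_def)
      fix p assume "p \<in> Field r"
      obtain a b where p: "p = (a, b)" by fastforce
      show "seg 0 (Suc j) \<noteq> under r p"
      proof
        assume *: "seg 0 (Suc j) = under r p"
        have "(a, b) \<in> under r p" using \<open>p \<in> Field r\<close> by (simp add: p F under_def mem)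
        then have "b < Suc j" unfolding *[symmetric] by (simp add: seg_def)
        \<comment> \<open>A segment of type \<omega> \<cdot> (j + 1) has no greatest element: with a
          point it contains the next point of the same copy.\<close>
        then have "(Suc a, b) \<in> under r p" unfolding *[symmetric] by (simp add: seg_def)
        then show False by (simp add: p under_def mem)
      qed
    qed
    then have "H (seg 0 (Suc j)) = (\<Inter>B\<in>{B. ofilter r B \<and> B \<subset> seg 0 (Suc j)}. H B)" by (rule H(6))
    moreover have "FRn G (Suc j) \<subseteq> H B" if B: "ofilter r B" "B \<subset> seg 0 (Suc j)" for B
    proof -
      obtain a b where ab: "(a, b) \<in> seg 0 (Suc j)" "(a, b) \<notin> B" using B(2) by auto
      \<comment> \<open>A point missing from the initial segment \<open>B\<close> lies above all of
        \<open>B\<close>, so that \<open>B\<close> reaches at most a points into the j-th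
        copy.\<close>
      have "B \<subseteq> seg a j"
      proof
        fix p assume p: "p \<in> B"
        obtain c d where cd: "p = (c, d)" by fastforce
        have "(c, d) \<in> seg 0 (Suc j)" using p cd B(2) by blast
        have "((a, b), (c, d)) \<notin> r" using p ab(2) B(1) unfolding ofilter_def cd under_def by blast
        then have "d < b \<or> d = b \<and> c < a"
          using \<open>(c, d) \<in> _\<close> ab(1) Suc.prems by (auto simp: mem subset_iff)
        then show "p \<in> seg a j" using ab(1) by (auto simp: cd seg_def)
      qed
      moreover have "seg a j \<subseteq> A" using sub Suc.prems by blast
      ultimately have "H (seg a j) \<subseteq> H B" using mono[OF B(1) of] by blast
      moreover have "fin_idx (G\<lparr>carrier := FRn G j\<rparr>) (H (seg a j) \<inter> FRn G j)"
        using Suc sub[of 0] by (intro fin \<open>seg a j \<subseteq> A\<close>) blast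
      then have "FRn G (Suc j) \<subseteq> H (seg a j) \<inter> FRn G j" by (auto simp: FR_def)
      ultimately show ?thesis by blast
    qed
    ultimately show ?case by blast
  qed
  show "finite (FRn G j)" if "j < n" "A = seg i j"
  proof -
    have "seg 0 j \<subseteq> A" unfolding that by (auto simp: seg_def)
    from fin[OF base[OF this], of i] have "fin_idx (G\<lparr>carrier := FRn G j\<rparr>) (H (seg i j) \<inter> FRn G j)"
      using that by blast
    moreover have "H (seg i j) = {\<one>}" using H(3) F that by simp
    ultimately show ?thesis
      using fin_idx_finite_overgroup[OF FRn_group[OF assms(1)], of j] by simp
  qed
  show "FRn G n = {\<one>}" if "A = seg 0 n"
    using base[of n] H(3) F that FRn_one_closed[OF assms(1), of n] by auto
qed

text \<open>A proper initial segment has type \<omega> \<cdot> j + i with j \<le> k. A chain on it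
  would make \<open>FRn G j\<close> finite, although it contains the infinite
  \<open>FRn G k\<close>.\<close>

lemma segment_omn:
  assumes "group G" "infinite (FRn G k)" "n = Suc k" "p \<in> Field (omn n)"
  shows "\<not> ord_residually_finite G (Restr (omn n) (underS (omn n) p))"
proof
  assume *: "ord_residually_finite G (Restr (omn n) (underS (omn n) p))"
  obtain i j where p: "p = (i, j)" "j < n" using assms(4) by (auto simp: Field_omn)
  have "ofilter (omn n) (underS (omn n) p)"
    using Well_order_omn by (simp add: wo_rel.underS_ofilter wo_rel_def)
  from initial_segment_bound(1)[OF assms(1) this * p(2), of i] have "finite (FRn G j)"
    using p by (simp add: underS_omn)
  moreover have "FRn G k \<subseteq> FRn G j" using p(2) assms(3) by (intro FRn_antimono) simp
  ultimately show False using assms(2) finite_subset by blast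
qed

theorem has_RF_depth_omn:
  assumes "group G" "countable (carrier G)" "FRn G n = {\<one>\<^bsub>G\<^esub>}" "infinite (FRn G k)" "n = Suc k"
  shows "has_RF_depth G (omn n)"
  unfolding has_RF_depth_def
proof (intro conjI allI impI)
  show "ord_residually_finite G (omn n)" using ord_residually_finite_omn[OF assms(1-3)] .
  fix s :: "(nat \<times> nat) rel" assume s: "ord_residually_finite G s"
  show "omn n \<le>o s"
  proof (rule ccontr)
    assume nle: "\<not> omn n \<le>o s"
    have W: "Well_order s" using s by (simp add: ord_residually_finite_def)
    have "s <o omn n" using nle W Well_order_omn ordLess_or_ordLeq by blast
    then obtain p where p: "p \<in> Field (omn n)" "s =o Restr (omn n) (underS (omn n) p)"
      using ordLess_iff_ordIso_Restr[OF Well_order_omn W] by blast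
    show False
      using segment_omn[OF assms(1,4,5) p(1)] ord_residually_finite_ordIso[OF p(2) s] by blast
  qed
qed

theorem has_RF_depth_omn_plus_1:
  assumes "group G" "countable (carrier G)" "finite (FRn G n)" "FRn G n \<noteq> {\<one>\<^bsub>G\<^esub>}"
    and "infinite (FRn G k)" "n = Suc k"
  shows "has_RF_depth G (ord_plus (omn n) (natLeq_on 1))"
  unfolding has_RF_depth_def
proof (intro conjI allI impI)
  let ?r = "ord_plus (omn n) (natLeq_on 1)"
  show "ord_residually_finite G ?r" using ord_residually_finite_omn_plus_1[OF assms(1-3)] .
  fix s :: "(nat \<times> nat + nat) rel" assume s: "ord_residually_finite G s"
  show "?r \<le>o s"
  proof (rule ccontr)
    assume nle: "\<not> ?r \<le>o s"
    have W: "Well_order s" using s by (simp add: ord_residually_finite_def)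
    have "s <o ?r" using nle W omn_plus_1(1) ordLess_or_ordLeq by blast
    then obtain p where p: "p \<in> Field ?r" "s =o Restr ?r (underS ?r p)"
      using ordLess_iff_ordIso_Restr[OF omn_plus_1(1) W] by blast
    have *: "ord_residually_finite G (Restr (omn n) A)" if "underS ?r p = Inl ` A" for A
    proof -
      have "Restr ?r (Inl ` A) = dir_image (Restr (omn n) A) Inl"
        by (auto simp: dir_image_def ord_plus_mem)
      moreover have "Well_order (Restr (omn n) A)" using Well_order_omn by (rule Well_order_Restr)
      ultimately have "Restr (omn n) A =o Restr ?r (underS ?r p)"
        using dir_image_ordIso[of "Restr (omn n) A" "Inl :: _ \<Rightarrow> nat \<times> nat + nat"] that by simp
      then have "s =o Restr (omn n) A" using p(2) ordIso_symmetric ordIso_transitive by blast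
      then show ?thesis using ord_residually_finite_ordIso s by blast
    qed
    from p(1) consider q where "q \<in> Field (omn n)" "p = Inl q" | "p = Inr 0" unfolding omn_plus_1(2) by blast
    then show False
    proof cases
      case (1 q)
      then show ?thesis using *[of "underS (omn n) q"] segment_omn[OF assms(1,5,6)] omn_plus_1(3) by blast
    next
      case 2
      \<comment> \<open>Below the point on top lies all of \<open>omn n\<close>, and a chain of this
        length would make \<open>FRn G n\<close> trivial.\<close>
      have "ofilter (omn n) (Field (omn n))"
        using Well_order_omn by (simp add: wo_rel.Field_ofilter wo_rel_def)
      moreover have "ord_residually_finite G (Restr (omn n) (Field (omn n)))"
        using *[of "Field (omn n)"] 2 omn_plus_1(4) by blast
      ultimately show ?thesis
        using initial_segment_bound(2)[OF assms(1)] assms(4) by (simp add: seg_Field)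
    qed
  qed
qed

section \<open>Free products\<close>

definition fp_reduced :: "'i set \<Rightarrow> ('i \<Rightarrow> 'g monoid) \<Rightarrow> ('i \<times> 'g) list \<Rightarrow> bool" where
  "fp_reduced I H w \<longleftrightarrow>
     (\<forall>(i, g)\<in>set w. i \<in> I \<and> g \<in> carrier (H i) \<and> g \<noteq> \<one>\<^bsub>H i\<^esub>) \<and> distinct_adj (map fst w)"

fun fp_push :: "('i \<Rightarrow> 'g monoid) \<Rightarrow> 'i \<times> 'g \<Rightarrow> ('i \<times> 'g) list \<Rightarrow> ('i \<times> 'g) list" where
  "fp_push H (i, g) [] = (if g = \<one>\<^bsub>H i\<^esub> then [] else [(i, g)])"
| "fp_push H (i, g) ((j, h) # w) =
     (if i = j then (if g \<otimes>\<^bsub>H i\<^esub> h = \<one>\<^bsub>H i\<^esub> then w else (i, g \<otimes>\<^bsub>H i\<^esub> h) # w)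
      else if g = \<one>\<^bsub>H i\<^esub> then (j, h) # w else (i, g) # (j, h) # w)"

text \<open>The elements are normal forms, so a nonempty reduced word is nontrivial by construction.
  Multiplication pushes the syllables of the left word one by one, as in
  \<open>free_group\<close>.\<close>

definition fp :: "'i set \<Rightarrow> ('i \<Rightarrow> 'g monoid) \<Rightarrow> ('i \<times> 'g) list monoid" where
  "fp I H = \<lparr>carrier = {w. fp_reduced I H w}, monoid.mult = foldr (fp_push H), one = []\<rparr>"

definition fp_in :: "('i \<Rightarrow> 'g monoid) \<Rightarrow> 'i \<Rightarrow> 'g \<Rightarrow> ('i \<times> 'g) list" where
  "fp_in H i g = (if g = \<one>\<^bsub>H i\<^esub> then [] else [(i, g)])"

definition fp_lift :: "('k, 'm) monoid_scheme \<Rightarrow> ('i \<Rightarrow> 'g \<Rightarrow> 'k) \<Rightarrow> ('i \<times> 'g) list \<Rightarrow> 'k" where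
  "fp_lift K h w = foldr (\<lambda>(i, g) x. h i g \<otimes>\<^bsub>K\<^esub> x) w \<one>\<^bsub>K\<^esub>"

lemma fp_reduced_Nil [simp]: "fp_reduced I H []"
  by (simp add: fp_reduced_def)

lemma fp_reduced_Cons:
  "fp_reduced I H ((i, g) # w) \<longleftrightarrow> i \<in> I \<and> g \<in> carrier (H i) \<and> g \<noteq> \<one>\<^bsub>H i\<^esub> \<and>
     fp_reduced I H w \<and> (w \<noteq> [] \<longrightarrow> i \<noteq> fst (hd w))"
  unfolding fp_reduced_def by (cases w) (auto simp: distinct_adj_Cons)

lemma carrier_fp: "carrier (fp I H) = {w. fp_reduced I H w}"
  and one_fp: "\<one>\<^bsub>fp I H\<^esub> = []"
  and mult_fp: "u \<otimes>\<^bsub>fp I H\<^esub> v = foldr (fp_push H) u v"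
  by (simp_all add: fp_def)

locale fp_family =
  fixes I :: "'i set" and H :: "'i \<Rightarrow> 'g monoid"
  assumes group_H: "i \<in> I \<Longrightarrow> group (H i)"
begin

lemma push_reduced:
  assumes "i \<in> I" "g \<in> carrier (H i)" "fp_reduced I H w"
  shows "fp_reduced I H (fp_push H (i, g) w)"
proof (cases w)
  case Nil
  then show ?thesis using assms by (simp add: fp_reduced_Cons)
next
  case (Cons p v)
  obtain j h where p: "p = (j, h)" by fastforce
  have "j \<in> I" using assms(3) unfolding Cons p by (simp add: fp_reduced_Cons)
  then interpret group "H j" by (rule group_H)
  show ?thesis
    using assms unfolding Cons p by (auto simp: fp_reduced_Cons)
qed

lemma push_one: "i \<in> I \<Longrightarrow> fp_reduced I H w \<Longrightarrow> fp_push H (i, \<one>\<^bsub>H i\<^esub>) w = w"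
proof (cases w)
  case (Cons p v)
  assume a: "i \<in> I" "fp_reduced I H w"
  obtain j h where p: "p = (j, h)" by fastforce
  have "j \<in> I" using a(2) unfolding Cons p by (simp add: fp_reduced_Cons)
  then interpret group "H j" by (rule group_H)
  show ?thesis using a unfolding Cons p by (auto simp: fp_reduced_Cons)
qed simp

text \<open>Pushing is an action of each factor on the normal forms; associativity and inverses of
  the free product rest on this.\<close>

lemma push_mult:
  assumes "i \<in> I" "g \<in> carrier (H i)" "h \<in> carrier (H i)" "fp_reduced I H w"
  shows "fp_push H (i, g) (fp_push H (i, h) w) = fp_push H (i, g \<otimes>\<^bsub>H i\<^esub> h) w"
proof -
  interpret group "H i" using group_H assms(1) .
  show ?thesis
  proof (cases "w \<noteq> [] \<and> fst (hd w) = i")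
    case True
    then obtain k v where w: "w = (i, k) # v" by (cases w) auto
    have v: "fp_reduced I H v" "k \<in> carrier (H i)" "v \<noteq> [] \<longrightarrow> i \<noteq> fst (hd v)" "k \<noteq> \<one>\<^bsub>H i\<^esub>"
      using assms(4) w by (auto simp: fp_reduced_Cons)
    show ?thesis
    proof (cases "h \<otimes>\<^bsub>H i\<^esub> k = \<one>\<^bsub>H i\<^esub>")
      case True
      then have "g \<otimes>\<^bsub>H i\<^esub> h \<otimes>\<^bsub>H i\<^esub> k = g" using assms v by (simp add: m_assoc)
      moreover have "fp_push H (i, g) v = (if g = \<one>\<^bsub>H i\<^esub> then v else (i, g) # v)"
        using v by (cases v) auto
      ultimately show ?thesis using w True by simp
    next
      case False
      then show ?thesis using w assms v by (simp add: m_assoc)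
    qed
  next
    case False
    then have *: "fp_push H (i, x) w = (if x = \<one>\<^bsub>H i\<^esub> then w else (i, x) # w)" for x
      by (cases w) auto
    show ?thesis using assms * by auto
  qed
qed

lemma foldr_push_reduced:
  assumes "fp_reduced I H u" "fp_reduced I H w"
  shows "fp_reduced I H (foldr (fp_push H) u w)"
  using assms by (induction u) (auto simp: fp_reduced_Cons push_reduced)

lemma foldr_push_push:
  assumes "i \<in> I" "g \<in> carrier (H i)" "fp_reduced I H v" "fp_reduced I H w"
  shows "foldr (fp_push H) (fp_push H (i, g) v) w = fp_push H (i, g) (foldr (fp_push H) v w)"
proof -
  interpret group "H i" using group_H assms(1) .
  show ?thesis
  proof (cases v)
    case Nil
    then show ?thesis using assms push_one by simp
  next
    case (Cons p v')
    obtain j h where p: "p = (j, h)" by fastforce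
    have v': "fp_reduced I H v'" "h \<in> carrier (H j)" "j \<in> I"
      using assms(3) unfolding Cons p by (auto simp: fp_reduced_Cons)
    have r: "fp_reduced I H (foldr (fp_push H) v' w)" using v' assms foldr_push_reduced by blast
    have r': "fp_reduced I H (fp_push H (j, h) (foldr (fp_push H) v' w))"
      using v' r push_reduced by blast
    show ?thesis
      using assms v' r r' push_mult[OF assms(1,2) _ r] push_one[OF assms(1) r] push_one[OF assms(1) r']
      unfolding Cons p by (auto simp del: fp_push.simps) (auto simp: split: if_splits)
  qed
qed

lemma foldr_push_Nil: "fp_reduced I H u \<Longrightarrow> foldr (fp_push H) u [] = u"
proof (induction u)
  case (Cons p u)
  obtain i g where p: "p = (i, g)" by fastforce
  have "foldr (fp_push H) u [] = u" using Cons p by (simp add: fp_reduced_Cons)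
  then show ?case using Cons.prems p by (cases u) (auto simp: fp_reduced_Cons)
qed simp

lemma foldr_push_assoc:
  assumes "fp_reduced I H u" "fp_reduced I H v" "fp_reduced I H w"
  shows "foldr (fp_push H) (foldr (fp_push H) u v) w = foldr (fp_push H) u (foldr (fp_push H) v w)"
  using assms
  by (induction u) (auto simp: fp_reduced_Cons foldr_push_push foldr_push_reduced)

lemma fp_in_closed:
  "i \<in> I \<Longrightarrow> g \<in> carrier (H i) \<Longrightarrow> fp_in H i g \<in> carrier (fp I H)"
  by (simp add: fp_in_def carrier_fp fp_reduced_Cons)

lemma fp_in_mult:
  assumes "i \<in> I" "g \<in> carrier (H i)" "w \<in> carrier (fp I H)"
  shows "fp_in H i g \<otimes>\<^bsub>fp I H\<^esub> w = fp_push H (i, g) w"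
  using push_one[OF assms(1)] assms(3) by (simp add: fp_in_def mult_fp carrier_fp)

lemma group_fp: "group (fp I H)"
proof (rule groupI)
  show "\<exists>v\<in>carrier (fp I H). v \<otimes>\<^bsub>fp I H\<^esub> u = \<one>\<^bsub>fp I H\<^esub>" if "u \<in> carrier (fp I H)" for u
    using that
  proof (induction u)
    case Nil
    then show ?case by (intro bexI[of _ "[]"]) (simp_all add: fp_def)
  next
    case (Cons p u)
    obtain i g where p: "p = (i, g)" by fastforce
    have red: "i \<in> I" "g \<in> carrier (H i)" "fp_reduced I H u" "g \<noteq> \<one>\<^bsub>H i\<^esub>"
      using Cons.prems p by (auto simp: carrier_fp fp_reduced_Cons)
    interpret group "H i" using group_H red(1) .
    obtain v where v: "fp_reduced I H v" "foldr (fp_push H) v u = []"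
      using Cons.IH red by (auto simp: fp_def)
    let ?v = "foldr (fp_push H) v (fp_in H i (inv\<^bsub>H i\<^esub> g))"
    have in': "fp_reduced I H (fp_in H i (inv\<^bsub>H i\<^esub> g))" "fp_reduced I H ((i, g) # u)"
      using red Cons.prems p by (auto simp: fp_in_def fp_reduced_Cons carrier_fp)
    have "fp_push H (i, g) u = (i, g) # u"
      using in'(2) foldr_push_Nil[OF in'(2)] foldr_push_Nil[OF red(3)] by simp
    then have "foldr (fp_push H) (fp_in H i (inv\<^bsub>H i\<^esub> g)) ((i, g) # u) = u"
      using red push_mult[OF red(1) _ red(2) red(3), of "inv\<^bsub>H i\<^esub> g"] push_one[OF red(1,3)]
        fp_in_mult[OF red(1), of "inv\<^bsub>H i\<^esub> g" "(i, g) # u"] in'(2)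
      by (simp add: mult_fp carrier_fp)
    then have "foldr (fp_push H) ?v ((i, g) # u) = []"
      using v foldr_push_assoc[OF v(1) in'] by simp
    then show ?case
      using foldr_push_reduced[OF v(1) in'(1)] p
      by (intro bexI[of _ ?v]) (simp_all add: fp_def)
  qed
qed (simp_all add: fp_def foldr_push_reduced foldr_push_assoc)

lemma fp_in_hom: "i \<in> I \<Longrightarrow> group_hom (H i) (fp I H) (fp_in H i)"
proof -
  assume i: "i \<in> I"
  interpret group "H i" using group_H i .
  have "fp_in H i (g \<otimes>\<^bsub>H i\<^esub> h) = fp_in H i g \<otimes>\<^bsub>fp I H\<^esub> fp_in H i h"
    if "g \<in> carrier (H i)" "h \<in> carrier (H i)" for g h
    using fp_in_mult[OF i that(1) fp_in_closed[OF i that(2)]] that by (simp add: fp_in_def)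
  then show ?thesis
    using i group_fp fp_in_closed
    by (simp add: group_hom_def group_hom_axioms_def hom_def is_group)
qed

lemma fp_Cons_eq:
  assumes "(i, g) # w \<in> carrier (fp I H)"
  shows "(i, g) # w = fp_in H i g \<otimes>\<^bsub>fp I H\<^esub> w"
    and "i \<in> I" "g \<in> carrier (H i)" "w \<in> carrier (fp I H)" "g \<noteq> \<one>\<^bsub>H i\<^esub>"
proof -
  have "fp_push H (i, g) w = (i, g) # w"
    using assms foldr_push_Nil[of "(i, g) # w"] foldr_push_Nil[of w]
    by (auto simp: carrier_fp fp_reduced_Cons)
  then show "(i, g) # w = fp_in H i g \<otimes>\<^bsub>fp I H\<^esub> w"
    using assms fp_in_mult[of i g w] by (simp add: carrier_fp fp_reduced_Cons)
qed (use assms in \<open>auto simp: carrier_fp fp_reduced_Cons\<close>)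

lemma fp_induct [consumes 1, case_names one mult]:
  assumes "w \<in> carrier (fp I H)" "P \<one>\<^bsub>fp I H\<^esub>"
    "\<And>i g w. i \<in> I \<Longrightarrow> g \<in> carrier (H i) \<Longrightarrow> w \<in> carrier (fp I H) \<Longrightarrow> P w
       \<Longrightarrow> P (fp_in H i g \<otimes>\<^bsub>fp I H\<^esub> w)"
  shows "P w"
  using assms(1)
proof (induction w)
  case Nil
  then show ?case using assms(2) by (simp add: one_fp)
next
  case (Cons p w)
  obtain i g where p: "p = (i, g)" by fastforce
  show ?case
    using Cons fp_Cons_eq[of i g w] assms(3)[of i g w] unfolding p by metis
qed

lemma fp_lift_closed:
  assumes "group K" "\<And>i. i \<in> I \<Longrightarrow> h i \<in> hom (H i) K" "fp_reduced I H w"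
  shows "fp_lift K h w \<in> carrier K"
proof -
  interpret K: group K by fact
  have cl: "h i g \<in> carrier K" if "i \<in> I" "g \<in> carrier (H i)" for i g
    using that assms(2) hom_in_carrier by metis
  show ?thesis
    using assms(3) by (induction w) (auto simp: fp_lift_def fp_reduced_Cons cl)
qed

lemma fp_lift_push:
  assumes "group K" "\<And>i. i \<in> I \<Longrightarrow> h i \<in> hom (H i) K"
    and "i \<in> I" "g \<in> carrier (H i)" "fp_reduced I H w"
  shows "fp_lift K h (fp_push H (i, g) w) = h i g \<otimes>\<^bsub>K\<^esub> fp_lift K h w"
proof -
  interpret K: group K by fact
  have one: "h i \<one>\<^bsub>H i\<^esub> = \<one>\<^bsub>K\<^esub>" if "i \<in> I" for i
    using that assms(1,2) group_H by (metis hom_one)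
  have cl: "h i g \<in> carrier K" if "i \<in> I" "g \<in> carrier (H i)" for i g
    using that assms(2) hom_in_carrier by metis
  have clw: "fp_lift K h w \<in> carrier K" if "fp_reduced I H w" for w
    using fp_lift_closed[of K h w] assms(1,2) that by blast
  have mult: "h i (a \<otimes>\<^bsub>H i\<^esub> b) = h i a \<otimes>\<^bsub>K\<^esub> h i b"
    if "a \<in> carrier (H i)" "b \<in> carrier (H i)" for a b
    using that assms(2)[OF assms(3)] hom_mult by metis
  show ?thesis
  proof (cases w)
    case Nil
    then show ?thesis using assms one cl by (simp add: fp_lift_def)
  next
    case (Cons p v)
    obtain j k where p: "p = (j, k)" by fastforce
    have v: "fp_reduced I H v" "k \<in> carrier (H j)" "j \<in> I"
      using assms(5) unfolding Cons p by (auto simp: fp_reduced_Cons)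
    have *: "fp_lift K h ((a, b) # u) = h a b \<otimes>\<^bsub>K\<^esub> fp_lift K h u" for a b u
      by (simp add: fp_lift_def)
    show ?thesis
    proof (cases "i = j")
      case True
      have "h i g \<otimes>\<^bsub>K\<^esub> fp_lift K h w = h i (g \<otimes>\<^bsub>H i\<^esub> k) \<otimes>\<^bsub>K\<^esub> fp_lift K h v"
        using True v assms cl[of i g] cl[of i k] clw[OF v(1)] mult unfolding Cons p *
        by (simp add: K.m_assoc)
      then show ?thesis
        using True one[OF assms(3)] clw[OF v(1)] unfolding Cons p by (auto simp: *)
    next
      case False
      then show ?thesis
        using one[OF assms(3)] cl[OF assms(3,4)] cl[OF v(3,2)] clw[OF v(1)]
        unfolding Cons p by (auto simp: *)
    qed
  qed
qed

lemma fp_lift_hom: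
  assumes "group K" "\<And>i. i \<in> I \<Longrightarrow> h i \<in> hom (H i) K"
  shows "group_hom (fp I H) K (fp_lift K h)"
proof -
  interpret K: group K by fact
  have cl: "fp_lift K h w \<in> carrier K" if "fp_reduced I H w" for w
    using fp_lift_closed[of K h w] assms that by blast
  have "fp_lift K h (u \<otimes>\<^bsub>fp I H\<^esub> v) = fp_lift K h u \<otimes>\<^bsub>K\<^esub> fp_lift K h v"
    if "fp_reduced I H u" "fp_reduced I H v" for u v
    using that
  proof (induction u)
    case Nil
    then show ?case using cl[of v] by (simp add: mult_fp fp_lift_def)
  next
    case (Cons p u)
    obtain i g where p: "p = (i, g)" by fastforce
    have u: "i \<in> I" "g \<in> carrier (H i)" "fp_reduced I H u"
      using Cons.prems p by (auto simp: fp_reduced_Cons)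
    have "fp_lift K h (p # u) = h i g \<otimes>\<^bsub>K\<^esub> fp_lift K h u"
      by (simp add: fp_lift_def p)
    moreover have "fp_lift K h ((p # u) \<otimes>\<^bsub>fp I H\<^esub> v) =
        h i g \<otimes>\<^bsub>K\<^esub> fp_lift K h (u \<otimes>\<^bsub>fp I H\<^esub> v)"
      using fp_lift_push[OF assms(1) _ u(1,2), of h "foldr (fp_push H) u v"] assms(2)
        foldr_push_reduced u Cons.prems p by (simp add: mult_fp)
    moreover have "h i g \<in> carrier K" using u assms(2) hom_in_carrier by metis
    ultimately show ?case
      using Cons cl[OF u(3)] cl[OF Cons.prems(2)] u by (simp add: K.m_assoc)
  qed
  then show ?thesis
    using cl group_fp assms(1)
    by (auto simp: group_hom_def group_hom_axioms_def hom_def carrier_fp)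
qed

lemma fp_lift_in:
  assumes "group K" "\<And>i. i \<in> I \<Longrightarrow> h i \<in> hom (H i) K" "i \<in> I" "g \<in> carrier (H i)"
  shows "fp_lift K h (fp_in H i g) = h i g"
proof -
  interpret K: group K by fact
  have "h i \<one>\<^bsub>H i\<^esub> = \<one>\<^bsub>K\<^esub>" "h i g \<in> carrier K"
    using assms group_H by (metis hom_one, metis hom_in_carrier)
  then show ?thesis by (simp add: fp_lift_def fp_in_def)
qed

end

section \<open>Unrestricted wreath products\<close>

text \<open>The shift by \<open>b\<close> on the left factor is chosen so that a pair
  \<open>(f, a)\<close> can record how an element g moves a section s of the top group: g s(q) = s(a
  q) j(f q). The base is unrestricted because the generators embedded below have values different
  from 1 at infinitely many q.\<close>

definition wr ::
    "('w, 'm) monoid_scheme \<Rightarrow> ('q, 'n) monoid_scheme \<Rightarrow> (('q \<Rightarrow> 'w) \<times> 'q) monoid" where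
  "wr W A = \<lparr>carrier = (carrier A \<rightarrow>\<^sub>E carrier W) \<times> carrier A,
     monoid.mult = (\<lambda>(f, a) (g, b). (\<lambda>q\<in>carrier A. f (b \<otimes>\<^bsub>A\<^esub> q) \<otimes>\<^bsub>W\<^esub> g q, a \<otimes>\<^bsub>A\<^esub> b)),
     one = (\<lambda>q\<in>carrier A. \<one>\<^bsub>W\<^esub>, \<one>\<^bsub>A\<^esub>)\<rparr>"

lemma carrier_wr: "carrier (wr W A) = (carrier A \<rightarrow>\<^sub>E carrier W) \<times> carrier A"
  and one_wr: "\<one>\<^bsub>wr W A\<^esub> = (\<lambda>q\<in>carrier A. \<one>\<^bsub>W\<^esub>, \<one>\<^bsub>A\<^esub>)"
  and mult_wr: "(f, a) \<otimes>\<^bsub>wr W A\<^esub> (g, b) =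
    (\<lambda>q\<in>carrier A. f (b \<otimes>\<^bsub>A\<^esub> q) \<otimes>\<^bsub>W\<^esub> g q, a \<otimes>\<^bsub>A\<^esub> b)"
  by (simp_all add: wr_def)

lemma group_wr:
  assumes "group W" "group A"
  shows "group (wr W A)"
proof -
  interpret W: group W by fact
  interpret A: group A by fact
  show ?thesis
  proof (rule groupI)
    fix x y assume "x \<in> carrier (wr W A)" "y \<in> carrier (wr W A)"
    then show "x \<otimes>\<^bsub>wr W A\<^esub> y \<in> carrier (wr W A)"
      by (cases x; cases y) (auto simp: carrier_wr mult_wr)
  next
    fix x y z assume "x \<in> carrier (wr W A)" "y \<in> carrier (wr W A)" "z \<in> carrier (wr W A)"
    then obtain f a g b h c where x: "x = (f, a)" "y = (g, b)" "z = (h, c)"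
      and c: "a \<in> carrier A" "b \<in> carrier A" "c \<in> carrier A"
      and f: "f \<in> carrier A \<rightarrow>\<^sub>E carrier W" "g \<in> carrier A \<rightarrow>\<^sub>E carrier W"
        "h \<in> carrier A \<rightarrow>\<^sub>E carrier W"
      by (auto simp: carrier_wr)
    have "f q \<in> carrier W" "g q \<in> carrier W" "h q \<in> carrier W" if "q \<in> carrier A" for q
      using f that by auto
    then show "x \<otimes>\<^bsub>wr W A\<^esub> y \<otimes>\<^bsub>wr W A\<^esub> z = x \<otimes>\<^bsub>wr W A\<^esub> (y \<otimes>\<^bsub>wr W A\<^esub> z)"
      using c unfolding x by (simp add: mult_wr A.m_assoc W.m_assoc cong: restrict_cong)
  next
    fix x assume "x \<in> carrier (wr W A)"
    then show "\<one>\<^bsub>wr W A\<^esub> \<otimes>\<^bsub>wr W A\<^esub> x = x"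
      by (cases x) (auto simp: carrier_wr mult_wr one_wr PiE_iff extensional_def fun_eq_iff)
  next
    fix x assume "x \<in> carrier (wr W A)"
    then obtain f a where x: "x = (f, a)" "f \<in> carrier A \<rightarrow>\<^sub>E carrier W" "a \<in> carrier A"
      by (auto simp: carrier_wr)
    define y where "y = (\<lambda>q\<in>carrier A. inv\<^bsub>W\<^esub> f (inv\<^bsub>A\<^esub> a \<otimes>\<^bsub>A\<^esub> q), inv\<^bsub>A\<^esub> a)"
    have *: "f q \<in> carrier W" if "q \<in> carrier A" for q using x that by auto
    show "\<exists>y\<in>carrier (wr W A). y \<otimes>\<^bsub>wr W A\<^esub> x = \<one>\<^bsub>wr W A\<^esub>"
    proof (rule bexI)
      show "y \<in> carrier (wr W A)" using x(3) * by (auto simp: carrier_wr y_def)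
      show "y \<otimes>\<^bsub>wr W A\<^esub> x = \<one>\<^bsub>wr W A\<^esub>"
        using x(3) * by (auto simp: mult_wr one_wr y_def x(1) A.m_assoc[symmetric] intro!: restrict_ext)
    qed
  qed (auto simp: carrier_wr one_wr)
qed

lemma wr_homI:
  assumes "group G" "group W" "group A" "\<pi> \<in> hom G A"
    and "\<And>g q. g \<in> carrier G \<Longrightarrow> q \<in> carrier A \<Longrightarrow> \<phi> g q \<in> carrier W"
    and "\<And>g h q. g \<in> carrier G \<Longrightarrow> h \<in> carrier G \<Longrightarrow> q \<in> carrier A \<Longrightarrow>
           \<phi> (g \<otimes>\<^bsub>G\<^esub> h) q = \<phi> g (\<pi> h \<otimes>\<^bsub>A\<^esub> q) \<otimes>\<^bsub>W\<^esub> \<phi> h q"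
  shows "(\<lambda>g. (\<lambda>q\<in>carrier A. \<phi> g q, \<pi> g)) \<in> hom G (wr W A)"
proof (rule homI)
  interpret A: group A by fact
  have cl: "\<pi> g \<in> carrier A" if "g \<in> carrier G" for g
    using that assms(4) hom_in_carrier by metis
  show "(\<lambda>q\<in>carrier A. \<phi> g q, \<pi> g) \<in> carrier (wr W A)" if "g \<in> carrier G" for g
    using that cl assms(5) by (auto simp: carrier_wr)
  fix g h assume gh: "g \<in> carrier G" "h \<in> carrier G"
  then show "(\<lambda>q\<in>carrier A. \<phi> (g \<otimes>\<^bsub>G\<^esub> h) q, \<pi> (g \<otimes>\<^bsub>G\<^esub> h)) =
      (\<lambda>q\<in>carrier A. \<phi> g q, \<pi> g) \<otimes>\<^bsub>wr W A\<^esub> (\<lambda>q\<in>carrier A. \<phi> h q, \<pi> h)"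
    using assms(6)[OF gh] hom_mult[OF assms(4) gh] cl by (auto simp: mult_wr intro!: restrict_ext)
qed

lemma wr_snd_hom: "group W \<Longrightarrow> group A \<Longrightarrow> group_hom (wr W A) A snd"
  using group_wr[of W A]
  by (auto simp: group_hom_def group_hom_axioms_def carrier_wr mult_wr intro!: homI)

text \<open>The kernel of the projection to \<open>A\<close> is a Cartesian power of
  \<open>W\<close>; its coordinates are homomorphisms to \<open>W\<close> that together separate its
  elements.\<close>

lemma rdepth_le_wr:
  assumes "rdepth_le n W" "rdepth_le 1 A"
  shows "rdepth_le (Suc n) (wr W A)"
proof (rule rdepth_le_extension[OF _ assms(2)])
  have gr: "group W" "group A" using assms by (simp_all add: rdepth_le_def)
  then show hom: "group_hom (wr W A) A snd" by (rule wr_snd_hom)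
  let ?K = "kernel (wr W A) A snd"
  let ?G = "(wr W A)\<lparr>carrier := ?K\<rparr>"
  have grK: "group ?G"
    using group_hom.subgroup_kernel[OF hom] group.subgroup_imp_group group_wr[OF gr] by blast
  show "rdepth_le n ?G"
  proof (rule rdepth_leI[OF grK])
    fix x assume x: "x \<in> FRn ?G n"
    then have "x \<in> ?K" using FRn_subgroup[OF grK, of n] subgroup.subset by fastforce
    then obtain f where f: "x = (f, \<one>\<^bsub>A\<^esub>)" "f \<in> carrier A \<rightarrow>\<^sub>E carrier W"
      by (auto simp: kernel_def carrier_wr)
    have "f q = \<one>\<^bsub>W\<^esub>" if q: "q \<in> carrier A" for q
    proof -
      have "group_hom ?G W (\<lambda>x. fst x q)"
        using grK gr q
        by (auto simp: group_hom_def group_hom_axioms_def kernel_def carrier_wr mult_wr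
            group.is_monoid monoid.l_one intro!: homI)
      then show ?thesis using rdepth_le_hom[OF assms(1) _ x] f(1) by force
    qed
    then show "x = \<one>\<^bsub>?G\<^esub>"
      using f by (auto simp: one_wr PiE_iff extensional_def fun_eq_iff)
  qed
qed

text \<open>
  A homomorphism to a wreath product is a cocycle; it is injective as soon as its source has
  generators that move a section of the base in the way that the cocycle predicts.
\<close>

lemma wr_section:
  fixes H (structure)
  assumes "group_hom H (wr W A) \<Phi>" "group_hom W H j" "group A"
    and s: "s \<in> carrier A \<rightarrow> carrier H"
    and T: "T \<subseteq> carrier H" "generate H T = carrier H"
    and sec: "\<And>t q. t \<in> T \<Longrightarrow> q \<in> carrier A \<Longrightarrow>
        t \<otimes> s q = s (snd (\<Phi> t) \<otimes>\<^bsub>A\<^esub> q) \<otimes> j (fst (\<Phi> t) q)"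
    and "h \<in> carrier H" "q \<in> carrier A"
  shows "h \<otimes> s q = s (snd (\<Phi> h) \<otimes>\<^bsub>A\<^esub> q) \<otimes> j (fst (\<Phi> h) q)"
proof -
  interpret H: group H using assms(1) by (simp add: group_hom_def)
  interpret \<Phi>: group_hom H "wr W A" \<Phi> by fact
  interpret j: group_hom W H j by fact
  interpret A: group A by fact
  have \<pi>: "snd (\<Phi> h) \<in> carrier A" and \<phi>: "q \<in> carrier A \<Longrightarrow> fst (\<Phi> h) q \<in> carrier W"
    if "h \<in> carrier H" for h q
    using \<Phi>.hom_closed[OF that] by (auto simp: carrier_wr)
  have \<Phi>m: "snd (\<Phi> (g \<otimes> h)) = snd (\<Phi> g) \<otimes>\<^bsub>A\<^esub> snd (\<Phi> h)"
    "q \<in> carrier A \<Longrightarrow> fst (\<Phi> (g \<otimes> h)) q = fst (\<Phi> g) (snd (\<Phi> h) \<otimes>\<^bsub>A\<^esub> q) \<otimes>\<^bsub>W\<^esub> fst (\<Phi> h) q"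
    if "g \<in> carrier H" "h \<in> carrier H" for g h q
    using \<Phi>.hom_mult[OF that] by (cases "\<Phi> g"; cases "\<Phi> h"; simp add: mult_wr)+
  have \<Phi>1: "snd (\<Phi> \<one>) = \<one>\<^bsub>A\<^esub>" "q \<in> carrier A \<Longrightarrow> fst (\<Phi> \<one>) q = \<one>\<^bsub>W\<^esub>" for q
    by (simp_all add: one_wr)
  have sc: "s q \<in> carrier H" if "q \<in> carrier A" for q using s that by blast
  let ?P = "\<lambda>h. \<forall>q\<in>carrier A. h \<otimes> s q = s (snd (\<Phi> h) \<otimes>\<^bsub>A\<^esub> q) \<otimes> j (fst (\<Phi> h) q)"
  have mult: "?P (g \<otimes> h)" if "g \<in> carrier H" "h \<in> carrier H" "?P g" "?P h" for g h
  proof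
    fix q assume q: "q \<in> carrier A"
    have "g \<otimes> h \<otimes> s q = g \<otimes> (s (snd (\<Phi> h) \<otimes>\<^bsub>A\<^esub> q) \<otimes> j (fst (\<Phi> h) q))"
      using that q sc by (simp add: H.m_assoc)
    also have "\<dots> = g \<otimes> s (snd (\<Phi> h) \<otimes>\<^bsub>A\<^esub> q) \<otimes> j (fst (\<Phi> h) q)"
      using that(1,2) q sc \<pi> \<phi> by (simp add: H.m_assoc)
    also have "\<dots> = s (snd (\<Phi> g) \<otimes>\<^bsub>A\<^esub> (snd (\<Phi> h) \<otimes>\<^bsub>A\<^esub> q)) \<otimes>
        j (fst (\<Phi> g) (snd (\<Phi> h) \<otimes>\<^bsub>A\<^esub> q)) \<otimes> j (fst (\<Phi> h) q)"
      using that(3)[rule_format, of "snd (\<Phi> h) \<otimes>\<^bsub>A\<^esub> q"] q \<pi>[OF that(2)] by simp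
    also have "\<dots> = s (snd (\<Phi> (g \<otimes> h)) \<otimes>\<^bsub>A\<^esub> q) \<otimes> j (fst (\<Phi> (g \<otimes> h)) q)"
      unfolding \<Phi>m(1)[OF that(1,2)] \<Phi>m(2)[OF that(1,2) q]
      using that(1,2) q sc \<pi> \<phi> by (simp add: A.m_assoc H.m_assoc)
    finally show "g \<otimes> h \<otimes> s q = s (snd (\<Phi> (g \<otimes> h)) \<otimes>\<^bsub>A\<^esub> q) \<otimes> j (fst (\<Phi> (g \<otimes> h)) q)" .
  qed
  have P_inv: "?P (inv h)" if h: "h \<in> carrier H" "?P h" for h
  proof
    fix q assume q: "q \<in> carrier A"
    let ?q = "snd (\<Phi> (inv h)) \<otimes>\<^bsub>A\<^esub> q"
    have q': "?q \<in> carrier A" "snd (\<Phi> h) \<otimes>\<^bsub>A\<^esub> ?q = q"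
      using h q \<pi>[of "inv h"] \<pi>[of h] \<Phi>m(1)[of h "inv h"] \<Phi>1
      by (auto simp: A.m_assoc[symmetric])
    define c where "c = fst (\<Phi> (inv h)) q"
    have c: "fst (\<Phi> h) ?q \<in> carrier W" "c \<in> carrier W"
      using \<phi>[OF h(1) q'(1)] \<phi>[OF H.inv_closed[OF h(1)] q] by (simp_all only: c_def)
    have e: "fst (\<Phi> h) ?q \<otimes>\<^bsub>W\<^esub> c = \<one>\<^bsub>W\<^esub>"
      using h(1) q \<Phi>m(2)[of h "inv h" q] \<Phi>1 by (simp add: c_def)
    have "h \<otimes> (s ?q \<otimes> j c) = h \<otimes> s ?q \<otimes> j c"
      using h(1) c sc[OF q'(1)] by (simp add: H.m_assoc)
    also have "h \<otimes> s ?q = s q \<otimes> j (fst (\<Phi> h) ?q)"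
      using h(2)[rule_format, OF q'(1)] q'(2) by simp
    also have "\<dots> \<otimes> j c = s q \<otimes> j (fst (\<Phi> h) ?q \<otimes>\<^bsub>W\<^esub> c)"
      using c sc[OF q] by (simp add: H.m_assoc)
    also have "\<dots> = s q" using e sc[OF q] by simp
    finally have "h \<otimes> (s ?q \<otimes> j c) = s q" .
    moreover have "s ?q \<otimes> j c \<in> carrier H" using c(2) sc[OF q'(1)] by simp
    ultimately have "inv h \<otimes> s q = s ?q \<otimes> j c"
      using h(1) sc[OF q] H.inv_solve_left[of "s ?q \<otimes> j c" h "s q"] by simp
    then show "inv h \<otimes> s q = s ?q \<otimes> j (fst (\<Phi> (inv h)) q)"
      by (simp only: c_def)
  qed
  have "h \<in> carrier H \<and> ?P h" if "h \<in> generate H T" for h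
    using that
  proof (induction rule: generate.induct)
    case one
    then show ?case using sc \<Phi>1 by simp
  next
    case (incl h)
    then show ?case using sec T(1) by auto
  next
    case (inv h)
    then have "h \<in> carrier H" "?P h" using sec T(1) by auto
    then show ?case using P_inv[of h] H.inv_closed[of h] by blast
  next
    case (eng g h)
    then show ?case using mult[of g h] H.m_closed[of g h] by blast
  qed
  then show ?thesis using T(2) assms(8,9) by simp
qed

lemma wr_section_inj:
  fixes H (structure)
  assumes "group_hom H (wr W A) \<Phi>" "group_hom W H j" "group A"
    and s: "s \<in> carrier A \<rightarrow> carrier H"
    and T: "T \<subseteq> carrier H" "generate H T = carrier H"
    and sec: "\<And>t q. t \<in> T \<Longrightarrow> q \<in> carrier A \<Longrightarrow>
        t \<otimes> s q = s (snd (\<Phi> t) \<otimes>\<^bsub>A\<^esub> q) \<otimes> j (fst (\<Phi> t) q)"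
  shows "inj_on \<Phi> (carrier H)"
proof -
  interpret H: group H using assms(1) by (simp add: group_hom_def)
  interpret \<Phi>: group_hom H "wr W A" \<Phi> by fact
  interpret j: group_hom W H j by fact
  interpret A: group A by fact
  show ?thesis
    unfolding \<Phi>.inj_on_one_iff
  proof (intro ballI allI impI)
    fix h assume h: "h \<in> carrier H" "\<Phi> h = \<one>\<^bsub>wr W A\<^esub>"
    have "s \<one>\<^bsub>A\<^esub> \<in> carrier H" using s by auto
    moreover have "h \<otimes> s \<one>\<^bsub>A\<^esub> = s \<one>\<^bsub>A\<^esub>"
      using wr_section[OF assms h(1) A.one_closed] h(2) calculation by (simp add: one_wr)
    ultimately show "h = \<one>" using h(1) by simp
  qed
qed

section \<open>Finite residuals of free products\<close>

text \<open>If substituting letter by letter leaves a word reduced, the induced homomorphism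
  performs no cancellation and in particular does not kill a nonempty word.\<close>

lemma fp_lift_map:
  assumes "fp_family J K" "fp_reduced J K (map (\<lambda>(i, g). (\<sigma> i, h i g)) w)"
  shows "fp_lift (fp J K) (\<lambda>i g. fp_in K (\<sigma> i) (h i g)) w = map (\<lambda>(i, g). (\<sigma> i, h i g)) w"
  using assms(2)
proof (induction w)
  case Nil
  then show ?case by (simp add: fp_lift_def one_fp)
next
  case (Cons p w)
  obtain i g where p: "p = (i, g)" by fastforce
  have red: "(\<sigma> i, h i g) # map (\<lambda>(i, g). (\<sigma> i, h i g)) w \<in> carrier (fp J K)"
    using Cons.prems p by (simp add: carrier_fp)
  then have "fp_reduced J K (map (\<lambda>(i, g). (\<sigma> i, h i g)) w)"
    by (simp add: carrier_fp fp_reduced_Cons)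
  then show ?case
    using Cons.IH fp_family.fp_Cons_eq(1)[OF assms(1) red] p by (simp add: fp_lift_def)
qed

context fp_family
begin

definition fp_words_le :: "nat \<Rightarrow> ('i \<times> 'g) list set" where
  "fp_words_le L = {w \<in> carrier (fp I H). length w \<le> L}"

text \<open>
  The group \<open>H i\<close> acts on the reduced words of bounded length: as in the free product on the
  words that begin in \<open>H i\<close> or have room for one more letter, and trivially on the others.
\<close>

definition fp_act :: "nat \<Rightarrow> 'i \<Rightarrow> 'g \<Rightarrow> ('i \<times> 'g) list \<Rightarrow> ('i \<times> 'g) list" where
  "fp_act L i g w =
     (if w \<noteq> [] \<and> fst (hd w) = i \<or> length w < L then fp_push H (i, g) w else w)"

lemma fp_act_closed:
  assumes "i \<in> I" "g \<in> carrier (H i)" "w \<in> fp_words_le L"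
  shows "fp_act L i g w \<in> fp_words_le L"
  using assms push_reduced[OF assms(1,2), of w]
  by (cases w) (auto simp: fp_act_def fp_words_le_def carrier_fp)

lemma fp_act_one: "i \<in> I \<Longrightarrow> w \<in> fp_words_le L \<Longrightarrow> fp_act L i \<one>\<^bsub>H i\<^esub> w = w"
  using push_one by (simp add: fp_act_def fp_words_le_def carrier_fp)

lemma fp_act_mult:
  assumes "i \<in> I" "g \<in> carrier (H i)" "h \<in> carrier (H i)" "w \<in> fp_words_le L"
  shows "fp_act L i g (fp_act L i h w) = fp_act L i (g \<otimes>\<^bsub>H i\<^esub> h) w"
proof -
  have w: "fp_reduced I H w" "length w \<le> L" using assms(4) by (auto simp: fp_words_le_def carrier_fp)
  have *: "fp_push H (i, h) w \<noteq> [] \<and> fst (hd (fp_push H (i, h) w)) = i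
      \<or> length (fp_push H (i, h) w) < L" if "w \<noteq> [] \<and> fst (hd w) = i \<or> length w < L"
  proof (cases w)
    case (Cons p v)
    obtain j k where p: "p = (j, k)" by fastforce
    show ?thesis
      by (cases "i = j"; cases "h \<otimes>\<^bsub>H i\<^esub> k = \<one>\<^bsub>H i\<^esub>"; cases "h = \<one>\<^bsub>H i\<^esub>")
        (use that w Cons p in \<open>simp_all\<close>)
  qed (use that in auto)
  show ?thesis
    using push_mult[OF assms(1-3) w(1)] * by (auto simp: fp_act_def)
qed

definition fp_perm :: "nat \<Rightarrow> 'i \<Rightarrow> 'g \<Rightarrow> ('i \<times> 'g) list \<Rightarrow> ('i \<times> 'g) list" where
  "fp_perm L i g = (\<lambda>w\<in>fp_words_le L. fp_act L i g w)"

lemma fp_perm_hom: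
  assumes "i \<in> I"
  shows "fp_perm L i \<in> hom (H i) (BijGroup (fp_words_le L))"
proof (rule homI)
  interpret group "H i" using group_H assms .
  fix g assume g: "g \<in> carrier (H i)"
  have "bij_betw (fp_act L i g) (fp_words_le L) (fp_words_le L)"
    using assms g fp_act_closed fp_act_mult fp_act_one
    by (intro bij_betw_byWitness[where f' = "fp_act L i (inv\<^bsub>H i\<^esub> g)"]) auto
  then show "fp_perm L i g \<in> carrier (BijGroup (fp_words_le L))"
    by (simp add: BijGroup_def Bij_def fp_perm_def)
next
  interpret group "H i" using group_H assms .
  have B: "fp_perm L i g \<in> Bij (fp_words_le L)" if "g \<in> carrier (H i)" for g
  proof -
    have "bij_betw (fp_act L i g) (fp_words_le L) (fp_words_le L)"
      using assms that fp_act_closed fp_act_mult fp_act_one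
      by (intro bij_betw_byWitness[where f' = "fp_act L i (inv\<^bsub>H i\<^esub> g)"]) auto
    then show ?thesis by (simp add: Bij_def fp_perm_def)
  qed
  fix g h assume gh: "g \<in> carrier (H i)" "h \<in> carrier (H i)"
  show "fp_perm L i (g \<otimes>\<^bsub>H i\<^esub> h) = fp_perm L i g \<otimes>\<^bsub>BijGroup (fp_words_le L)\<^esub> fp_perm L i h"
    using B[OF gh(1)] B[OF gh(2)] fp_act_mult[OF assms gh] fp_act_closed[OF assms gh(2)]
    by (auto simp: BijGroup_def compose_def fp_perm_def intro!: restrict_ext)
qed

text \<open>Built up from the right, every proper suffix of \<open>w\<close> still has room for one
  more letter. So the permutation of \<open>w\<close> sends the empty word to \<open>w\<close> and
  is nontrivial unless \<open>w\<close> is empty.\<close>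

lemma fp_lift_act:
  assumes "w \<in> fp_words_le L"
  shows "fp_lift (BijGroup (fp_words_le L)) (fp_perm L) w [] = w"
    (is "fp_lift ?B ?h w [] = w")
  using assms
proof (induction w)
  case Nil
  then show ?case by (simp add: fp_lift_def BijGroup_def)
next
  case (Cons p w)
  obtain i g where p: "p = (i, g)" by fastforce
  have pw: "(i, g) # w \<in> carrier (fp I H)" "length w < L"
    using Cons.prems p by (auto simp: fp_words_le_def)
  note C = fp_Cons_eq[OF pw(1)]
  have w: "w \<in> fp_words_le L" "[] \<in> fp_words_le L"
    using C pw by (auto simp: fp_words_le_def carrier_fp)
  have hom: "group_hom (fp I H) ?B (fp_lift ?B ?h)"
    by (rule fp_lift_hom) (simp_all add: group_BijGroup fp_perm_hom)
  have "fp_lift ?B ?h w \<in> carrier ?B" "?h i g \<in> carrier ?B"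
    using group_hom.hom_closed[OF hom] C fp_perm_hom[of i L] hom_in_carrier by metis+
  then have "fp_lift ?B ?h (p # w) [] = ?h i g (fp_lift ?B ?h w [])"
    using w(2) p by (simp add: fp_lift_def BijGroup_def compose_def)
  also have "\<dots> = fp_act L i g w" using w by (simp add: Cons.IH) (simp add: fp_perm_def)
  also have "\<dots> = fp_push H (i, g) w" using pw by (simp add: fp_act_def)
  also have "\<dots> = p # w" using C(1) fp_in_mult[OF C(2-4)] p by simp
  finally show ?case .
qed

text \<open>Only finitely many letters are available, so the words of bounded length form a finite
  set, and \<open>w\<close> is detected by its permutation of the words no longer than
  \<open>w\<close>.\<close>

lemma rdepth_le_fp_finite:
  assumes "finite {i \<in> I. carrier (H i) \<noteq> {\<one>\<^bsub>H i\<^esub>}}" "\<And>i. i \<in> I \<Longrightarrow> finite (carrier (H i))"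
  shows "rdepth_le 1 (fp I H)"
proof (rule rdepth_leI[OF group_fp])
  fix w assume w: "w \<in> FRn (fp I H) 1"
  then have wc: "w \<in> carrier (fp I H)" using FR_subset by fastforce
  define L where "L = length w"
  have wL: "w \<in> fp_words_le L" using wc by (simp add: fp_words_le_def L_def)
  let ?I = "{i \<in> I. carrier (H i) \<noteq> {\<one>\<^bsub>H i\<^esub>}}"
  let ?S = "\<Union>i\<in>?I. {i} \<times> carrier (H i)"
  have "fp_words_le L \<subseteq> {v. set v \<subseteq> ?S \<and> length v \<le> L}"
    by (force simp: fp_words_le_def carrier_fp fp_reduced_def)
  moreover have "finite ?S" using assms by auto
  ultimately have fin: "finite (fp_words_le L)"
    using finite_lists_length_le finite_subset by blast
  let ?B = "BijGroup (fp_words_le L)" and ?h = "fp_perm L"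
  have "carrier ?B \<subseteq> fp_words_le L \<rightarrow>\<^sub>E fp_words_le L"
    by (auto simp: BijGroup_def Bij_def bij_betw_def PiE_def)
  then have "finite (carrier ?B)" using fin finite_PiE finite_subset by (metis (no_types))
  then have B: "rdepth_le 1 ?B" using rdepth_le_finite group_BijGroup by blast
  have hom: "group_hom (fp I H) ?B (fp_lift ?B ?h)"
    by (rule fp_lift_hom) (simp_all add: group_BijGroup fp_perm_hom)
  have "fp_lift ?B ?h w = \<one>\<^bsub>?B\<^esub>" using rdepth_le_hom[OF B hom w] .
  moreover have "[] \<in> fp_words_le L" by (simp add: fp_words_le_def carrier_fp)
  ultimately have "w = []" using fp_lift_act[OF wL] by (simp add: BijGroup_def)
  then show "w = \<one>\<^bsub>fp I H\<^esub>" by (simp add: one_fp)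
qed

text \<open>For a given word, each factor is replaced by a finite quotient in which the letters of
  the word survive, and factors that do not occur in it are collapsed. This leaves finitely many
  nontrivial finite factors, and the word stays reduced.\<close>

lemma rdepth_le_fp_1:
  assumes "\<And>i. i \<in> I \<Longrightarrow> rdepth_le 1 (H i)"
  shows "rdepth_le 1 (fp I H)"
proof (rule rdepth_leI[OF group_fp])
  fix w assume w: "w \<in> FRn (fp I H) 1"
  then have wc: "w \<in> carrier (fp I H)" using FR_subset by fastforce
  define S where "S i = {g. (i, g) \<in> set w}" for i
  have S: "finite (S i)" for i
  proof -
    have "S i \<subseteq> snd ` set w" by (force simp: S_def)
    then show ?thesis using finite_subset by blast
  qed
  have Si: "S i \<subseteq> carrier (H i) - {\<one>\<^bsub>H i\<^esub>}" if "i \<in> I" for i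
    using wc by (auto simp: S_def carrier_fp fp_reduced_def)
  have "\<exists>N. N \<lhd> H i \<and> fin_idx (H i) N \<and> N \<inter> S i = {} \<and> (S i = {} \<longrightarrow> N = carrier (H i))"
    if i: "i \<in> I" for i
  proof (cases "S i = {}")
    case True
    interpret group "H i" using group_H i .
    have "carrier (H i) \<lhd> H i" using subgroup_self by (auto simp: normal_inv_iff)
    then show ?thesis using True fin_idx_carrier by blast
  qed (use residually_finite_normal[OF assms[OF i] S Si[OF i]] in blast)
  then obtain N where N: "\<And>i. i \<in> I \<Longrightarrow> N i \<lhd> H i" "\<And>i. i \<in> I \<Longrightarrow> fin_idx (H i) (N i)"
    "\<And>i. i \<in> I \<Longrightarrow> N i \<inter> S i = {}" "\<And>i. i \<in> I \<Longrightarrow> S i = {} \<Longrightarrow> N i = carrier (H i)"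
    by metis
  define Q where "Q i = H i Mod N i" for i
  have Q: "group (Q i)" if "i \<in> I" for i
    using N(1)[OF that] by (simp add: Q_def normal.factorgroup_is_group)
  interpret Q: fp_family I Q by (rule fp_family.intro) (rule Q)
  have "finite (carrier (Q i))" if "i \<in> I" for i
    using N(2)[OF that] by (simp add: Q_def FactGroup_def fin_idx_def)
  moreover have "{i \<in> I. carrier (Q i) \<noteq> {\<one>\<^bsub>Q i\<^esub>}} \<subseteq> fst ` set w"
  proof
    fix i assume i: "i \<in> {i \<in> I. carrier (Q i) \<noteq> {\<one>\<^bsub>Q i\<^esub>}}"
    interpret group "H i" using group_H i by simp
    have "S i \<noteq> {}"
    proof
      assume "S i = {}"
      then have "N i = carrier (H i)" using N(4) i by simp
      then have "carrier (Q i) = {\<one>\<^bsub>Q i\<^esub>}"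
        using coset_join2[OF _ subgroup_self] unfolding Q_def carrier_FactGroup by auto
      then show False using i by simp
    qed
    then show "i \<in> fst ` set w" by (force simp: S_def)
  qed
  ultimately have RQ: "rdepth_le 1 (fp I Q)"
    by (intro Q.rdepth_le_fp_finite) (auto elim: finite_subset)
  let ?h = "\<lambda>i g. fp_in Q i (N i #>\<^bsub>H i\<^esub> g)"
  have "?h i \<in> hom (H i) (fp I Q)" if "i \<in> I" for i
    using normal.r_coset_hom_Mod[OF N(1)[OF that]] group_hom.homh[OF Q.fp_in_hom[OF that]]
    by (force simp: Q_def intro: hom_compose[unfolded comp_def])
  then have "group_hom (fp I H) (fp I Q) (fp_lift (fp I Q) ?h)"
    by (intro fp_lift_hom Q.group_fp) auto
  then have one: "fp_lift (fp I Q) ?h w = []"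
    using rdepth_le_hom[OF RQ _ w] by (simp add: one_fp)
  have "fp_reduced I Q (map (\<lambda>(i, g). (i, N i #>\<^bsub>H i\<^esub> g)) w)"
  proof -
    have letters: "N i #>\<^bsub>H i\<^esub> g \<in> carrier (Q i) \<and> N i #>\<^bsub>H i\<^esub> g \<noteq> \<one>\<^bsub>Q i\<^esub> \<and> i \<in> I"
      if ig: "(i, g) \<in> set w" for i g
    proof -
      have i: "i \<in> I" "g \<in> carrier (H i)" using ig wc by (auto simp: carrier_fp fp_reduced_def)
      interpret group "H i" using group_H i by simp
      have "g \<notin> N i" using N(3)[OF i(1)] ig by (auto simp: S_def)
      then have "N i #>\<^bsub>H i\<^esub> g \<noteq> N i"
        using rcos_self[OF i(2)] N(1)[OF i(1)] normal_imp_subgroup by blast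
      then show ?thesis using i by (auto simp: Q_def carrier_FactGroup)
    qed
    have "map fst (map (\<lambda>(i, g). (i, N i #>\<^bsub>H i\<^esub> g)) w) = map fst w"
      by (simp add: case_prod_unfold)
    then have "distinct_adj (map fst (map (\<lambda>(i, g). (i, N i #>\<^bsub>H i\<^esub> g)) w))"
      using wc by (simp only: carrier_fp fp_reduced_def mem_Collect_eq)
    then show ?thesis
      unfolding fp_reduced_def using letters by (auto simp del: map_map)
  qed
  from fp_lift_map[OF Q.fp_family_axioms, where \<sigma> = "\<lambda>i. i", OF this] one
  show "w = \<one>\<^bsub>fp I H\<^esub>" by (simp add: one_fp)
qed

end

section \<open>The quotient by the finite residual\<close>

lemma FR_D: "x \<in> FR G \<Longrightarrow> fin_idx G K \<Longrightarrow> x \<in> K"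
  by (simp add: FR_def)

lemma fin_idx_image:
  fixes G (structure)
  assumes "group_hom G Q \<pi>" "\<pi> ` carrier G = carrier Q" "fin_idx G K"
  shows "fin_idx Q (\<pi> ` K)"
proof -
  interpret group_hom G Q \<pi> by fact
  obtain f :: "_ \<Rightarrow> nat" where f: "finite (f ` carrier G)"
    "\<And>x y. x \<in> carrier G \<Longrightarrow> y \<in> carrier G \<Longrightarrow> f x = f y \<Longrightarrow> x \<otimes> inv y \<in> K"
    using fin_idxE[OF G.group_axioms assms(3)] by blast
  define r where "r c = (SOME x. x \<in> carrier G \<and> \<pi> x = c)" for c
  have r: "r c \<in> carrier G" "\<pi> (r c) = c" if "c \<in> carrier Q" for c
  proof -
    have "\<exists>x. x \<in> carrier G \<and> \<pi> x = c" using that assms(2) by (metis imageE)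
    from someI_ex[OF this] show "r c \<in> carrier G" "\<pi> (r c) = c" by (simp_all add: r_def)
  qed
  show ?thesis
  proof (rule fin_idxI[where f = "\<lambda>c. f (r c)"])
    show "subgroup (\<pi> ` K) Q"
      using subgroup_img_is_subgroup fin_idx_subgroup[OF assms(3)] .
    show "finite ((\<lambda>c. f (r c)) ` carrier Q)"
      by (rule finite_subset[OF _ f(1)]) (use r in auto)
    fix c d assume cd: "c \<in> carrier Q" "d \<in> carrier Q" "f (r c) = f (r d)"
    then have "r c \<otimes> inv (r d) \<in> K" using r f(2) by simp
    moreover have "\<pi> (r c \<otimes> inv (r d)) = c \<otimes>\<^bsub>Q\<^esub> inv\<^bsub>Q\<^esub> d" using cd r by simp
    ultimately show "c \<otimes>\<^bsub>Q\<^esub> inv\<^bsub>Q\<^esub> d \<in> \<pi> ` K" by (metis imageI)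
  qed (rule H.group_axioms)
qed

lemma FR_normal:
  fixes G (structure)
  assumes "group G"
  shows "FR G \<lhd> G"
proof -
  interpret group G by fact
  show ?thesis
    unfolding normal_inv_iff
  proof (intro conjI ballI FR_subgroup assms)
    fix x h assume x: "x \<in> carrier G" "h \<in> FR G"
    have "group_hom G G (\<lambda>y. x \<otimes> y \<otimes> inv x)"
      using x(1) by (auto simp: group_hom_def group_hom_axioms_def m_assoc inv_solve_left
          intro!: homI)
    from FR_hom[OF this x(2)] show "x \<otimes> h \<otimes> inv x \<in> FR G" .
  qed
qed

text \<open>Every finite index subgroup contains \<open>FR G\<close>, so it is recovered from its
  image in the quotient, and these images already intersect trivially.\<close>

lemma rdepth_le_Mod_FR:
  fixes G (structure)
  assumes "group G"
  shows "rdepth_le 1 (G Mod FR G)"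
proof -
  interpret group G by fact
  interpret N: normal "FR G" G using FR_normal[OF assms] .
  have hom: "group_hom G (G Mod FR G) (\<lambda>x. FR G #> x)"
    using N.factorgroup_is_group N.r_coset_hom_Mod
    by (simp add: group_hom_def group_hom_axioms_def)
  show ?thesis
  proof (rule rdepth_leI[OF N.factorgroup_is_group])
    fix c assume "c \<in> FRn (G Mod FR G) 1"
    then have c: "c \<in> FR (G Mod FR G)" by simp
    then obtain x where x: "x \<in> carrier G" "c = FR G #> x"
      using FR_subset[of "G Mod FR G"] by (auto simp: carrier_FactGroup)
    have "x \<in> K" if K: "fin_idx G K" for K
    proof -
      have "fin_idx (G Mod FR G) ((\<lambda>x. FR G #> x) ` K)"
        by (rule fin_idx_image[OF hom _ K]) (simp add: carrier_FactGroup)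
      with c have "c \<in> (\<lambda>x. FR G #> x) ` K" by (rule FR_D)
      then obtain k where k: "k \<in> K" "c = FR G #> k" by auto
      have Ksub: "subgroup K G" using fin_idx_subgroup[OF K] .
      then have kc: "k \<in> carrier G" using k subgroup.mem_carrier by metis
      have "x \<in> FR G #> k" using rcos_self[OF x(1) N.subgroup_axioms] x k by simp
      then obtain n where n: "n \<in> FR G" "x = n \<otimes> k" by (auto simp: r_coset_def)
      then have "n \<in> K" using K FR_D by metis
      then show "x \<in> K" using n k Ksub subgroup.m_closed by metis
    qed
    then have "x \<in> FR G" using x(1) unfolding FR_def by blast
    from coset_join2[OF x(1) N.subgroup_axioms this]
    show "c = \<one>\<^bsub>G Mod FR G\<^esub>" using x(2) by simp
  qed
qed


text \<open>
  The kernel of the map from a free product of groups \<open>H i\<close> to the free product of their quotients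
  by the finite residuals is a free product of conjugates of these residuals.  It is enough to
  embed the free product of the \<open>H i\<close> in a wreath product.
\<close>

locale fp_residual = fp_family I H for I :: "nat set" and H :: "nat \<Rightarrow> 'g monoid" +
  assumes countable_H: "i \<in> I \<Longrightarrow> countable (carrier (H i))"
begin

definition Q where "Q i = H i Mod FR (H i)"

text \<open>A transversal of the quotient, normalised at the trivial coset so that lifting a reduced
  word letter by letter gives a reduced word.\<close>

definition \<sigma> where "\<sigma> i c = (if c = \<one>\<^bsub>Q i\<^esub> then \<one>\<^bsub>H i\<^esub> else (SOME x. x \<in> c))"

definition pr where "pr i g = FR (H i) #>\<^bsub>H i\<^esub> g"

definition sec where "sec w = map (\<lambda>(i, c). (i, \<sigma> i c)) w"

text \<open>A word is split into its part in factor i, which may be trivial, and a word that does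
  not begin in factor i. The latter, \<open>tli i w\<close>, represents the orbit of
  \<open>w\<close> under left multiplication by factor i.\<close>

definition hdi where
  "hdi i w = (if w \<noteq> [] \<and> fst (hd w) = i then snd (hd w) else \<one>\<^bsub>Q i\<^esub>)"

definition tli :: "nat \<Rightarrow> (nat \<times> 'g set) list \<Rightarrow> (nat \<times> 'g set) list" where
  "tli i w = (if w \<noteq> [] \<and> fst (hd w) = i then tl w else w)"

text \<open>The factors of the kernel are indexed by pairs of a factor and a word. Coding them by
  natural numbers makes the kernel a free product of the same type as the original one, so that
  \<open>rdepth_le_fp\<close> can go by induction.\<close>

definition enc where "enc = to_nat_on (I \<times> carrier (fp I Q))"

definition dec where "dec = from_nat_into (I \<times> carrier (fp I Q))"

definition J where "J = enc ` (I \<times> carrier (fp I Q))"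

definition N where "N m = (H (fst (dec m)))\<lparr>carrier := FR (H (fst (dec m)))\<rparr>"

lemma normal_FR: "i \<in> I \<Longrightarrow> FR (H i) \<lhd> H i"
  using FR_normal group_H by blast

lemma group_Q: "i \<in> I \<Longrightarrow> group (Q i)"
  using normal_FR normal.factorgroup_is_group by (auto simp: Q_def)

sublocale Q: fp_family I Q
  by (rule fp_family.intro) (rule group_Q)

lemma pr_hom: "i \<in> I \<Longrightarrow> group_hom (H i) (Q i) (pr i)"
  using normal_FR[of i] group_Q[of i] group_H[of i] normal.r_coset_hom_Mod[of "FR (H i)" "H i"]
  by (simp add: group_hom_def group_hom_axioms_def Q_def pr_def[abs_def])

lemma pr_eq_one: "i \<in> I \<Longrightarrow> g \<in> carrier (H i) \<Longrightarrow> pr i g = \<one>\<^bsub>Q i\<^esub> \<longleftrightarrow> g \<in> FR (H i)"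
  using group.coset_join1[OF group_H, of i "FR (H i)" g] group.coset_join2[OF group_H, of i g "FR (H i)"]
    normal_imp_subgroup[OF normal_FR] subgroup.subset
  by (auto simp: pr_def Q_def)

lemma \<sigma>_props:
  assumes "i \<in> I" "c \<in> carrier (Q i)"
  shows "\<sigma> i c \<in> carrier (H i)" "pr i (\<sigma> i c) = c" "\<sigma> i c = \<one>\<^bsub>H i\<^esub> \<longleftrightarrow> c = \<one>\<^bsub>Q i\<^esub>"
proof -
  interpret group "H i" using group_H assms(1) .
  interpret pr: group_hom "H i" "Q i" "pr i" using pr_hom assms(1) .
  have S: "subgroup (FR (H i)) (H i)" using FR_subgroup group_axioms .
  have "\<sigma> i c \<in> carrier (H i) \<and> pr i (\<sigma> i c) = c"
  proof (cases "c = \<one>\<^bsub>Q i\<^esub>")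
    case False
    obtain x where x: "x \<in> carrier (H i)" "c = pr i x"
      using assms(2) by (auto simp: Q_def carrier_FactGroup pr_def)
    have "\<sigma> i c \<in> c"
      using False rcos_self[OF x(1) S] x(2) someI[of "\<lambda>y. y \<in> c" x]
      by (simp add: \<sigma>_def pr_def)
    then have y: "\<sigma> i c \<in> FR (H i) #>\<^bsub>H i\<^esub> x" using x(2) by (simp add: pr_def)
    then have "pr i (\<sigma> i c) = pr i x"
      using repr_independence[OF y x(1) S] by (simp add: pr_def)
    moreover have "\<sigma> i c \<in> carrier (H i)"
      using y subgroup.elemrcos_carrier[OF S group_axioms x(1)] by blast
    ultimately show ?thesis using x by simp
  qed (simp add: \<sigma>_def)
  then show "\<sigma> i c \<in> carrier (H i)" "pr i (\<sigma> i c) = c" by auto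
  have "\<sigma> i c = \<one>\<^bsub>H i\<^esub>" if "c = \<one>\<^bsub>Q i\<^esub>" using that by (simp add: \<sigma>_def)
  moreover have "c = \<one>\<^bsub>Q i\<^esub>" if "\<sigma> i c = \<one>\<^bsub>H i\<^esub>"
    using \<open>pr i (\<sigma> i c) = c\<close> pr.hom_one unfolding that by simp
  ultimately show "\<sigma> i c = \<one>\<^bsub>H i\<^esub> \<longleftrightarrow> c = \<one>\<^bsub>Q i\<^esub>" by blast
qed

lemma sec_closed: "w \<in> carrier (fp I Q) \<Longrightarrow> sec w \<in> carrier (fp I H)"
proof -
  assume w: "w \<in> carrier (fp I Q)"
  have "map fst (sec w) = map fst w" by (simp add: sec_def case_prod_unfold)
  then show ?thesis
    using w \<sigma>_props unfolding carrier_fp fp_reduced_def mem_Collect_eq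
    by (auto simp: sec_def simp del: map_map)
qed

lemma hdi_closed: "i \<in> I \<Longrightarrow> w \<in> carrier (fp I Q) \<Longrightarrow> hdi i w \<in> carrier (Q i)"
  using group_Q[of i] group.is_monoid
  by (cases w) (auto simp: hdi_def carrier_fp fp_reduced_Cons intro: monoid.one_closed)

lemma tli_closed: "w \<in> carrier (fp I Q) \<Longrightarrow> tli i w \<in> carrier (fp I Q)"
  by (cases w) (auto simp: tli_def carrier_fp fp_reduced_Cons)

lemma push_split:
  assumes "i \<in> I" "c \<in> carrier (Q i)" "w \<in> carrier (fp I Q)"
  shows "hdi i (fp_push Q (i, c) w) = c \<otimes>\<^bsub>Q i\<^esub> hdi i w" "tli i (fp_push Q (i, c) w) = tli i w"
proof -
  interpret group "Q i" using group_Q assms(1) .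
  have "hdi i (fp_push Q (i, c) w) = c \<otimes>\<^bsub>Q i\<^esub> hdi i w \<and> tli i (fp_push Q (i, c) w) = tli i w"
  proof (cases "w \<noteq> [] \<and> fst (hd w) = i")
    case True
    then obtain k v where w: "w = (i, k) # v" by (cases w) auto
    have "v \<noteq> [] \<longrightarrow> i \<noteq> fst (hd v)"
      using assms(3) w by (auto simp: carrier_fp fp_reduced_Cons)
    then show ?thesis using w by (auto simp: hdi_def tli_def)
  next
    case False
    then have "fp_push Q (i, c) w = (if c = \<one>\<^bsub>Q i\<^esub> then w else (i, c) # w)"
    proof (cases w)
      case (Cons p v)
      then show ?thesis using False by (cases p) simp
    qed simp
    then show ?thesis using False assms by (auto simp: hdi_def tli_def)
  qed
  then show "hdi i (fp_push Q (i, c) w) = c \<otimes>\<^bsub>Q i\<^esub> hdi i w" "tli i (fp_push Q (i, c) w) = tli i w"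
    by auto
qed

lemma sec_split:
  assumes "i \<in> I" "w \<in> carrier (fp I Q)"
  shows "sec w = fp_in H i (\<sigma> i (hdi i w)) \<otimes>\<^bsub>fp I H\<^esub> sec (tli i w)"
proof (cases "w \<noteq> [] \<and> fst (hd w) = i")
  case True
  then obtain k v where w: "w = (i, k) # v" by (cases w) auto
  have "sec w = (i, \<sigma> i k) # sec v" by (simp add: w sec_def)
  then show ?thesis
    using fp_Cons_eq(1)[of i "\<sigma> i k" "sec v"] sec_closed[OF assms(2)] w by (simp add: hdi_def tli_def)
next
  case False
  then have "fp_in H i (\<sigma> i (hdi i w)) = \<one>\<^bsub>fp I H\<^esub>" "tli i w = w"
    by (auto simp: hdi_def tli_def \<sigma>_def fp_in_def one_fp)
  then show ?thesis
    using sec_closed[OF assms(2)] group.is_monoid[OF group_fp] by (simp add: monoid.l_one)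
qed

lemma dec_enc: "i \<in> I \<Longrightarrow> w \<in> carrier (fp I Q) \<Longrightarrow> dec (enc (i, w)) = (i, w)"
proof -
  assume i: "i \<in> I" "w \<in> carrier (fp I Q)"
  have "countable (carrier (Q i))" if "i \<in> I" for i
    using countable_H[OF that] by (simp add: Q_def carrier_FactGroup)
  then have "countable (\<Union>i\<in>I. {i} \<times> carrier (Q i))" by auto
  then have "countable (lists (\<Union>i\<in>I. {i} \<times> carrier (Q i)))" by (rule countable_lists)
  moreover have "carrier (fp I Q) \<subseteq> lists (\<Union>i\<in>I. {i} \<times> carrier (Q i))"
    by (force simp: carrier_fp fp_reduced_def)
  ultimately have "countable (carrier (fp I Q))" using countable_subset by blast
  then have "countable (I \<times> carrier (fp I Q))" by auto
  then show ?thesis using i by (simp add: dec_def enc_def)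
qed

lemma N_enc: "i \<in> I \<Longrightarrow> w \<in> carrier (fp I Q) \<Longrightarrow> N (enc (i, w)) = (H i)\<lparr>carrier := FR (H i)\<rparr>"
  by (simp add: N_def dec_enc)

sublocale N: fp_family J N
proof (rule fp_family.intro)
  fix m assume "m \<in> J"
  then obtain i w where "i \<in> I" "w \<in> carrier (fp I Q)" "m = enc (i, w)" by (auto simp: J_def)
  then show "group (N m)"
    using group.subgroup_imp_group[OF group_H FR_subgroup[OF group_H]] by (simp add: N_enc)
qed

text \<open>How the letter \<open>g\<close> differs from its lift when it acts on a lifted word of the quotient.\<close>

definition cyc where
  "cyc i g w = inv\<^bsub>H i\<^esub> (\<sigma> i (pr i g \<otimes>\<^bsub>Q i\<^esub> hdi i w)) \<otimes>\<^bsub>H i\<^esub> (g \<otimes>\<^bsub>H i\<^esub> \<sigma> i (hdi i w))"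

lemma cyc_closed:
  assumes "i \<in> I" "g \<in> carrier (H i)" "w \<in> carrier (fp I Q)"
  shows "cyc i g w \<in> FR (H i)"
proof -
  interpret group "H i" using group_H assms(1) .
  interpret pr: group_hom "H i" "Q i" "pr i" using pr_hom assms(1) .
  let ?c = "pr i g \<otimes>\<^bsub>Q i\<^esub> hdi i w"
  have h: "hdi i w \<in> carrier (Q i)" "?c \<in> carrier (Q i)"
    using assms hdi_closed by auto
  note s = \<sigma>_props[OF assms(1) h(1)] \<sigma>_props[OF assms(1) h(2)]
  have "pr i (cyc i g w) = inv\<^bsub>Q i\<^esub> ?c \<otimes>\<^bsub>Q i\<^esub> ?c"
    using s assms h by (simp add: cyc_def)
  then have "pr i (cyc i g w) = \<one>\<^bsub>Q i\<^esub>" using h by simp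
  moreover have "cyc i g w \<in> carrier (H i)" using s assms by (simp add: cyc_def)
  ultimately show ?thesis using pr_eq_one assms(1) by blast
qed

text \<open>The factor with index (i, v) stands for the conjugate of \<open>FR (H i)\<close> by the
  lift of v. A letter times a lifted word is the lift of the product times the conjugate of
  \<open>cyc i g w\<close> with v = \<open>tli i w\<close>.\<close>

definition \<Phi> where
  "\<Phi> i g = (\<lambda>w\<in>carrier (fp I Q). fp_in N (enc (i, tli i w)) (cyc i g w), fp_in Q i (pr i g))"

text \<open>Left multiplication by factor i leaves \<open>tli i w\<close> alone, so the two cocycle
  values lie in the same free factor, where the values of the transversal between them
  cancel.\<close>

lemma \<Phi>_hom:
  assumes "i \<in> I"
  shows "\<Phi> i \<in> hom (H i) (wr (fp J N) (fp I Q))"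
  unfolding \<Phi>_def[abs_def]
proof (rule wr_homI)
  interpret group "H i" using group_H assms .
  interpret pr: group_hom "H i" "Q i" "pr i" using pr_hom assms .
  have J: "enc (i, tli i w) \<in> J" if "w \<in> carrier (fp I Q)" for w
    using assms tli_closed[OF that] by (simp add: J_def)
  have NF: "N (enc (i, tli i w)) = (H i)\<lparr>carrier := FR (H i)\<rparr>" if "w \<in> carrier (fp I Q)" for w
    using assms tli_closed[OF that] by (simp add: N_enc)
  show "(\<lambda>g. fp_in Q i (pr i g)) \<in> hom (H i) (fp I Q)"
    using Group.hom_compose[OF pr.homh group_hom.homh[OF Q.fp_in_hom[OF assms]]] by (simp add: comp_def)
  show "fp_in N (enc (i, tli i w)) (cyc i g w) \<in> carrier (fp J N)"
    if "g \<in> carrier (H i)" "w \<in> carrier (fp I Q)" for g w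
    using N.fp_in_closed[OF J[OF that(2)]] cyc_closed[OF assms that] NF[OF that(2)] by simp
  fix g h w assume gh: "g \<in> carrier (H i)" "h \<in> carrier (H i)" and w: "w \<in> carrier (fp I Q)"
  let ?w = "fp_in Q i (pr i h) \<otimes>\<^bsub>fp I Q\<^esub> w"
  have prc: "pr i h \<in> carrier (Q i)" "pr i g \<in> carrier (Q i)" using gh by auto
  have push: "?w = fp_push Q (i, pr i h) w" using Q.fp_in_mult assms prc w by simp
  have wc: "?w \<in> carrier (fp I Q)"
    using w Q.fp_in_closed[OF assms prc(1)] Q.group_fp by (simp add: group.is_monoid monoid.m_closed)
  have t: "tli i ?w = tli i w" "hdi i ?w = pr i h \<otimes>\<^bsub>Q i\<^esub> hdi i w"
    unfolding push using push_split[OF assms prc(1) w] by auto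
  have hc: "hdi i w \<in> carrier (Q i)" using hdi_closed assms w by simp
  have s1: "\<sigma> i (hdi i w) \<in> carrier (H i)" using \<sigma>_props(1)[OF assms hc] .
  have s2: "\<sigma> i (pr i h \<otimes>\<^bsub>Q i\<^esub> hdi i w) \<in> carrier (H i)" using \<sigma>_props(1)[OF assms] prc hc by simp
  have s3: "\<sigma> i (pr i g \<otimes>\<^bsub>Q i\<^esub> (pr i h \<otimes>\<^bsub>Q i\<^esub> hdi i w)) \<in> carrier (H i)"
    using \<sigma>_props(1)[OF assms] prc hc by simp
  have c: "cyc i (g \<otimes>\<^bsub>H i\<^esub> h) w = cyc i g ?w \<otimes>\<^bsub>H i\<^esub> cyc i h w"
    unfolding cyc_def t(2) using gh prc hc s1 s2 s3
    by (simp add: m_assoc pr.H.m_assoc inv_solve_left)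
      (simp add: m_assoc[symmetric])
  have "fp_in N (enc (i, tli i w)) (cyc i g ?w \<otimes>\<^bsub>N (enc (i, tli i w))\<^esub> cyc i h w) =
      fp_in N (enc (i, tli i w)) (cyc i g ?w) \<otimes>\<^bsub>fp J N\<^esub> fp_in N (enc (i, tli i w)) (cyc i h w)"
    using group_hom.hom_mult[OF N.fp_in_hom[OF J[OF w]]] cyc_closed[OF assms gh(1) wc]
      cyc_closed[OF assms gh(2) w] NF[OF w] by simp
  then show "fp_in N (enc (i, tli i w)) (cyc i (g \<otimes>\<^bsub>H i\<^esub> h) w) =
      fp_in N (enc (i, tli i ?w)) (cyc i g ?w) \<otimes>\<^bsub>fp J N\<^esub> fp_in N (enc (i, tli i w)) (cyc i h w)"
    using c t(1) NF[OF w] by simp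
qed (use assms group_H N.group_fp Q.group_fp in auto)

text \<open>The section is \<open>sec\<close>, and it is enough to follow it under the
  letters.\<close>

lemma fp_embeds_wr:
  "group_hom (fp I H) (wr (fp J N) (fp I Q)) (fp_lift (wr (fp J N) (fp I Q)) \<Phi>)" (is ?hom)
  "inj_on (fp_lift (wr (fp J N) (fp I Q)) \<Phi>) (carrier (fp I H))" (is ?inj)
proof -
  let ?W = "wr (fp J N) (fp I Q)"
  have grW: "group ?W" using group_wr N.group_fp Q.group_fp by blast
  show hom: ?hom using fp_lift_hom[OF grW] \<Phi>_hom by blast
  interpret G: group "fp I H" using group_fp .
  \<comment> \<open>Here the abstract factors become the conjugates of the finite residuals inside
    the original free product.\<close>
  define j where "j m n = inv\<^bsub>fp I H\<^esub> sec (snd (dec m)) \<otimes>\<^bsub>fp I H\<^esub> fp_in H (fst (dec m)) n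
      \<otimes>\<^bsub>fp I H\<^esub> sec (snd (dec m))" for m n
  have j: "j m \<in> hom (N m) (fp I H)" if mJ: "m \<in> J" for m
  proof -
    obtain i w where m: "i \<in> I" "w \<in> carrier (fp I Q)" "m = enc (i, w)"
      using mJ unfolding J_def by blast
    interpret f: group_hom "H i" "fp I H" "fp_in H i" using fp_in_hom m(1) .
    have F: "FR (H i) \<subseteq> carrier (H i)" by (rule FR_subset)
    have sc: "sec w \<in> carrier (fp I H)" using sec_closed m(2) .
    have *: "inv\<^bsub>fp I H\<^esub> b \<otimes>\<^bsub>fp I H\<^esub> (x \<otimes>\<^bsub>fp I H\<^esub> y) \<otimes>\<^bsub>fp I H\<^esub> b =
        (inv\<^bsub>fp I H\<^esub> b \<otimes>\<^bsub>fp I H\<^esub> x \<otimes>\<^bsub>fp I H\<^esub> b) \<otimes>\<^bsub>fp I H\<^esub> (inv\<^bsub>fp I H\<^esub> b \<otimes>\<^bsub>fp I H\<^esub> y \<otimes>\<^bsub>fp I H\<^esub> b)"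
      if "b \<in> carrier (fp I H)" "x \<in> carrier (fp I H)" "y \<in> carrier (fp I H)" for b x y
    proof -
      have "b \<otimes>\<^bsub>fp I H\<^esub> (inv\<^bsub>fp I H\<^esub> b \<otimes>\<^bsub>fp I H\<^esub> z) = z" if "z \<in> carrier (fp I H)" for z
        using that \<open>b \<in> carrier (fp I H)\<close> by (simp add: G.m_assoc[symmetric])
      then show ?thesis using that by (simp add: G.m_assoc)
    qed
    show ?thesis
      using F sc * unfolding j_def m(3) dec_enc[OF m(1,2)] N_enc[OF m(1,2)]
      by (auto intro!: homI simp: subset_iff)
  qed
  have homj: "group_hom (fp J N) (fp I H) (fp_lift (fp I H) j)"
    using N.fp_lift_hom[OF G.group_axioms] j by blast
  define T where "T = (\<Union>i\<in>I. fp_in H i ` carrier (H i))"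
  have T: "T \<subseteq> carrier (fp I H)" using fp_in_closed by (auto simp: T_def)
  have "w \<in> generate (fp I H) T" if "w \<in> carrier (fp I H)" for w
    using that
  proof (induction rule: fp_induct)
    case (mult i g w)
    then have "fp_in H i g \<in> T" by (auto simp: T_def)
    then show ?case using mult by (auto intro: generate.intros)
  qed (rule generate.one)
  then have gen: "generate (fp I H) T = carrier (fp I H)"
    using G.generate_incl[OF T] by blast
  show ?inj
  proof (rule wr_section_inj[OF hom homj Q.group_fp _ T gen])
    show "sec \<in> carrier (fp I Q) \<rightarrow> carrier (fp I H)" using sec_closed by auto
    fix t w assume "t \<in> T" and w: "w \<in> carrier (fp I Q)"
    then obtain i g where t: "i \<in> I" "g \<in> carrier (H i)" "t = fp_in H i g" by (auto simp: T_def)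
    interpret Hi: group "H i" using group_H t(1) .
    interpret f: group_hom "H i" "fp I H" "fp_in H i" using fp_in_hom t(1) .
    interpret pr: group_hom "H i" "Q i" "pr i" using pr_hom t(1) .
    have lift: "fp_lift ?W \<Phi> t = \<Phi> i g"
      unfolding t(3) using fp_lift_in[OF grW _ t(1,2)] \<Phi>_hom by blast
    let ?w = "fp_in Q i (pr i g) \<otimes>\<^bsub>fp I Q\<^esub> w"
    have prc: "pr i g \<in> carrier (Q i)" using t by simp
    have push: "?w = fp_push Q (i, pr i g) w" using Q.fp_in_mult t(1) prc w by simp
    have wc: "?w \<in> carrier (fp I Q)"
      using w Q.fp_in_closed[OF t(1) prc] Q.group_fp by (simp add: group.is_monoid monoid.m_closed)
    have tt: "tli i ?w = tli i w" "hdi i ?w = pr i g \<otimes>\<^bsub>Q i\<^esub> hdi i w"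
      unfolding push using push_split[OF t(1) prc w] by auto
    let ?v = "tli i w"
    have v: "?v \<in> carrier (fp I Q)" using tli_closed[OF w] .
    have sv: "sec ?v \<in> carrier (fp I H)" using sec_closed[OF v] .
    have hc: "hdi i w \<in> carrier (Q i)" using hdi_closed t(1) w by simp
    have s1: "\<sigma> i (hdi i w) \<in> carrier (H i)" using \<sigma>_props(1)[OF t(1) hc] .
    have s2: "\<sigma> i (pr i g \<otimes>\<^bsub>Q i\<^esub> hdi i w) \<in> carrier (H i)" using \<sigma>_props(1)[OF t(1)] prc hc by simp
    have cy: "cyc i g w \<in> carrier (H i)" using cyc_closed[OF t(1,2) w] FR_subset[of "H i"] by blast
    have J: "enc (i, ?v) \<in> J" using t(1) v by (simp add: J_def)
    have "fp_lift (fp I H) j (fp_in N (enc (i, ?v)) (cyc i g w)) = j (enc (i, ?v)) (cyc i g w)"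
      using N.fp_lift_in[OF G.group_axioms _ J] j cyc_closed[OF t(1,2) w] N_enc[OF t(1) v] by simp
    also have "\<dots> = inv\<^bsub>fp I H\<^esub> sec ?v \<otimes>\<^bsub>fp I H\<^esub> fp_in H i (cyc i g w) \<otimes>\<^bsub>fp I H\<^esub> sec ?v"
      using dec_enc[OF t(1) v] by (simp add: j_def)
    finally have jj: "fp_lift (fp I H) j (fp_in N (enc (i, ?v)) (cyc i g w)) =
        inv\<^bsub>fp I H\<^esub> sec ?v \<otimes>\<^bsub>fp I H\<^esub> fp_in H i (cyc i g w) \<otimes>\<^bsub>fp I H\<^esub> sec ?v" .
    have e: "g \<otimes>\<^bsub>H i\<^esub> \<sigma> i (hdi i w) = \<sigma> i (pr i g \<otimes>\<^bsub>Q i\<^esub> hdi i w) \<otimes>\<^bsub>H i\<^esub> cyc i g w"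
      using s1 s2 t(2) by (simp add: cyc_def Hi.m_assoc[symmetric])
    have "t \<otimes>\<^bsub>fp I H\<^esub> sec w = fp_in H i (g \<otimes>\<^bsub>H i\<^esub> \<sigma> i (hdi i w)) \<otimes>\<^bsub>fp I H\<^esub> sec ?v"
      unfolding sec_split[OF t(1) w] t(3) using t(2) s1 sv by (simp add: G.m_assoc)
    also have "\<dots> = fp_in H i (\<sigma> i (hdi i ?w)) \<otimes>\<^bsub>fp I H\<^esub> fp_in H i (cyc i g w) \<otimes>\<^bsub>fp I H\<^esub> sec ?v"
      unfolding e tt using s2 cy by simp
    also have "\<dots> = fp_in H i (\<sigma> i (hdi i ?w)) \<otimes>\<^bsub>fp I H\<^esub> sec ?v \<otimes>\<^bsub>fp I H\<^esub>
        (inv\<^bsub>fp I H\<^esub> sec ?v \<otimes>\<^bsub>fp I H\<^esub> fp_in H i (cyc i g w) \<otimes>\<^bsub>fp I H\<^esub> sec ?v)"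
    proof -
      have swap: "x \<otimes>\<^bsub>fp I H\<^esub> c \<otimes>\<^bsub>fp I H\<^esub> s = x \<otimes>\<^bsub>fp I H\<^esub> s \<otimes>\<^bsub>fp I H\<^esub> (inv\<^bsub>fp I H\<^esub> s \<otimes>\<^bsub>fp I H\<^esub> c \<otimes>\<^bsub>fp I H\<^esub> s)"
        if "x \<in> carrier (fp I H)" "c \<in> carrier (fp I H)" "s \<in> carrier (fp I H)" for x c s
      proof -
        have "s \<otimes>\<^bsub>fp I H\<^esub> (inv\<^bsub>fp I H\<^esub> s \<otimes>\<^bsub>fp I H\<^esub> (c \<otimes>\<^bsub>fp I H\<^esub> s)) = c \<otimes>\<^bsub>fp I H\<^esub> s"
          using that G.m_assoc[of s "inv\<^bsub>fp I H\<^esub> s" "c \<otimes>\<^bsub>fp I H\<^esub> s", symmetric] by simp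
        then show ?thesis using that by (simp add: G.m_assoc)
      qed
      show ?thesis
        unfolding tt using f.hom_closed[OF s2] f.hom_closed[OF cy] sv by (rule swap)
    qed
    also have "fp_in H i (\<sigma> i (hdi i ?w)) \<otimes>\<^bsub>fp I H\<^esub> sec ?v = sec ?w"
      using sec_split[OF t(1) wc] tt by simp
    finally show "t \<otimes>\<^bsub>fp I H\<^esub> sec w = sec (snd (fp_lift ?W \<Phi> t) \<otimes>\<^bsub>fp I Q\<^esub> w) \<otimes>\<^bsub>fp I H\<^esub>
        fp_lift (fp I H) j (fst (fp_lift ?W \<Phi> t) w)"
      unfolding lift using w jj by (simp add: \<Phi>_def)
  qed
qed

end

text \<open>One residual is spent on the top group, a free product of residually finite quotients.
  The base is a free product of groups \<open>FR (H i)\<close>, which have one residual less to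
  go.\<close>

theorem rdepth_le_fp:
  fixes H :: "nat \<Rightarrow> 'g monoid"
  assumes "1 \<le> n" "\<And>i. i \<in> I \<Longrightarrow> rdepth_le n (H i)" "\<And>i. i \<in> I \<Longrightarrow> countable (carrier (H i))"
  shows "rdepth_le n (fp I H)"
  using assms
proof (induction n arbitrary: I H rule: nat_induct_at_least)
  case base
  then interpret fp_family I H by (intro fp_family.intro rdepth_le_group)
  show ?case using rdepth_le_fp_1 base by blast
next
  case (Suc n)
  have gr: "group (H i)" if "i \<in> I" for i using Suc.prems(1)[OF that] rdepth_le_group by blast
  interpret fp_residual I H
    by (intro fp_residual.intro fp_family.intro fp_residual_axioms.intro gr Suc.prems(2))
  have "rdepth_le 1 (fp I Q)"
    using Q.rdepth_le_fp_1 rdepth_le_Mod_FR[OF gr] by (simp add: Q_def)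
  moreover have "rdepth_le n (fp J N)"
  proof (rule Suc.IH)
    fix m assume "m \<in> J"
    then obtain i w where m: "i \<in> I" "w \<in> carrier (fp I Q)" "m = enc (i, w)" by (auto simp: J_def)
    have "FRn (H i) (Suc n) = {\<one>\<^bsub>H i\<^esub>}" using Suc.prems(1)[OF m(1)] by (simp add: rdepth_le_def)
    then show "rdepth_le n (N m)"
      using N.group_H[OF \<open>m \<in> J\<close>] unfolding FRn_Suc' m(3) N_enc[OF m(1,2)] rdepth_le_def by simp
    show "countable (carrier (N m))"
      unfolding m(3) N_enc[OF m(1,2)]
      using countable_subset[OF FR_subset countable_H[OF m(1)]] by simp
  qed
  ultimately have "rdepth_le (Suc n) (wr (fp J N) (fp I Q))" by (intro rdepth_le_wr)
  then show ?case using rdepth_le_inj fp_embeds_wr by blast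
qed

section \<open>Presented groups\<close>

definition word_eval :: "('k, 'm) monoid_scheme \<Rightarrow> ('x \<Rightarrow> 'k) \<Rightarrow> 'x word \<Rightarrow> 'k" where
  "word_eval K \<phi> w =
     foldr (\<lambda>(x, b) y. (if b then \<phi> x else inv\<^bsub>K\<^esub> \<phi> x) \<otimes>\<^bsub>K\<^esub> y) w \<one>\<^bsub>K\<^esub>"

abbreviation gen :: "'x \<Rightarrow> 'x word" where
  "gen x \<equiv> [(x, True)]"

definition cls :: "'x set \<Rightarrow> 'x word set \<Rightarrow> 'x word \<Rightarrow> 'x word set" where
  "cls S R w = normal_closure (free_group S) R #>\<^bsub>free_group S\<^esub> w"

lemma word_eval_Nil [simp]: "word_eval K \<phi> [] = \<one>\<^bsub>K\<^esub>"
  by (simp add: word_eval_def)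

lemma word_eval_Cons:
  "word_eval K \<phi> ((x, b) # w) = (if b then \<phi> x else inv\<^bsub>K\<^esub> \<phi> x) \<otimes>\<^bsub>K\<^esub> word_eval K \<phi> w"
  by (simp add: word_eval_def)

lemma carrier_free_group: "carrier (free_group S) = {w. reduced w \<and> fst ` set w \<subseteq> S}"
  and one_free_group: "\<one>\<^bsub>free_group S\<^esub> = []"
  by (simp_all add: free_group_def)

lemma gen_closed: "x \<in> S \<Longrightarrow> gen x \<in> carrier (free_group S)"
  by (simp add: carrier_free_group reduced_Cons)

lemma word_eval_closed:
  assumes "group K" "\<phi> \<in> S \<rightarrow> carrier K" "fst ` set w \<subseteq> S"
  shows "word_eval K \<phi> w \<in> carrier K"
proof -
  interpret K: group K by fact
  show ?thesis
    using assms(2,3)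
  proof (induction w)
    case (Cons l w)
    then show ?case by (cases l) (auto simp: word_eval_Cons)
  qed simp
qed

lemma word_eval_hom:
  assumes "group K" "\<phi> \<in> S \<rightarrow> carrier K"
  shows "group_hom (free_group S) K (word_eval K \<phi>)"
proof -
  interpret K: group K by fact
  note cl = word_eval_closed[OF assms]
  have cons: "word_eval K \<phi> (cons_letter (x, b) w) = word_eval K \<phi> ((x, b) # w)"
    if "x \<in> S" "fst ` set w \<subseteq> S" for x b w
  proof (cases w)
    case (Cons m v)
    obtain y c where m: "m = (y, c)" by fastforce
    have "\<phi> x \<in> carrier K" "word_eval K \<phi> v \<in> carrier K"
      using that assms(2) cl[of v] Cons by auto
    then show ?thesis
      using Cons m by (auto simp: word_eval_Cons inv_letter_def K.m_assoc[symmetric])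
  qed (simp add: word_eval_Cons)
  have "word_eval K \<phi> (foldr cons_letter u v) = word_eval K \<phi> u \<otimes>\<^bsub>K\<^esub> word_eval K \<phi> v"
    if "fst ` set u \<subseteq> S" "fst ` set v \<subseteq> S" for u v
    using that
  proof (induction u)
    case (Cons l u)
    obtain x b where l: "l = (x, b)" by fastforce
    have x: "x \<in> S" "fst ` set u \<subseteq> S" using Cons.prems l by auto
    then have "\<phi> x \<in> carrier K" using assms(2) by auto
    moreover have "fst ` set (foldr cons_letter u v) \<subseteq> S"
      using set_foldr[of u v] x Cons.prems(2) by blast
    ultimately show ?case
      using Cons x l cons[OF x(1), of "foldr cons_letter u v" b] cl[of u] cl[of v]
      by (simp add: word_eval_Cons K.m_assoc)
  qed (simp add: cl)
  then show ?thesis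
    using cl group_free_group assms(1)
    by (auto simp: group_hom_def group_hom_axioms_def free_group_def intro!: homI)
qed

lemma word_eval_gen: "group K \<Longrightarrow> \<phi> x \<in> carrier K \<Longrightarrow> word_eval K \<phi> (gen x) = \<phi> x"
  by (simp add: word_eval_Cons group.is_monoid monoid.r_one)

lemma word_eval_comp:
  assumes "group_hom K L h" "\<phi> \<in> S \<rightarrow> carrier K" "fst ` set w \<subseteq> S"
  shows "h (word_eval K \<phi> w) = word_eval L (\<lambda>x. h (\<phi> x)) w"
proof -
  interpret group_hom K L h by fact
  show ?thesis
    using assms(3)
  proof (induction w)
    case (Cons l w)
    then show ?case
      using assms(2) word_eval_closed[OF G.group_axioms assms(2), of w]
      by (cases l) (auto simp: word_eval_Cons Pi_iff)
  qed simp
qed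

lemma normal_closure_normal:
  fixes G (structure)
  assumes "group G" "R \<subseteq> carrier G"
  shows "normal_closure G R \<lhd> G"
proof -
  interpret group G by fact
  have c: "carrier G \<lhd> G" using subgroup_self by (auto simp: normal_inv_iff)
  have "subgroup (normal_closure G R) G"
    unfolding normal_closure_def
    using c assms(2) by (intro subgroups_Inter) (auto simp: normal_imp_subgroup)
  then show ?thesis
    unfolding normal_inv_iff by (auto simp: normal_closure_def normal_inv_iff)
qed

lemma normal_closure_least: "N \<lhd> G \<Longrightarrow> R \<subseteq> N \<Longrightarrow> normal_closure G R \<subseteq> N"
  by (auto simp: normal_closure_def)

lemma normal_closure_incl: "R \<subseteq> normal_closure G R"
  by (auto simp: normal_closure_def)

locale presentation =
  fixes S :: "'x set" and R :: "'x word set"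
  assumes R: "R \<subseteq> carrier (free_group S)"
begin

lemma normal: "normal_closure (free_group S) R \<lhd> free_group S"
  using normal_closure_normal[OF group_free_group R] .

lemma group_presented: "group (presented_group S R)"
  unfolding presented_group_def using normal by (rule normal.factorgroup_is_group)

lemma cls_hom: "group_hom (free_group S) (presented_group S R) (cls S R)"
  using group_presented group_free_group normal.r_coset_hom_Mod[OF normal]
  by (simp add: group_hom_def group_hom_axioms_def presented_group_def cls_def[abs_def])

lemma carrier_presented: "carrier (presented_group S R) = cls S R ` carrier (free_group S)"
  by (simp add: presented_group_def carrier_FactGroup cls_def)

lemma cls_relator: "r \<in> R \<Longrightarrow> cls S R r = \<one>\<^bsub>presented_group S R\<^esub>"
  using group.coset_join2[OF group_free_group, of r S "normal_closure (free_group S) R"]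
    R normal_closure_incl[of R "free_group S"] normal_imp_subgroup[OF normal]
  by (auto simp only: presented_group_def cls_def one_FactGroup)

lemma cls_gen_closed: "(\<lambda>x. cls S R (gen x)) \<in> S \<rightarrow> carrier (presented_group S R)"
  by (auto simp: carrier_presented intro!: imageI gen_closed)

lemma free_Cons:
  assumes "l # w \<in> carrier (free_group S)"
  shows "l # w = [l] \<otimes>\<^bsub>free_group S\<^esub> w" "[l] \<in> carrier (free_group S)" "w \<in> carrier (free_group S)"
  using assms by (auto simp: free_group_def reduced_Cons) (cases w; simp)

lemma cls_eq_word_eval:
  "w \<in> carrier (free_group S) \<Longrightarrow>
     word_eval (presented_group S R) (\<lambda>x. cls S R (gen x)) w = cls S R w"
proof (induction w)
  case Nil
  then show ?case
    using group_hom.hom_one[OF cls_hom] by (simp add: one_free_group)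
next
  case (Cons l w)
  interpret F: group "free_group S" by (rule group_free_group)
  interpret group_hom "free_group S" "presented_group S R" "cls S R" by (rule cls_hom)
  obtain x b where l: "l = (x, b)" by fastforce
  note c = free_Cons[OF Cons.prems]
  have x: "x \<in> S" using c(2) l by (simp add: carrier_free_group)
  have "gen x \<otimes>\<^bsub>free_group S\<^esub> [(x, False)] = \<one>\<^bsub>free_group S\<^esub>"
    by (simp add: free_group_def inv_letter_def)
  moreover have "[(x, False)] \<in> carrier (free_group S)"
    using x by (simp add: carrier_free_group reduced_Cons)
  ultimately have "inv\<^bsub>free_group S\<^esub> (gen x) = [(x, False)]"
    using F.inv_comm F.inv_equality gen_closed[OF x] by metis
  then have "cls S R [l] =
      (if b then cls S R (gen x) else inv\<^bsub>presented_group S R\<^esub> (cls S R (gen x)))"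
    using gen_closed[OF x] hom_inv[of "gen x"] l by auto
  then have "word_eval (presented_group S R) (\<lambda>x. cls S R (gen x)) (l # w) =
      cls S R [l] \<otimes>\<^bsub>presented_group S R\<^esub> cls S R w"
    using Cons.IH[OF c(3)] l by (simp add: word_eval_Cons)
  also have "\<dots> = cls S R (l # w)"
    using hom_mult[OF c(2,3)] by (simp only: c(1)[symmetric])
  finally show ?case .
qed

lemma generate_gens:
  "generate (presented_group S R) ((\<lambda>x. cls S R (gen x)) ` S) = carrier (presented_group S R)"
proof
  interpret P: group "presented_group S R" by (rule group_presented)
  show "generate (presented_group S R) ((\<lambda>x. cls S R (gen x)) ` S) \<subseteq> carrier (presented_group S R)"
    using cls_gen_closed by (intro P.generate_incl) auto
  have "word_eval (presented_group S R) (\<lambda>x. cls S R (gen x)) w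
      \<in> generate (presented_group S R) ((\<lambda>x. cls S R (gen x)) ` S)"
    if "fst ` set w \<subseteq> S" for w
    using that
  proof (induction w)
    case (Cons l w)
    then show ?case
      by (cases l) (auto simp: word_eval_Cons intro: generate.intros)
  qed (simp add: generate.one)
  then show "carrier (presented_group S R) \<subseteq> generate (presented_group S R) ((\<lambda>x. cls S R (gen x)) ` S)"
    using cls_eq_word_eval by (force simp: carrier_presented carrier_free_group)
qed

text \<open>The universal property of a presentation: the kernel of the evaluation is normal and
  contains the relators, hence their normal closure.\<close>

lemma presented_lift:
  assumes "group K" "\<phi> \<in> S \<rightarrow> carrier K" "\<And>r. r \<in> R \<Longrightarrow> word_eval K \<phi> r = \<one>\<^bsub>K\<^esub>"
  obtains h where "group_hom (presented_group S R) K h"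
    "\<And>w. w \<in> carrier (free_group S) \<Longrightarrow> h (cls S R w) = word_eval K \<phi> w"
    "\<And>x. x \<in> S \<Longrightarrow> h (cls S R (gen x)) = \<phi> x"
proof -
  interpret e: group_hom "free_group S" K "word_eval K \<phi>" by (rule word_eval_hom) fact+
  have "R \<subseteq> kernel (free_group S) K (word_eval K \<phi>)"
    using R assms(3) by (auto simp: kernel_def)
  then have "normal_closure (free_group S) R \<subseteq> kernel (free_group S) K (word_eval K \<phi>)"
    using normal_closure_least e.normal_kernel by blast
  then have *: "word_eval K \<phi> u = word_eval K \<phi> v"
    if "u \<in> carrier (free_group S)" "v \<in> carrier (free_group S)" "cls S R u = cls S R v" for u v
  proof -
    have "u \<in> normal_closure (free_group S) R #>\<^bsub>free_group S\<^esub> v"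
      using group.rcos_self[OF group_free_group that(1) normal_imp_subgroup[OF normal]] that(3)
      by (simp add: cls_def)
    then obtain n where n: "n \<in> normal_closure (free_group S) R" "u = n \<otimes>\<^bsub>free_group S\<^esub> v"
      by (auto simp: r_coset_def)
    then have "n \<in> carrier (free_group S)" "word_eval K \<phi> n = \<one>\<^bsub>K\<^esub>"
      using \<open>normal_closure _ R \<subseteq> _\<close> by (auto simp: kernel_def)
    then show ?thesis using n that(2) by simp
  qed
  obtain h where h: "h \<in> hom (free_group S Mod normal_closure (free_group S) R) K"
    "\<And>w. w \<in> carrier (free_group S) \<Longrightarrow> h (normal_closure (free_group S) R #>\<^bsub>free_group S\<^esub> w) = word_eval K \<phi> w"
    using FactGroup_universal[OF e.homh normal] * unfolding cls_def by metis
  show ?thesis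
  proof (rule that)
    show "group_hom (presented_group S R) K h"
      using h(1) group_presented assms(1)
      by (simp add: group_hom_def group_hom_axioms_def presented_group_def)
    show w: "h (cls S R w) = word_eval K \<phi> w" if "w \<in> carrier (free_group S)" for w
      using h(2)[OF that] by (simp add: cls_def)
    show "h (cls S R (gen x)) = \<phi> x" if "x \<in> S" for x
      using w[OF gen_closed[OF that]] word_eval_gen[OF assms(1), of \<phi> x] assms(2) that by auto
  qed
qed

lemma countable_presented: "countable S \<Longrightarrow> countable (carrier (presented_group S R))"
proof -
  assume "countable S"
  then have "countable (lists (S \<times> (UNIV :: bool set)))" by (intro countable_lists) auto
  moreover have "carrier (free_group S) \<subseteq> lists (S \<times> UNIV)"
    by (auto simp: carrier_free_group)
  ultimately show ?thesis
    unfolding carrier_presented using countable_subset by (intro countable_image) blast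
qed

end

section \<open>The group \<open>\<langle>e, t | t e t\<inverse> = e\<^sup>2\<rangle>\<close>\<close>

definition dyadic :: "rat set" where
  "dyadic = {b. \<exists>(n::int) (i::nat). b * 2 ^ i = of_int n}"

text \<open>The pair \<open>(j, b)\<close> is the affine map x \<mapsto> 2^j x + b of the rationals.
  With b in Z[1/2] this is the Baumslag-Solitar group BS(1,2), where e = \<open>(0, 1)\<close> and t
  = \<open>(1, 0)\<close>.\<close>

definition aff :: "(int \<times> rat) set \<Rightarrow> (int \<times> rat) monoid" where
  "aff C = \<lparr>carrier = C, monoid.mult = (\<lambda>(j, b) (l, d). (j + l, b + 2 powi j * d)), one = (0, 0)\<rparr>"

definition BS :: "(int \<times> rat) monoid" where
  "BS = aff (UNIV \<times> dyadic)"

text \<open>The infinite cyclic group as the integer translations inside \<open>BS\<close>, so that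
  both can be factors of one free product.\<close>

definition ZZ :: "(int \<times> rat) monoid" where
  "ZZ = aff ({0} \<times> \<int>)"

lemma dyadicE:
  assumes "b \<in> dyadic" "d \<in> dyadic"
  obtains n m :: int and i :: nat where "b * 2 ^ i = of_int n" "d * 2 ^ i = of_int m"
proof -
  obtain n i m l where *: "b * 2 ^ i = of_int n" "d * 2 ^ l = of_int m"
    using assms unfolding dyadic_def by blast
  have "b * 2 ^ (i + l) = of_int (n * 2 ^ l)" "d * 2 ^ (i + l) = of_int (m * 2 ^ i)"
    by (simp_all add: power_add *[symmetric])
  then show ?thesis using that by blast
qed

lemma dyadic_of_int: "of_int n \<in> dyadic"
  unfolding dyadic_def mem_Collect_eq by (rule exI[of _ n], rule exI[of _ 0]) simp

lemma dyadic_0 [simp]: "0 \<in> dyadic"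
  using dyadic_of_int[of 0] by simp

lemma dyadic_add: "b \<in> dyadic \<Longrightarrow> d \<in> dyadic \<Longrightarrow> b + d \<in> dyadic"
proof -
  assume "b \<in> dyadic" "d \<in> dyadic"
  then obtain n m :: int and i :: nat where "b * 2 ^ i = of_int n" "d * 2 ^ i = of_int m"
    by (rule dyadicE)
  then have "(b + d) * 2 ^ i = of_int (n + m)" by (simp add: distrib_right)
  then show ?thesis unfolding dyadic_def by blast
qed

lemma dyadic_minus: "b \<in> dyadic \<Longrightarrow> - b \<in> dyadic"
proof -
  assume "b \<in> dyadic"
  then obtain n i where "b * 2 ^ i = of_int n" unfolding dyadic_def by blast
  then have "- b * 2 ^ i = of_int (- n)" by simp
  then show ?thesis unfolding dyadic_def by blast
qed

lemma dyadic_powi: "b \<in> dyadic \<Longrightarrow> 2 powi j * b \<in> dyadic"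
proof -
  assume "b \<in> dyadic"
  then obtain n i where n: "b * 2 ^ i = of_int n" unfolding dyadic_def by blast
  show ?thesis
  proof (cases "0 \<le> j")
    case True
    then have "2 powi j * b * 2 ^ i = of_int (2 ^ nat j * n)"
      by (simp add: n[symmetric] power_int_def)
    then show ?thesis unfolding dyadic_def by blast
  next
    case False
    then have "2 powi j * b * 2 ^ (i + nat (- j)) = of_int n"
      by (simp add: n[symmetric] power_int_def power_add field_simps)
    then show ?thesis unfolding dyadic_def by blast
  qed
qed

lemma dyadic_diff: "b \<in> dyadic \<Longrightarrow> d \<in> dyadic \<Longrightarrow> b - d \<in> dyadic"
  using dyadic_add[OF _ dyadic_minus] by fastforce

lemma aff_group:
  assumes "(0, 0) \<in> C" "\<And>j b l d. (j, b) \<in> C \<Longrightarrow> (l, d) \<in> C \<Longrightarrow> (j + l, b + 2 powi j * d) \<in> C"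
    and "\<And>j b. (j, b) \<in> C \<Longrightarrow> (- j, - (2 powi (- j) * b)) \<in> C"
  shows "group (aff C)"
proof (rule groupI)
  fix x assume x: "x \<in> carrier (aff C)"
  obtain j b where jb: "x = (j, b)" by fastforce
  show "\<exists>y\<in>carrier (aff C). y \<otimes>\<^bsub>aff C\<^esub> x = \<one>\<^bsub>aff C\<^esub>"
    using x assms(3)[of j b] jb
    by (intro bexI[of _ "(- j, - (2 powi (- j) * b))"]) (auto simp: aff_def)
qed (use assms in \<open>auto simp: aff_def power_int_add algebra_simps\<close>)

lemma group_BS: "group BS"
  unfolding BS_def by (rule aff_group) (auto intro: dyadic_add dyadic_powi dyadic_minus)

lemma group_ZZ: "group ZZ"
  unfolding ZZ_def by (rule aff_group) auto

lemma BS_simps: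
  "carrier BS = UNIV \<times> dyadic" "\<one>\<^bsub>BS\<^esub> = (0, 0)"
  "(j, b) \<otimes>\<^bsub>BS\<^esub> (l, d) = (j + l, b + 2 powi j * d)"
  by (simp_all add: BS_def aff_def)

lemma ZZ_simps:
  "carrier ZZ = {0} \<times> \<int>" "\<one>\<^bsub>ZZ\<^esub> = (0, 0)"
  "(j, b) \<otimes>\<^bsub>ZZ\<^esub> (l, d) = (j + l, b + 2 powi j * d)"
  by (simp_all add: ZZ_def aff_def)

lemma inv_BS: "b \<in> dyadic \<Longrightarrow> inv\<^bsub>BS\<^esub> (j, b) = (- j, - (2 powi (- j) * b))"
  by (intro group.inv_equality[OF group_BS])
    (auto simp: BS_simps dyadic_powi dyadic_minus)

lemma BS_fin_idx_mod:
  assumes "0 < (r::int)"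
  shows "fin_idx BS {(j, b). b \<in> dyadic \<and> r dvd j}"
proof (rule fin_idxI[OF group_BS, where f = "\<lambda>(j, b). j mod r"])
  interpret group BS by (rule group_BS)
  show "subgroup {(j, b). b \<in> dyadic \<and> r dvd j} BS"
  proof (rule subgroupI)
    have "(0, 0) \<in> {(j, b). b \<in> dyadic \<and> r dvd j}" by simp
    then show "{(j, b). b \<in> dyadic \<and> r dvd j} \<noteq> {}" by blast
  qed (auto simp: BS_simps inv_BS dyadic_powi dyadic_minus intro!: dyadic_add)
  show "finite ((\<lambda>(j, b). j mod r) ` carrier BS)"
    by (rule finite_subset[of _ "{0..<r}"]) (use assms in auto)
  fix x y assume xy: "x \<in> carrier BS" "y \<in> carrier BS" "(\<lambda>(j, b). j mod r) x = (\<lambda>(j, b). j mod r) y"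
  obtain j b l d where "x = (j, b)" "y = (l, d)" by fastforce
  then show "x \<otimes>\<^bsub>BS\<^esub> inv\<^bsub>BS\<^esub> y \<in> {(j, b). b \<in> dyadic \<and> r dvd j}"
    using xy by (auto simp: BS_simps inv_BS mod_eq_dvd_iff dyadic_powi dyadic_minus intro!: dyadic_add dyadic_diff)
qed

text \<open>Since 2 is invertible modulo the odd number \<open>M\<close>, every dyadic number is
  congruent to an integer.\<close>

lemma dyadic_residue:
  assumes "0 < M" "odd (M::int)" "b \<in> dyadic"
  shows "\<exists>k\<in>{0..<M}. \<exists>z\<in>dyadic. b - of_int k = of_int M * z"
proof -
  obtain n i where n: "b * 2 ^ i = of_int n" using assms(3) unfolding dyadic_def by blast
  \<comment> \<open>The inverse of 2 modulo \<open>M\<close>.\<close>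
  define h where "h = (M + 1) div 2"
  have h: "2 * h = M + 1" using assms(2) unfolding h_def by presburger
  have "M dvd 2 ^ i * h ^ i - 1"
  proof -
    have "2 ^ i * h ^ i = (M + 1) ^ i" by (simp add: power_mult_distrib[symmetric] h)
    moreover have "M dvd (M + 1) ^ i - 1" using power_diff_1_eq[of "M + 1" i] by simp
    ultimately show ?thesis by simp
  qed
  then obtain c where c: "2 ^ i * h ^ i - 1 = M * c" by auto
  define k where "k = n * h ^ i mod M"
  have "n - 2 ^ i * k = n - 2 ^ i * (n * h ^ i) + 2 ^ i * (M * (n * h ^ i div M))"
    unfolding k_def minus_div_mult_eq_mod[symmetric] by (simp add: algebra_simps)
  also have "\<dots> = M * (2 ^ i * (n * h ^ i div M) - n * c)"
  proof -
    have "2 ^ i * h ^ i = M * c + 1" using c by simp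
    then have "2 ^ i * (n * h ^ i) = n * (M * c + 1)" by (metis mult.left_commute)
    then show ?thesis by (simp add: algebra_simps)
  qed
  finally have e: "n - 2 ^ i * k = M * (2 ^ i * (n * h ^ i div M) - n * c)" .
  define z :: rat where "z = of_int (2 ^ i * (n * h ^ i div M) - n * c) / 2 ^ i"
  have "(b - of_int k) * 2 ^ i = of_int (n - 2 ^ i * k)"
    using n by (simp add: algebra_simps)
  also have "\<dots> = of_int M * z * 2 ^ i" unfolding e z_def by simp
  finally have "b - of_int k = of_int M * z" by simp
  moreover have "z * 2 ^ i = of_int (2 ^ i * (n * h ^ i div M) - n * c)"
    unfolding z_def by simp
  then have "z \<in> dyadic" unfolding dyadic_def by blast
  moreover have "k \<in> {0..<M}" using assms(1) by (simp add: k_def)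
  ultimately show ?thesis by blast
qed

text \<open>The affine maps act on Z[1/2] modulo \<open>M\<close>, which has finitely many classes.
  The subgroup is the stabiliser of the class of 0.\<close>

lemma BS_fin_idx_translations:
  assumes "0 < M" "odd (M::int)"
  shows "fin_idx BS {(j, b). \<exists>z\<in>dyadic. b = of_int M * z}"
proof -
  interpret group BS by (rule group_BS)
  define res where "res b = (SOME k. k \<in> {0..<M} \<and> (\<exists>z\<in>dyadic. b - of_int k = of_int M * z))" for b
  have res: "res b \<in> {0..<M}" "\<exists>z\<in>dyadic. b - of_int (res b) = of_int M * z" if "b \<in> dyadic" for b
  proof -
    have "\<exists>k. k \<in> {0..<M} \<and> (\<exists>z\<in>dyadic. b - of_int k = of_int M * z)"
      using dyadic_residue[OF assms that] by blast
    from someI_ex[OF this]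
    show "res b \<in> {0..<M}" "\<exists>z\<in>dyadic. b - of_int (res b) = of_int M * z"
      unfolding res_def by blast+
  qed
  have Mz: "of_int M * z \<in> dyadic" if z: "z \<in> dyadic" for z
  proof -
    obtain n i where n: "z * 2 ^ i = of_int n" using z unfolding dyadic_def by blast
    then have "of_int M * z * 2 ^ i = of_int (M * n)" by simp
    then show ?thesis unfolding dyadic_def by blast
  qed
  show ?thesis
  \<comment> \<open>Right cosets of this stabiliser correspond to images of 0 under inverses, and
    the inverse of \<open>(j, b)\<close> sends 0 to - 2^(-j) b.\<close>
  proof (rule fin_idxI[OF group_BS, where f = "\<lambda>(j, b). res (2 powi (- j) * b)"])
    show "subgroup {(j, b). \<exists>z\<in>dyadic. b = of_int M * z} BS"
    proof (rule subgroupI)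
      show "{(j, b). \<exists>z\<in>dyadic. b = of_int M * z} \<subseteq> carrier BS" using Mz by (auto simp: BS_simps)
      have "(0::int, 0) \<in> {(j::int, b). \<exists>z\<in>dyadic. b = rat_of_int M * z}"
        by (auto intro: bexI[of _ 0])
      then show "{(j::int, b). \<exists>z\<in>dyadic. b = rat_of_int M * z} \<noteq> {}" by blast
    next
      fix x assume "x \<in> {(j::int, b). \<exists>z\<in>dyadic. b = rat_of_int M * z}"
      then obtain j z where x: "z \<in> dyadic" "x = (j, of_int M * z)" by auto
      show "inv\<^bsub>BS\<^esub> x \<in> {(j::int, b). \<exists>z\<in>dyadic. b = rat_of_int M * z}"
        using x(1) Mz[OF x(1)] unfolding x(2)
        by (auto simp: inv_BS intro!: bexI[of _ "- (2 powi (- j) * z)"] dyadic_minus dyadic_powi)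
    next
      fix x y assume "x \<in> {(j::int, b). \<exists>z\<in>dyadic. b = rat_of_int M * z}"
        "y \<in> {(j::int, b). \<exists>z\<in>dyadic. b = rat_of_int M * z}"
      then obtain j z l v where x: "z \<in> dyadic" "x = (j, of_int M * z)"
        "v \<in> dyadic" "y = (l, of_int M * v)" by auto
      then show "x \<otimes>\<^bsub>BS\<^esub> y \<in> {(j::int, b). \<exists>z\<in>dyadic. b = rat_of_int M * z}"
        by (auto simp: BS_simps algebra_simps
            intro!: bexI[of _ "z + 2 powi j * v"] dyadic_add dyadic_powi)
    qed
    show "finite ((\<lambda>(j, b). res (2 powi (- j) * b)) ` carrier BS)"
      by (rule finite_subset[of _ "{0..<M}"]) (use res dyadic_powi in \<open>auto simp: BS_simps\<close>)
    fix x y assume xy: "x \<in> carrier BS" "y \<in> carrier BS"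
      "(\<lambda>(j, b). res (2 powi (- j) * b)) x = (\<lambda>(j, b). res (2 powi (- j) * b)) y"
    obtain j b l d where jb: "x = (j, b)" "y = (l, d)" by fastforce
    have bd: "b \<in> dyadic" "d \<in> dyadic" using xy jb by (auto simp: BS_simps)
    obtain z where z: "z \<in> dyadic" "2 powi (- j) * b - of_int (res (2 powi (- j) * b)) = of_int M * z"
      using res(2)[OF dyadic_powi[OF bd(1)]] by blast
    obtain v where v: "v \<in> dyadic" "2 powi (- l) * d - of_int (res (2 powi (- l) * d)) = of_int M * v"
      using res(2)[OF dyadic_powi[OF bd(2)]] by blast
    have "2 powi (- j) * b - 2 powi (- l) * d = of_int M * (z - v)"
      using z(2) v(2) xy(3) jb by (simp add: algebra_simps)
    then have "2 powi j * (2 powi (- j) * b - 2 powi (- l) * d) = of_int M * (2 powi j * (z - v))"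
      by simp
    moreover have "2 powi j * (2 powi (- j) * b) = b"
      by (simp add: power_int_minus)
    ultimately have "b - 2 powi j * (2 powi (- l) * d) = of_int M * (2 powi j * (z - v))"
      by (simp add: right_diff_distrib)
    moreover have "2 powi j * (z - v) \<in> dyadic"
      using dyadic_powi[OF dyadic_add[OF z(1) dyadic_minus[OF v(1)]], of j] by simp
    ultimately show "x \<otimes>\<^bsub>BS\<^esub> inv\<^bsub>BS\<^esub> y \<in> {(j, b). \<exists>z\<in>dyadic. b = of_int M * z}"
      using bd jb by (auto simp: BS_simps inv_BS)
  qed
qed

lemma rdepth_le_BS: "rdepth_le 1 BS"
proof (rule rdepth_leI[OF group_BS])
  fix x assume "x \<in> FRn BS 1"
  then have x: "x \<in> FR BS" by simp
  obtain j b where jb: "x = (j, b)" by fastforce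
  have b: "b \<in> dyadic" using x FR_subset[of BS] jb by (auto simp: BS_simps)
  have "j = 0"
  proof (rule ccontr)
    assume "j \<noteq> 0"
    \<comment> \<open>A modulus that exceeds |j| and hence divides j only if j = 0.\<close>
    moreover have "\<bar>j\<bar> + 1 dvd j"
      using FR_D[OF x BS_fin_idx_mod[of "\<bar>j\<bar> + 1"]] jb by simp
    ultimately show False using dvd_imp_le_int[of j "\<bar>j\<bar> + 1"] by simp
  qed
  moreover have "b = 0"
  proof (rule ccontr)
    assume b0: "b \<noteq> 0"
    obtain n i where n: "b * 2 ^ i = of_int n" using b unfolding dyadic_def by blast
    have n0: "n \<noteq> 0" using b0 n by auto
    \<comment> \<open>Odd, hence prime to all denominators, and larger than |n|, hence no divisor of
      the numerator.\<close>
    define M where "M = 2 * \<bar>n\<bar> + 1"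
    obtain z where z: "z \<in> dyadic" "b = of_int M * z"
      using FR_D[OF x BS_fin_idx_translations[of M]] jb by (auto simp: M_def)
    obtain m l where m: "z * 2 ^ l = of_int m" using z unfolding dyadic_def by blast
    have "rat_of_int (n * 2 ^ l) = of_int (M * (m * 2 ^ i))"
      by (simp add: n[symmetric] m[symmetric] z(2))
    then have "n * 2 ^ l = M * (m * 2 ^ i)" using of_int_eq_iff by blast
    then have "M dvd n * 2 ^ l" by simp
    moreover have "coprime M (2 ^ l)" unfolding M_def by simp
    ultimately have "M dvd n" using coprime_dvd_mult_left_iff by blast
    then have "\<bar>M\<bar> \<le> \<bar>n\<bar>" using n0 dvd_imp_le_int by blast
    then show False by (simp add: M_def)
  qed
  ultimately show "x = \<one>\<^bsub>BS\<^esub>" using jb by (simp add: BS_simps)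
qed

lemma ZZ_subgroup_BS: "subgroup (carrier ZZ) BS" "ZZ = BS\<lparr>carrier := carrier ZZ\<rparr>"
proof -
  interpret group BS by (rule group_BS)
  show "subgroup (carrier ZZ) BS"
    by (rule subgroupI) (auto simp: BS_simps ZZ_simps inv_BS dyadic_of_int elim!: Ints_cases)
qed (simp add: ZZ_def BS_def aff_def)

lemma rdepth_le_ZZ: "rdepth_le 1 ZZ"
  using rdepth_le_subgroup[OF rdepth_le_BS ZZ_subgroup_BS(1)] ZZ_subgroup_BS(2) by simp

text \<open>
  In any group with \<open>t e = e\<^sup>2 t\<close> the element \<open>t\<^sup>-\<^sup>i e\<^sup>n t\<^sup>i\<close> depends only on \<open>n / 2\<^sup>i\<close>.
\<close>

locale bs_pair = group K for K (structure) +
  fixes e t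
  assumes e: "e \<in> carrier K" and t: "t \<in> carrier K" and te: "t \<otimes> e = e \<otimes> e \<otimes> t"
begin

definition F where "F i (n::int) = inv (t [^] (i::nat)) \<otimes> (e [^] n \<otimes> t [^] i)"

lemma F_closed [simp]: "F i n \<in> carrier K"
  using e t by (simp add: F_def)

lemma conj_pow: "t \<otimes> e [^] (n::int) = e [^] (2 * n) \<otimes> t"
proof -
  have "group_hom K K (\<lambda>x. t \<otimes> x \<otimes> inv t)"
    using t by (auto simp: group_hom_def group_hom_axioms_def m_assoc inv_solve_left intro!: homI)
  then interpret c: group_hom K K "\<lambda>x. t \<otimes> x \<otimes> inv t" .
  have "t \<otimes> e \<otimes> inv t = e [^] (2::int)"
    using te e t by (simp add: m_assoc int_pow_def2 numeral_2_eq_2)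
  then have "t \<otimes> e [^] n \<otimes> inv t = (e [^] (2::int)) [^] n"
    using c.hom_int_pow[OF e, of n] by simp
  also have "\<dots> = e [^] (2 * n)" using e by (simp add: int_pow_pow)
  finally show ?thesis
    using e t by (metis int_pow_closed inv_solve_right' m_closed)
qed

lemma F_Suc: "F (Suc i) (2 * n) = F i n"
proof -
  have "F (Suc i) (2 * n) = inv (t [^] i) \<otimes> (inv t \<otimes> (e [^] (2 * n) \<otimes> t)) \<otimes> t [^] i"
    unfolding F_def nat_pow_Suc2[OF t] using e t by (simp add: m_assoc inv_mult_group)
  also have "inv t \<otimes> (e [^] (2 * n) \<otimes> t) = e [^] n"
    using e t by (simp add: conj_pow[symmetric] m_assoc[symmetric])
  finally show ?thesis using e t by (simp add: F_def m_assoc)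
qed

lemma F_add: "F (i + l) (2 ^ l * n) = F i n"
  by (induction l) (simp_all add: F_Suc mult.assoc)

lemma F_eq: "n * 2 ^ l = m * 2 ^ i \<Longrightarrow> F i n = F l m"
  using F_add[of i l n] F_add[of l i m] by (simp add: mult.commute add.commute)

text \<open>The power of \<open>e\<close> with dyadic exponent \<open>b\<close>; the fraction chosen
  for \<open>b\<close> is immaterial by \<open>F_eq\<close>.\<close>

definition E :: "rat \<Rightarrow> 'a" where "E b = (let (i, n) = (SOME (i, n). b * 2 ^ i = of_int n) in F i n)"

lemma E_eq: "b * 2 ^ i = of_int n \<Longrightarrow> E b = F i n"
proof -
  assume bn: "b * 2 ^ i = of_int n"
  obtain l m where lm: "(SOME (i, n). b * 2 ^ i = rat_of_int n) = (l, m)" by fastforce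
  have "b * 2 ^ l = of_int m"
    using someI[of "\<lambda>(i, n). b * 2 ^ i = rat_of_int n" "(i, n)"] bn lm by simp
  then have "rat_of_int (n * 2 ^ l) = of_int (m * 2 ^ i)" using bn[symmetric] by simp
  then have "n * 2 ^ l = m * 2 ^ i" using of_int_eq_iff by blast
  moreover have "E b = F l m" using lm by (simp add: E_def)
  ultimately show ?thesis using F_eq[of n l m i] by simp
qed

lemma E_closed: "b \<in> dyadic \<Longrightarrow> E b \<in> carrier K"
  using E_eq unfolding dyadic_def by auto

lemma E_of_int: "E (of_int n) = e [^] n"
  using E_eq[of "of_int n" 0 n] e by (simp add: F_def)

lemma E_plus: "b \<in> dyadic \<Longrightarrow> d \<in> dyadic \<Longrightarrow> E (b + d) = E b \<otimes> E d"
proof -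
  assume "b \<in> dyadic" "d \<in> dyadic"
  then obtain n m :: int and i :: nat where *: "b * 2 ^ i = of_int n" "d * 2 ^ i = of_int m"
    by (rule dyadicE)
  then have "(b + d) * 2 ^ i = of_int (n + m)" by (simp add: distrib_right)
  then have "E (b + d) = F i (n + m)" by (rule E_eq)
  also have "\<dots> = inv (t [^] i) \<otimes> (e [^] n \<otimes> (t [^] i \<otimes> (inv (t [^] i) \<otimes> (e [^] m \<otimes> t [^] i))))"
    using e t inv_solve_left[of "inv (t [^] i) \<otimes> (e [^] m \<otimes> t [^] i)" "t [^] i"]
    by (simp add: F_def int_pow_mult[symmetric] m_assoc)
      (simp add: int_pow_mult m_assoc[symmetric])
  also have "\<dots> = F i n \<otimes> F i m" using e t by (simp add: F_def m_assoc)
  finally show ?thesis using E_eq * by simp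
qed

lemma E_conj: "b \<in> dyadic \<Longrightarrow> t \<otimes> E b = E (2 * b) \<otimes> t"
proof -
  assume "b \<in> dyadic"
  then obtain n i where bn: "b * 2 ^ i = of_int n" unfolding dyadic_def by blast
  then have "b * 2 ^ Suc i = of_int (2 * n)" "2 * b * 2 ^ i = of_int (2 * n)" by simp_all
  then have *: "E b = F (Suc i) (2 * n)" "E (2 * b) = F i (2 * n)" by (simp_all only: E_eq)
  show ?thesis
    unfolding * F_def using e t by (simp add: inv_mult_group m_assoc[symmetric])
qed

lemma E_conj_powi: "b \<in> dyadic \<Longrightarrow> t [^] j \<otimes> E b = E (2 powi j * b) \<otimes> t [^] (j::int)"
proof (induction j rule: int_induct[of _ 0])
  case base
  then show ?case by (simp add: E_closed)
next
  case (step1 j)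
  have b: "2 powi j * b \<in> dyadic" using step1 dyadic_powi by blast
  have "t [^] (j + 1) = t \<otimes> t [^] j" using t int_pow_mult[of t 1 j] by (simp add: add.commute)
  then have "t [^] (j + 1) \<otimes> E b = t \<otimes> (t [^] j \<otimes> E b)"
    using t step1 E_closed by (simp add: m_assoc)
  also have "\<dots> = t \<otimes> E (2 powi j * b) \<otimes> t [^] j" using step1 t b E_closed by (simp add: m_assoc)
  also have "\<dots> = E (2 powi (j + 1) * b) \<otimes> (t \<otimes> t [^] j)"
    using E_conj[OF b] t dyadic_powi[OF b, of 1] E_closed
    by (simp add: m_assoc power_int_add mult.assoc mult.left_commute)
  finally show ?case using \<open>t [^] (j + 1) = t \<otimes> t [^] j\<close> by simp
next
  case (step2 j)
  define c where "c = 2 powi (j - 1) * b"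
  have b: "c \<in> dyadic" using step2 dyadic_powi unfolding c_def by blast
  have c2: "2 * c = 2 powi j * b" unfolding c_def by (simp add: power_int_diff)
  have cl: "E b \<in> carrier K" "E c \<in> carrier K" "E (2 * c) \<in> carrier K"
    using E_closed b step2 dyadic_powi[OF b, of 1] by simp_all
  have tj: "t [^] j = t \<otimes> t [^] (j - 1)" using t int_pow_mult[of t 1 "j - 1"] by simp
  have "t \<otimes> (t [^] (j - 1) \<otimes> E b) = t [^] j \<otimes> E b" using cl t tj by (simp add: m_assoc)
  also have "\<dots> = E (2 * c) \<otimes> t [^] j" using step2 c2 by simp
  also have "\<dots> = t \<otimes> (E c \<otimes> t [^] (j - 1))"
    using E_conj[OF b] cl t tj by (simp add: m_assoc[symmetric])
  finally show ?case using cl t unfolding c_def by simp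
qed

text \<open>The group of affine maps has the universal property of \<langle>e, t | t e = e^2
  t\<rangle>: an element is a translation followed by a power of t, and \<open>E_conj_powi\<close>
  moves such powers past translations.\<close>

lemma BS_lift:
  obtains h where "group_hom BS K h" "h (0, 1) = e" "h (1, 0) = t" "\<And>k. h (0, of_int k) = e [^] k"
    "\<And>j b. h (j, b) = E b \<otimes> t [^] j"
proof -
  have hom: "group_hom BS K (\<lambda>(j, b). E b \<otimes> t [^] j)"
  proof -
    have "E b \<otimes> t [^] j \<otimes> (E d \<otimes> t [^] l) = E (b + 2 powi j * d) \<otimes> t [^] (j + l)"
      if "b \<in> dyadic" "d \<in> dyadic" for b d and j l :: int
    proof -
      have "E b \<otimes> t [^] j \<otimes> (E d \<otimes> t [^] l) = E b \<otimes> (t [^] j \<otimes> E d) \<otimes> t [^] l"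
        using that t E_closed by (simp add: m_assoc)
      also have "\<dots> = E b \<otimes> E (2 powi j * d) \<otimes> (t [^] j \<otimes> t [^] l)"
        using that t E_closed dyadic_powi[OF that(2), of j] E_conj_powi[OF that(2), of j]
        by (simp add: m_assoc)
      also have "\<dots> = E (b + 2 powi j * d) \<otimes> t [^] (j + l)"
        using that t dyadic_powi[OF that(2), of j] by (simp add: E_plus int_pow_mult)
      finally show ?thesis .
    qed
    then show ?thesis
      using group_BS t E_closed
      by (auto simp: group_hom_def group_hom_axioms_def BS_simps intro!: homI)
  qed
  show ?thesis
  proof (rule that[OF hom])
    show k: "(\<lambda>(j::int, b). E b \<otimes> t [^] j) (0, of_int k) = e [^] k" for k
      using E_of_int[of k] e by simp
    show "(\<lambda>(j::int, b). E b \<otimes> t [^] j) (0, 1) = e" using k[of 1] e by simp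
    show "(\<lambda>(j::int, b). E b \<otimes> t [^] j) (1, 0) = t" using E_of_int[of 0] t by simp
  qed simp
qed

end

lemma ZZ_lift:
  fixes K (structure)
  assumes "group K" "x \<in> carrier K"
  shows "group_hom ZZ K (\<lambda>(j, b). x [^] \<lfloor>b\<rfloor>)"
proof -
  interpret group K by fact
  show ?thesis
    using group_ZZ assms
    by (auto simp: group_hom_def group_hom_axioms_def ZZ_simps int_pow_mult intro!: homI elim!: Ints_cases)
qed

section \<open>The group \<open>AG\<close> and its diagonal subgroup\<close>

text \<open>Three factors generated by a, b, c; \<open>p\<close> tells in which of them the cyclic
  group is enlarged to \<open>BS\<close>. All choices of \<open>p\<close> share the multiplication
  of words, so the groups \<open>FP p\<close> are literally subsets of one another.\<close>

definition fam :: "(nat \<Rightarrow> bool) \<Rightarrow> nat \<Rightarrow> (int \<times> rat) monoid" where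
  "fam p i = (if p i then BS else ZZ)"

definition FP :: "(nat \<Rightarrow> bool) \<Rightarrow> (nat \<times> int \<times> rat) list monoid" where
  "FP p = fp {0, 1, 2} (fam p)"

definition lt :: "nat \<Rightarrow> int \<Rightarrow> (nat \<times> int \<times> rat) list" where
  "lt i k = (if k = 0 then [] else [(i, 0, of_int k)])"

text \<open>In the first factor of \<open>AG\<close> the letter t belongs to a, in the second one to
  b; with \<open>pF\<close> no letter is added and the group is free.\<close>

definition p1 :: "nat \<Rightarrow> bool" where "p1 i \<longleftrightarrow> i = 0"
definition p2 :: "nat \<Rightarrow> bool" where "p2 i \<longleftrightarrow> i = 1"
definition pF :: "nat \<Rightarrow> bool" where "pF i \<longleftrightarrow> False"

text \<open>
  Both factors of \<open>AG\<close> contain the free group \<open>FP pF\<close> of rank 3, and \<open>CG\<close> is its diagonal copy.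
\<close>

definition AG :: "((nat \<times> int \<times> rat) list \<times> (nat \<times> int \<times> rat) list) monoid" where
  "AG = FP p1 \<times>\<times> FP p2"

definition CG :: "((nat \<times> int \<times> rat) list \<times> (nat \<times> int \<times> rat) list) set" where
  "CG = {(w, w) | w. w \<in> carrier (FP pF)}"

lemma fam_simps:
  "\<one>\<^bsub>fam p i\<^esub> = (0, 0)" "monoid.mult (fam p i) = (\<lambda>(j, b) (l, d). (j + l, b + 2 powi j * d))"
  by (simp_all add: fam_def BS_def ZZ_def aff_def)

lemma group_fam: "group (fam p i)"
  by (simp add: fam_def group_BS group_ZZ)

lemma fp_family_fam: "fp_family I (fam p)"
  by (rule fp_family.intro) (rule group_fam)

lemma group_FP: "group (FP p)"
  unfolding FP_def using fp_family.group_fp[OF fp_family_fam] .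

lemma rdepth_le_FP: "rdepth_le 1 (FP p)"
  unfolding FP_def
  using rdepth_le_BS rdepth_le_ZZ
  by (intro fp_family.rdepth_le_fp_1[OF fp_family_fam]) (simp add: fam_def)

lemma fp_push_fam: "fp_push (fam p) = fp_push (fam q)"
proof (intro ext)
  fix x :: "nat \<times> int \<times> rat" and w
  obtain i g where x: "x = (i, g)" by (meson surj_pair)
  show "fp_push (fam p) x w = fp_push (fam q) x w"
    unfolding x by (cases w) (auto simp: fam_simps)
qed

lemma mult_FP: "monoid.mult (FP p) = foldr (fp_push (fam pF))"
  by (simp add: FP_def fp_def fp_push_fam[of p pF])

lemma one_FP: "\<one>\<^bsub>FP p\<^esub> = []"
  by (simp add: FP_def fp_def)

lemma carrier_FP: "carrier (FP p) = {w. (\<forall>x\<in>set w. fst x \<in> {0, 1, 2} \<and>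
    snd x \<in> carrier (fam p (fst x)) \<and> snd x \<noteq> (0, 0)) \<and> distinct_adj (map fst w)}"
  by (simp add: FP_def carrier_fp fp_reduced_def fam_simps case_prod_unfold)

lemma carrier_ZZ_BS: "carrier ZZ \<subseteq> carrier BS"
  using subgroup.subset[OF ZZ_subgroup_BS(1)] .

lemma FP_mono: "(\<And>i. p i \<Longrightarrow> q i) \<Longrightarrow> carrier (FP p) \<subseteq> carrier (FP q)"
proof -
  assume "\<And>i. p i \<Longrightarrow> q i"
  then have "carrier (fam p i) \<subseteq> carrier (fam q i)" for i
    using carrier_ZZ_BS by (simp add: fam_def)
  then show ?thesis unfolding carrier_FP by blast
qed

lemma FP_Int: "carrier (FP p) \<inter> carrier (FP q) = carrier (FP (\<lambda>i. p i \<and> q i))"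
proof -
  have "carrier (fam (\<lambda>i. p i \<and> q i) i) = carrier (fam p i) \<inter> carrier (fam q i)" for i
    using carrier_ZZ_BS by (auto simp: fam_def)
  then show ?thesis unfolding carrier_FP by blast
qed

lemma lt_eq: "lt i k = fp_in (fam p) i (0, of_int k)"
  by (simp add: lt_def fp_in_def fam_simps)

lemma lt_closed: "i \<in> {0, 1, 2} \<Longrightarrow> lt i k \<in> carrier (FP p)"
  unfolding FP_def lt_eq[of i k p]
  by (rule fp_family.fp_in_closed[OF fp_family_fam])
    (auto simp: fam_def BS_simps ZZ_simps dyadic_of_int)

lemma FP_lift:
  fixes K (structure)
  assumes "group K" "\<And>i. i \<in> {0, 1, 2} \<Longrightarrow> x i \<in> carrier K"
    and "\<And>i. i \<in> {0, 1, 2} \<Longrightarrow> p i \<Longrightarrow> t i \<in> carrier K \<and> t i \<otimes> x i = x i \<otimes> x i \<otimes> t i"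
  obtains h where "group_hom (FP p) K h"
    "\<And>i k. i \<in> {0, 1, 2} \<Longrightarrow> h (lt i k) = x i [^] k"
    "\<And>i. i \<in> {0, 1, 2} \<Longrightarrow> p i \<Longrightarrow> h [(i, 1, 0)] = t i"
proof -
  interpret K: group K by fact
  interpret fp_family "{0, 1, 2}" "fam p" by (rule fp_family_fam)
  have "\<exists>f. group_hom (fam p i) K f \<and> (\<forall>k. f (0, of_int k) = x i [^] k) \<and> (p i \<longrightarrow> f (1, 0) = t i)"
    if i: "i \<in> {0, 1, 2}" for i
  proof (cases "p i")
    case True
    then interpret bs_pair K "x i" "t i"
      using assms i by (simp add: bs_pair_def bs_pair_axioms_def)
    show ?thesis using True by (rule_tac BS_lift) (auto simp: fam_def)
  next
    case False
    then show ?thesis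
      using ZZ_lift[OF assms(1) assms(2)[OF i]]
      by (intro exI[of _ "\<lambda>(j, b). x i [^] \<lfloor>b\<rfloor>"]) (simp add: fam_def)
  qed
  then obtain f where f: "\<And>i. i \<in> {0, 1, 2} \<Longrightarrow> group_hom (fam p i) K (f i)"
    "\<And>i k. i \<in> {0, 1, 2} \<Longrightarrow> f i (0, of_int k) = x i [^] k"
    "\<And>i. i \<in> {0, 1, 2} \<Longrightarrow> p i \<Longrightarrow> f i (1, 0) = t i"
    by metis
  have fh: "f i \<in> hom (fam p i) K" if "i \<in> {0, 1, 2}" for i
    using f(1)[OF that] by (simp add: group_hom.homh)
  show ?thesis
  proof (rule that)
    show "group_hom (FP p) K (fp_lift K f)"
      unfolding FP_def using fp_lift_hom[OF assms(1)] fh by blast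
    show "fp_lift K f (lt i k) = x i [^] k" if "i \<in> {0, 1, 2}" for i k
      unfolding lt_eq[of i k p] using fp_lift_in[OF assms(1) fh that, of "(0, of_int k)"] f(2)[OF that]
      by (auto simp: fam_def BS_simps ZZ_simps dyadic_of_int)
    show "fp_lift K f [(i, 1, 0)] = t i" if "i \<in> {0, 1, 2}" "p i" for i
      using fp_lift_in[OF assms(1) fh that(1), of "(1, 0)"] f(3)[OF that] that(2)
      by (simp add: fam_def BS_simps fp_in_def)
  qed
qed

lemma FPF_induct [consumes 1, case_names one mult]:
  assumes "w \<in> carrier (FP pF)" "P []"
    and "\<And>i k w. i \<in> {0, 1, 2} \<Longrightarrow> w \<in> carrier (FP pF) \<Longrightarrow> P w \<Longrightarrow> P (lt i k \<otimes>\<^bsub>FP pF\<^esub> w)"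
  shows "P w"
  using assms(1) unfolding FP_def
proof (induction rule: fp_family.fp_induct[OF fp_family_fam, consumes 1])
  case (2 i g w)
  then obtain k where "g = (0, of_int k)" by (auto simp: fam_def pF_def ZZ_simps elim: Ints_cases)
  then show ?case using 2 assms(3)[of i w k] by (simp add: lt_eq[of i k pF] FP_def)
qed (use assms(2) in \<open>simp add: one_fp\<close>)

section \<open>The direct product and its diagonal\<close>

lemma group_AG: "group AG"
  unfolding AG_def by (rule DirProd_group) (rule group_FP)+

lemma carrier_AG: "carrier AG = carrier (FP p1) \<times> carrier (FP p2)"
  and one_AG: "\<one>\<^bsub>AG\<^esub> = ([], [])"
  and mult_AG: "(x, y) \<otimes>\<^bsub>AG\<^esub> (x', y') = (x \<otimes>\<^bsub>FP p1\<^esub> x', y \<otimes>\<^bsub>FP p2\<^esub> y')"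
  by (simp_all add: AG_def one_FP)

text \<open>\<open>FP pA\<close> contains both factors of \<open>AG\<close>, so that the two
  coordinates of an element can be compared.\<close>

definition pA :: "nat \<Rightarrow> bool" where "pA i \<longleftrightarrow> i < 2"

lemma AG_fst: "group_hom AG (FP pA) fst" and AG_snd: "group_hom AG (FP pA) snd"
proof -
  have *: "carrier (FP p1) \<subseteq> carrier (FP pA)" "carrier (FP p2) \<subseteq> carrier (FP pA)"
    by (rule FP_mono; simp add: p1_def p2_def pA_def)+
  then show "group_hom AG (FP pA) fst" "group_hom AG (FP pA) snd"
    using group_AG group_FP[of pA]
    by (auto simp: group_hom_def group_hom_axioms_def carrier_AG mult_AG mult_FP intro!: homI)
qed

lemma rdepth_le_AG: "rdepth_le 1 AG"
proof (rule rdepth_leI[OF group_AG])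
  fix x assume x: "x \<in> FRn AG 1"
  have "fst x = []" "snd x = []"
    using rdepth_le_hom[OF rdepth_le_FP AG_fst x] rdepth_le_hom[OF rdepth_le_FP AG_snd x]
    by (simp_all add: one_FP)
  then show "x = \<one>\<^bsub>AG\<^esub>" by (simp add: one_AG prod_eq_iff)
qed

lemma CG_eq: "CG = {x \<in> carrier AG. fst x = snd x}"
proof -
  have "carrier (FP pF) = carrier (FP p1) \<inter> carrier (FP p2)"
    unfolding FP_Int by (rule arg_cong[where f = "\<lambda>p. carrier (FP p)"]) (auto simp: p1_def p2_def pF_def)
  then show ?thesis by (auto simp: CG_def carrier_AG)
qed

lemma CG_subgroup: "subgroup CG AG"
proof -
  interpret group AG by (rule group_AG)
  interpret f: group_hom AG "FP pA" fst by (rule AG_fst)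
  interpret s: group_hom AG "FP pA" snd by (rule AG_snd)
  show ?thesis
  proof (rule subgroupI)
    show "CG \<noteq> {}" using one_closed by (auto simp: CG_eq one_AG)
  qed (auto simp: CG_eq)
qed

lemma CG_hom: "group_hom (FP pF) AG (\<lambda>w. (w, w))"
  using group_FP group_AG CG_eq
  by (auto simp: group_hom_def group_hom_axioms_def CG_def mult_AG mult_FP intro!: homI)

text \<open>\<open>CG\<close> is closed in the profinite topology: it is the equaliser of the two
  projections to the residually finite group \<open>FP pA\<close>. A normal subgroup
  \<open>M\<close> that misses the quotient of the two coordinates of g is pulled back along both
  projections.\<close>

lemma CG_closed:
  assumes "g \<in> carrier AG" "g \<notin> CG"
  shows "\<exists>N. N \<lhd> AG \<and> fin_idx AG N \<and> (\<forall>n\<in>N. \<forall>c\<in>CG. g \<noteq> n \<otimes>\<^bsub>AG\<^esub> c)"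
proof -
  interpret group AG by (rule group_AG)
  interpret P: group "FP pA" by (rule group_FP)
  interpret f: group_hom AG "FP pA" fst by (rule AG_fst)
  interpret s: group_hom AG "FP pA" snd by (rule AG_snd)
  have ne: "fst g \<noteq> snd g" using assms by (auto simp: CG_eq)
  have g: "fst g \<in> carrier (FP pA)" "snd g \<in> carrier (FP pA)" using assms by auto
  define d where "d = fst g \<otimes>\<^bsub>FP pA\<^esub> inv\<^bsub>FP pA\<^esub> snd g"
  have "d \<noteq> \<one>\<^bsub>FP pA\<^esub>" "d \<in> carrier (FP pA)"
    using ne g P.inv_equality[of "fst g" "inv\<^bsub>FP pA\<^esub> snd g"] by (auto simp: d_def)
  then have "\<exists>M. M \<lhd> FP pA \<and> fin_idx (FP pA) M \<and> M \<inter> {d} = {}"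
    by (intro residually_finite_normal rdepth_le_FP) auto
  then obtain M where M: "M \<lhd> FP pA" "fin_idx (FP pA) M" "fst g \<otimes>\<^bsub>FP pA\<^esub> inv\<^bsub>FP pA\<^esub> snd g \<notin> M"
    by (auto simp: d_def)
  define N where "N = {x \<in> carrier AG. fst x \<in> M} \<inter> {x \<in> carrier AG. snd x \<in> M}"
  interpret M: normal M "FP pA" using M(1) .
  have fin: "fin_idx AG N"
    unfolding N_def by (intro fin_idx_Int group_AG fin_idx_preimage[OF AG_fst] fin_idx_preimage[OF AG_snd] M(2))
  moreover have "N \<lhd> AG"
    unfolding normal_inv_iff
  proof (intro conjI ballI fin_idx_subgroup[OF fin])
    fix x h assume "x \<in> carrier AG" "h \<in> N"
    then show "x \<otimes>\<^bsub>AG\<^esub> h \<otimes>\<^bsub>AG\<^esub> inv\<^bsub>AG\<^esub> x \<in> N"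
      using M.inv_op_closed2 by (auto simp: N_def)
  qed
  moreover have "g \<noteq> n \<otimes>\<^bsub>AG\<^esub> c" if n: "n \<in> N" "c \<in> CG" for n c
  proof
    assume gn: "g = n \<otimes>\<^bsub>AG\<^esub> c"
    have nc: "n \<in> carrier AG" "c \<in> carrier AG" "fst n \<in> M" "snd n \<in> M" "snd c = fst c"
      using n by (auto simp: N_def CG_eq)
    then have m: "fst n \<in> carrier (FP pA)" "snd n \<in> carrier (FP pA)" "fst c \<in> carrier (FP pA)"
      by auto
    have "fst g \<otimes>\<^bsub>FP pA\<^esub> inv\<^bsub>FP pA\<^esub> snd g = fst n \<otimes>\<^bsub>FP pA\<^esub> inv\<^bsub>FP pA\<^esub> snd n"
      using m nc gn by (simp add: P.inv_mult_group P.m_assoc P.inv_solve_left)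
        (simp add: P.m_assoc[symmetric])
    then show False using M(3) nc M.m_closed M.m_inv_closed by simp
  qed
  ultimately show ?thesis by blast
qed

definition bits :: "(bool \<times> bool) monoid" where
  "bits = \<lparr>carrier = UNIV, monoid.mult = (\<lambda>(a, b) (c, d). (a \<noteq> c, b \<noteq> d)), one = (False, False)\<rparr>"

lemma bits_simps [simp]:
  "carrier bits = UNIV" "\<one>\<^bsub>bits\<^esub> = (False, False)" "(a, b) \<otimes>\<^bsub>bits\<^esub> (c, d) = (a \<noteq> c, b \<noteq> d)"
  by (simp_all add: bits_def)

lemma group_bits: "group bits"
  by (rule groupI) auto

text \<open>
  The free group acts on \<open>bits \<times> int\<close>: its first two generators flip a bit, and the third one adds 1
  to the integer if both bits are 0.
\<close>

definition actgen :: "nat \<Rightarrow> (bool \<times> bool \<Rightarrow> int) \<times> bool \<times> bool" where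
  "actgen i = (if i = 0 then (\<lambda>_. 0, True, False) else if i = 1 then (\<lambda>_. 0, False, True)
     else (\<lambda>q. if q = (False, False) then 1 else 0, False, False))"

text \<open>The wreath product notation keeps what is needed later: the diagonal element of w
  conjugates the letter with bits q to the letter with bits moved by \<open>snd (act w)\<close>,
  times the power of d with exponent \<open>fst (act w) q\<close>.\<close>

definition act :: "(nat \<times> int \<times> rat) list \<Rightarrow> (bool \<times> bool \<Rightarrow> int) \<times> bool \<times> bool" where
  "act = (SOME h. group_hom (FP pF) (wr integer_group bits) h \<and>
     (\<forall>i\<in>{0, 1, 2}. h (lt i 1) = actgen i))"

lemma group_act: "group (wr integer_group bits)"
  by (rule group_wr) (simp_all add: group_bits)

lemma act:
  "group_hom (FP pF) (wr integer_group bits) act"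
  "act (lt 0 1) = actgen 0" "act (lt 1 1) = actgen 1" "act (lt 2 1) = actgen 2"
proof -
  interpret K: group "wr integer_group bits" by (rule group_act)
  have "\<exists>h. group_hom (FP pF) (wr integer_group bits) h \<and> (\<forall>i\<in>{0, 1, 2}. h (lt i 1) = actgen i)"
  proof (rule FP_lift[OF group_act, of actgen pF "\<lambda>_. undefined"])
    show "actgen i \<in> carrier (wr integer_group bits)" for i
      by (auto simp: actgen_def carrier_wr integer_group_def)
    then show ?thesis if "group_hom (FP pF) (wr integer_group bits) h"
      "\<And>i k. i \<in> {0, 1, 2} \<Longrightarrow> h (lt i k) = actgen i [^]\<^bsub>wr integer_group bits\<^esub> k" for h
      using that by (intro exI[of _ h]) auto
  qed (simp_all add: pF_def)
  from someI_ex[OF this]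
  show "group_hom (FP pF) (wr integer_group bits) act"
  "act (lt 0 1) = actgen 0" "act (lt 1 1) = actgen 1" "act (lt 2 1) = actgen 2"
    unfolding act_def by auto
qed

lemma act_mult:
  assumes "v \<in> carrier (FP pF)" "w \<in> carrier (FP pF)"
  shows "fst (act (v \<otimes>\<^bsub>FP pF\<^esub> w)) q = fst (act v) (snd (act w) \<otimes>\<^bsub>bits\<^esub> q) + fst (act w) q"
    "snd (act (v \<otimes>\<^bsub>FP pF\<^esub> w)) = snd (act v) \<otimes>\<^bsub>bits\<^esub> snd (act w)"
  using group_hom.hom_mult[OF act(1) assms]
  by (cases "act v"; cases "act w"; simp add: mult_wr)+

lemma act_one: "fst (act []) q = 0" "snd (act []) = (False, False)"
  using group_hom.hom_one[OF act(1)] by (simp_all add: one_FP one_wr)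

lemma ZZ_pow: "(0, 1) [^]\<^bsub>ZZ\<^esub> k = (0, of_int k)" for k :: int
proof -
  interpret Z: group ZZ by (rule group_ZZ)
  have one: "(0, 1) \<in> carrier ZZ" by (simp add: ZZ_simps)
  have "(0, 1) [^]\<^bsub>ZZ\<^esub> n = (0, of_nat n)" for n :: nat
    by (induction n) (simp_all add: ZZ_simps)
  then have nat: "(0, of_nat n) = (0, 1) [^]\<^bsub>ZZ\<^esub> n" for n :: nat by simp
  have "(0, of_int k) = (0, 1) [^]\<^bsub>ZZ\<^esub> k"
  proof (cases k rule: int_cases2)
    case (nonneg n)
    then show ?thesis using nat[of n] by (simp only: int_pow_int of_int_of_nat_eq)
  next
    case (nonpos n)
    have "inv\<^bsub>ZZ\<^esub> (0, of_nat n) = (0, - of_nat n)"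
      by (rule Z.inv_equality) (auto simp: ZZ_simps)
    then show ?thesis
      using nat[of n] nonpos Z.int_pow_neg_int[OF one, of n] by (simp only: of_int_minus of_int_of_nat_eq)
  qed
  then show ?thesis by (simp only:)
qed

lemma lt_pow:
  assumes "i \<in> {0, 1, 2}"
  shows "lt i k = lt i 1 [^]\<^bsub>FP p\<^esub> k"
proof -
  interpret fp_family "{0, 1, 2}" "fam p" by (rule fp_family_fam)
  interpret h: group_hom "fam p i" "FP p" "fp_in (fam p) i"
    unfolding FP_def by (rule fp_in_hom[OF assms])
  have ZZ: "group_hom ZZ (fam p i) (\<lambda>x. x)"
  proof -
    have "carrier ZZ \<subseteq> carrier (fam p i)" using carrier_ZZ_BS by (simp add: fam_def)
    moreover have "monoid.mult ZZ = monoid.mult (fam p i)" by (simp add: fam_simps ZZ_def aff_def)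
    ultimately show ?thesis
      using group_fam group_ZZ by (auto simp: group_hom_def group_hom_axioms_def intro!: homI)
  qed
  have one: "(0, 1) \<in> carrier ZZ" by (simp add: ZZ_simps)
  have "(0, of_int k) = (0, 1) [^]\<^bsub>ZZ\<^esub> k" by (simp only: ZZ_pow)
  then have "lt i k = fp_in (fam p) i ((0, 1) [^]\<^bsub>fam p i\<^esub> k)"
    using group_hom.hom_int_pow[OF ZZ one, of k] by (simp add: lt_eq[of i k p])
  also have "\<dots> = fp_in (fam p) i (0, 1) [^]\<^bsub>FP p\<^esub> k"
    using group_hom.hom_closed[OF ZZ one] by (simp add: h.hom_int_pow)
  finally show ?thesis using lt_eq[of i 1 p] by simp
qed

lemma FPF_induct_gen [consumes 1, case_names one mult mult_inv]:
  assumes "w \<in> carrier (FP pF)" "P []"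
    and "\<And>i w. i \<in> {0, 1, 2} \<Longrightarrow> w \<in> carrier (FP pF) \<Longrightarrow> P w \<Longrightarrow> P (lt i 1 \<otimes>\<^bsub>FP pF\<^esub> w)"
    and "\<And>i w. i \<in> {0, 1, 2} \<Longrightarrow> w \<in> carrier (FP pF) \<Longrightarrow> P w \<Longrightarrow>
           P (inv\<^bsub>FP pF\<^esub> (lt i 1) \<otimes>\<^bsub>FP pF\<^esub> w)"
  shows "P w"
  using assms(1)
proof (induction rule: FPF_induct)
  case (mult i k w)
  interpret group "FP pF" by (rule group_FP)
  let ?x = "lt i 1"
  have x: "?x \<in> carrier (FP pF)" using lt_closed mult by blast
  have pos: "P (?x [^]\<^bsub>FP pF\<^esub> n \<otimes>\<^bsub>FP pF\<^esub> w)" for n :: nat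
  proof (induction n)
    case (Suc n)
    have "?x [^]\<^bsub>FP pF\<^esub> Suc n \<otimes>\<^bsub>FP pF\<^esub> w = ?x \<otimes>\<^bsub>FP pF\<^esub> (?x [^]\<^bsub>FP pF\<^esub> n \<otimes>\<^bsub>FP pF\<^esub> w)"
      unfolding nat_pow_Suc2[OF x] using x mult by (simp add: m_assoc)
    then show ?case using assms(3) Suc x mult by simp
  qed (use mult in simp)
  have neg: "P (inv\<^bsub>FP pF\<^esub> (?x [^]\<^bsub>FP pF\<^esub> n) \<otimes>\<^bsub>FP pF\<^esub> w)" for n :: nat
  proof (induction n)
    case (Suc n)
    have "inv\<^bsub>FP pF\<^esub> (?x [^]\<^bsub>FP pF\<^esub> Suc n) \<otimes>\<^bsub>FP pF\<^esub> w =
        inv\<^bsub>FP pF\<^esub> ?x \<otimes>\<^bsub>FP pF\<^esub> (inv\<^bsub>FP pF\<^esub> (?x [^]\<^bsub>FP pF\<^esub> n) \<otimes>\<^bsub>FP pF\<^esub> w)"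
      using x mult by (simp add: inv_mult_group m_assoc)
    then show ?case using assms(4) Suc x mult by simp
  qed (use mult in simp)
  have "P (?x [^]\<^bsub>FP pF\<^esub> k \<otimes>\<^bsub>FP pF\<^esub> w)"
  proof (cases k rule: int_cases2)
    case (nonneg n)
    then show ?thesis using pos[of n] by (simp only: int_pow_int)
  next
    case (nonpos n)
    then show ?thesis using neg[of n] by (simp only: int_pow_neg_int[OF x])
  qed
  then show ?case using lt_pow[OF mult(1), of k pF] by (simp only:)
qed (rule assms(2))

text \<open>The flips extend to a homomorphism from \<open>AG\<close> to the group of bits, though
  not from one factor: t a = a^2 t forces a \<mapsto> 0 in the first factor, so the flip by a is
  read off the second coordinate, and likewise the flip by b off the first one.\<close>

lemma bits_separation:
  "\<exists>N. N \<lhd> AG \<and> fin_idx AG N \<and> (\<forall>w. (w, w) \<in> N \<longrightarrow> w \<in> carrier (FP pF) \<longrightarrow> snd (act w) = (False, False))"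
proof -
  interpret B: group bits by (rule group_bits)
  have lift: "\<exists>h. group_hom (FP p) bits h \<and> (\<forall>i\<in>{0, 1, 2}. h (lt i 1) = x i)"
    if "\<And>i. i \<in> {0, 1, 2} \<Longrightarrow> p i \<Longrightarrow> x i = (False, False)" for p x
  proof (rule FP_lift[OF group_bits, of x p "\<lambda>_. (False, False)"])
    show ?thesis if "group_hom (FP p) bits h"
      "\<And>i k. i \<in> {0, 1, 2} \<Longrightarrow> h (lt i k) = x i [^]\<^bsub>bits\<^esub> k" for h
      using that by (intro exI[of _ h]) auto
  qed (use that in auto)
  obtain h1 where h1: "group_hom (FP p1) bits h1"
    "\<forall>i\<in>{0, 1, 2}. h1 (lt i 1) = (if i = 1 then (False, True) else (False, False))"
    using lift[of p1 "\<lambda>i. if i = 1 then (False, True) else (False, False)"] by (auto simp: p1_def)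
  obtain h2 where h2: "group_hom (FP p2) bits h2"
    "\<forall>i\<in>{0, 1, 2}. h2 (lt i 1) = (if i = 0 then (True, False) else (False, False))"
    using lift[of p2 "\<lambda>i. if i = 0 then (True, False) else (False, False)"] by (auto simp: p2_def)
  interpret h1: group_hom "FP p1" bits h1 by fact
  interpret h2: group_hom "FP p2" bits h2 by fact
  define \<eta> where "\<eta> x = h1 (fst x) \<otimes>\<^bsub>bits\<^esub> h2 (snd x)" for x
  have eta: "group_hom AG bits \<eta>"
    using group_AG group_bits
    by (auto simp: group_hom_def group_hom_axioms_def \<eta>_def carrier_AG mult_AG intro!: homI)
      (auto simp: bits_def split: prod.splits)
  have F: "carrier (FP pF) \<subseteq> carrier (FP p1)" "carrier (FP pF) \<subseteq> carrier (FP p2)"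
    by (rule FP_mono; simp add: pF_def)+
  interpret e: group_hom AG bits \<eta> by fact
  interpret d: group_hom "FP pF" AG "\<lambda>w. (w, w)" by (rule CG_hom)
  interpret act: group_hom "FP pF" "wr integer_group bits" act by (rule act(1))
  have sb: "group_hom (wr integer_group bits) bits snd" by (rule wr_snd_hom) (simp_all add: group_bits)
  interpret sb: group_hom "wr integer_group bits" bits snd by fact
  have gen: "\<eta> (lt i 1, lt i 1) = snd (act (lt i 1))" if "i \<in> {0, 1, 2}" for i
    using h1(2) h2(2) that act(2-4) by (auto simp: \<eta>_def actgen_def)
  have agree: "\<eta> (w, w) = snd (act w)" if "w \<in> carrier (FP pF)" for w
    using that
  proof (induction rule: FPF_induct_gen)
    case one
    then show ?case using e.hom_one act_one by (simp add: one_AG)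
  next
    case (mult i w)
    have l: "lt i 1 \<in> carrier (FP pF)" using lt_closed mult by blast
    show ?case
      using mult l gen[OF mult(1)] act_mult(2)[OF l mult(2)] d.hom_mult[OF l mult(2)]
        e.hom_mult[OF d.hom_closed[OF l] d.hom_closed[OF mult(2)]] by simp
  next
    case (mult_inv i w)
    have l: "lt i 1 \<in> carrier (FP pF)" using lt_closed mult_inv by blast
    let ?l = "inv\<^bsub>FP pF\<^esub> (lt i 1)"
    have "snd (act ?l) = inv\<^bsub>bits\<^esub> snd (act (lt i 1))"
      using act.hom_inv[OF l] sb.hom_inv[OF act.hom_closed[OF l]] by simp
    moreover have "\<eta> (?l, ?l) = inv\<^bsub>bits\<^esub> \<eta> (lt i 1, lt i 1)"
      using d.hom_inv[OF l] e.hom_inv[OF d.hom_closed[OF l]] by simp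
    ultimately show ?case
      using mult_inv l gen[OF mult_inv(1)] act_mult(2)[of ?l w] d.hom_mult[of ?l w]
        e.hom_mult[of "(?l, ?l)" "(w, w)"] d.hom_closed[of ?l] d.hom_closed[of w] by simp
  qed
  have "fin_idx bits {\<one>\<^bsub>bits\<^esub>}"
    by (rule fin_idx_finite[OF group_bits _ B.triv_subgroup]) simp
  then have fin: "fin_idx AG {x \<in> carrier AG. \<eta> x \<in> {\<one>\<^bsub>bits\<^esub>}}" by (rule fin_idx_preimage[OF eta])
  moreover have "{x \<in> carrier AG. \<eta> x \<in> {\<one>\<^bsub>bits\<^esub>}} \<lhd> AG"
    using e.normal_kernel by (simp add: kernel_def)
  ultimately show ?thesis using agree by (intro exI[of _ "{x \<in> carrier AG. \<eta> x \<in> {\<one>\<^bsub>bits\<^esub>}}"]) auto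
qed

text \<open>A transversal of the left cosets of \<open>CG\<close>: the predicate under the choice
  depends only on the coset of g. \<open>cpart g\<close> is the remaining diagonal element, written
  as one of its coordinates.\<close>

definition rep where "rep g = (SOME h. h \<in> carrier AG \<and> inv\<^bsub>AG\<^esub> h \<otimes>\<^bsub>AG\<^esub> g \<in> CG)"

definition cpart where "cpart g = fst (inv\<^bsub>AG\<^esub> (rep g) \<otimes>\<^bsub>AG\<^esub> g)"

lemma rep:
  assumes "g \<in> carrier AG"
  shows "rep g \<in> carrier AG" "cpart g \<in> carrier (FP pF)" "g = rep g \<otimes>\<^bsub>AG\<^esub> (cpart g, cpart g)"
proof -
  interpret group AG by (rule group_AG)
  have "\<exists>h. h \<in> carrier AG \<and> inv\<^bsub>AG\<^esub> h \<otimes>\<^bsub>AG\<^esub> g \<in> CG"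
    using assms subgroup.one_closed[OF CG_subgroup] by (intro exI[of _ g]) simp
  from someI_ex[OF this] have *: "rep g \<in> carrier AG" "inv\<^bsub>AG\<^esub> (rep g) \<otimes>\<^bsub>AG\<^esub> g \<in> CG"
    unfolding rep_def by auto
  show "rep g \<in> carrier AG" by fact
  from *(2) have w: "cpart g \<in> carrier (FP pF)" "inv\<^bsub>AG\<^esub> (rep g) \<otimes>\<^bsub>AG\<^esub> g = (cpart g, cpart g)"
    by (auto simp: CG_def cpart_def)
  show "cpart g \<in> carrier (FP pF)" by fact
  show "g = rep g \<otimes>\<^bsub>AG\<^esub> (cpart g, cpart g)"
    using assms *(1) unfolding w(2)[symmetric] by (simp add: m_assoc[symmetric])
qed

lemma rep_mult:
  assumes "g \<in> carrier AG" "w \<in> carrier (FP pF)"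
  shows "rep (g \<otimes>\<^bsub>AG\<^esub> (w, w)) = rep g" "cpart (g \<otimes>\<^bsub>AG\<^esub> (w, w)) = cpart g \<otimes>\<^bsub>FP pF\<^esub> w"
proof -
  interpret group AG by (rule group_AG)
  interpret C: subgroup CG AG by (rule CG_subgroup)
  have w: "(w, w) \<in> CG" using assms by (auto simp: CG_def)
  have "inv\<^bsub>AG\<^esub> h \<otimes>\<^bsub>AG\<^esub> (g \<otimes>\<^bsub>AG\<^esub> (w, w)) \<in> CG \<longleftrightarrow> inv\<^bsub>AG\<^esub> h \<otimes>\<^bsub>AG\<^esub> g \<in> CG"
    if h: "h \<in> carrier AG" for h
  proof
    assume "inv\<^bsub>AG\<^esub> h \<otimes>\<^bsub>AG\<^esub> g \<in> CG"
    then have "inv\<^bsub>AG\<^esub> h \<otimes>\<^bsub>AG\<^esub> g \<otimes>\<^bsub>AG\<^esub> (w, w) \<in> CG" using C.m_closed[OF _ w] by blast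
    then show "inv\<^bsub>AG\<^esub> h \<otimes>\<^bsub>AG\<^esub> (g \<otimes>\<^bsub>AG\<^esub> (w, w)) \<in> CG"
      using h assms(1) C.mem_carrier[OF w] by (simp add: m_assoc)
  next
    assume "inv\<^bsub>AG\<^esub> h \<otimes>\<^bsub>AG\<^esub> (g \<otimes>\<^bsub>AG\<^esub> (w, w)) \<in> CG"
    then have "inv\<^bsub>AG\<^esub> h \<otimes>\<^bsub>AG\<^esub> (g \<otimes>\<^bsub>AG\<^esub> (w, w)) \<otimes>\<^bsub>AG\<^esub> inv\<^bsub>AG\<^esub> (w, w) \<in> CG"
      using C.m_closed C.m_inv_closed[OF w] by blast
    then show "inv\<^bsub>AG\<^esub> h \<otimes>\<^bsub>AG\<^esub> g \<in> CG"
      using h assms(1) C.mem_carrier[OF w] by (simp add: m_assoc)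
  qed
  then show r: "rep (g \<otimes>\<^bsub>AG\<^esub> (w, w)) = rep g" unfolding rep_def by (metis (no_types, lifting))
  have "inv\<^bsub>AG\<^esub> (rep g) \<otimes>\<^bsub>AG\<^esub> (g \<otimes>\<^bsub>AG\<^esub> (w, w)) = inv\<^bsub>AG\<^esub> (rep g) \<otimes>\<^bsub>AG\<^esub> g \<otimes>\<^bsub>AG\<^esub> (w, w)"
    using assms rep(1)[OF assms(1)] C.mem_carrier[OF w] by (simp add: m_assoc)
  then show "cpart (g \<otimes>\<^bsub>AG\<^esub> (w, w)) = cpart g \<otimes>\<^bsub>FP pF\<^esub> w"
    unfolding cpart_def r
    by (cases "inv\<^bsub>AG\<^esub> (rep g) \<otimes>\<^bsub>AG\<^esub> g") (simp add: mult_AG mult_FP)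
qed

lemma rep_rep: "g \<in> carrier AG \<Longrightarrow> rep (rep g) = rep g"
  using rep_mult(1)[of "rep g" "cpart g"] rep[of g] by metis

lemma rep_eq_iff:
  assumes "g \<in> carrier AG" "h \<in> carrier AG" "inv\<^bsub>AG\<^esub> g \<otimes>\<^bsub>AG\<^esub> h \<in> CG"
  shows "rep g = rep h"
proof -
  interpret group AG by (rule group_AG)
  obtain w where w: "w \<in> carrier (FP pF)" "inv\<^bsub>AG\<^esub> g \<otimes>\<^bsub>AG\<^esub> h = (w, w)"
    using assms(3) by (auto simp: CG_def)
  have "h = g \<otimes>\<^bsub>AG\<^esub> (w, w)" using assms(1,2) w(2)[symmetric] by (simp add: m_assoc[symmetric])
  then show ?thesis using rep_mult(1)[OF assms(1) w(1)] by simp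
qed

text \<open>Commutation is given for generators only. It is spread to the whole factors by
  corestricting the lifts to centralisers: first that of the generators of the second factor, then
  that of the image of the first factor.\<close>

lemma AG_lift:
  fixes K (structure)
  assumes "group K" and cl: "\<And>i. i \<in> {0, 1, 2} \<Longrightarrow> x i \<in> carrier K \<and> y i \<in> carrier K"
    "t \<in> carrier K" "v \<in> carrier K"
    and rel: "t \<otimes> x 0 = x 0 \<otimes> x 0 \<otimes> t" "v \<otimes> y 1 = y 1 \<otimes> y 1 \<otimes> v"
    and com: "\<And>i j. i \<in> {0, 1, 2} \<Longrightarrow> j \<in> {0, 1, 2} \<Longrightarrow> x i \<otimes> y j = y j \<otimes> x i"
      "\<And>i. i \<in> {0, 1, 2} \<Longrightarrow> x i \<otimes> v = v \<otimes> x i" "\<And>i. i \<in> {0, 1, 2} \<Longrightarrow> t \<otimes> y i = y i \<otimes> t"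
      "t \<otimes> v = v \<otimes> t"
  obtains s where "group_hom AG K s" "\<And>i. i \<in> {0, 1, 2} \<Longrightarrow> s (lt i 1, []) = x i"
    "\<And>i. i \<in> {0, 1, 2} \<Longrightarrow> s ([], lt i 1) = y i" "s ([(0, 1, 0)], []) = t" "s ([], [(1, 1, 0)]) = v"
proof -
  interpret K: group K by fact
  have cent: "subgroup {z \<in> carrier K. \<forall>u\<in>U. z \<otimes> u = u \<otimes> z} K" if U: "U \<subseteq> carrier K" for U
  proof (rule K.subgroupI)
    show "{z \<in> carrier K. \<forall>u\<in>U. z \<otimes> u = u \<otimes> z} \<noteq> {}"
      using U by (auto intro!: exI[of _ \<one>])
    show "inv a \<in> {z \<in> carrier K. \<forall>u\<in>U. z \<otimes> u = u \<otimes> z}"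
      if a: "a \<in> {z \<in> carrier K. \<forall>u\<in>U. z \<otimes> u = u \<otimes> z}" for a
    proof -
      have "inv a \<otimes> u = u \<otimes> inv a" if u: "u \<in> U" for u
      proof -
        have "a \<otimes> u = u \<otimes> a" "u \<in> carrier K" "a \<in> carrier K" using a u U by auto
        then show ?thesis by (metis K.inv_closed K.inv_solve_left' K.inv_solve_right K.m_assoc K.m_closed)
      qed
      then show ?thesis using a by auto
    qed
    show "a \<otimes> b \<in> {z \<in> carrier K. \<forall>u\<in>U. z \<otimes> u = u \<otimes> z}"
      if a: "a \<in> {z \<in> carrier K. \<forall>u\<in>U. z \<otimes> u = u \<otimes> z}"
        "b \<in> {z \<in> carrier K. \<forall>u\<in>U. z \<otimes> u = u \<otimes> z}" for a b
    proof -
      have "a \<otimes> b \<otimes> u = u \<otimes> (a \<otimes> b)" if u: "u \<in> U" for u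
      proof -
        have *: "a \<otimes> u = u \<otimes> a" "b \<otimes> u = u \<otimes> b" "u \<in> carrier K" "a \<in> carrier K" "b \<in> carrier K"
          using a u U by auto
        have "a \<otimes> b \<otimes> u = a \<otimes> (b \<otimes> u)" using *(4,5,3) by (rule K.m_assoc)
        also have "\<dots> = a \<otimes> (u \<otimes> b)" by (simp only: *(2))
        also have "\<dots> = a \<otimes> u \<otimes> b" using *(4,3,5) by (rule K.m_assoc[symmetric])
        also have "\<dots> = u \<otimes> a \<otimes> b" by (simp only: *(1))
        also have "\<dots> = u \<otimes> (a \<otimes> b)" using *(3-5) by (rule K.m_assoc)
        finally show ?thesis .
      qed
      then show ?thesis using a by auto
    qed
  qed auto
  define U1 where "U1 = insert v (y ` {0, 1, 2})"
  define M1 where "M1 = {z \<in> carrier K. \<forall>u\<in>U1. z \<otimes> u = u \<otimes> z}"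
  have M1: "subgroup M1 K" unfolding M1_def using cl by (intro cent) (auto simp: U1_def)
  then have gM1: "group (K\<lparr>carrier := M1\<rparr>)" by (rule K.subgroup_imp_group)
  have x: "x i \<in> M1" if "i \<in> {0, 1, 2}" for i
    using cl(1)[OF that] com(1)[OF that] com(2)[OF that] by (auto simp: M1_def U1_def)
  have t: "t \<in> M1" using cl(2) com(3,4) by (auto simp: M1_def U1_def)
  obtain h1 where h1: "group_hom (FP p1) (K\<lparr>carrier := M1\<rparr>) h1"
    "\<And>i k. i \<in> {0, 1, 2} \<Longrightarrow> h1 (lt i k) = x i [^]\<^bsub>K\<lparr>carrier := M1\<rparr>\<^esub> (k::int)" "h1 [(0, 1, 0)] = t"
  proof -
    note ex = that
    show thesis
    proof (rule FP_lift[OF gM1, of x p1 "\<lambda>_. t"])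
      fix h assume "group_hom (FP p1) (K\<lparr>carrier := M1\<rparr>) h"
        "\<And>i k. i \<in> {0, 1, 2} \<Longrightarrow> h (lt i k) = x i [^]\<^bsub>K\<lparr>carrier := M1\<rparr>\<^esub> (k::int)"
        "\<And>i. i \<in> {0, 1, 2} \<Longrightarrow> p1 i \<Longrightarrow> h [(i, 1, 0)] = t"
      then show thesis using ex[of h] by (simp add: p1_def)
    qed (use x t rel(1) in \<open>auto simp: p1_def\<close>)
  qed
  have h1c: "h1 a \<in> M1" if "a \<in> carrier (FP p1)" for a
    using group_hom.hom_closed[OF h1(1) that] by simp
  have M1c: "M1 \<subseteq> carrier K" by (auto simp: M1_def)
  define U2 where "U2 = h1 ` carrier (FP p1)"
  define M2 where "M2 = {z \<in> carrier K. \<forall>u\<in>U2. z \<otimes> u = u \<otimes> z}"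
  have M2: "subgroup M2 K" unfolding M2_def using h1c M1c by (intro cent) (auto simp: U2_def)
  then have gM2: "group (K\<lparr>carrier := M2\<rparr>)" by (rule K.subgroup_imp_group)
  have U12: "u \<otimes> h = h \<otimes> u" if "u \<in> U1" "h \<in> U2" for u h
    using that h1c by (auto simp: U2_def M1_def)
  have y: "y i \<in> M2" if "i \<in> {0, 1, 2}" for i
    using cl(1)[OF that] U12[of "y i"] that by (auto simp: M2_def U1_def)
  have v: "v \<in> M2" using cl(3) U12[of v] by (auto simp: M2_def U1_def)
  obtain h2 where h2: "group_hom (FP p2) (K\<lparr>carrier := M2\<rparr>) h2"
    "\<And>i k. i \<in> {0, 1, 2} \<Longrightarrow> h2 (lt i k) = y i [^]\<^bsub>K\<lparr>carrier := M2\<rparr>\<^esub> (k::int)" "h2 [(1, 1, 0)] = v"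
  proof -
    note ex = that
    show thesis
    proof (rule FP_lift[OF gM2, of y p2 "\<lambda>_. v"])
      fix h assume "group_hom (FP p2) (K\<lparr>carrier := M2\<rparr>) h"
        "\<And>i k. i \<in> {0, 1, 2} \<Longrightarrow> h (lt i k) = y i [^]\<^bsub>K\<lparr>carrier := M2\<rparr>\<^esub> (k::int)"
        "\<And>i. i \<in> {0, 1, 2} \<Longrightarrow> p2 i \<Longrightarrow> h [(i, 1, 0)] = v"
      then show thesis using ex[of h] by (simp add: p2_def)
    qed (use y v rel(2) in \<open>auto simp: p2_def\<close>)
  qed
  have h2c: "h2 b \<in> M2" if "b \<in> carrier (FP p2)" for b
    using group_hom.hom_closed[OF h2(1) that] by simp
  have M2c: "M2 \<subseteq> carrier K" by (auto simp: M2_def)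
  define s where "s z = h1 (fst z) \<otimes> h2 (snd z)" for z
  have one: "h1 [] = \<one>" "h2 [] = \<one>"
    using group_hom.hom_one[OF h1(1)] group_hom.hom_one[OF h2(1)] by (simp_all add: one_FP)
  show ?thesis
  proof (rule that)
    show "group_hom AG K s"
      unfolding group_hom_def group_hom_axioms_def
    proof (intro conjI group_AG assms(1) homI)
      show "s z \<in> carrier K" if "z \<in> carrier AG" for z
        using that h1c h2c M1c M2c by (auto simp: s_def carrier_AG intro!: K.m_closed)
      fix z z' assume "z \<in> carrier AG" "z' \<in> carrier AG"
      then obtain a b a' b' where z: "z = (a, b)" "z' = (a', b')" "a \<in> carrier (FP p1)" "a' \<in> carrier (FP p1)"
        "b \<in> carrier (FP p2)" "b' \<in> carrier (FP p2)" by (auto simp: carrier_AG)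
      have c: "h1 a \<in> carrier K" "h1 a' \<in> carrier K" "h2 b \<in> carrier K" "h2 b' \<in> carrier K"
        using z h1c h2c M1c M2c by auto
      have e: "h2 b \<otimes> h1 a' = h1 a' \<otimes> h2 b"
        using h2c[OF z(5)] z(4) by (simp add: M2_def U2_def)
      have "s (z \<otimes>\<^bsub>AG\<^esub> z') = h1 a \<otimes> h1 a' \<otimes> (h2 b \<otimes> h2 b')"
        using group_hom.hom_mult[OF h1(1) z(3,4)] group_hom.hom_mult[OF h2(1) z(5,6)]
        unfolding z(1,2) by (simp add: s_def mult_AG)
      also have "\<dots> = h1 a \<otimes> (h1 a' \<otimes> h2 b) \<otimes> h2 b'" using c by (simp add: K.m_assoc)
      also have "\<dots> = h1 a \<otimes> (h2 b \<otimes> h1 a') \<otimes> h2 b'" using e by simp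
      also have "\<dots> = s z \<otimes> s z'" using c unfolding z(1,2) by (simp add: s_def K.m_assoc)
      finally show "s (z \<otimes>\<^bsub>AG\<^esub> z') = s z \<otimes> s z'" .
    qed
    show "s (lt i 1, []) = x i" if "i \<in> {0, 1, 2}" for i
      using h1(2)[OF that, of 1] one x[OF that] M1c group.int_pow_1[OF gM1, of "x i"] by (auto simp: s_def)
    show "s ([], lt i 1) = y i" if "i \<in> {0, 1, 2}" for i
      using h2(2)[OF that, of 1] one y[OF that] M2c group.int_pow_1[OF gM2, of "y i"] by (auto simp: s_def)
    show "s ([(0, 1, 0)], []) = t" "s ([], [(1, 1, 0)]) = v"
      using h1(3) h2(3) one cl by (simp_all add: s_def)
  qed
qed

section \<open>The presentations\<close>

text \<open>
  The generators \<open>0, \<dots>, 7\<close> are \<open>a\<^sub>1, t\<^sub>1, b\<^sub>1, c\<^sub>1, a\<^sub>2, t\<^sub>2, b\<^sub>2, c\<^sub>2\<close>, and the generator \<open>i\<close> of the given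
  presentation becomes \<open>dgen i\<close>.
\<close>

definition code :: "bool \<times> bool \<Rightarrow> nat" where
  "code \<beta> = (if fst \<beta> then 1 else 0) + (if snd \<beta> then 2 else 0)"

text \<open>From 8 on the numbers come in blocks of five: d_i followed by its four letters
  u.\<close>

definition dgen :: "nat \<Rightarrow> nat" where "dgen i = 8 + 5 * i"

definition ugen :: "nat \<Rightarrow> bool \<times> bool \<Rightarrow> nat" where "ugen i \<beta> = 9 + 5 * i + code \<beta>"

definition pw :: "nat list \<Rightarrow> nat word" where "pw xs = map (\<lambda>x. (x, True)) xs"

definition ren :: "nat word \<Rightarrow> nat word" where "ren w = map (\<lambda>(x, b). (dgen x, b)) w"

text \<open>Prescribes values on the three kinds of generators by decoding the numbering;
  \<open>(n - 9) mod 5\<close> is the \<open>code\<close> of the bits.\<close>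

definition assign :: "(nat \<Rightarrow> 'k) \<Rightarrow> (nat \<Rightarrow> 'k) \<Rightarrow> (nat \<Rightarrow> bool \<times> bool \<Rightarrow> 'k) \<Rightarrow> nat \<Rightarrow> 'k" where
  "assign a d u n = (if n < 8 then a n else if (n - 8) mod 5 = 0 then d ((n - 8) div 5)
     else u ((n - 8) div 5) ((n - 9) mod 5 \<in> {1, 3}, (n - 9) mod 5 \<in> {2, 3}))"

lemma assign_simps:
  "n < 8 \<Longrightarrow> assign a d u n = a n" "assign a d u (dgen i) = d i" "assign a d u (ugen i \<beta>) = u i \<beta>"
proof -
  have c: "code \<beta> < 4" by (simp add: code_def)
  have "ugen i \<beta> - 8 = Suc (code \<beta>) + 5 * i" "ugen i \<beta> - 9 = code \<beta> + 5 * i" "\<not> ugen i \<beta> < 8"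
    by (simp_all add: ugen_def)
  moreover have "(Suc (code \<beta>) + 5 * i) mod 5 = Suc (code \<beta>)" "(Suc (code \<beta>) + 5 * i) div 5 = i"
    "(code \<beta> + 5 * i) mod 5 = code \<beta>"
    using c by (simp_all only: mod_mult_self2 div_mult_self2) simp_all
  moreover have "(code \<beta> \<in> {1, 3}, code \<beta> \<in> {2, 3}) = \<beta>"
    by (cases \<beta>) (auto simp: code_def)
  ultimately show "assign a d u (ugen i \<beta>) = u i \<beta>"
    by (simp add: assign_def)
qed (simp_all add: assign_def dgen_def)

locale step = presentation S R for S :: "nat set" and R +
  fixes f :: "nat word"
  assumes finS: "finite S" and finR: "finite R" and f: "f \<in> carrier (free_group S)"
begin

definition S' :: "nat set" where
  "S' = {..<8} \<union> dgen ` S \<union> (\<lambda>(i, \<beta>). ugen i \<beta>) ` (S \<times> UNIV)"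

text \<open>Positive words are reduced as they stand, whereas \<open>ren f\<close> may cancel
  against a generator; hence the products of the free group in the last family. That family makes
  the image of \<open>f\<close> central in the new group.\<close>

definition rels :: "(nat word \<times> nat word) set" where
  "rels = {(pw [1, 0], pw [0, 0, 1]), (pw [5, 6], pw [6, 6, 5])}
    \<union> {(pw [x, y], pw [y, x]) | x y. x \<in> {0, 1, 2, 3} \<and> y \<in> {4, 5, 6, 7}}
    \<union> {(ren w, []) | w. w \<in> R}
    \<union> {(pw [x, x + 4, dgen i], pw [dgen i, x, x + 4]) | x i. x \<in> {0, 2, 3} \<and> i \<in> S}
    \<union> {(pw [0, 4, ugen i (a, b)], pw [ugen i (\<not> a, b), 0, 4]) | i a b. i \<in> S}
    \<union> {(pw [2, 6, ugen i (a, b)], pw [ugen i (a, \<not> b), 2, 6]) | i a b. i \<in> S}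
    \<union> {(pw [3, 7, ugen i \<beta>], pw [ugen i \<beta>, 3, 7]) | i \<beta>. i \<in> S \<and> \<beta> \<noteq> (False, False)}
    \<union> {(pw [3, 7, ugen i (False, False)], pw [ugen i (False, False), dgen i, 3, 7]) | i. i \<in> S}
    \<union> {(ren f \<otimes>\<^bsub>free_group S'\<^esub> gen x, gen x \<otimes>\<^bsub>free_group S'\<^esub> ren f) | x. x \<in> S'}"

definition R' :: "nat word set" where
  "R' = (\<lambda>(l, r). l \<otimes>\<^bsub>free_group S'\<^esub> inv\<^bsub>free_group S'\<^esub> r) ` rels"

end

text \<open>Models, that is homomorphisms from the new group, described by equations between
  products. In this form they can be verified in wreath products and exploited in finite quotients;
  \<open>step_model_iff\<close> returns to relators.\<close>

locale step_model = step S R f + K: group K for S R f and K :: "('k, 'm) monoid_scheme" (structure) +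
  fixes \<phi> :: "nat \<Rightarrow> 'k"
  assumes \<phi>: "\<phi> \<in> S' \<rightarrow> carrier K"
    and rel_bs1: "\<phi> 1 \<otimes> \<phi> 0 = \<phi> 0 \<otimes> \<phi> 0 \<otimes> \<phi> 1"
    and rel_bs2: "\<phi> 5 \<otimes> \<phi> 6 = \<phi> 6 \<otimes> \<phi> 6 \<otimes> \<phi> 5"
    and rel_com: "\<And>x y. x \<in> {0, 1, 2, 3} \<Longrightarrow> y \<in> {4, 5, 6, 7} \<Longrightarrow> \<phi> x \<otimes> \<phi> y = \<phi> y \<otimes> \<phi> x"
    and rel_R: "\<And>w. w \<in> R \<Longrightarrow> word_eval K (\<lambda>i. \<phi> (dgen i)) w = \<one>"
    and rel_d: "\<And>x i. x \<in> {0, 2, 3} \<Longrightarrow> i \<in> S \<Longrightarrow>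
        \<phi> x \<otimes> \<phi> (x + 4) \<otimes> \<phi> (dgen i) = \<phi> (dgen i) \<otimes> (\<phi> x \<otimes> \<phi> (x + 4))"
    and rel_u0: "\<And>i a b. i \<in> S \<Longrightarrow>
        \<phi> 0 \<otimes> \<phi> 4 \<otimes> \<phi> (ugen i (a, b)) = \<phi> (ugen i (\<not> a, b)) \<otimes> (\<phi> 0 \<otimes> \<phi> 4)"
    and rel_u1: "\<And>i a b. i \<in> S \<Longrightarrow>
        \<phi> 2 \<otimes> \<phi> 6 \<otimes> \<phi> (ugen i (a, b)) = \<phi> (ugen i (a, \<not> b)) \<otimes> (\<phi> 2 \<otimes> \<phi> 6)"
    and rel_u2: "\<And>i \<beta>. i \<in> S \<Longrightarrow> \<beta> \<noteq> (False, False) \<Longrightarrow>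
        \<phi> 3 \<otimes> \<phi> 7 \<otimes> \<phi> (ugen i \<beta>) = \<phi> (ugen i \<beta>) \<otimes> (\<phi> 3 \<otimes> \<phi> 7)"
    and rel_u3: "\<And>i. i \<in> S \<Longrightarrow>
        \<phi> 3 \<otimes> \<phi> 7 \<otimes> \<phi> (ugen i (False, False)) =
        \<phi> (ugen i (False, False)) \<otimes> \<phi> (dgen i) \<otimes> (\<phi> 3 \<otimes> \<phi> 7)"
    and rel_f: "\<And>x. x \<in> S' \<Longrightarrow>
        word_eval K (\<lambda>i. \<phi> (dgen i)) f \<otimes> \<phi> x = \<phi> x \<otimes> word_eval K (\<lambda>i. \<phi> (dgen i)) f"

section \<open>From relators to equations\<close>

context step
begin

lemma finite_S': "finite S'"
  using finS by (simp add: S'_def)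

lemma finite_rels: "finite rels"
proof -
  have 1: "finite {(pw [x, y], pw [y, x]) | x y. x \<in> {0, 1, 2, 3} \<and> y \<in> {4, 5, 6, 7}}"
    by (rule finite_subset[of _ "(\<lambda>(x, y). (pw [x, y], pw [y, x])) ` ({0, 1, 2, 3} \<times> {4, 5, 6, 7})"]) auto
  have 2: "finite {(ren w, []::nat word) | w. w \<in> R}"
    by (rule finite_subset[of _ "(\<lambda>w. (ren w, [])) ` R"]) (use finR in auto)
  have 3: "finite {(pw [x, x + 4, dgen i], pw [dgen i, x, x + 4]) | x i. x \<in> {0, 2, 3} \<and> i \<in> S}"
    by (rule finite_subset[of _ "(\<lambda>(x, i). (pw [x, x + 4, dgen i], pw [dgen i, x, x + 4])) ` ({0, 2, 3} \<times> S)"])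
      (use finS in auto)
  have 4: "finite {(g i \<beta>) | i \<beta>. i \<in> S \<and> P \<beta>}" for g :: "nat \<Rightarrow> bool \<times> bool \<Rightarrow> nat word \<times> nat word" and P
  proof (rule finite_subset)
    show "{(g i \<beta>) | i \<beta>. i \<in> S \<and> P \<beta>} \<subseteq> (\<Union>i\<in>S. range (g i))" by blast
  qed (use finS in simp)
  have 5: "finite {(g i (a, b)) | i a b. i \<in> S}" for g :: "nat \<Rightarrow> bool \<times> bool \<Rightarrow> nat word \<times> nat word"
  proof (rule finite_subset)
    show "{(g i (a, b)) | i a b. i \<in> S} \<subseteq> (\<Union>i\<in>S. range (g i))" by blast
  qed (use finS in simp)
  have 6: "finite {(g i) | i. i \<in> A}" if "finite A" for g :: "nat \<Rightarrow> nat word \<times> nat word" and A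
    using that by simp
  show ?thesis
    unfolding rels_def
    using 1 2 3 4[of "\<lambda>i \<beta>. (pw [3, 7, ugen i \<beta>], pw [ugen i \<beta>, 3, 7])" "\<lambda>\<beta>. \<beta> \<noteq> (False, False)"]
      5[of "\<lambda>i \<beta>. (pw [0, 4, ugen i \<beta>], pw [ugen i (\<not> fst \<beta>, snd \<beta>), 0, 4])"]
      5[of "\<lambda>i \<beta>. (pw [2, 6, ugen i \<beta>], pw [ugen i (fst \<beta>, \<not> snd \<beta>), 2, 6])"]
      6[OF finS, of "\<lambda>i. (pw [3, 7, ugen i (False, False)], pw [ugen i (False, False), dgen i, 3, 7])"]
      6[OF finite_S', of "\<lambda>x. (ren f \<otimes>\<^bsub>free_group S'\<^esub> gen x, gen x \<otimes>\<^bsub>free_group S'\<^esub> ren f)"]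
    by (intro finite_UnI) (simp_all del: Collect_case_prod)
qed

lemma finite_R': "finite R'"
  using finite_rels by (simp add: R'_def)

lemma pw_closed: "set xs \<subseteq> S' \<Longrightarrow> pw xs \<in> carrier (free_group S')"
  by (auto simp: carrier_free_group pw_def reduced_def inv_letter_def)

lemma ren_closed: "w \<in> carrier (free_group S) \<Longrightarrow> ren w \<in> carrier (free_group S')"
proof -
  assume w: "w \<in> carrier (free_group S)"
  have "ren w ! Suc i \<noteq> inv_letter (ren w ! i)" if "Suc i < length (ren w)" for i
  proof -
    have "w ! Suc i \<noteq> inv_letter (w ! i)"
      using w that by (auto simp: carrier_free_group reduced_def ren_def)
    then show ?thesis
      using that by (cases "w ! i"; cases "w ! Suc i") (auto simp: ren_def inv_letter_def dgen_def)
  qed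
  then have "reduced (ren w)" by (simp add: reduced_def)
  moreover have "fst ` set (ren w) \<subseteq> S'"
    using w by (force simp: carrier_free_group ren_def S'_def)
  ultimately show ?thesis by (simp add: carrier_free_group)
qed

lemma word_eval_ren: "word_eval K \<phi> (ren w) = word_eval K (\<lambda>i. \<phi> (dgen i)) w"
  by (induction w) (auto simp: ren_def word_eval_Cons)

lemma S'_mem: "n < 8 \<Longrightarrow> n \<in> S'" "i \<in> S \<Longrightarrow> dgen i \<in> S'" "i \<in> S \<Longrightarrow> ugen i \<beta> \<in> S'"
  by (auto simp: S'_def)

lemma rels_closed:
  assumes "(l, r) \<in> rels"
  shows "l \<in> carrier (free_group S')" "r \<in> carrier (free_group S')"
proof -
  interpret F: group "free_group S'" by (rule group_free_group)
  have nil: "[] \<in> carrier (free_group S')" using F.one_closed by (simp add: one_free_group)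
  have f': "ren f \<in> carrier (free_group S')" using ren_closed[OF f] .
  have w: "ren w \<in> carrier (free_group S')" if "w \<in> R" for w using ren_closed R that by blast
  have p2: "pw [x, y] \<in> carrier (free_group S')" if "x \<in> S'" "y \<in> S'" for x y
    using that by (auto intro!: pw_closed)
  have p3: "pw [x, y, z] \<in> carrier (free_group S')" if "x \<in> S'" "y \<in> S'" "z \<in> S'" for x y z
    using that by (auto intro!: pw_closed)
  have p4: "pw [x, y, z, v] \<in> carrier (free_group S')" if "x \<in> S'" "y \<in> S'" "z \<in> S'" "v \<in> S'" for x y z v
    using that by (auto intro!: pw_closed)
  have x: "x \<in> S'" if "x \<in> {0, 1, 2, 3} \<or> x \<in> {4, 5, 6, 7}" for x
    using that by (intro S'_mem(1)) auto
  have y: "x \<in> S'" "x + 4 \<in> S'" if "x \<in> {0, 2, 3}" for x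
    using that by (auto intro!: S'_mem(1))
  have "l \<in> carrier (free_group S') \<and> r \<in> carrier (free_group S')"
    using assms unfolding rels_def
  proof (elim UnE, goal_cases)
    case 1
    then show ?case using S'_mem(1) by (auto intro!: p2 p3)
  next
    case 2
    then obtain x0 y0 where "l = pw [x0, y0]" "r = pw [y0, x0]" "x0 \<in> {0, 1, 2, 3}" "y0 \<in> {4, 5, 6, 7}"
      by blast
    then show ?case by (simp only:) (intro conjI p2 x; simp)
  next
    case 3
    then show ?case using w nil by blast
  next
    case 4
    then obtain x0 i where "l = pw [x0, x0 + 4, dgen i]" "r = pw [dgen i, x0, x0 + 4]" "x0 \<in> {0, 2, 3}" "i \<in> S"
      by blast
    then show ?case by (simp only:) (intro conjI p3 y S'_mem; simp)
  next
    case 5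
    then show ?case by clarify (intro conjI p3 S'_mem; simp)
  next
    case 6
    then show ?case by clarify (intro conjI p3 S'_mem; simp)
  next
    case 7
    then obtain i \<beta> where "l = pw [3, 7, ugen i \<beta>]" "r = pw [ugen i \<beta>, 3, 7]" "i \<in> S" by blast
    then show ?case by (simp only:) (intro conjI p3 S'_mem; simp)
  next
    case 8
    then show ?case by clarify (intro conjI p3 p4 S'_mem; simp)
  next
    case 9
    then obtain x0 where "l = ren f \<otimes>\<^bsub>free_group S'\<^esub> gen x0" "r = gen x0 \<otimes>\<^bsub>free_group S'\<^esub> ren f" "x0 \<in> S'"
      by blast
    then show ?case using F.m_closed f' gen_closed[of x0 S'] by simp
  qed
  then show "l \<in> carrier (free_group S')" "r \<in> carrier (free_group S')" by auto
qed

lemma R'_closed: "R' \<subseteq> carrier (free_group S')"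
proof -
  interpret F: group "free_group S'" by (rule group_free_group)
  show ?thesis using rels_closed by (auto simp: R'_def)
qed

lemma relator_iff:
  assumes "group K" "\<phi> \<in> S' \<rightarrow> carrier K"
  shows "(\<forall>r\<in>R'. word_eval K \<phi> r = \<one>\<^bsub>K\<^esub>) \<longleftrightarrow> (\<forall>(l, r)\<in>rels. word_eval K \<phi> l = word_eval K \<phi> r)"
proof -
  interpret K: group K by fact
  interpret e: group_hom "free_group S'" K "word_eval K \<phi>" by (rule word_eval_hom) fact+
  have "word_eval K \<phi> (l \<otimes>\<^bsub>free_group S'\<^esub> inv\<^bsub>free_group S'\<^esub> r) = \<one>\<^bsub>K\<^esub> \<longleftrightarrow>
      word_eval K \<phi> l = word_eval K \<phi> r" if "(l, r) \<in> rels" for l r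
  proof -
    note c = rels_closed[OF that]
    have "word_eval K \<phi> (l \<otimes>\<^bsub>free_group S'\<^esub> inv\<^bsub>free_group S'\<^esub> r) =
        word_eval K \<phi> l \<otimes>\<^bsub>K\<^esub> inv\<^bsub>K\<^esub> word_eval K \<phi> r"
      using c by simp
    moreover have "x \<otimes>\<^bsub>K\<^esub> inv\<^bsub>K\<^esub> y = \<one>\<^bsub>K\<^esub> \<longleftrightarrow> x = y" if "x \<in> carrier K" "y \<in> carrier K" for x y
      using that K.inv_equality[of x "inv\<^bsub>K\<^esub> y"] by auto
    ultimately show ?thesis using c by simp
  qed
  then show ?thesis by (fastforce simp: R'_def)
qed

lemma eval_pw:
  assumes "group K" "\<phi> \<in> S' \<rightarrow> carrier K"
  shows "x \<in> S' \<Longrightarrow> y \<in> S' \<Longrightarrow> word_eval K \<phi> (pw [x, y]) = \<phi> x \<otimes>\<^bsub>K\<^esub> \<phi> y"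
    "x \<in> S' \<Longrightarrow> y \<in> S' \<Longrightarrow> z \<in> S' \<Longrightarrow> word_eval K \<phi> (pw [x, y, z]) = \<phi> x \<otimes>\<^bsub>K\<^esub> (\<phi> y \<otimes>\<^bsub>K\<^esub> \<phi> z)"
    "x \<in> S' \<Longrightarrow> y \<in> S' \<Longrightarrow> z \<in> S' \<Longrightarrow> v \<in> S' \<Longrightarrow>
      word_eval K \<phi> (pw [x, y, z, v]) = \<phi> x \<otimes>\<^bsub>K\<^esub> (\<phi> y \<otimes>\<^bsub>K\<^esub> (\<phi> z \<otimes>\<^bsub>K\<^esub> \<phi> v))"
proof -
  interpret K: group K by fact
  have "\<phi> x \<in> carrier K" if "x \<in> S'" for x using that assms(2) by auto
  then show "x \<in> S' \<Longrightarrow> y \<in> S' \<Longrightarrow> word_eval K \<phi> (pw [x, y]) = \<phi> x \<otimes>\<^bsub>K\<^esub> \<phi> y"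
    "x \<in> S' \<Longrightarrow> y \<in> S' \<Longrightarrow> z \<in> S' \<Longrightarrow> word_eval K \<phi> (pw [x, y, z]) = \<phi> x \<otimes>\<^bsub>K\<^esub> (\<phi> y \<otimes>\<^bsub>K\<^esub> \<phi> z)"
    "x \<in> S' \<Longrightarrow> y \<in> S' \<Longrightarrow> z \<in> S' \<Longrightarrow> v \<in> S' \<Longrightarrow>
      word_eval K \<phi> (pw [x, y, z, v]) = \<phi> x \<otimes>\<^bsub>K\<^esub> (\<phi> y \<otimes>\<^bsub>K\<^esub> (\<phi> z \<otimes>\<^bsub>K\<^esub> \<phi> v))"
    by (simp_all add: pw_def word_eval_Cons)
qed

lemma step_model_iff:
  assumes "group K" "\<phi> \<in> S' \<rightarrow> carrier K"
  shows "step_model S R f K \<phi> \<longleftrightarrow> (\<forall>r\<in>R'. word_eval K \<phi> r = \<one>\<^bsub>K\<^esub>)"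
proof -
  interpret K: group K by fact
  interpret e: group_hom "free_group S'" K "word_eval K \<phi>" by (rule word_eval_hom) fact+
  note ev = eval_pw[OF assms]
  have c: "\<phi> x \<in> carrier K" if "x \<in> S'" for x using that assms(2) by auto
  have m: "0 \<in> S'" "1 \<in> S'" "2 \<in> S'" "3 \<in> S'" "4 \<in> S'" "5 \<in> S'" "6 \<in> S'" "7 \<in> S'"
    by (simp_all add: S'_mem)
  have mx: "x \<in> S'" if "x \<in> {0, 1, 2, 3}" for x using that by (auto simp: S'_mem)
  have my: "x \<in> S'" if "x \<in> {4, 5, 6, 7}" for x using that by (auto simp: S'_mem)
  have mz: "x \<in> S'" "x + 4 \<in> S'" if "x \<in> {0, 2, 3}" for x using that by (auto simp: S'_mem)
  have fc: "ren f \<in> carrier (free_group S')" using ren_closed[OF f] .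
  have a: "x \<otimes>\<^bsub>K\<^esub> (y \<otimes>\<^bsub>K\<^esub> z) = x \<otimes>\<^bsub>K\<^esub> y \<otimes>\<^bsub>K\<^esub> z"
    if "x \<in> carrier K" "y \<in> carrier K" "z \<in> carrier K" for x y z
    using that by (simp add: K.m_assoc)
  have ef: "word_eval K \<phi> (ren f \<otimes>\<^bsub>free_group S'\<^esub> gen x) =
      word_eval K (\<lambda>i. \<phi> (dgen i)) f \<otimes>\<^bsub>K\<^esub> \<phi> x"
    "word_eval K \<phi> (gen x \<otimes>\<^bsub>free_group S'\<^esub> ren f) =
      \<phi> x \<otimes>\<^bsub>K\<^esub> word_eval K (\<lambda>i. \<phi> (dgen i)) f" if "x \<in> S'" for x
    using e.hom_mult[OF fc gen_closed[OF that]] e.hom_mult[OF gen_closed[OF that] fc]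
      word_eval_gen[of K \<phi> x, OF assms(1) c[OF that]] by (simp_all add: word_eval_ren)
  have iff: "step_model S R f K \<phi> \<longleftrightarrow> (\<forall>(l, r)\<in>rels. word_eval K \<phi> l = word_eval K \<phi> r)"
  proof
    assume "step_model S R f K \<phi>"
    then interpret step_model S R f K \<phi> .
    have "word_eval K \<phi> l = word_eval K \<phi> r" if "(l, r) \<in> rels" for l r
      using that unfolding rels_def
    proof (elim UnE, goal_cases)
      case 1
      then consider "l = pw [1, 0] \<and> r = pw [0, 0, 1]" | "l = pw [5, 6] \<and> r = pw [6, 6, 5]" by blast
      then show ?case
        using rel_bs1 rel_bs2 by cases (simp_all add: ev m c K.m_assoc del: One_nat_def)
    next
      case 2
      then obtain x y where "l = pw [x, y]" "r = pw [y, x]" "x \<in> {0, 1, 2, 3}" "y \<in> {4, 5, 6, 7}" by blast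
      then show ?case using rel_com[of x y] by (simp add: ev mx my)
    next
      case 3
      then obtain w where "l = ren w" "r = []" "w \<in> R" by blast
      then show ?case using rel_R[of w] by (simp add: word_eval_ren)
    next
      case 4
      then obtain x i where "l = pw [x, x + 4, dgen i]" "r = pw [dgen i, x, x + 4]" and h: "x \<in> {0, 2, 3}" "i \<in> S"
        by blast
      then show ?case using rel_d[OF h] mz[OF h(1)] by (simp add: ev S'_mem c K.m_assoc)
    next
      case 5
      then obtain i a b where "l = pw [0, 4, ugen i (a, b)]" "r = pw [ugen i (\<not> a, b), 0, 4]" and h: "i \<in> S"
        by blast
      then show ?case using rel_u0[OF h] by (simp add: ev m S'_mem c K.m_assoc)
    next
      case 6
      then obtain i a b where "l = pw [2, 6, ugen i (a, b)]" "r = pw [ugen i (a, \<not> b), 2, 6]" and h: "i \<in> S"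
        by blast
      then show ?case using rel_u1[OF h] by (simp add: ev m S'_mem c K.m_assoc)
    next
      case 7
      then obtain i \<beta> where "l = pw [3, 7, ugen i \<beta>]" "r = pw [ugen i \<beta>, 3, 7]" and h: "i \<in> S" "\<beta> \<noteq> (False, False)"
        by blast
      then show ?case using rel_u2[OF h] by (simp add: ev m S'_mem c K.m_assoc)
    next
      case 8
      then obtain i where "l = pw [3, 7, ugen i (False, False)]" "r = pw [ugen i (False, False), dgen i, 3, 7]"
        and h: "i \<in> S"
        by blast
      then show ?case using rel_u3[OF h] by (simp add: ev m S'_mem c K.m_assoc)
    next
      case 9
      then obtain x where "l = ren f \<otimes>\<^bsub>free_group S'\<^esub> gen x" "r = gen x \<otimes>\<^bsub>free_group S'\<^esub> ren f"
        and h: "x \<in> S'"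
        by blast
      then show ?case using rel_f[OF h] ef[OF h] by simp
    qed
    then show "\<forall>(l, r)\<in>rels. word_eval K \<phi> l = word_eval K \<phi> r" by blast
  next
    assume "\<forall>(l, r)\<in>rels. word_eval K \<phi> l = word_eval K \<phi> r"
    then have E: "word_eval K \<phi> l = word_eval K \<phi> r" if "(l, r) \<in> rels" for l r using that by blast
    show "step_model S R f K \<phi>"
    proof unfold_locales
      show "\<phi> \<in> S' \<rightarrow> carrier K" by fact
      show "\<phi> 1 \<otimes>\<^bsub>K\<^esub> \<phi> 0 = \<phi> 0 \<otimes>\<^bsub>K\<^esub> \<phi> 0 \<otimes>\<^bsub>K\<^esub> \<phi> 1"
        using E[of "pw [1, 0]" "pw [0, 0, 1]"] by (simp add: rels_def ev m c K.m_assoc del: One_nat_def)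
      show "\<phi> 5 \<otimes>\<^bsub>K\<^esub> \<phi> 6 = \<phi> 6 \<otimes>\<^bsub>K\<^esub> \<phi> 6 \<otimes>\<^bsub>K\<^esub> \<phi> 5"
        using E[of "pw [5, 6]" "pw [6, 6, 5]"] by (simp add: rels_def ev m c K.m_assoc)
      show "\<phi> x \<otimes>\<^bsub>K\<^esub> \<phi> y = \<phi> y \<otimes>\<^bsub>K\<^esub> \<phi> x" if "x \<in> {0, 1, 2, 3}" "y \<in> {4, 5, 6, 7}" for x y
      proof -
        have "(pw [x, y], pw [y, x]) \<in> rels" unfolding rels_def using that by blast
        from E[OF this] show ?thesis using that by (simp add: ev mx my)
      qed
      show "word_eval K (\<lambda>i. \<phi> (dgen i)) w = \<one>\<^bsub>K\<^esub>" if "w \<in> R" for w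
      proof -
        have "(ren w, []) \<in> rels" unfolding rels_def using that by blast
        from E[OF this] show ?thesis by (simp add: word_eval_ren)
      qed
      show "\<phi> x \<otimes>\<^bsub>K\<^esub> \<phi> (x + 4) \<otimes>\<^bsub>K\<^esub> \<phi> (dgen i) = \<phi> (dgen i) \<otimes>\<^bsub>K\<^esub> (\<phi> x \<otimes>\<^bsub>K\<^esub> \<phi> (x + 4))"
        if "x \<in> {0, 2, 3}" "i \<in> S" for x i
      proof -
        have "(pw [x, x + 4, dgen i], pw [dgen i, x, x + 4]) \<in> rels" unfolding rels_def using that by blast
        from E[OF this] show ?thesis using that by (simp add: ev mz S'_mem c K.m_assoc)
      qed
      show "\<phi> 0 \<otimes>\<^bsub>K\<^esub> \<phi> 4 \<otimes>\<^bsub>K\<^esub> \<phi> (ugen i (a, b)) = \<phi> (ugen i (\<not> a, b)) \<otimes>\<^bsub>K\<^esub> (\<phi> 0 \<otimes>\<^bsub>K\<^esub> \<phi> 4)"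
        if "i \<in> S" for i a b
      proof -
        have "(pw [0, 4, ugen i (a, b)], pw [ugen i (\<not> a, b), 0, 4]) \<in> rels" unfolding rels_def using that by blast
        from E[OF this] show ?thesis using that by (simp add: ev m S'_mem c K.m_assoc)
      qed
      show "\<phi> 2 \<otimes>\<^bsub>K\<^esub> \<phi> 6 \<otimes>\<^bsub>K\<^esub> \<phi> (ugen i (a, b)) = \<phi> (ugen i (a, \<not> b)) \<otimes>\<^bsub>K\<^esub> (\<phi> 2 \<otimes>\<^bsub>K\<^esub> \<phi> 6)"
        if "i \<in> S" for i a b
      proof -
        have "(pw [2, 6, ugen i (a, b)], pw [ugen i (a, \<not> b), 2, 6]) \<in> rels" unfolding rels_def using that by blast
        from E[OF this] show ?thesis using that by (simp add: ev m S'_mem c K.m_assoc)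
      qed
      show "\<phi> 3 \<otimes>\<^bsub>K\<^esub> \<phi> 7 \<otimes>\<^bsub>K\<^esub> \<phi> (ugen i \<beta>) = \<phi> (ugen i \<beta>) \<otimes>\<^bsub>K\<^esub> (\<phi> 3 \<otimes>\<^bsub>K\<^esub> \<phi> 7)"
        if "i \<in> S" "\<beta> \<noteq> (False, False)" for i \<beta>
      proof -
        have "(pw [3, 7, ugen i \<beta>], pw [ugen i \<beta>, 3, 7]) \<in> rels" unfolding rels_def using that by blast
        from E[OF this] show ?thesis using that by (simp add: ev m S'_mem c K.m_assoc)
      qed
      show "\<phi> 3 \<otimes>\<^bsub>K\<^esub> \<phi> 7 \<otimes>\<^bsub>K\<^esub> \<phi> (ugen i (False, False)) =
          \<phi> (ugen i (False, False)) \<otimes>\<^bsub>K\<^esub> \<phi> (dgen i) \<otimes>\<^bsub>K\<^esub> (\<phi> 3 \<otimes>\<^bsub>K\<^esub> \<phi> 7)" if "i \<in> S" for i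
      proof -
        have "(pw [3, 7, ugen i (False, False)], pw [ugen i (False, False), dgen i, 3, 7]) \<in> rels"
          unfolding rels_def using that by blast
        from E[OF this] show ?thesis using that by (simp add: ev m S'_mem c K.m_assoc)
      qed
      show "word_eval K (\<lambda>i. \<phi> (dgen i)) f \<otimes>\<^bsub>K\<^esub> \<phi> x = \<phi> x \<otimes>\<^bsub>K\<^esub> word_eval K (\<lambda>i. \<phi> (dgen i)) f"
        if "x \<in> S'" for x
      proof -
        have "(ren f \<otimes>\<^bsub>free_group S'\<^esub> gen x, gen x \<otimes>\<^bsub>free_group S'\<^esub> ren f) \<in> rels"
          unfolding rels_def using that by blast
        from E[OF this] show ?thesis by (simp only: ef[OF that])
      qed
    qed
  qed
  show ?thesis using iff relator_iff[OF assms] by blast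
qed

end

section \<open>Finite quotients\<close>

context group
begin

definition cj where "cj x g = x \<otimes> g \<otimes> inv x"

lemma cj_closed [simp]: "x \<in> carrier G \<Longrightarrow> g \<in> carrier G \<Longrightarrow> cj x g \<in> carrier G"
  by (simp add: cj_def)

lemma cj_mult: "x \<in> carrier G \<Longrightarrow> y \<in> carrier G \<Longrightarrow> g \<in> carrier G \<Longrightarrow> cj (x \<otimes> y) g = cj x (cj y g)"
  by (simp add: cj_def inv_mult_group m_assoc)

lemma cj_hom: "x \<in> carrier G \<Longrightarrow> group_hom G G (cj x)"
  by unfold_locales (auto intro!: homI simp: cj_def m_assoc inv_solve_left)

lemma cj_eq_iff:
  "x \<in> carrier G \<Longrightarrow> g \<in> carrier G \<Longrightarrow> h \<in> carrier G \<Longrightarrow> cj x g = h \<longleftrightarrow> x \<otimes> g = h \<otimes> x"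
  by (metis cj_def inv_solve_right' m_closed)

lemma cj_inv: "x \<in> carrier G \<Longrightarrow> g \<in> carrier G \<Longrightarrow> cj x g = h \<Longrightarrow> cj (inv x) h = g"
  by (auto simp: cj_def m_assoc inv_solve_left')

lemma cj_odd_pow:
  assumes "x \<in> carrier G" "g \<in> carrier G" "h \<in> carrier G" "cj x g = h" "cj x h = g" "odd m"
  shows "cj (x [^] (m::nat)) g = h"
proof -
  have e: "cj (x [^] (2 * k)) g = g" for k :: nat
  proof (induction k)
    case (Suc k)
    have "x [^] (2 * Suc k) = x [^] (2 * k) \<otimes> (x \<otimes> x)"
      using assms(1) by (simp add: m_assoc)
    then show ?case using Suc assms(1-5) by (simp add: cj_mult)
  qed (use assms(2) in \<open>simp add: cj_def\<close>)
  obtain k where "m = 2 * k + 1" using assms(6) by (elim oddE)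
  then have "x [^] m = x \<otimes> x [^] (2 * k)" using assms(1) nat_pow_Suc2 by simp
  then show ?thesis using assms(1-4) e[of k] by (simp add: cj_mult)
qed

text \<open>With k the order of the group, t^k = 1, and conjugating e by t^k gives e = e^(2^k). So e
  is killed by 2^k - 1, which is odd.\<close>

lemma odd_torsion:
  assumes "finite (carrier G)" "t \<in> carrier G" "e \<in> carrier G" "t \<otimes> e = e \<otimes> e \<otimes> t"
  obtains m :: nat where "odd m" "e [^] m = \<one>"
proof -
  interpret bs_pair G e t by unfold_locales (use assms in auto)
  have *: "t [^] k \<otimes> e = e [^] (2 ^ k :: int) \<otimes> t [^] k" for k :: nat
  proof (induction k)
    case (Suc k)
    have "t [^] Suc k \<otimes> e = t \<otimes> (t [^] k \<otimes> e)"
      using assms nat_pow_Suc2[of t k] by (simp add: m_assoc)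
    also have "\<dots> = (t \<otimes> e [^] (2 ^ k :: int)) \<otimes> t [^] k"
      using assms by (simp add: Suc m_assoc)
    also have "\<dots> = e [^] (2 ^ Suc k :: int) \<otimes> t [^] Suc k"
      using assms conj_pow[of "2 ^ k"] nat_pow_Suc2[of t k] by (simp add: m_assoc)
    finally show ?case .
  qed (use assms in simp)
  define k where "k = order G"
  have "t [^] k = \<one>" "0 < k"
    using assms pow_order_eq_1[of t] order_gt_0_iff_finite by (auto simp: k_def)
  then have "e = e [^] (2 ^ k :: int)" using *[of k] assms by simp
  also have "\<dots> = e [^] (2 ^ k :: nat)"
    using int_pow_int[of G e "2 ^ k"] by simp
  finally have e: "e = e [^] (2 ^ k :: nat)" .
  obtain j where j: "2 ^ k = Suc j" using not0_implies_Suc[of "2 ^ k"] by auto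
  have "e [^] j \<otimes> e = e" using e assms unfolding j by simp
  then have "e [^] j = \<one>" using assms r_cancel_one by simp
  moreover have "odd j" using j \<open>0 < k\<close> by (metis even_Suc even_power even_two_times_div_two dvd_refl)
  ultimately show ?thesis using that by blast
qed

end

context step_model
begin

lemma \<phi>_closed [simp]: "n < 8 \<Longrightarrow> \<phi> n \<in> carrier K" "i \<in> S \<Longrightarrow> \<phi> (dgen i) \<in> carrier K"
  "i \<in> S \<Longrightarrow> \<phi> (ugen i \<beta>) \<in> carrier K"
  using \<phi> S'_mem by (auto simp: Pi_iff)

lemma cj_rels:
  assumes "i \<in> S"
  shows "x \<in> {0, 2, 3} \<Longrightarrow> K.cj (\<phi> x \<otimes> \<phi> (x + 4)) (\<phi> (dgen i)) = \<phi> (dgen i)"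
    "K.cj (\<phi> 0 \<otimes> \<phi> 4) (\<phi> (ugen i (a, b))) = \<phi> (ugen i (\<not> a, b))"
    "K.cj (\<phi> 2 \<otimes> \<phi> 6) (\<phi> (ugen i (a, b))) = \<phi> (ugen i (a, \<not> b))"
    "\<beta> \<noteq> (False, False) \<Longrightarrow> K.cj (\<phi> 3 \<otimes> \<phi> 7) (\<phi> (ugen i \<beta>)) = \<phi> (ugen i \<beta>)"
    "K.cj (\<phi> 3 \<otimes> \<phi> 7) (\<phi> (ugen i (False, False))) = \<phi> (ugen i (False, False)) \<otimes> \<phi> (dgen i)"
proof -
  have c: "\<phi> x \<otimes> \<phi> (x + 4) \<in> carrier K" if "x \<in> {0, 2, 3}" for x
    using that by (intro K.m_closed \<phi>_closed(1)) auto
  show "x \<in> {0, 2, 3} \<Longrightarrow> K.cj (\<phi> x \<otimes> \<phi> (x + 4)) (\<phi> (dgen i)) = \<phi> (dgen i)"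
    using rel_d[of x i] assms c[of x] by (simp add: K.cj_eq_iff)
qed (use rel_u0 rel_u1 rel_u2 rel_u3 assms in \<open>simp_all add: K.cj_eq_iff\<close>)

lemma finite_trivial:
  assumes "finite (carrier K)" "i \<in> S"
  shows "\<phi> (dgen i) = \<one>"
proof -
  obtain m where m: "odd m" "\<phi> 0 [^] (m::nat) = \<one>"
    using K.odd_torsion[of "\<phi> 1" "\<phi> 0"] rel_bs1 assms(1) by auto
  obtain m' where m': "odd m'" "\<phi> 6 [^] (m'::nat) = \<one>"
    using K.odd_torsion[of "\<phi> 5" "\<phi> 6"] rel_bs2 assms(1) by auto
  define \<kappa> where "\<kappa> = (\<phi> 0 \<otimes> \<phi> 4) [^] m"
  define \<kappa>' where "\<kappa>' = (\<phi> 2 \<otimes> \<phi> 6) [^] m'"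
  define y where "y = \<phi> 3 \<otimes> \<phi> 7"
  define z where "z = y \<otimes> \<kappa> \<otimes> inv y \<otimes> inv \<kappa>"
  have \<kappa>: "\<kappa> = \<phi> 4 [^] m"
    using K.pow_mult_distrib[of "\<phi> 0" "\<phi> 4" m] rel_com[of 0 4] m by (simp add: \<kappa>_def)
  have \<kappa>': "\<kappa>' = \<phi> 2 [^] m'"
    using K.pow_mult_distrib[of "\<phi> 2" "\<phi> 6" m'] rel_com[of 2 6] m' by (simp add: \<kappa>'_def)
  have cl: "\<kappa> \<in> carrier K" "\<kappa>' \<in> carrier K" "y \<in> carrier K"
    by (simp_all add: \<kappa> \<kappa>' y_def)
  have "\<phi> 4 \<otimes> \<phi> 3 = \<phi> 3 \<otimes> \<phi> 4" using rel_com[of 3 4] by simp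
  then have "\<phi> 4 [^] m \<otimes> \<phi> 3 = \<phi> 3 \<otimes> \<phi> 4 [^] m" by (intro K.group_commutes_pow) simp_all
  \<comment> \<open>Once \<kappa> is a power of a_2, the part c_1 of y does not matter for
    conjugating it, and z becomes a commutator inside the image of the second factor.\<close>
  then have "K.cj (\<phi> 3) \<kappa> = \<kappa>" using cl by (simp add: K.cj_eq_iff \<kappa>)
  moreover have "y = \<phi> 7 \<otimes> \<phi> 3" using rel_com[of 3 7] by (simp add: y_def)
  ultimately have "K.cj y \<kappa> = K.cj (\<phi> 7) \<kappa>" using cl by (simp add: K.cj_mult)
  then have z7: "z = K.cj (\<phi> 7) \<kappa> \<otimes> inv \<kappa>" by (simp add: z_def K.cj_def)
  have zc: "z \<in> carrier K" using cl by (simp add: z_def)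
  interpret c: group_hom K K "K.cj (\<phi> 2)" by (rule K.cj_hom) simp
  have "\<phi> 4 [^] m \<otimes> \<phi> 2 = \<phi> 2 \<otimes> \<phi> 4 [^] m"
    using rel_com[of 2 4] by (intro K.group_commutes_pow) simp_all
  then have "K.cj (\<phi> 2) \<kappa> = \<kappa>" "K.cj (\<phi> 2) (\<phi> 7) = \<phi> 7"
    using cl rel_com[of 2 7] by (simp_all add: K.cj_eq_iff \<kappa>)
  then have "K.cj (\<phi> 2) z = z" using cl unfolding z7 by (simp add: K.cj_def[of "\<phi> 7"])
  then have "\<phi> 2 \<otimes> z = z \<otimes> \<phi> 2" using zc by (simp add: K.cj_eq_iff)
  then have com: "\<kappa>' \<otimes> z = z \<otimes> \<kappa>'" unfolding \<kappa>' using zc by (intro K.group_commutes_pow) simp_all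
  note R = cj_rels[OF assms(2)]
  let ?u = "\<lambda>\<beta>. \<phi> (ugen i \<beta>)"
  have k: "K.cj \<kappa> (?u (a, b)) = ?u (\<not> a, b)" for a b
    unfolding \<kappa>_def using m(1) assms(2) R(2)[of a b] R(2)[of "\<not> a" b] by (intro K.cj_odd_pow) simp_all
  have k': "K.cj \<kappa>' (?u (a, b)) = ?u (a, \<not> b)" for a b
    unfolding \<kappa>'_def using m'(1) assms(2) R(3)[of a b] R(3)[of a "\<not> b"] by (intro K.cj_odd_pow) simp_all
  have "(\<phi> 2 \<otimes> \<phi> 6) [^] m' \<otimes> \<phi> (dgen i) = \<phi> (dgen i) \<otimes> (\<phi> 2 \<otimes> \<phi> 6) [^] m'"
    using R(1)[of 2] assms(2) by (intro K.group_commutes_pow) (simp_all add: K.cj_eq_iff)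
  then have k'd: "K.cj \<kappa>' (\<phi> (dgen i)) = \<phi> (dgen i)"
    using cl assms(2) by (simp add: K.cj_eq_iff \<kappa>'_def)
  have ik: "K.cj (inv \<kappa>) (?u (a, b)) = ?u (\<not> a, b)" for a b
    using K.cj_inv[OF cl(1) _ k[of "\<not> a" b]] assms(2) by simp
  have yu: "K.cj y (?u \<beta>) = ?u \<beta>" if "\<beta> \<noteq> (False, False)" for \<beta> using R(4)[OF that] by (simp add: y_def)
  have iy: "K.cj (inv y) (?u \<beta>) = ?u \<beta>" if "\<beta> \<noteq> (False, False)" for \<beta>
    using K.cj_inv[OF cl(3) _ yu[OF that]] assms(2) by simp
  have zu: "K.cj z (?u \<beta>) = K.cj y (K.cj \<kappa> (K.cj (inv y) (K.cj (inv \<kappa>) (?u \<beta>))))" for \<beta>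
    using cl assms(2) by (simp add: z_def K.cj_mult)
  \<comment> \<open>The inverse of \<kappa> moves the letter to bits 10, where the inverse of y does
    nothing; after moving back, only the outer y contributes d_i. With bits 01 instead, neither
    occurrence of y meets bits 00.\<close>
  have "K.cj z (?u (False, False)) = ?u (False, False) \<otimes> \<phi> (dgen i)"
    using R(5)[folded y_def] by (simp add: zu ik iy k)
  then have "K.cj \<kappa>' (K.cj z (?u (False, False))) = ?u (False, True) \<otimes> \<phi> (dgen i)"
    using group_hom.hom_mult[OF K.cj_hom[OF cl(2)], of "?u (False, False)" "\<phi> (dgen i)"] assms(2) k' k'd by simp
  moreover have "K.cj z (K.cj \<kappa>' (?u (False, False))) = ?u (False, True)"
    by (simp add: zu ik iy k k' yu)
  ultimately have "?u (False, True) \<otimes> \<phi> (dgen i) = ?u (False, True)"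
    using K.cj_mult[of \<kappa>' z] K.cj_mult[of z \<kappa>'] com cl zc assms(2) by simp
  then show ?thesis using assms(2) by (simp add: K.r_cancel_one)
qed

end

section \<open>Models in wreath products\<close>

definition agen :: "nat \<Rightarrow> (nat \<times> int \<times> rat) list \<times> (nat \<times> int \<times> rat) list" where
  "agen n = [(lt 0 1, []), ([(0, 1, 0)], []), (lt 1 1, []), (lt 2 1, []),
     ([], lt 0 1), ([], [(1, 1, 0)]), ([], lt 1 1), ([], lt 2 1)] ! n"

lemma agen_simps: "agen 0 = (lt 0 1, [])" "agen 1 = ([(0, 1, 0)], [])" "agen 2 = (lt 1 1, [])"
  "agen 3 = (lt 2 1, [])" "agen 4 = ([], lt 0 1)" "agen 5 = ([], [(1, 1, 0)])"
  "agen 6 = ([], lt 1 1)" "agen 7 = ([], lt 2 1)"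
  by (simp_all add: agen_def)

lemma less_8_cases:
  "n < 8 \<Longrightarrow> n = 0 \<or> n = 1 \<or> n = 2 \<or> n = 3 \<or> n = 4 \<or> n = 5 \<or> n = 6 \<or> n = (7::nat)"
  by arith

lemma agen_closed: "n < 8 \<Longrightarrow> agen n \<in> carrier AG"
proof -
  have "[(0, 1, 0)] \<in> carrier (FP p1)" "[(1, 1, 0)] \<in> carrier (FP p2)"
    by (auto simp: carrier_FP fam_def p1_def p2_def BS_simps)
  moreover have "[] \<in> carrier (FP p)" for p by (simp add: carrier_FP)
  ultimately show "n < 8 \<Longrightarrow> agen n \<in> carrier AG"
    by (elim less_8_cases[elim_format] disjE) (simp_all add: agen_simps carrier_AG lt_closed del: One_nat_def)
qed

lemma FP_bs:
  assumes "i \<in> {0, 1, 2}" "p i"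
  shows "[(i, 1, 0)] \<otimes>\<^bsub>FP p\<^esub> lt i 1 = lt i 1 \<otimes>\<^bsub>FP p\<^esub> lt i 1 \<otimes>\<^bsub>FP p\<^esub> [(i, 1, 0)]"
proof -
  interpret fp_family "{0, 1, 2}" "fam p" by (rule fp_family_fam)
  interpret h: group_hom "fam p i" "FP p" "fp_in (fam p) i"
    unfolding FP_def using assms(1) by (rule fp_in_hom)
  have e: "lt i 1 = fp_in (fam p) i (0, 1)" "[(i, 1, 0)] = fp_in (fam p) i (1, 0)"
    using lt_eq[of i 1 p] by (simp_all add: fp_in_def fam_simps)
  have c: "(0, 1) \<in> carrier (fam p i)" "(1, 0) \<in> carrier (fam p i)"
    using assms(2) dyadic_of_int[of 1] by (simp_all add: fam_def BS_simps)
  have "(1, 0) \<otimes>\<^bsub>fam p i\<^esub> (0, 1) = (0, 1) \<otimes>\<^bsub>fam p i\<^esub> (0, 1) \<otimes>\<^bsub>fam p i\<^esub> (1, 0)"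
    by (simp add: fam_simps)
  then show ?thesis
    unfolding e using c by (simp only: h.hom_mult[symmetric] h.G.m_closed)
qed

lemma agen_rels:
  "agen 1 \<otimes>\<^bsub>AG\<^esub> agen 0 = agen 0 \<otimes>\<^bsub>AG\<^esub> agen 0 \<otimes>\<^bsub>AG\<^esub> agen 1"
  "agen 5 \<otimes>\<^bsub>AG\<^esub> agen 6 = agen 6 \<otimes>\<^bsub>AG\<^esub> agen 6 \<otimes>\<^bsub>AG\<^esub> agen 5"
  "x \<in> {0, 1, 2, 3} \<Longrightarrow> y \<in> {4, 5, 6, 7} \<Longrightarrow> agen x \<otimes>\<^bsub>AG\<^esub> agen y = agen y \<otimes>\<^bsub>AG\<^esub> agen x"
  "agen 0 \<otimes>\<^bsub>AG\<^esub> agen 4 = (lt 0 1, lt 0 1)" "agen 2 \<otimes>\<^bsub>AG\<^esub> agen 6 = (lt 1 1, lt 1 1)"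
  "agen 3 \<otimes>\<^bsub>AG\<^esub> agen 7 = (lt 2 1, lt 2 1)"
proof -
  interpret P1: group "FP p1" by (rule group_FP)
  interpret P2: group "FP p2" by (rule group_FP)
  have n: "w \<otimes>\<^bsub>FP p1\<^esub> [] = w" "[] \<otimes>\<^bsub>FP p1\<^esub> w = w" if "w \<in> carrier (FP p1)" for w
    using that P1.l_one P1.r_one by (simp_all add: one_FP)
  have n': "w \<otimes>\<^bsub>FP p2\<^esub> [] = w" "[] \<otimes>\<^bsub>FP p2\<^esub> w = w" if "w \<in> carrier (FP p2)" for w
    using that P2.l_one P2.r_one by (simp_all add: one_FP)
  have nn: "[] \<in> carrier (FP p)" for p by (simp add: carrier_FP)
  have bs: "[(0, 1, 0)] \<in> carrier (FP p1)" "[(1, 1, 0)] \<in> carrier (FP p2)"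
    by (auto simp: carrier_FP fam_def p1_def p2_def BS_simps)
  show "agen 1 \<otimes>\<^bsub>AG\<^esub> agen 0 = agen 0 \<otimes>\<^bsub>AG\<^esub> agen 0 \<otimes>\<^bsub>AG\<^esub> agen 1"
    using FP_bs[of 0 p1] by (simp add: agen_simps mult_AG n n' nn p1_def del: One_nat_def)
  show "agen 5 \<otimes>\<^bsub>AG\<^esub> agen 6 = agen 6 \<otimes>\<^bsub>AG\<^esub> agen 6 \<otimes>\<^bsub>AG\<^esub> agen 5"
    using FP_bs[of 1 p2] by (simp add: agen_simps mult_AG n n' nn p2_def del: One_nat_def)
  show "agen 0 \<otimes>\<^bsub>AG\<^esub> agen 4 = (lt 0 1, lt 0 1)" "agen 2 \<otimes>\<^bsub>AG\<^esub> agen 6 = (lt 1 1, lt 1 1)"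
    "agen 3 \<otimes>\<^bsub>AG\<^esub> agen 7 = (lt 2 1, lt 2 1)"
    by (simp_all add: agen_simps mult_AG n n' nn lt_closed)
  show "agen x \<otimes>\<^bsub>AG\<^esub> agen y = agen y \<otimes>\<^bsub>AG\<^esub> agen x" if "x \<in> {0, 1, 2, 3}" "y \<in> {4, 5, 6, 7}"
  proof -
    have "snd (agen x) = []" "fst (agen y) = []"
      using that by (auto simp: agen_simps simp del: One_nat_def)
    moreover have "agen x \<in> carrier AG" "agen y \<in> carrier AG" using that by (auto intro!: agen_closed)
    ultimately show ?thesis
      by (cases "agen x"; cases "agen y") (simp add: mult_AG carrier_AG n n')
  qed
qed

context step
begin

abbreviation "DD \<equiv> presented_group S R"

text \<open>The value at q is meant to be the conjugate of the generator by the inverse of q. Write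
  this inverse as x times the diagonal element of c, with x = \<open>rep (inv q)\<close>. The
  diagonal element acts on d_i and the letters through \<open>act c\<close>, and conjugation by x
  selects the copies belonging to the coset of x: \<open>\<delta> x\<close> of D and
  \<open>\<upsilon> x\<close> of the letters.\<close>

definition wgen where
  "wgen W \<delta> \<upsilon> = assign (\<lambda>n. (\<lambda>q\<in>carrier AG. \<one>\<^bsub>W\<^esub>, agen n))
     (\<lambda>i. (\<lambda>q\<in>carrier AG. \<delta> (rep (inv\<^bsub>AG\<^esub> q)) (cls S R (gen i)), \<one>\<^bsub>AG\<^esub>))
     (\<lambda>i \<beta>. (\<lambda>q\<in>carrier AG. let x = rep (inv\<^bsub>AG\<^esub> q); c = act (cpart (inv\<^bsub>AG\<^esub> q)) in
        \<upsilon> x i (snd c \<otimes>\<^bsub>bits\<^esub> \<beta>) \<otimes>\<^bsub>W\<^esub> \<delta> x (cls S R (gen i)) [^]\<^bsub>W\<^esub> fst c \<beta>, \<one>\<^bsub>AG\<^esub>))"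

text \<open>The values at the d_i come from one homomorphism on D, so the relators of D hold in the
  model and the value of f can be read off.\<close>

lemma wgen_base:
  fixes W (structure)
  assumes "group W" and \<delta>: "\<And>x. x \<in> carrier AG \<Longrightarrow> group_hom DD W (\<delta> x)"
  defines "\<eta> \<equiv> \<lambda>x. (\<lambda>q\<in>carrier AG. \<delta> (rep (inv\<^bsub>AG\<^esub> q)) x, \<one>\<^bsub>AG\<^esub>)"
  shows "group_hom DD (wr W AG) \<eta>"
    "\<And>w. w \<in> carrier (free_group S) \<Longrightarrow>
      \<eta> (cls S R w) = word_eval (wr W AG) (\<lambda>i. wgen W \<delta> \<upsilon> (dgen i)) w"
proof -
  interpret W: group W by fact
  interpret A: group AG by (rule group_AG)
  interpret X: group "wr W AG" using assms(1) group_AG by (rule group_wr)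
  have wd: "wgen W \<delta> \<upsilon> (dgen i) = \<eta> (cls S R (gen i))" for i by (simp add: wgen_def assign_simps \<eta>_def)
  have dh: "group_hom DD W (\<delta> (rep (inv\<^bsub>AG\<^esub> q)))" if "q \<in> carrier AG" for q
    using rep(1) that by (intro \<delta>) simp
  show *: "group_hom DD (wr W AG) \<eta>"
    unfolding group_hom_def group_hom_axioms_def \<eta>_def
  proof (intro conjI wr_homI[OF group_presented])
    show "(\<lambda>_. \<one>\<^bsub>AG\<^esub>) \<in> hom DD AG" by (auto intro!: homI)
    show "\<delta> (rep (inv\<^bsub>AG\<^esub> q)) g \<in> carrier W" if "g \<in> carrier DD" "q \<in> carrier AG" for g q
      using group_hom.hom_closed[OF dh] that by blast
    show "\<delta> (rep (inv\<^bsub>AG\<^esub> q)) (g \<otimes>\<^bsub>DD\<^esub> h) =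
        \<delta> (rep (inv\<^bsub>AG\<^esub> (\<one>\<^bsub>AG\<^esub> \<otimes>\<^bsub>AG\<^esub> q))) g \<otimes> \<delta> (rep (inv\<^bsub>AG\<^esub> q)) h"
      if "g \<in> carrier DD" "h \<in> carrier DD" "q \<in> carrier AG" for g h q
      using group_hom.hom_mult[OF dh] that by simp
  qed (use group_presented X.group_axioms in simp_all)
  show "\<eta> (cls S R w) = word_eval (wr W AG) (\<lambda>i. wgen W \<delta> \<upsilon> (dgen i)) w" if "w \<in> carrier (free_group S)" for w
    using word_eval_comp[OF * cls_gen_closed, of w] that cls_eq_word_eval[OF that]
    by (simp add: carrier_free_group wd)
qed

text \<open>The relations that involve diagonal elements are shift rules for the functions on
  \<open>AG\<close>, and they follow from the multiplication rule of \<open>act\<close>. The element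
  f becomes the constant function with value \<open>z\<close>, which commutes with all values in the
  base and is unaffected by shifts.\<close>

lemma wgen_model:
  fixes W (structure)
  assumes "group W" and \<delta>: "\<And>x. x \<in> carrier AG \<Longrightarrow> group_hom DD W (\<delta> x)"
    and \<upsilon>: "\<And>x i \<beta>. x \<in> carrier AG \<Longrightarrow> i \<in> S \<Longrightarrow> \<upsilon> x i \<beta> \<in> carrier W"
    and z: "z \<in> carrier W" "\<And>x. x \<in> carrier AG \<Longrightarrow> \<delta> x (cls S R f) = z"
    and zd: "\<And>x i. x \<in> carrier AG \<Longrightarrow> i \<in> S \<Longrightarrow> z \<otimes> \<delta> x (cls S R (gen i)) = \<delta> x (cls S R (gen i)) \<otimes> z"
    and zu: "\<And>x i \<beta>. x \<in> carrier AG \<Longrightarrow> i \<in> S \<Longrightarrow> z \<otimes> \<upsilon> x i \<beta> = \<upsilon> x i \<beta> \<otimes> z"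
  shows "step_model S R f (wr W AG) (wgen W \<delta> \<upsilon>)"
proof -
  interpret W: group W by fact
  interpret A: group AG by (rule group_AG)
  interpret X: group "wr W AG" using assms(1) group_AG by (rule group_wr)
  define D where "D i q = \<delta> (rep (inv\<^bsub>AG\<^esub> q)) (cls S R (gen i))" for i q
  define U where "U i \<beta> q = (let x = rep (inv\<^bsub>AG\<^esub> q); c = act (cpart (inv\<^bsub>AG\<^esub> q)) in
        \<upsilon> x i (snd c \<otimes>\<^bsub>bits\<^esub> \<beta>) \<otimes> \<delta> x (cls S R (gen i)) [^] fst c \<beta>)" for i \<beta> q
  let ?c = "\<lambda>h. (\<lambda>q\<in>carrier AG. \<one>, h)"
  let ?e = "\<lambda>F. (\<lambda>q\<in>carrier AG. F q, \<one>\<^bsub>AG\<^esub>)"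
  let ?\<phi> = "wgen W \<delta> \<upsilon>"
  have wg: "?\<phi> n = ?c (agen n)" if "n < 8" for n using that by (simp add: wgen_def assign_simps)
  have wd: "?\<phi> (dgen i) = ?e (D i)" for i by (simp add: wgen_def assign_simps D_def)
  have wu: "?\<phi> (ugen i \<beta>) = ?e (U i \<beta>)" for i \<beta> by (simp add: wgen_def assign_simps U_def)
  have Dc: "D i q \<in> carrier W" if "i \<in> S" "q \<in> carrier AG" for i q
  proof -
    have "rep (inv\<^bsub>AG\<^esub> q) \<in> carrier AG" using rep that by simp
    then interpret d: group_hom DD W "\<delta> (rep (inv\<^bsub>AG\<^esub> q))" by (rule \<delta>)
    show ?thesis using cls_gen_closed that unfolding D_def by (intro d.hom_closed) auto
  qed
  have Uc: "U i \<beta> q \<in> carrier W" if "i \<in> S" "q \<in> carrier AG" for i \<beta> q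
    using that \<upsilon> rep(1)[of "inv\<^bsub>AG\<^esub> q"] Dc[OF that] by (auto simp: U_def Let_def D_def)
  have cm: "?c g \<otimes>\<^bsub>wr W AG\<^esub> ?c h = ?c (g \<otimes>\<^bsub>AG\<^esub> h)" if "g \<in> carrier AG" "h \<in> carrier AG" for g h
    using that by (auto simp: mult_wr)
  have ce: "?c g \<otimes>\<^bsub>wr W AG\<^esub> ?e F = (\<lambda>q\<in>carrier AG. F q, g)" if "g \<in> carrier AG" "\<And>q. q \<in> carrier AG \<Longrightarrow> F q \<in> carrier W" for g F
    using that by (simp add: mult_wr cong: restrict_cong)
  have ec: "?e F \<otimes>\<^bsub>wr W AG\<^esub> ?c g = (\<lambda>q\<in>carrier AG. F (g \<otimes>\<^bsub>AG\<^esub> q), g)" if "g \<in> carrier AG" "\<And>q. q \<in> carrier AG \<Longrightarrow> F q \<in> carrier W" for g F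
    using that by (simp add: mult_wr cong: restrict_cong)
  have ee: "?e F \<otimes>\<^bsub>wr W AG\<^esub> ?e F' = ?e (\<lambda>q. F q \<otimes> F' q)" for F F'
    by (auto simp: mult_wr)
  \<comment> \<open>A left shift of q by a diagonal element is a right multiplication of its
    inverse, which changes \<open>cpart\<close> but not \<open>rep\<close>.\<close>
  have ic: "inv\<^bsub>AG\<^esub> q = inv\<^bsub>AG\<^esub> ((w, w) \<otimes>\<^bsub>AG\<^esub> q) \<otimes>\<^bsub>AG\<^esub> (w, w)"
    if "w \<in> carrier (FP pF)" "q \<in> carrier AG" for w q
  proof -
    have "(w, w) \<in> carrier AG" using that group_hom.hom_closed[OF CG_hom] by blast
    then show ?thesis using that by (simp add: A.inv_mult_group A.m_assoc)
  qed
  have Dw: "D i ((w, w) \<otimes>\<^bsub>AG\<^esub> q) = D i q" if "w \<in> carrier (FP pF)" "q \<in> carrier AG" for i w q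
  proof -
    have "(w, w) \<otimes>\<^bsub>AG\<^esub> q \<in> carrier AG" using that group_hom.hom_closed[OF CG_hom] by blast
    then show ?thesis
      using rep_mult(1)[OF _ that(1), of "inv\<^bsub>AG\<^esub> ((w, w) \<otimes>\<^bsub>AG\<^esub> q)"]
      unfolding D_def ic[OF that, symmetric] by simp
  qed
  have Uw: "U i \<beta> q = U i (snd (act w) \<otimes>\<^bsub>bits\<^esub> \<beta>) ((w, w) \<otimes>\<^bsub>AG\<^esub> q) \<otimes> D i q [^] fst (act w) \<beta>"
    if "i \<in> S" "w \<in> carrier (FP pF)" "q \<in> carrier AG" for i \<beta> w q
  proof -
    interpret b: group bits by (rule group_bits)
    define q' where "q' = inv\<^bsub>AG\<^esub> ((w, w) \<otimes>\<^bsub>AG\<^esub> q)"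
    have q': "q' \<in> carrier AG" using that group_hom.hom_closed[OF CG_hom] unfolding q'_def by blast
    have q: "inv\<^bsub>AG\<^esub> q = q' \<otimes>\<^bsub>AG\<^esub> (w, w)" unfolding q'_def by (rule ic[OF that(2,3)])
    note r = rep_mult[OF q' that(2)] rep(1,2)[OF q']
    have "D i q = \<delta> (rep q') (cls S R (gen i))" unfolding D_def q r(1) ..
    moreover then have "\<delta> (rep q') (cls S R (gen i)) \<in> carrier W" using Dc[OF that(1,3)] by simp
    ultimately show ?thesis
      using act_mult[OF r(4) that(2)] \<upsilon>[OF r(3) that(1)]
      unfolding U_def q r(1,2) Let_def q'_def[symmetric]
      by (simp add: W.m_assoc W.int_pow_mult b.m_assoc)
  qed
  have lw: "lt i 1 \<in> carrier (FP pF)" if "i \<in> {0, 1, 2}" for i using that by (rule lt_closed)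
  have lwa: "(lt i 1, lt i 1) \<in> carrier AG" if "i \<in> {0, 1, 2}" for i
    using lt_closed[OF that] by (simp add: carrier_AG)
  have sq: "?\<phi> x \<otimes>\<^bsub>wr W AG\<^esub> ?\<phi> (x + 4) = ?c (lt j 1, lt j 1)"
    if "(x, j) \<in> {(0, 0), (2, 1), (3, 2)}" for x j
  proof -
    have "agen x \<otimes>\<^bsub>AG\<^esub> agen (x + 4) = (lt j 1, lt j 1)" "x + 4 < 8"
      using that agen_rels(4-6) by auto
    then show ?thesis by (simp add: wg cm agen_closed)
  qed
  have cU: "?c (w, w) \<otimes>\<^bsub>wr W AG\<^esub> ?\<phi> (ugen i \<beta>) = ?\<phi> (ugen i (snd (act w) \<otimes>\<^bsub>bits\<^esub> \<beta>)) \<otimes>\<^bsub>wr W AG\<^esub> ?c (w, w)"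
    if "i \<in> S" "w \<in> carrier (FP pF)" "fst (act w) \<beta> = 0" for i \<beta> w
  proof -
    have w: "(w, w) \<in> carrier AG" using that group_hom.hom_closed[OF CG_hom] by blast
    have "(\<lambda>q\<in>carrier AG. U i \<beta> q) = (\<lambda>q\<in>carrier AG. U i (snd (act w) \<otimes>\<^bsub>bits\<^esub> \<beta>) ((w, w) \<otimes>\<^bsub>AG\<^esub> q))"
    proof (rule restrict_ext)
      fix q assume q: "q \<in> carrier AG"
      show "U i \<beta> q = U i (snd (act w) \<otimes>\<^bsub>bits\<^esub> \<beta>) ((w, w) \<otimes>\<^bsub>AG\<^esub> q)"
        using Uw[OF that(1,2) q, of \<beta>] that(3) Uc[OF that(1), of "(w, w) \<otimes>\<^bsub>AG\<^esub> q"] w q by simp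
    qed
    then show ?thesis
      unfolding wu using ce[OF w, of "U i \<beta>"] ec[OF w, of "U i (snd (act w) \<otimes>\<^bsub>bits\<^esub> \<beta>)"] Uc[OF that(1)]
      by simp
  qed
  show ?thesis
  proof unfold_locales
    show "?\<phi> \<in> S' \<rightarrow> carrier (wr W AG)"
      using Dc Uc agen_closed by (auto simp: S'_def wg wd wu carrier_wr)
    show "?\<phi> 1 \<otimes>\<^bsub>wr W AG\<^esub> ?\<phi> 0 = ?\<phi> 0 \<otimes>\<^bsub>wr W AG\<^esub> ?\<phi> 0 \<otimes>\<^bsub>wr W AG\<^esub> ?\<phi> 1"
      "?\<phi> 5 \<otimes>\<^bsub>wr W AG\<^esub> ?\<phi> 6 = ?\<phi> 6 \<otimes>\<^bsub>wr W AG\<^esub> ?\<phi> 6 \<otimes>\<^bsub>wr W AG\<^esub> ?\<phi> 5"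
      using agen_rels(1,2) by (simp_all add: wg cm agen_closed del: One_nat_def)
    show "?\<phi> x \<otimes>\<^bsub>wr W AG\<^esub> ?\<phi> y = ?\<phi> y \<otimes>\<^bsub>wr W AG\<^esub> ?\<phi> x"
      if "x \<in> {0, 1, 2, 3}" "y \<in> {4, 5, 6, 7}" for x y
    proof -
      have "x < 8" "y < 8" using that by auto
      then show ?thesis using agen_rels(3)[OF that] by (simp only: wg cm agen_closed)
    qed
    show "?\<phi> x \<otimes>\<^bsub>wr W AG\<^esub> ?\<phi> (x + 4) \<otimes>\<^bsub>wr W AG\<^esub> ?\<phi> (dgen i) =
        ?\<phi> (dgen i) \<otimes>\<^bsub>wr W AG\<^esub> (?\<phi> x \<otimes>\<^bsub>wr W AG\<^esub> ?\<phi> (x + 4))" if x: "x \<in> {0, 2, 3}" and i: "i \<in> S" for x i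
    proof -
      obtain j :: nat where j: "(x, j) \<in> {(0, 0), (2, 1), (3, 2)}" "j \<in> {0, 1, 2}" using x by auto
      show ?thesis
        unfolding sq[OF j(1)] wd using lwa[OF j(2)] lw[OF j(2)] Dc[OF i]
        by (simp add: ce ec Dw cong: restrict_cong)
    qed
    show "?\<phi> 0 \<otimes>\<^bsub>wr W AG\<^esub> ?\<phi> 4 \<otimes>\<^bsub>wr W AG\<^esub> ?\<phi> (ugen i (a, b)) =
        ?\<phi> (ugen i (\<not> a, b)) \<otimes>\<^bsub>wr W AG\<^esub> (?\<phi> 0 \<otimes>\<^bsub>wr W AG\<^esub> ?\<phi> 4)" if i: "i \<in> S" for i a b
      using cU[OF i lw, of 0 "(a, b)"] sq[of 0 0] by (simp add: act actgen_def)
    show "?\<phi> 2 \<otimes>\<^bsub>wr W AG\<^esub> ?\<phi> 6 \<otimes>\<^bsub>wr W AG\<^esub> ?\<phi> (ugen i (a, b)) =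
        ?\<phi> (ugen i (a, \<not> b)) \<otimes>\<^bsub>wr W AG\<^esub> (?\<phi> 2 \<otimes>\<^bsub>wr W AG\<^esub> ?\<phi> 6)" if i: "i \<in> S" for i a b
      using cU[OF i lw, of 1 "(a, b)"] sq[of 2 1] by (simp add: act actgen_def del: One_nat_def)
    show "?\<phi> 3 \<otimes>\<^bsub>wr W AG\<^esub> ?\<phi> 7 \<otimes>\<^bsub>wr W AG\<^esub> ?\<phi> (ugen i \<beta>) =
        ?\<phi> (ugen i \<beta>) \<otimes>\<^bsub>wr W AG\<^esub> (?\<phi> 3 \<otimes>\<^bsub>wr W AG\<^esub> ?\<phi> 7)"
      if i: "i \<in> S" and \<beta>: "\<beta> \<noteq> (False, False)" for i \<beta>
      using cU[OF i lw, of 2 \<beta>] sq[of 3 2] \<beta> by (cases \<beta>) (simp add: act actgen_def)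
    show "?\<phi> 3 \<otimes>\<^bsub>wr W AG\<^esub> ?\<phi> 7 \<otimes>\<^bsub>wr W AG\<^esub> ?\<phi> (ugen i (False, False)) =
        ?\<phi> (ugen i (False, False)) \<otimes>\<^bsub>wr W AG\<^esub> ?\<phi> (dgen i) \<otimes>\<^bsub>wr W AG\<^esub> (?\<phi> 3 \<otimes>\<^bsub>wr W AG\<^esub> ?\<phi> 7)"
      if i: "i \<in> S" for i
    proof -
      have "U i (False, False) q = U i (False, False) ((lt 2 1, lt 2 1) \<otimes>\<^bsub>AG\<^esub> q) \<otimes> D i q"
        if "q \<in> carrier AG" for q
        using Uw[OF i lw that, of 2 "(False, False)"] Dc[OF i that] by (simp add: act actgen_def)
      then have "(\<lambda>q\<in>carrier AG. U i (False, False) q) =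
          (\<lambda>q\<in>carrier AG. U i (False, False) ((lt 2 1, lt 2 1) \<otimes>\<^bsub>AG\<^esub> q) \<otimes> D i ((lt 2 1, lt 2 1) \<otimes>\<^bsub>AG\<^esub> q))"
        using Dw[OF lw[of 2]] by (intro restrict_ext) simp
      moreover have "?c (lt 2 1, lt 2 1) \<otimes>\<^bsub>wr W AG\<^esub> ?e (U i (False, False)) =
          (\<lambda>q\<in>carrier AG. U i (False, False) q, (lt 2 1, lt 2 1))"
        using Uc[OF i] by (intro ce lwa) auto
      moreover have "?e (\<lambda>q. U i (False, False) q \<otimes> D i q) \<otimes>\<^bsub>wr W AG\<^esub> ?c (lt 2 1, lt 2 1) =
          (\<lambda>q\<in>carrier AG. U i (False, False) ((lt 2 1, lt 2 1) \<otimes>\<^bsub>AG\<^esub> q) \<otimes>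
            D i ((lt 2 1, lt 2 1) \<otimes>\<^bsub>AG\<^esub> q), (lt 2 1, lt 2 1))"
        using Uc[OF i] Dc[OF i] by (intro ec lwa) auto
      ultimately show ?thesis
        using sq[of 3 2] unfolding wu wd ee by simp
    qed
    define \<eta> where "\<eta> x = (\<lambda>q\<in>carrier AG. \<delta> (rep (inv\<^bsub>AG\<^esub> q)) x, \<one>\<^bsub>AG\<^esub>)" for x
    have \<eta>: "group_hom DD (wr W AG) \<eta>"
      "\<And>w. w \<in> carrier (free_group S) \<Longrightarrow> \<eta> (cls S R w) = word_eval (wr W AG) (\<lambda>i. ?\<phi> (dgen i)) w"
      using wgen_base(1)[OF assms(1) \<delta>] wgen_base(2)[OF assms(1) \<delta>, where \<upsilon> = \<upsilon>] unfolding \<eta>_def[abs_def] by auto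
    note ev = \<eta>(2)
    show "word_eval (wr W AG) (\<lambda>i. ?\<phi> (dgen i)) w = \<one>\<^bsub>wr W AG\<^esub>" if "w \<in> R" for w
    proof -
      have "cls S R w = \<one>\<^bsub>DD\<^esub>" using that by (rule cls_relator)
      then have "\<eta> (cls S R w) = \<one>\<^bsub>wr W AG\<^esub>"
        using group_hom.hom_one[OF \<eta>(1)] by simp
      then show ?thesis using ev[of w] R that by auto
    qed
    show "word_eval (wr W AG) (\<lambda>i. ?\<phi> (dgen i)) f \<otimes>\<^bsub>wr W AG\<^esub> ?\<phi> x =
        ?\<phi> x \<otimes>\<^bsub>wr W AG\<^esub> word_eval (wr W AG) (\<lambda>i. ?\<phi> (dgen i)) f" if "x \<in> S'" for x
    proof -
      have e: "word_eval (wr W AG) (\<lambda>i. ?\<phi> (dgen i)) f = ?e (\<lambda>_. z)"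
        using ev[OF f] z(2) rep(1) unfolding \<eta>_def by (simp cong: restrict_cong)
      have zD: "z \<otimes> D i q = D i q \<otimes> z" if "i \<in> S" "q \<in> carrier AG" for i q
        using zd rep(1) that unfolding D_def by simp
      have zU: "z \<otimes> U i \<beta> q = U i \<beta> q \<otimes> z" if "i \<in> S" "q \<in> carrier AG" for i \<beta> q
      proof -
        define x where "x = rep (inv\<^bsub>AG\<^esub> q)"
        define c where "c = act (cpart (inv\<^bsub>AG\<^esub> q))"
        have x: "x \<in> carrier AG" using rep(1) that by (simp add: x_def)
        have d: "D i q \<in> carrier W" using Dc that by blast
        have "D i q [^] fst c \<beta> \<otimes> z = z \<otimes> D i q [^] fst c \<beta>"
          using group_hom.hom_int_pow[OF W.cj_hom[OF z(1)] d, of "fst c \<beta>"] zD[OF that] d z(1) W.cj_eq_iff by (metis W.int_pow_closed)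
        then show ?thesis
          using \<upsilon>[OF x that(1)] zu[OF x that(1)] z(1) d unfolding U_def D_def Let_def x_def[symmetric] c_def[symmetric]
          by (metis W.int_pow_closed W.m_assoc)
      qed
      show ?thesis
        unfolding e using that unfolding S'_def
      proof (elim UnE imageE)
        assume "x \<in> {..<8}"
        then show "?e (\<lambda>_. z) \<otimes>\<^bsub>wr W AG\<^esub> ?\<phi> x = ?\<phi> x \<otimes>\<^bsub>wr W AG\<^esub> ?e (\<lambda>_. z)"
          using agen_closed z(1) by (simp add: wg ce ec)
      next
        fix i assume "x = dgen i" "i \<in> S"
        then show "?e (\<lambda>_. z) \<otimes>\<^bsub>wr W AG\<^esub> ?\<phi> x = ?\<phi> x \<otimes>\<^bsub>wr W AG\<^esub> ?e (\<lambda>_. z)"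
          by (simp add: ee wd) (intro restrict_ext zD)
      next
        fix p assume "x = (\<lambda>(i, \<beta>). ugen i \<beta>) p" "p \<in> S \<times> UNIV"
        then obtain i \<beta> where "x = ugen i \<beta>" "i \<in> S" by auto
        then show "?e (\<lambda>_. z) \<otimes>\<^bsub>wr W AG\<^esub> ?\<phi> x = ?\<phi> x \<otimes>\<^bsub>wr W AG\<^esub> ?e (\<lambda>_. z)"
          by (simp add: ee wu) (intro restrict_ext zU)
      qed
    qed
  qed
qed


end

section \<open>The element stays in the iterated finite residual\<close>

lemma (in presentation) commute_gens:
  fixes z
  assumes z: "z \<in> carrier (presented_group S R)"
    and c: "\<And>x. x \<in> S \<Longrightarrow> z \<otimes>\<^bsub>presented_group S R\<^esub> cls S R (gen x) = cls S R (gen x) \<otimes>\<^bsub>presented_group S R\<^esub> z"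
    and x: "x \<in> carrier (presented_group S R)"
  shows "z \<otimes>\<^bsub>presented_group S R\<^esub> x = x \<otimes>\<^bsub>presented_group S R\<^esub> z"
proof -
  interpret P: group "presented_group S R" by (rule group_presented)
  have g: "cls S R (gen x) \<in> carrier (presented_group S R)" if "x \<in> S" for x using cls_gen_closed that by auto
  have "x \<in> generate (presented_group S R) ((\<lambda>x. cls S R (gen x)) ` S)"
    using x by (simp add: generate_gens)
  then have "x \<in> carrier (presented_group S R) \<and> P.cj z x = x"
  proof (induction rule: generate.induct)
    case (eng h1 h2)
    then show ?case using group_hom.hom_mult[OF P.cj_hom[OF z], of h1 h2] by simp
  next
    case one
    then show ?case using group_hom.hom_one[OF P.cj_hom[OF z]] by simp
  next
    case (incl h)
    then obtain y where y: "h = cls S R (gen y)" "y \<in> S" by auto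
    then show ?case using c[of y] g[of y] z by (simp add: P.cj_eq_iff)
  next
    case (inv h)
    then obtain y where y: "h = cls S R (gen y)" "y \<in> S" by auto
    then have "P.cj z h = h" "h \<in> carrier (presented_group S R)" using c[of y] g[of y] z by (simp_all add: P.cj_eq_iff)
    then show ?case using group_hom.hom_inv[OF P.cj_hom[OF z], of h] by simp
  qed
  then show ?thesis using z P.cj_eq_iff by blast
qed

context step
begin

abbreviation "GG \<equiv> presented_group S' R'"

lemma presentation': "presentation S' R'"
  using R'_closed by (simp add: presentation_def)

definition g' where "g' n = cls S' R' (gen n)"

lemma g'_abs: "g' = (\<lambda>n. cls S' R' (gen n))"
  by (simp add: g'_def fun_eq_iff)

lemma group_GG: "group GG"
  using presentation.group_presented[OF presentation'] .

lemma model_hom: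
  assumes "group_hom GG K h"
  shows "step_model S R f K (\<lambda>n. h (g' n))"
proof -
  interpret p: presentation S' R' by (rule presentation')
  interpret group_hom GG K h by fact
  have "(\<lambda>n. h (g' n)) \<in> S' \<rightarrow> carrier K"
    using p.cls_gen_closed by (auto simp: g'_def Pi_iff)
  moreover have "word_eval K (\<lambda>n. h (g' n)) r = \<one>\<^bsub>K\<^esub>" if r: "r \<in> R'" for r
  proof -
    have rc: "r \<in> carrier (free_group S')" using r R'_closed by blast
    have "h (word_eval GG g' r) = word_eval K (\<lambda>n. h (g' n)) r"
      using word_eval_comp[OF assms p.cls_gen_closed, of r] rc by (simp add: carrier_free_group g'_abs)
    moreover have "word_eval GG g' r = \<one>\<^bsub>GG\<^esub>"
      using p.cls_eq_word_eval[OF rc] p.cls_relator[OF r] by (simp add: g'_abs)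
    ultimately show ?thesis by simp
  qed
  ultimately show ?thesis using step_model_iff[OF H.group_axioms] by blast
qed

lemma model_GG: "step_model S R f GG g'"
proof -
  interpret P: group GG by (rule group_GG)
  have "group_hom GG GG (\<lambda>x. x)" by unfold_locales (auto intro!: homI)
  then show ?thesis using model_hom by fastforce
qed

lemma base_hom:
  obtains \<eta> where "group_hom DD GG \<eta>"
    "\<And>w. w \<in> carrier (free_group S) \<Longrightarrow> \<eta> (cls S R w) = cls S' R' (ren w)"
    "\<And>i. i \<in> S \<Longrightarrow> \<eta> (cls S R (gen i)) = g' (dgen i)"
proof -
  interpret p: presentation S' R' by (rule presentation')
  interpret m: step_model S R f GG g' by (rule model_GG)
  have c: "(\<lambda>i. g' (dgen i)) \<in> S \<rightarrow> carrier GG" by auto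
  have e: "word_eval GG (\<lambda>i. g' (dgen i)) w = cls S' R' (ren w)" if "w \<in> carrier (free_group S)" for w
    using p.cls_eq_word_eval[OF ren_closed[OF that]] by (simp add: word_eval_ren g'_abs)
  show ?thesis
    by (rule presented_lift[OF m.K.group_axioms c]) (use m.rel_R e that in auto)
qed

text \<open>The quotient by a normal subgroup of finite index is a finite model, where
  \<open>finite_trivial\<close> applies.\<close>

lemma dgen_FR:
  assumes "i \<in> S"
  shows "g' (dgen i) \<in> FR GG"
proof (rule FR_memberI[OF group_GG])
  interpret m: step_model S R f GG g' by (rule model_GG)
  show "g' (dgen i) \<in> carrier GG" using assms by simp
  fix N assume N: "N \<lhd> GG" "fin_idx GG N"
  interpret N: normal N GG by fact
  interpret q: group "GG Mod N" by (rule N.factorgroup_is_group)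
  have h: "group_hom GG (GG Mod N) (\<lambda>x. N #>\<^bsub>GG\<^esub> x)"
    using N.r_coset_hom_Mod by unfold_locales
  interpret M: step_model S R f "GG Mod N" "\<lambda>n. N #>\<^bsub>GG\<^esub> g' n"
    using h by (rule model_hom)
  have "finite (carrier (GG Mod N))"
    using N(2) by (simp add: fin_idx_def FactGroup_def)
  from M.finite_trivial[OF this assms] have "N #>\<^bsub>GG\<^esub> g' (dgen i) = N" by simp
  then show "g' (dgen i) \<in> N"
    using m.K.rcos_self[OF _ N.is_subgroup, of "g' (dgen i)"] assms by simp
qed

end

text \<open>The invariant of the induction. For n > 0 the groups \<open>DD\<close> and
  \<open>QQ\<close> are the M_n and \<Gamma>_n of the final theorem.\<close>

locale central_step = step S R f for S R f +
  fixes n :: nat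
  assumes central: "x \<in> carrier DD \<Longrightarrow> cls S R f \<otimes>\<^bsub>DD\<^esub> x = x \<otimes>\<^bsub>DD\<^esub> cls S R f"
    and involution: "cls S R f \<otimes>\<^bsub>DD\<^esub> cls S R f = \<one>\<^bsub>DD\<^esub>"
    and nontrivial: "cls S R f \<noteq> \<one>\<^bsub>DD\<^esub>"
    and in_FRn: "cls S R f \<in> FRn DD n"
    and quotient: "rdepth_le n (presented_group S (insert f R))"
begin

lemma cls_f_closed: "cls S R f \<in> carrier DD"
  using f by (simp add: carrier_presented)

lemma central': "x \<in> carrier GG \<Longrightarrow> cls S' R' (ren f) \<otimes>\<^bsub>GG\<^esub> x = x \<otimes>\<^bsub>GG\<^esub> cls S' R' (ren f)"
proof (rule presentation.commute_gens[OF presentation'])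
  interpret p: presentation S' R' by (rule presentation')
  interpret m: step_model S R f GG g' by (rule model_GG)
  show "cls S' R' (ren f) \<in> carrier GG" using ren_closed[OF f] by (simp add: p.carrier_presented)
  have "word_eval GG (\<lambda>i. g' (dgen i)) f = cls S' R' (ren f)"
    using p.cls_eq_word_eval[OF ren_closed[OF f]] by (simp add: word_eval_ren g'_abs)
  then show "cls S' R' (ren f) \<otimes>\<^bsub>GG\<^esub> cls S' R' (gen x) = cls S' R' (gen x) \<otimes>\<^bsub>GG\<^esub> cls S' R' (ren f)"
    if "x \<in> S'" for x
    using m.rel_f[OF that] by (simp add: g'_def)
qed

lemma involution': "cls S' R' (ren f) \<otimes>\<^bsub>GG\<^esub> cls S' R' (ren f) = \<one>\<^bsub>GG\<^esub>"
proof -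
  obtain \<eta> where \<eta>: "group_hom DD GG \<eta>" "\<eta> (cls S R f) = cls S' R' (ren f)" using base_hom f by metis
  interpret \<eta>: group_hom DD GG \<eta> by fact
  show ?thesis using \<eta>.hom_mult[OF cls_f_closed cls_f_closed] involution \<eta>(2) by simp
qed

text \<open>D is mapped into \<open>FR GG\<close> because its generators are; the remaining n
  residuals are compared inside \<open>FR GG\<close> by \<open>FRn_Suc'\<close>.\<close>

lemma in_FRn': "cls S' R' (ren f) \<in> FRn GG (Suc n)"
proof -
  obtain \<eta> where \<eta>: "group_hom DD GG \<eta>" "\<eta> (cls S R f) = cls S' R' (ren f)"
    "\<And>i. i \<in> S \<Longrightarrow> \<eta> (cls S R (gen i)) = g' (dgen i)" using base_hom f by metis
  interpret \<eta>: group_hom DD GG \<eta> by fact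
  interpret F: subgroup "FR GG" GG using group_GG by (rule FR_subgroup)
  have cg: "(\<lambda>x. cls S R (gen x)) ` S \<subseteq> carrier DD" using cls_gen_closed by auto
  have "\<eta> ` (\<lambda>x. cls S R (gen x)) ` S \<subseteq> FR GG" using \<eta>(3) dgen_FR by auto
  then have "generate GG (\<eta> ` (\<lambda>x. cls S R (gen x)) ` S) \<subseteq> FR GG"
    using \<eta>.H.generate_subgroup_incl F.is_subgroup by blast
  then have im: "\<eta> ` carrier DD \<subseteq> FR GG"
    using \<eta>.generate_img[OF cg] by (simp add: generate_gens)
  have "group_hom DD (GG\<lparr>carrier := FR GG\<rparr>) \<eta>"
    unfolding group_hom_def group_hom_axioms_def
    using \<eta>.G.group_axioms F.subgroup_is_group[OF group_GG] im \<eta>.homh by (auto simp: hom_def)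
  from FRn_hom[OF this in_FRn] show ?thesis unfolding FRn_Suc' \<eta>(2) .
qed

text \<open>The model with \<open>W\<close> = D, all copies of D identified and the letters
  \<open>\<upsilon>\<close> trivial is enough: there f becomes the constant function with value
  f.\<close>

lemma nontrivial': "cls S' R' (ren f) \<noteq> \<one>\<^bsub>GG\<^esub>"
proof
  assume *: "cls S' R' (ren f) = \<one>\<^bsub>GG\<^esub>"
  interpret p: presentation S' R' by (rule presentation')
  interpret D: group DD by (rule group_presented)
  interpret A: group AG by (rule group_AG)
  let ?\<delta> = "\<lambda>_ x. x" and ?\<upsilon> = "\<lambda>_ _ _. \<one>\<^bsub>DD\<^esub>"
  let ?\<phi> = "wgen DD ?\<delta> ?\<upsilon>"
  have idh: "group_hom DD DD (\<lambda>x. x)" by unfold_locales (auto intro!: homI)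
  have "cls S R (gen i) \<in> carrier DD" if "i \<in> S" for i using cls_gen_closed that by auto
  then have "step_model S R f (wr DD AG) ?\<phi>"
    using idh central cls_f_closed D.group_axioms by (intro wgen_model[where z = "cls S R f"]) auto
  then interpret m: step_model S R f "wr DD AG" ?\<phi> .
  obtain h where h: "group_hom GG (wr DD AG) h" "h (cls S' R' (ren f)) = word_eval (wr DD AG) ?\<phi> (ren f)"
    using p.presented_lift[OF m.K.group_axioms m.\<phi>] step_model_iff[OF m.K.group_axioms m.\<phi>]
      m.step_model_axioms ren_closed[OF f] by metis
  have "word_eval (wr DD AG) ?\<phi> (ren f) = (\<lambda>q\<in>carrier AG. cls S R f, \<one>\<^bsub>AG\<^esub>)"
    unfolding word_eval_ren using wgen_base(2)[OF D.group_axioms idh f, symmetric] .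
  then have "(\<lambda>q\<in>carrier AG. cls S R f) = (\<lambda>q\<in>carrier AG. \<one>\<^bsub>DD\<^esub>)"
    using group_hom.hom_one[OF h(1)] h(2) * by (simp add: one_wr)
  then have "cls S R f = \<one>\<^bsub>DD\<^esub>"
    using A.one_closed by (metis restrict_apply')
  then show False using nontrivial by blast
qed

end

section \<open>The subgroup generated by the first eight generators\<close>

context step_model
begin

definition acts where
  "acts s w \<longleftrightarrow> (\<forall>i\<in>S. K.cj (s (w, w)) (\<phi> (dgen i)) = \<phi> (dgen i) \<and>
     (\<forall>\<beta>. K.cj (s (w, w)) (\<phi> (ugen i \<beta>)) =
       \<phi> (ugen i (snd (act w) \<otimes>\<^bsub>bits\<^esub> \<beta>)) \<otimes> \<phi> (dgen i) [^] fst (act w) \<beta>))"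

lemma actsD:
  assumes "acts s w" "i \<in> S"
  shows "K.cj (s (w, w)) (\<phi> (dgen i)) = \<phi> (dgen i)"
    "K.cj (s (w, w)) (\<phi> (ugen i \<beta>)) =
       \<phi> (ugen i (snd (act w) \<otimes>\<^bsub>bits\<^esub> \<beta>)) \<otimes> \<phi> (dgen i) [^] fst (act w) \<beta>"
  using assms unfolding acts_def by blast+

lemma acts_mult:
  assumes s: "group_hom AG K s" and v: "v \<in> carrier (FP pF)" "acts s v" and w: "w \<in> carrier (FP pF)" "acts s w"
  shows "acts s (v \<otimes>\<^bsub>FP pF\<^esub> w)"
  unfolding acts_def
proof (intro ballI conjI allI)
  interpret s: group_hom AG K s by fact
  interpret b: group bits by (rule group_bits)
  have c: "(v, v) \<in> carrier AG" "(w, w) \<in> carrier AG" using v w group_hom.hom_closed[OF CG_hom] by blast+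
  have "(v \<otimes>\<^bsub>FP pF\<^esub> w, v \<otimes>\<^bsub>FP pF\<^esub> w) = (v, v) \<otimes>\<^bsub>AG\<^esub> (w, w)"
    using group_hom.hom_mult[OF CG_hom] v w by simp
  then have m: "s (v \<otimes>\<^bsub>FP pF\<^esub> w, v \<otimes>\<^bsub>FP pF\<^esub> w) = s (v, v) \<otimes> s (w, w)" using c by simp
  fix i assume i: "i \<in> S"
  show "K.cj (s (v \<otimes>\<^bsub>FP pF\<^esub> w, v \<otimes>\<^bsub>FP pF\<^esub> w)) (\<phi> (dgen i)) = \<phi> (dgen i)"
    using v(2) w(2) i c unfolding m by (simp add: K.cj_mult acts_def)
  fix \<beta>
  interpret h: group_hom K K "K.cj (s (v, v))" using c by (intro K.cj_hom) simp
  have "K.cj (s (v, v)) (\<phi> (dgen i) [^] k) = \<phi> (dgen i) [^] k" for k :: int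
    using h.hom_int_pow[of "\<phi> (dgen i)" k] v(2) i by (simp add: acts_def)
  then show "K.cj (s (v \<otimes>\<^bsub>FP pF\<^esub> w, v \<otimes>\<^bsub>FP pF\<^esub> w)) (\<phi> (ugen i \<beta>)) =
      \<phi> (ugen i (snd (act (v \<otimes>\<^bsub>FP pF\<^esub> w)) \<otimes>\<^bsub>bits\<^esub> \<beta>)) \<otimes> \<phi> (dgen i) [^] fst (act (v \<otimes>\<^bsub>FP pF\<^esub> w)) \<beta>"
    using actsD[OF v(2) i] actsD[OF w(2) i] i c unfolding m
    by (simp add: K.cj_mult act_mult[OF v(1) w(1)] b.m_assoc K.m_assoc K.int_pow_mult)
qed

lemma acts_inv:
  assumes s: "group_hom AG K s" and w: "w \<in> carrier (FP pF)" "acts s w"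
  shows "acts s (inv\<^bsub>FP pF\<^esub> w)"
  unfolding acts_def
proof (intro ballI conjI allI)
  interpret s: group_hom AG K s by fact
  interpret b: group bits by (rule group_bits)
  interpret F: group "FP pF" by (rule group_FP)
  let ?v = "inv\<^bsub>FP pF\<^esub> w"
  have c: "(w, w) \<in> carrier AG" using w group_hom.hom_closed[OF CG_hom] by blast
  have "(?v, ?v) = inv\<^bsub>AG\<^esub> (w, w)" using group_hom.hom_inv[OF CG_hom] w by simp
  then have m: "s (?v, ?v) = inv (s (w, w))" using c by simp
  have "w \<otimes>\<^bsub>FP pF\<^esub> ?v = []" using w by (simp add: one_FP[symmetric, of pF])
  then have a: "fst (act w) (snd (act ?v) \<otimes>\<^bsub>bits\<^esub> \<beta>) + fst (act ?v) \<beta> = 0"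
    "snd (act w) \<otimes>\<^bsub>bits\<^esub> snd (act ?v) = (False, False)" for \<beta>
    using act_mult[OF w(1) F.inv_closed[OF w(1)]] act_one by simp_all
  fix i assume i: "i \<in> S"
  show d: "K.cj (s (?v, ?v)) (\<phi> (dgen i)) = \<phi> (dgen i)"
    using w(2) i c K.cj_inv[of "s (w, w)" "\<phi> (dgen i)"] unfolding m by (simp add: acts_def)
  fix \<beta>
  interpret h: group_hom K K "K.cj (s (?v, ?v))" using c unfolding m by (intro K.cj_hom) simp
  have dk: "K.cj (s (?v, ?v)) (\<phi> (dgen i) [^] k) = \<phi> (dgen i) [^] k" for k :: int
    using h.hom_int_pow[of "\<phi> (dgen i)" k] d i by simp
  \<comment> \<open>The bits that w moves to \<beta>: the action of the inverse is found by solving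
    the formula for w at \<beta>'.\<close>
  define \<beta>' where "\<beta>' = snd (act ?v) \<otimes>\<^bsub>bits\<^esub> \<beta>"
  have "snd (act w) \<otimes>\<^bsub>bits\<^esub> \<beta>' = \<beta>"
    using a(2) b.m_assoc[of "snd (act w)" "snd (act ?v)" \<beta>] b.l_one[of \<beta>] by (simp add: \<beta>'_def)
  then have "K.cj (s (w, w)) (\<phi> (ugen i \<beta>')) = \<phi> (ugen i \<beta>) \<otimes> \<phi> (dgen i) [^] fst (act w) \<beta>'"
    using actsD(2)[OF w(2) i, of \<beta>'] by simp
  then have "K.cj (s (?v, ?v)) (\<phi> (ugen i \<beta>) \<otimes> \<phi> (dgen i) [^] fst (act w) \<beta>') = \<phi> (ugen i \<beta>')"
    unfolding m using c i by (intro K.cj_inv) simp_all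
  then have "K.cj (s (?v, ?v)) (\<phi> (ugen i \<beta>)) \<otimes> \<phi> (dgen i) [^] fst (act w) \<beta>' = \<phi> (ugen i \<beta>')"
    using i dk by simp
  then have "K.cj (s (?v, ?v)) (\<phi> (ugen i \<beta>)) = \<phi> (ugen i \<beta>') \<otimes> inv (\<phi> (dgen i) [^] fst (act w) \<beta>')"
    using i h.hom_closed[of "\<phi> (ugen i \<beta>)"] by (intro K.inv_solve_right[THEN iffD2]) simp_all
  also have "inv (\<phi> (dgen i) [^] fst (act w) \<beta>') = \<phi> (dgen i) [^] fst (act ?v) \<beta>"
    using i a(1)[of \<beta>] K.int_pow_neg[of "\<phi> (dgen i)" "fst (act w) \<beta>'"]
    by (simp add: \<beta>'_def eq_neg_iff_add_eq_0[symmetric] add.commute)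
  finally show "K.cj (s (?v, ?v)) (\<phi> (ugen i \<beta>)) =
      \<phi> (ugen i (snd (act ?v) \<otimes>\<^bsub>bits\<^esub> \<beta>)) \<otimes> \<phi> (dgen i) [^] fst (act ?v) \<beta>"
    by (simp add: \<beta>'_def)
qed

text \<open>The first eight generators define a homomorphism from \<open>AG\<close> whose diagonal
  elements conjugate as \<open>act\<close> prescribes. For the generators of the diagonal these are
  the defining relations, and \<open>acts\<close> passes to products and inverses.\<close>

lemma section_hom:
  obtains s where "group_hom AG K s" "\<And>k. k < 8 \<Longrightarrow> s (agen k) = \<phi> k"
    "\<And>w. w \<in> carrier (FP pF) \<Longrightarrow> acts s w"
proof -
  define x where "x = (\<lambda>i::nat. if i = 0 then \<phi> 0 else if i = 1 then \<phi> 2 else \<phi> 3)"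
  define y where "y = (\<lambda>i::nat. if i = 0 then \<phi> 4 else if i = 1 then \<phi> 6 else \<phi> 7)"
  obtain s where s: "group_hom AG K s" "\<And>i. i \<in> {0, 1, 2} \<Longrightarrow> s (lt i 1, []) = x i"
    "\<And>i. i \<in> {0, 1, 2} \<Longrightarrow> s ([], lt i 1) = y i" "s ([(0, 1, 0)], []) = \<phi> 1" "s ([], [(1, 1, 0)]) = \<phi> 5"
  proof (rule AG_lift[OF K.group_axioms, of x y "\<phi> 1" "\<phi> 5"])
    show "x i \<otimes> y j = y j \<otimes> x i" "x i \<otimes> \<phi> 5 = \<phi> 5 \<otimes> x i" "\<phi> 1 \<otimes> y j = y j \<otimes> \<phi> 1" for i j
      unfolding x_def y_def by (auto intro!: rel_com)
    show "\<phi> 1 \<otimes> \<phi> 5 = \<phi> 5 \<otimes> \<phi> 1" by (intro rel_com) simp_all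
  qed (use rel_bs1 rel_bs2 in \<open>auto simp: x_def y_def\<close>)
  have sk: "s (agen k) = \<phi> k" if "k < 8" for k
    using less_8_cases[OF that] s(2)[of 0] s(2)[of 1] s(2)[of 2] s(3)[of 0] s(3)[of 1] s(3)[of 2] s(4,5)
    by (elim disjE) (simp_all add: agen_simps x_def y_def del: One_nat_def)
  interpret s: group_hom AG K s by fact
  have d: "s (lt 0 1, lt 0 1) = \<phi> 0 \<otimes> \<phi> 4" "s (lt 1 1, lt 1 1) = \<phi> 2 \<otimes> \<phi> 6" "s (lt 2 1, lt 2 1) = \<phi> 3 \<otimes> \<phi> 7"
    using agen_closed sk unfolding agen_rels(4-6)[symmetric] by simp_all
  have lt: "acts s (lt i 1)" if "i \<in> {0, 1, 2}" for i
  proof -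
    have "acts s (lt 0 1)" "acts s (lt 1 1)" "acts s (lt 2 1)"
      unfolding acts_def d using cj_rels(1)[of _ 0] cj_rels(1)[of _ 2] cj_rels(1)[of _ 3] cj_rels(2-5)
      by (auto simp: act actgen_def simp del: One_nat_def)
    then show ?thesis using that by auto
  qed
  have "acts s w" if "w \<in> carrier (FP pF)" for w
    using that
  proof (induction rule: FPF_induct_gen)
    case one
    have "s ([], []) = \<one>" using s.hom_one by (simp add: one_AG)
    then show ?case using act_one by (auto simp: acts_def K.cj_def)
  next
    case (mult i w)
    then show ?case using lt lt_closed by (intro acts_mult[OF s(1)]) auto
  next
    case (mult_inv i w)
    interpret F: group "FP pF" by (rule group_FP)
    show ?case using mult_inv lt lt_closed by (intro acts_mult[OF s(1)] acts_inv[OF s(1)] F.inv_closed) auto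
  qed
  then show ?thesis using that s(1) sk by blast
qed

end

section \<open>The quotient embeds in a wreath product\<close>

text \<open>The infinite cyclic group once more, as a presented group, so that it has the type of
  \<open>QQ\<close> and both can be factors of one free product.\<close>

abbreviation UU :: "nat word set monoid" where "UU \<equiv> presented_group {0} {}"

definition u0 :: "nat word set" where "u0 = cls {0} {} (gen 0)"

lemma presentation_UU: "presentation {0} {}"
  by (simp add: presentation_def)

lemma group_UU: "group UU"
  using presentation.group_presented[OF presentation_UU] .

lemma u0_closed [simp]: "u0 \<in> carrier UU"
  using presentation.cls_gen_closed[OF presentation_UU] by (simp add: u0_def Pi_iff)

lemma UU_lift:
  fixes K (structure)
  assumes "group K" "x \<in> carrier K"
  shows "\<exists>h. group_hom UU K h \<and> h u0 = x"
  using presentation.presented_lift[OF presentation_UU assms(1), of "\<lambda>_. x"] assms(2)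
  unfolding u0_def by (metis Pi_I empty_iff singletonI)

lemma carrier_UU: "carrier UU = {u0 [^]\<^bsub>UU\<^esub> k | k :: int. True}"
proof -
  interpret U: group UU by (rule group_UU)
  have "generate UU {u0} = carrier UU"
    using presentation.generate_gens[OF presentation_UU] by (simp add: u0_def)
  then show ?thesis using U.generate_pow[OF u0_closed] by auto
qed

lemma UU_ZZ: obtains h where "group_hom UU ZZ h" "\<And>k :: int. h (u0 [^]\<^bsub>UU\<^esub> k) = (0, of_int k)"
proof -
  have one: "(0, 1) \<in> carrier ZZ" by (simp add: ZZ_simps)
  obtain h where h: "group_hom UU ZZ h" "h u0 = (0, 1)" using UU_lift[OF group_ZZ one] by blast
  have "h (u0 [^]\<^bsub>UU\<^esub> k) = (0, of_int k)" for k :: int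
    using group_hom.hom_int_pow[OF h(1) u0_closed, of k] h(2) by (simp add: ZZ_pow)
  then show ?thesis using that h(1) by blast
qed

lemma rdepth_le_UU: "rdepth_le 1 UU"
proof -
  obtain h where h: "group_hom UU ZZ h" "\<And>k :: int. h (u0 [^]\<^bsub>UU\<^esub> k) = (0, of_int k)" by (rule UU_ZZ) blast
  then have "inj_on h (carrier UU)"
    unfolding carrier_UU by (auto simp: inj_on_def)
  then show ?thesis using rdepth_le_inj[OF rdepth_le_ZZ h(1)] by blast
qed

type_synonym agrp = "(nat \<times> int \<times> rat) list \<times> (nat \<times> int \<times> rat) list"

context step
begin

abbreviation "QQ \<equiv> presented_group S (insert f R)"
abbreviation "QG \<equiv> presented_group S' (insert (ren f) R')"

text \<open>For each coset representative x one copy of D / <f>, with index \<open>None\<close>, and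
  one infinite cyclic group for each letter u. The indices are coded by natural numbers, as
  \<open>rdepth_le_fp\<close> requires.\<close>

definition HH :: "nat \<Rightarrow> nat word set monoid" where
  "HH m = (case snd (from_nat m :: agrp \<times> (nat \<times> bool \<times> bool) option) of None \<Rightarrow> QQ | Some _ \<Rightarrow> UU)"

definition JJ :: "nat set" where
  "JJ = (to_nat :: agrp \<times> (nat \<times> bool \<times> bool) option \<Rightarrow> nat) ` (rep ` carrier AG \<times> insert None (Some ` (S \<times> UNIV)))"

abbreviation "WW \<equiv> fp JJ HH"

lemma HH_simps [simp]: "HH (to_nat (x :: agrp, None :: (nat \<times> bool \<times> bool) option)) = QQ"
  "HH (to_nat (x :: agrp, Some y :: (nat \<times> bool \<times> bool) option)) = UU"
  by (simp_all add: HH_def)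

lemma presentation_QQ: "presentation S (insert f R)"
  using R f by (simp add: presentation_def)

lemma presentation_QG: "presentation S' (insert (ren f) R')"
  using R'_closed ren_closed[OF f] by (simp add: presentation_def)

lemma group_QQ: "group QQ" and group_QG: "group QG"
  using presentation.group_presented presentation_QQ presentation_QG by blast+

lemma fp_family_HH: "fp_family JJ HH"
  by (rule fp_family.intro) (auto simp: HH_def group_QQ group_UU split: option.splits)

definition \<rho> where
  "\<rho> = (SOME h. group_hom DD QQ h \<and> (\<forall>w\<in>carrier (free_group S). h (cls S R w) = cls S (insert f R) w))"

lemma \<rho>: "group_hom DD QQ \<rho>" "\<And>w. w \<in> carrier (free_group S) \<Longrightarrow> \<rho> (cls S R w) = cls S (insert f R) w"
proof -
  interpret q: presentation S "insert f R" by (rule presentation_QQ)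
  have "word_eval QQ (\<lambda>x. cls S (insert f R) (gen x)) r = \<one>\<^bsub>QQ\<^esub>" if "r \<in> R" for r
    using q.cls_eq_word_eval[of r] q.cls_relator[of r] that R by auto
  from presented_lift[OF group_QQ q.cls_gen_closed this]
  have "\<exists>h. group_hom DD QQ h \<and> (\<forall>w\<in>carrier (free_group S). h (cls S R w) = cls S (insert f R) w)"
    using q.cls_eq_word_eval by metis
  from someI_ex[OF this] show "group_hom DD QQ \<rho>"
    "\<And>w. w \<in> carrier (free_group S) \<Longrightarrow> \<rho> (cls S R w) = cls S (insert f R) w"
    unfolding \<rho>_def by auto
qed

text \<open>\<open>rep x\<close> in place of x makes the index admissible for every x in
  \<open>AG\<close>; on representatives nothing changes.\<close>

definition \<delta> where "\<delta> x e = fp_in HH (to_nat (rep x, None :: (nat \<times> bool \<times> bool) option)) (\<rho> e)"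

definition \<upsilon> where "\<upsilon> x i \<beta> = fp_in HH (to_nat (rep x, Some (i :: nat, \<beta> :: bool \<times> bool))) u0"

lemma JJ_mem: "x \<in> carrier AG \<Longrightarrow> to_nat (rep x, None :: (nat \<times> bool \<times> bool) option) \<in> JJ"
  "x \<in> carrier AG \<Longrightarrow> i \<in> S \<Longrightarrow> to_nat (rep x, Some (i, \<beta>) :: (nat \<times> bool \<times> bool) option) \<in> JJ"
  by (auto simp: JJ_def)

lemma JJ_cases:
  assumes "m \<in> JJ"
  obtains x where "x \<in> rep ` carrier AG" "m = to_nat (x :: agrp, None :: (nat \<times> bool \<times> bool) option)"
  | x i \<beta> where "x \<in> rep ` carrier AG" "i \<in> S" "m = to_nat (x :: agrp, Some (i, \<beta>) :: (nat \<times> bool \<times> bool) option)"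
  using assms unfolding JJ_def by blast

lemma \<delta>_hom: "x \<in> carrier AG \<Longrightarrow> group_hom DD WW (\<delta> x)"
proof -
  assume x: "x \<in> carrier AG"
  interpret fp_family JJ HH by (rule fp_family_HH)
  interpret r: group_hom DD QQ \<rho> by (rule \<rho>)
  interpret i: group_hom QQ WW "fp_in HH (to_nat (rep x, None :: (nat \<times> bool \<times> bool) option))"
    using fp_in_hom[OF JJ_mem(1)[OF x]] by simp
  show ?thesis
    unfolding group_hom_def group_hom_axioms_def
    using r.G.group_axioms group_fp by (auto intro!: homI simp: \<delta>_def)
qed

lemma \<upsilon>_closed: "x \<in> carrier AG \<Longrightarrow> i \<in> S \<Longrightarrow> \<upsilon> x i \<beta> \<in> carrier WW"
proof -
  assume x: "x \<in> carrier AG" "i \<in> S"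
  interpret fp_family JJ HH by (rule fp_family_HH)
  show ?thesis using fp_in_closed[OF JJ_mem(2)[OF x, of \<beta>], of u0] by (simp add: \<upsilon>_def)
qed

definition \<gamma> where "\<gamma> n = cls S' (insert (ren f) R') (gen n)"

lemma \<gamma>_abs: "\<gamma> = (\<lambda>n. cls S' (insert (ren f) R') (gen n))"
  by (simp add: \<gamma>_def fun_eq_iff)

lemma model_QG: "step_model S R f QG \<gamma>"
proof -
  interpret p: presentation S' "insert (ren f) R'" by (rule presentation_QG)
  have "word_eval QG \<gamma> r = \<one>\<^bsub>QG\<^esub>" if "r \<in> R'" for r
    using p.cls_eq_word_eval[of r] p.cls_relator[of r] that R'_closed unfolding \<gamma>_abs by auto
  then show ?thesis
    using step_model_iff[OF group_QG, of \<gamma>] p.cls_gen_closed by (simp add: \<gamma>_abs)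
qed

lemma wgen_WW: "step_model S R f (wr WW AG) (wgen WW \<delta> \<upsilon>)"
  "word_eval (wr WW AG) (\<lambda>i. wgen WW \<delta> \<upsilon> (dgen i)) f = \<one>\<^bsub>wr WW AG\<^esub>"
proof -
  interpret fp_family JJ HH by (rule fp_family_HH)
  interpret W: group WW by (rule group_fp)
  interpret q: presentation S "insert f R" by (rule presentation_QQ)
  have "\<rho> (cls S R f) = \<one>\<^bsub>QQ\<^esub>" using \<rho>(2)[OF f] q.cls_relator[of f] by simp
  then have 1: "\<delta> x (cls S R f) = \<one>\<^bsub>WW\<^esub>" if "x \<in> carrier AG" for x
    using group_hom.hom_one[OF fp_in_hom[OF JJ_mem(1)[OF that]]] by (simp add: \<delta>_def)
  have d: "\<delta> x (cls S R (gen i)) \<in> carrier WW" if "x \<in> carrier AG" "i \<in> S" for x i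
    using group_hom.hom_closed[OF \<delta>_hom[OF that(1)]] cls_gen_closed that(2) by auto
  show "step_model S R f (wr WW AG) (wgen WW \<delta> \<upsilon>)"
    by (rule wgen_model[OF group_fp \<delta>_hom \<upsilon>_closed W.one_closed 1]) (use d \<upsilon>_closed in auto)
  have "(\<lambda>q\<in>carrier AG. \<delta> (rep (inv\<^bsub>AG\<^esub> q)) (cls S R f)) = (\<lambda>q\<in>carrier AG. \<one>\<^bsub>WW\<^esub>)"
    using rep(1) group.inv_closed[OF group_AG] by (intro restrict_ext 1) blast
  then show "word_eval (wr WW AG) (\<lambda>i. wgen WW \<delta> \<upsilon> (dgen i)) f = \<one>\<^bsub>wr WW AG\<^esub>"
    using wgen_base(2)[of WW \<delta> f \<upsilon>, OF group_fp \<delta>_hom f] by (simp add: one_wr)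
qed

lemma QG_lift:
  assumes "step_model S R f K \<phi>" "word_eval K (\<lambda>i. \<phi> (dgen i)) f = \<one>\<^bsub>K\<^esub>"
  obtains h where "group_hom QG K h" "\<And>n. n \<in> S' \<Longrightarrow> h (\<gamma> n) = \<phi> n"
proof -
  interpret m: step_model S R f K \<phi> by fact
  interpret p: presentation S' "insert (ren f) R'" by (rule presentation_QG)
  have "word_eval K \<phi> r = \<one>\<^bsub>K\<^esub>" if "r \<in> insert (ren f) R'" for r
    using step_model_iff[OF m.K.group_axioms m.\<phi>] assms that by (auto simp: word_eval_ren)
  from p.presented_lift[OF m.K.group_axioms m.\<phi> this] show ?thesis
    using that unfolding \<gamma>_def by blast
qed

lemma QQ_QG:
  obtains \<iota> where "group_hom QQ QG \<iota>" "\<And>i. i \<in> S \<Longrightarrow> \<iota> (cls S (insert f R) (gen i)) = \<gamma> (dgen i)"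
proof -
  interpret m: step_model S R f QG \<gamma> by (rule model_QG)
  interpret p: presentation S' "insert (ren f) R'" by (rule presentation_QG)
  interpret q: presentation S "insert f R" by (rule presentation_QQ)
  have "word_eval QG (\<lambda>i. \<gamma> (dgen i)) f = \<one>\<^bsub>QG\<^esub>"
    using p.cls_eq_word_eval[OF ren_closed[OF f]] p.cls_relator[of "ren f"]
    by (simp add: word_eval_ren \<gamma>_abs)
  then have "word_eval QG (\<lambda>i. \<gamma> (dgen i)) r = \<one>\<^bsub>QG\<^esub>" if "r \<in> insert f R" for r
    using m.rel_R that by auto
  moreover have "(\<lambda>i. \<gamma> (dgen i)) \<in> S \<rightarrow> carrier QG" by auto
  ultimately show ?thesis
    using q.presented_lift[OF group_QG, of "\<lambda>i. \<gamma> (dgen i)"] that by metis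
qed

text \<open>The section is the homomorphism s from \<open>AG\<close>, and \<open>j\<close> sends the
  factors of the base to the actual conjugates by s x of the copy of D / <f> and of the letters. The
  formula for \<open>wgen\<close> was made so that \<open>wr_section_inj\<close> applies to
  these.\<close>

lemma QG_embedding:
  obtains \<Phi> where "group_hom QG (wr WW AG) \<Phi>" "inj_on \<Phi> (carrier QG)"
    "\<And>n. n \<in> S' \<Longrightarrow> \<Phi> (\<gamma> n) = wgen WW \<delta> \<upsilon> n"
proof -
  interpret m: step_model S R f QG \<gamma> by (rule model_QG)
  interpret p: presentation S' "insert (ren f) R'" by (rule presentation_QG)
  interpret F: fp_family JJ HH by (rule fp_family_HH)
  interpret A: group AG by (rule group_AG)
  obtain \<Phi> where \<Phi>: "group_hom QG (wr WW AG) \<Phi>" "\<And>n. n \<in> S' \<Longrightarrow> \<Phi> (\<gamma> n) = wgen WW \<delta> \<upsilon> n"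
    using QG_lift[OF wgen_WW] by blast
  obtain s where s: "group_hom AG QG s" "\<And>k. k < 8 \<Longrightarrow> s (agen k) = \<gamma> k"
    "\<And>w. w \<in> carrier (FP pF) \<Longrightarrow> m.acts s w" using m.section_hom by blast
  interpret s: group_hom AG QG s by fact
  obtain \<iota> where \<iota>: "group_hom QQ QG \<iota>" "\<And>i. i \<in> S \<Longrightarrow> \<iota> (cls S (insert f R) (gen i)) = \<gamma> (dgen i)"
    using QQ_QG by blast
  define h where "h m = (case from_nat m :: agrp \<times> (nat \<times> bool \<times> bool) option of
      (x, None) \<Rightarrow> (\<lambda>g. m.K.cj (s x) (\<iota> g))
    | (x, Some (i, \<beta>)) \<Rightarrow> (SOME h. group_hom UU QG h \<and> h u0 = m.K.cj (s x) (\<gamma> (ugen i \<beta>))))" for m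
  have h0: "h (to_nat (x :: agrp, None :: (nat \<times> bool \<times> bool) option)) = (\<lambda>g. m.K.cj (s x) (\<iota> g))" for x
    by (simp add: h_def)
  have h1: "group_hom UU QG (h (to_nat (x :: agrp, Some (i :: nat, \<beta> :: bool \<times> bool))))"
    "h (to_nat (x :: agrp, Some (i :: nat, \<beta> :: bool \<times> bool))) u0 = m.K.cj (s x) (\<gamma> (ugen i \<beta>))"
    if "x \<in> carrier AG" "i \<in> S" for x i \<beta>
  proof -
    have "m.K.cj (s x) (\<gamma> (ugen i \<beta>)) \<in> carrier QG" using that by simp
    from someI_ex[OF UU_lift[OF group_QG this]]
    show "group_hom UU QG (h (to_nat (x :: agrp, Some (i :: nat, \<beta> :: bool \<times> bool))))"
      "h (to_nat (x :: agrp, Some (i :: nat, \<beta> :: bool \<times> bool))) u0 = m.K.cj (s x) (\<gamma> (ugen i \<beta>))"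
      by (simp_all add: h_def)
  qed
  have hh: "h m \<in> hom (HH m) QG" if "m \<in> JJ" for m
    using that
  proof (cases rule: JJ_cases)
    case (1 x)
    have "x \<in> carrier AG" using 1 rep(1) by auto
    then have "group_hom QG QG (m.K.cj (s x))" by (intro m.K.cj_hom) simp
    then have "m.K.cj (s x) \<circ> \<iota> \<in> hom QQ QG"
      using group_hom.homh \<iota>(1) Group.hom_compose by blast
    then show ?thesis unfolding 1 h0 HH_simps comp_def .
  next
    case (2 x i \<beta>)
    then have "x \<in> carrier AG" using rep(1) by auto
    then show ?thesis using 2 h1(1)[OF _ 2(2), of x \<beta>] by (simp add: group_hom.homh)
  qed
  define j where "j = fp_lift QG h"
  have j: "group_hom WW QG j" unfolding j_def using hh group_QG by (intro F.fp_lift_hom) auto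
  interpret j: group_hom WW QG j by fact
  have jd: "j (\<delta> x (cls S R (gen i))) = m.K.cj (s (rep x)) (\<gamma> (dgen i))" if "x \<in> carrier AG" "i \<in> S" for x i
  proof -
    have g: "gen i \<in> carrier (free_group S)" using that by (intro gen_closed)
    have "\<rho> (cls S R (gen i)) = cls S (insert f R) (gen i)" using \<rho>(2)[OF g] .
    moreover have "cls S (insert f R) (gen i) \<in> carrier QQ"
      using presentation.cls_gen_closed[OF presentation_QQ] that by auto
    ultimately show ?thesis
      using F.fp_lift_in[OF group_QG hh JJ_mem(1)[OF that(1)], of "cls S (insert f R) (gen i)"] \<iota>(2)[OF that(2)]
      unfolding j_def \<delta>_def by (simp add: h0)
  qed
  have ju: "j (\<upsilon> x i \<beta>) = m.K.cj (s (rep x)) (\<gamma> (ugen i \<beta>))" if "x \<in> carrier AG" "i \<in> S" for x i \<beta>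
    using F.fp_lift_in[OF group_QG hh JJ_mem(2)[OF that, of \<beta>], of u0] h1(2)[OF rep(1)[OF that(1)] that(2)]
    unfolding j_def \<upsilon>_def by simp
  \<comment> \<open>Moving t past s q conjugates it by the inverse of s q, which is s x times the
    image of a diagonal element.\<close>
  have sec: "t \<otimes>\<^bsub>QG\<^esub> s q = s q \<otimes>\<^bsub>QG\<^esub> m.K.cj (s x) (m.K.cj (s (c, c)) t)"
    if q: "q \<in> carrier AG" and x: "x = rep (inv\<^bsub>AG\<^esub> q)" "c = cpart (inv\<^bsub>AG\<^esub> q)" and t: "t \<in> carrier QG" for q x c t
  proof -
    note r = rep[OF A.inv_closed[OF q], folded x]
    have cc: "(c, c) \<in> carrier AG" using r(2) group_hom.hom_closed[OF CG_hom] by blast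
    have "inv\<^bsub>QG\<^esub> (s q) = s x \<otimes>\<^bsub>QG\<^esub> s (c, c)"
      using s.hom_inv[OF q] r(1,3) cc by simp
    then have "m.K.cj (s x) (m.K.cj (s (c, c)) t) = m.K.cj (inv\<^bsub>QG\<^esub> (s q)) t"
      using r(1) cc t by (simp add: m.K.cj_mult)
    then show ?thesis
      using q t by (simp add: m.K.cj_def m.K.m_assoc[symmetric])
  qed
  have "inj_on \<Phi> (carrier QG)"
  proof (rule wr_section_inj[OF \<Phi>(1) j group_AG])
    show "s \<in> carrier AG \<rightarrow> carrier QG" by auto
    show "\<gamma> ` S' \<subseteq> carrier QG" "generate QG (\<gamma> ` S') = carrier QG"
      using p.cls_gen_closed p.generate_gens by (auto simp: \<gamma>_abs)
    fix t q assume "t \<in> \<gamma> ` S'" and q: "q \<in> carrier AG"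
    then obtain n where n: "t = \<gamma> n" "n \<in> S'" by blast
    define x where "x = rep (inv\<^bsub>AG\<^esub> q)"
    define c where "c = cpart (inv\<^bsub>AG\<^esub> q)"
    note r = rep(1,2)[OF A.inv_closed[OF q], folded x_def c_def]
    have rx: "rep x = x" unfolding x_def by (rule rep_rep) (use q in simp)
    note sec = sec[OF q x_def c_def]
    interpret X: group_hom QG QG "m.K.cj (s x)" using r(1) by (intro m.K.cj_hom) simp
    have dc: "\<delta> x (cls S R (gen i)) \<in> carrier WW" if "i \<in> S" for i
      using group_hom.hom_closed[OF \<delta>_hom[OF r(1)]] cls_gen_closed that by auto
    consider "n < 8" | i where "i \<in> S" "n = dgen i" | i \<beta> where "i \<in> S" "n = ugen i \<beta>"
      using n(2) by (auto simp: S'_def)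
    then show "t \<otimes>\<^bsub>QG\<^esub> s q = s (snd (\<Phi> t) \<otimes>\<^bsub>AG\<^esub> q) \<otimes>\<^bsub>QG\<^esub> j (fst (\<Phi> t) q)"
    proof cases
      case 1
      then show ?thesis
        using \<Phi>(2)[OF n(2)] q s(2)[OF 1] agen_closed[OF 1] s.hom_mult[OF agen_closed[OF 1] q] n(1)
        by (simp add: wgen_def assign_simps)
    next
      case (2 i)
      then show ?thesis
        using \<Phi>(2)[OF n(2)] q sec[of "\<gamma> (dgen i)"] jd[OF r(1) 2(1), unfolded rx] m.actsD(1)[OF s(3)[OF r(2)] 2(1)] n(1)
        by (simp add: wgen_def assign_simps x_def[symmetric])
    next
      case (3 i \<beta>)
      have "j (fst (\<Phi> t) q) = j (\<upsilon> x i (snd (act c) \<otimes>\<^bsub>bits\<^esub> \<beta>) \<otimes>\<^bsub>WW\<^esub> \<delta> x (cls S R (gen i)) [^]\<^bsub>WW\<^esub> fst (act c) \<beta>)"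
        using \<Phi>(2)[OF n(2)] q n(1) 3 by (simp add: wgen_def assign_simps x_def[symmetric] c_def[symmetric] Let_def)
      also have "\<dots> = m.K.cj (s x) (\<gamma> (ugen i (snd (act c) \<otimes>\<^bsub>bits\<^esub> \<beta>))) \<otimes>\<^bsub>QG\<^esub> m.K.cj (s x) (\<gamma> (dgen i)) [^]\<^bsub>QG\<^esub> fst (act c) \<beta>"
        using \<upsilon>_closed[OF r(1) 3(1)] dc[OF 3(1)] j.hom_int_pow[OF dc[OF 3(1)]] ju[OF r(1) 3(1), unfolded rx] jd[OF r(1) 3(1), unfolded rx] by simp
      also have "\<dots> = m.K.cj (s x) (m.K.cj (s (c, c)) (\<gamma> n))"
        using m.actsD(2)[OF s(3)[OF r(2)] 3(1), of \<beta>] X.hom_int_pow[of "\<gamma> (dgen i)"] 3 by simp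
      finally show ?thesis
        using \<Phi>(2)[OF n(2)] q n(1) 3 sec[of t] by (simp add: wgen_def assign_simps)
    qed
  qed
  then show ?thesis using that \<Phi> by blast
qed

end

text \<open>The infinite cyclic factors of the base need one residual of their own, whence 1 \<le>
  n; the top group \<open>AG\<close> adds one more.\<close>

lemma (in step) rdepth_le_QG:
  assumes "1 \<le> n" "rdepth_le n QQ"
  shows "rdepth_le (Suc n) QG"
proof -
  obtain \<Phi> where \<Phi>: "group_hom QG (wr WW AG) \<Phi>" "inj_on \<Phi> (carrier QG)" using QG_embedding by blast
  have "countable (carrier QQ)" "countable (carrier UU)"
    using presentation.countable_presented[OF presentation_QQ] presentation.countable_presented[OF presentation_UU]
      finS by (simp_all add: countable_finite)
  then have "rdepth_le n WW"
    using assms rdepth_le_mono[OF assms(1) rdepth_le_UU]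
    by (intro rdepth_le_fp) (auto simp: HH_def split: option.splits)
  then show ?thesis
    using rdepth_le_inj[OF rdepth_le_wr[OF _ rdepth_le_AG] \<Phi>] by blast
qed

text \<open>Conditions that pass to smaller subgroups can be met together by intersecting.\<close>

lemma normal_separation:
  fixes G (structure)
  assumes "group G" "finite P" "\<And>p. p \<in> P \<Longrightarrow> \<exists>N. N \<lhd> G \<and> fin_idx G N \<and> C p N"
    and "\<And>p N N'. N' \<subseteq> N \<Longrightarrow> C p N \<Longrightarrow> C p N'"
  shows "\<exists>N. N \<lhd> G \<and> fin_idx G N \<and> (\<forall>p\<in>P. C p N)"
  using assms(2,3)
proof (induction P rule: finite_induct)
  case empty
  have "carrier G \<lhd> G" using group.subgroup_self[OF assms(1)] assms(1)
    by (auto simp: group.normal_inv_iff group.is_monoid monoid.m_closed)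
  then show ?case using fin_idx_carrier[OF assms(1)] by blast
next
  case (insert p P)
  then obtain N N' where N: "N \<lhd> G" "fin_idx G N" "\<forall>p\<in>P. C p N" and N': "N' \<lhd> G" "fin_idx G N'" "C p N'"
    by (meson insertCI)
  have "N \<inter> N' \<lhd> G"
    using N(1) N'(1) assms(1) group.subgroups_Inter_pair by (auto simp: group.normal_inv_iff)
  moreover have "fin_idx G (N \<inter> N')" using fin_idx_Int[OF assms(1) N(2) N'(2)] .
  ultimately show ?case using N(3) N'(3) assms(4)[of "N \<inter> N'"] by (metis Int_lower1 Int_lower2 insert_iff)
qed

section \<open>Separating letters in finite quotients\<close>

text \<open>Up to powers of d_i, the conjugate of the letter with bits \<beta> by g equals that of
  the letter with bits moved by the inverse of v by g times the diagonal element of v. The set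
  \<open>orb N g \<beta>\<close> is the class of \<open>(g, \<beta>)\<close> under this
  identification, together with its translates by N.\<close>

definition orb :: "agrp set \<Rightarrow> agrp \<Rightarrow> bool \<times> bool \<Rightarrow> (agrp \<times> bool \<times> bool) set" where
  "orb N g \<beta> = {(n \<otimes>\<^bsub>AG\<^esub> g \<otimes>\<^bsub>AG\<^esub> (v, v), snd (act (inv\<^bsub>FP pF\<^esub> v)) \<otimes>\<^bsub>bits\<^esub> \<beta>) | n v.
     n \<in> N \<and> v \<in> carrier (FP pF)}"

lemma FPF_diag: "v \<in> carrier (FP pF) \<Longrightarrow> (v, v) \<in> carrier AG"
  using group_hom.hom_closed[OF CG_hom] by blast

lemma FPF_diag_mult: "v \<in> carrier (FP pF) \<Longrightarrow> w \<in> carrier (FP pF) \<Longrightarrow>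
    (v \<otimes>\<^bsub>FP pF\<^esub> w, v \<otimes>\<^bsub>FP pF\<^esub> w) = (v, v) \<otimes>\<^bsub>AG\<^esub> (w, w)"
  using group_hom.hom_mult[OF CG_hom] by blast

lemma orb_diag_subset:
  assumes "N \<lhd> AG" "g \<in> carrier AG" "c \<in> carrier (FP pF)"
  shows "orb N (g \<otimes>\<^bsub>AG\<^esub> (c, c)) \<beta> \<subseteq> orb N g (snd (act c) \<otimes>\<^bsub>bits\<^esub> \<beta>)"
proof
  interpret A: group AG by (rule group_AG)
  interpret F: group "FP pF" by (rule group_FP)
  interpret N: normal N AG by fact
  interpret b: group bits by (rule group_bits)
  fix p assume "p \<in> orb N (g \<otimes>\<^bsub>AG\<^esub> (c, c)) \<beta>"
  then obtain n v where p: "p = (n \<otimes>\<^bsub>AG\<^esub> (g \<otimes>\<^bsub>AG\<^esub> (c, c)) \<otimes>\<^bsub>AG\<^esub> (v, v), snd (act (inv\<^bsub>FP pF\<^esub> v)) \<otimes>\<^bsub>bits\<^esub> \<beta>)"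
    "n \<in> N" "v \<in> carrier (FP pF)" by (auto simp: orb_def)
  define w where "w = c \<otimes>\<^bsub>FP pF\<^esub> v"
  have w: "w \<in> carrier (FP pF)" using p assms(3) by (simp add: w_def)
  have "n \<otimes>\<^bsub>AG\<^esub> (g \<otimes>\<^bsub>AG\<^esub> (c, c)) \<otimes>\<^bsub>AG\<^esub> (v, v) = n \<otimes>\<^bsub>AG\<^esub> g \<otimes>\<^bsub>AG\<^esub> (w, w)"
    using p assms FPF_diag[OF assms(3)] FPF_diag[OF p(3)] FPF_diag_mult[OF assms(3) p(3)] N.mem_carrier[OF p(2)]
    by (simp add: w_def A.m_assoc)
  moreover have "inv\<^bsub>FP pF\<^esub> v = inv\<^bsub>FP pF\<^esub> w \<otimes>\<^bsub>FP pF\<^esub> c"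
    using p assms(3) by (simp add: w_def F.inv_mult_group F.m_assoc)
  then have "snd (act (inv\<^bsub>FP pF\<^esub> v)) \<otimes>\<^bsub>bits\<^esub> \<beta> = snd (act (inv\<^bsub>FP pF\<^esub> w)) \<otimes>\<^bsub>bits\<^esub> (snd (act c) \<otimes>\<^bsub>bits\<^esub> \<beta>)"
    using w assms(3) by (simp add: act_mult b.m_assoc)
  ultimately show "p \<in> orb N g (snd (act c) \<otimes>\<^bsub>bits\<^esub> \<beta>)" using p w unfolding orb_def by blast
qed

lemma orb_diag:
  assumes "N \<lhd> AG" "g \<in> carrier AG" "c \<in> carrier (FP pF)"
  shows "orb N (g \<otimes>\<^bsub>AG\<^esub> (c, c)) \<beta> = orb N g (snd (act c) \<otimes>\<^bsub>bits\<^esub> \<beta>)"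
proof (rule antisym[OF orb_diag_subset[OF assms]])
  interpret A: group AG by (rule group_AG)
  interpret F: group "FP pF" by (rule group_FP)
  interpret b: group bits by (rule group_bits)
  let ?d = "inv\<^bsub>FP pF\<^esub> c"
  have d: "?d \<in> carrier (FP pF)" using assms by simp
  have "c \<otimes>\<^bsub>FP pF\<^esub> ?d = []" "?d \<otimes>\<^bsub>FP pF\<^esub> c = []" using assms by (simp_all add: one_FP[symmetric, of pF])
  then have "(c, c) \<otimes>\<^bsub>AG\<^esub> (?d, ?d) = \<one>\<^bsub>AG\<^esub>" "snd (act ?d) \<otimes>\<^bsub>bits\<^esub> snd (act c) = (False, False)"
    using FPF_diag_mult[OF assms(3) d] act_mult(2)[OF d assms(3)] act_one by (simp_all add: one_AG)
  then have e: "g \<otimes>\<^bsub>AG\<^esub> (c, c) \<otimes>\<^bsub>AG\<^esub> (?d, ?d) = g"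
    "snd (act ?d) \<otimes>\<^bsub>bits\<^esub> (snd (act c) \<otimes>\<^bsub>bits\<^esub> \<beta>) = \<beta>"
    using assms(2) FPF_diag[OF assms(3)] FPF_diag[OF d] b.m_assoc[of "snd (act ?d)" "snd (act c)" \<beta>] b.l_one[of \<beta>]
    by (simp_all add: A.m_assoc)
  show "orb N g (snd (act c) \<otimes>\<^bsub>bits\<^esub> \<beta>) \<subseteq> orb N (g \<otimes>\<^bsub>AG\<^esub> (c, c)) \<beta>"
    using orb_diag_subset[OF assms(1) _ d, of "g \<otimes>\<^bsub>AG\<^esub> (c, c)" "snd (act c) \<otimes>\<^bsub>bits\<^esub> \<beta>"]
      assms(2) FPF_diag[OF assms(3)] by (simp add: e)
qed

lemma orb_normal:
  assumes "N \<lhd> AG" "g \<in> carrier AG" "n \<in> N"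
  shows "orb N (n \<otimes>\<^bsub>AG\<^esub> g) \<beta> = orb N g \<beta>"
proof -
  interpret A: group AG by (rule group_AG)
  interpret N: normal N AG by fact
  have *: "orb N (n \<otimes>\<^bsub>AG\<^esub> g) \<beta> \<subseteq> orb N g \<beta>" if "g \<in> carrier AG" "n \<in> N" for g n
  proof
    fix p assume "p \<in> orb N (n \<otimes>\<^bsub>AG\<^esub> g) \<beta>"
    then obtain m v where p: "p = (m \<otimes>\<^bsub>AG\<^esub> (n \<otimes>\<^bsub>AG\<^esub> g) \<otimes>\<^bsub>AG\<^esub> (v, v), snd (act (inv\<^bsub>FP pF\<^esub> v)) \<otimes>\<^bsub>bits\<^esub> \<beta>)"
      "m \<in> N" "v \<in> carrier (FP pF)" by (auto simp: orb_def)
    have "p = (m \<otimes>\<^bsub>AG\<^esub> n \<otimes>\<^bsub>AG\<^esub> g \<otimes>\<^bsub>AG\<^esub> (v, v), snd (act (inv\<^bsub>FP pF\<^esub> v)) \<otimes>\<^bsub>bits\<^esub> \<beta>)"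
      unfolding p(1) using that p(2) by (simp add: A.m_assoc)
    moreover have "m \<otimes>\<^bsub>AG\<^esub> n \<in> N" using that p(2) by simp
    ultimately show "p \<in> orb N g \<beta>" using p(3) unfolding orb_def by blast
  qed
  have "orb N (inv\<^bsub>AG\<^esub> n \<otimes>\<^bsub>AG\<^esub> (n \<otimes>\<^bsub>AG\<^esub> g)) \<beta> \<subseteq> orb N (n \<otimes>\<^bsub>AG\<^esub> g) \<beta>"
    using assms by (intro *) auto
  moreover have "inv\<^bsub>AG\<^esub> n \<otimes>\<^bsub>AG\<^esub> (n \<otimes>\<^bsub>AG\<^esub> g) = g" using assms by (simp add: A.m_assoc[symmetric])
  ultimately show ?thesis using *[OF assms(2,3)] by simp
qed

text \<open>Different cosets of \<open>CG\<close> are separated because \<open>CG\<close> is closed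
  (\<open>CG_closed\<close>). If the cosets agree and only the bits differ, a diagonal element of N
  would have to move bits, which \<open>bits_separation\<close> excludes.\<close>

lemma orb_separation:
  assumes x: "x \<in> rep ` carrier AG" "y \<in> rep ` carrier AG" and ne: "(x, \<beta>) \<noteq> (y, \<beta>')"
  shows "\<exists>N. N \<lhd> AG \<and> fin_idx AG N \<and> (y, \<beta>') \<notin> orb N x \<beta>"
proof -
  interpret A: group AG by (rule group_AG)
  interpret F: group "FP pF" by (rule group_FP)
  interpret b: group bits by (rule group_bits)
  have c: "x \<in> carrier AG" "y \<in> carrier AG" "rep x = x" "rep y = y" using x rep(1) rep_rep by auto
  have conj: "inv\<^bsub>AG\<^esub> x \<otimes>\<^bsub>AG\<^esub> y = inv\<^bsub>AG\<^esub> x \<otimes>\<^bsub>AG\<^esub> n \<otimes>\<^bsub>AG\<^esub> x \<otimes>\<^bsub>AG\<^esub> (v, v)" "inv\<^bsub>AG\<^esub> x \<otimes>\<^bsub>AG\<^esub> n \<otimes>\<^bsub>AG\<^esub> x \<in> N"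
    if "y = n \<otimes>\<^bsub>AG\<^esub> x \<otimes>\<^bsub>AG\<^esub> (v, v)" "n \<in> N" "v \<in> carrier (FP pF)" "N \<lhd> AG" for n v N
  proof -
    interpret N: normal N AG by fact
    show "inv\<^bsub>AG\<^esub> x \<otimes>\<^bsub>AG\<^esub> y = inv\<^bsub>AG\<^esub> x \<otimes>\<^bsub>AG\<^esub> n \<otimes>\<^bsub>AG\<^esub> x \<otimes>\<^bsub>AG\<^esub> (v, v)"
      using that(1,2) c FPF_diag[OF that(3)] by (simp add: A.m_assoc)
    show "inv\<^bsub>AG\<^esub> x \<otimes>\<^bsub>AG\<^esub> n \<otimes>\<^bsub>AG\<^esub> x \<in> N" using N.inv_op_closed1[OF c(1) that(2)] .
  qed
  show ?thesis
  proof (cases "x = y")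
    case False
    have "inv\<^bsub>AG\<^esub> x \<otimes>\<^bsub>AG\<^esub> y \<notin> CG" using rep_eq_iff[OF c(1,2)] c(3,4) False by auto
    then obtain N where N: "N \<lhd> AG" "fin_idx AG N" "\<And>n c. n \<in> N \<Longrightarrow> c \<in> CG \<Longrightarrow> inv\<^bsub>AG\<^esub> x \<otimes>\<^bsub>AG\<^esub> y \<noteq> n \<otimes>\<^bsub>AG\<^esub> c"
      using CG_closed[of "inv\<^bsub>AG\<^esub> x \<otimes>\<^bsub>AG\<^esub> y"] c by auto
    have "(y, \<beta>') \<notin> orb N x \<beta>"
    proof
      assume "(y, \<beta>') \<in> orb N x \<beta>"
      then obtain n v where n: "y = n \<otimes>\<^bsub>AG\<^esub> x \<otimes>\<^bsub>AG\<^esub> (v, v)" "n \<in> N" "v \<in> carrier (FP pF)"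
        by (auto simp: orb_def)
      moreover have "(v, v) \<in> CG" using n by (auto simp: CG_def)
      ultimately show False using conj[OF n N(1)] N(3) by blast
    qed
    then show ?thesis using N by blast
  next
    case True
    obtain N where N: "N \<lhd> AG" "fin_idx AG N"
      "\<And>w. (w, w) \<in> N \<Longrightarrow> w \<in> carrier (FP pF) \<Longrightarrow> snd (act w) = (False, False)"
      using bits_separation by blast
    interpret N: normal N AG by (rule N(1))
    have "(y, \<beta>') \<notin> orb N x \<beta>"
    proof
      assume "(y, \<beta>') \<in> orb N x \<beta>"
      then obtain n v where n: "y = n \<otimes>\<^bsub>AG\<^esub> x \<otimes>\<^bsub>AG\<^esub> (v, v)" "n \<in> N" "v \<in> carrier (FP pF)"
        "\<beta>' = snd (act (inv\<^bsub>FP pF\<^esub> v)) \<otimes>\<^bsub>bits\<^esub> \<beta>"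
        by (auto simp: orb_def)
      note cj = conj[OF n(1-3) N(1)]
      have "inv\<^bsub>AG\<^esub> x \<otimes>\<^bsub>AG\<^esub> n \<otimes>\<^bsub>AG\<^esub> x \<otimes>\<^bsub>AG\<^esub> (v, v) = \<one>\<^bsub>AG\<^esub>"
        using cj(1) c True by simp
      then have "inv\<^bsub>AG\<^esub> (v, v) = inv\<^bsub>AG\<^esub> x \<otimes>\<^bsub>AG\<^esub> n \<otimes>\<^bsub>AG\<^esub> x"
        using A.inv_equality FPF_diag[OF n(3)] N.mem_carrier[OF cj(2)] by blast
      moreover have "inv\<^bsub>AG\<^esub> (v, v) = (inv\<^bsub>FP pF\<^esub> v, inv\<^bsub>FP pF\<^esub> v)"
        using group_hom.hom_inv[OF CG_hom n(3)] by simp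
      ultimately have "snd (act (inv\<^bsub>FP pF\<^esub> v)) = (False, False)"
        using cj(2) n(3) by (intro N(3)) auto
      then have "\<beta>' = \<beta>" using n(4) b.l_one[of \<beta>] by simp
      then show False using ne True by simp
    qed
    then show ?thesis using N by blast
  qed
qed

lemma orb_mono: "N' \<subseteq> N \<Longrightarrow> orb N' x \<beta> \<subseteq> orb N x \<beta>"
  by (auto simp: orb_def)

lemma orb_self: "N \<lhd> AG \<Longrightarrow> x \<in> carrier AG \<Longrightarrow> (x, \<beta>) \<in> orb N x \<beta>"
proof -
  assume N: "N \<lhd> AG" and x: "x \<in> carrier AG"
  interpret A: group AG by (rule group_AG)
  interpret F: group "FP pF" by (rule group_FP)
  interpret b: group bits by (rule group_bits)
  have "\<one>\<^bsub>AG\<^esub> \<in> N" using subgroup.one_closed[OF normal_imp_subgroup[OF N]] .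
  moreover have "x = \<one>\<^bsub>AG\<^esub> \<otimes>\<^bsub>AG\<^esub> x \<otimes>\<^bsub>AG\<^esub> ([], [])" using x by (simp add: one_AG[symmetric])
  moreover have "\<beta> = snd (act (inv\<^bsub>FP pF\<^esub> [])) \<otimes>\<^bsub>bits\<^esub> \<beta>"
    using b.l_one[of \<beta>] act_one F.inv_one by (simp add: one_FP)
  ultimately show ?thesis using F.one_closed unfolding orb_def one_FP by blast
qed


text \<open>Residual finiteness for n = 0, where the copies of D / <f> vanish and the base is a free
  product of infinite cyclic groups. If h has a nontrivial value w in the base, choose N separating
  the finitely many letters of w, and identify all letters in the same \<open>orb N\<close>. After
  this the cocycle no longer changes when q is shifted by N, so it restricts to a homomorphism from
  a finite index subgroup to a residually finite free product, where w survives.\<close>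

lemma (in step) rdepth_le_1_QG:
  assumes "carrier QQ = {\<one>\<^bsub>QQ\<^esub>}"
  shows "rdepth_le 1 QG"
proof (rule rdepth_leI[OF group_QG])
  fix h assume "h \<in> FRn QG 1"
  then have h: "h \<in> FR QG" "h \<in> carrier QG" "h \<in> FRn QG 1" using FR_subset[of QG] by auto
  interpret m: step_model S R f QG \<gamma> by (rule model_QG)
  interpret p: presentation S' "insert (ren f) R'" by (rule presentation_QG)
  interpret F: fp_family JJ HH by (rule fp_family_HH)
  interpret A: group AG by (rule group_AG)
  obtain \<Phi> where \<Phi>: "group_hom QG (wr WW AG) \<Phi>" "inj_on \<Phi> (carrier QG)"
    "\<And>n. n \<in> S' \<Longrightarrow> \<Phi> (\<gamma> n) = wgen WW \<delta> \<upsilon> n" using QG_embedding by blast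
  interpret \<Phi>: group_hom QG "wr WW AG" \<Phi> by fact
  interpret W: group WW by (rule F.group_fp)
  interpret s: group_hom "wr WW AG" AG snd by (rule wr_snd_hom[OF F.group_fp group_AG])
  define \<pi> where "\<pi> g = snd (\<Phi> g)" for g
  have \<pi>: "group_hom QG AG \<pi>"
    unfolding group_hom_def group_hom_axioms_def \<pi>_def
    using Group.hom_compose[OF \<Phi>.homh s.homh] by (simp add: comp_def group_QG group_AG)
  interpret \<pi>: group_hom QG AG \<pi> by fact
  have wc: "fst (\<Phi> g) q \<in> carrier WW" if "g \<in> carrier QG" "q \<in> carrier AG" for g q
    using \<Phi>.hom_closed[OF that(1)] that(2) by (auto simp: carrier_wr)
  have coc: "fst (\<Phi> (g \<otimes>\<^bsub>QG\<^esub> k)) q = fst (\<Phi> g) (\<pi> k \<otimes>\<^bsub>AG\<^esub> q) \<otimes>\<^bsub>WW\<^esub> fst (\<Phi> k) q"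
    if "g \<in> carrier QG" "k \<in> carrier QG" "q \<in> carrier AG" for g k q
    using \<Phi>.hom_mult[OF that(1,2)] that(3) by (cases "\<Phi> g"; cases "\<Phi> k") (simp add: mult_wr \<pi>_def)
  have "fst (\<Phi> h) q = \<one>\<^bsub>WW\<^esub>" if q: "q \<in> carrier AG" for q
  proof (rule ccontr)
    define w where "w = fst (\<Phi> h) q"
    assume "fst (\<Phi> h) q \<noteq> \<one>\<^bsub>WW\<^esub>"
    then have w: "w \<noteq> []" "fp_reduced JJ HH w"
      using wc[OF h(2) q] by (simp_all add: w_def one_fp carrier_fp)
    have letter: "\<exists>x i (\<beta> :: bool \<times> bool). x \<in> rep ` carrier AG \<and> i \<in> S \<and> m = to_nat (x, Some (i, \<beta>)) \<and>
        g \<in> carrier UU \<and> g \<noteq> \<one>\<^bsub>UU\<^esub>" if "(m, g) \<in> set w" for m g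
    proof -
      have "m \<in> JJ" "g \<in> carrier (HH m)" "g \<noteq> \<one>\<^bsub>HH m\<^esub>" using w(2) that by (auto simp: fp_reduced_def)
      from this(1) show ?thesis
      proof (cases rule: JJ_cases)
        case (1 x)
        then show ?thesis using \<open>g \<in> _\<close> \<open>g \<noteq> _\<close> assms by simp
      next
        case (2 x i \<beta>)
        then have "g \<in> carrier UU" "g \<noteq> \<one>\<^bsub>UU\<^esub>" using \<open>g \<in> _\<close> \<open>g \<noteq> _\<close> by simp_all
        then show ?thesis using 2(1,2) unfolding 2(3) by blast
      qed
    qed
    define lab where "lab m = (fst (from_nat m :: agrp \<times> (nat \<times> bool \<times> bool) option),
      snd (the (snd (from_nat m :: agrp \<times> (nat \<times> bool \<times> bool) option))))" for m
    define L where "L = (lab \<circ> fst) ` set w"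
    have L: "fst a \<in> rep ` carrier AG" if "a \<in> L" for a
      using that letter unfolding L_def lab_def by fastforce
    have "\<exists>N. N \<lhd> AG \<and> fin_idx AG N \<and>
        (\<forall>p\<in>{(a, b). a \<in> L \<and> b \<in> L \<and> a \<noteq> b}. snd p \<notin> orb N (fst (fst p)) (snd (fst p)))"
    proof (rule normal_separation[OF group_AG])
      have "finite (L \<times> L)" by (simp add: L_def)
      then show "finite {(a, b). a \<in> L \<and> b \<in> L \<and> a \<noteq> b}" by (rule rev_finite_subset) auto
      show "\<exists>N. N \<lhd> AG \<and> fin_idx AG N \<and> snd p \<notin> orb N (fst (fst p)) (snd (fst p))"
        if "p \<in> {(a, b). a \<in> L \<and> b \<in> L \<and> a \<noteq> b}" for p
      proof -
        obtain x \<beta> y \<beta>' where p: "p = ((x, \<beta>), (y, \<beta>'))" by (metis prod.exhaust)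
        then show ?thesis
          using that L[of "(x, \<beta>)"] L[of "(y, \<beta>')"] orb_separation[of x y \<beta> \<beta>'] by simp
      qed
    qed (use orb_mono in blast)
    then obtain N where N: "N \<lhd> AG" "fin_idx AG N"
      "\<And>a b. a \<in> L \<Longrightarrow> b \<in> L \<Longrightarrow> a \<noteq> b \<Longrightarrow> b \<notin> orb N (fst a) (snd a)" by fastforce
    interpret N: normal N AG by (rule N(1))
    \<comment> \<open>The new name of a letter u_i\<beta> at x keeps i and remembers
      \<open>(x, \<beta>)\<close> only modulo N.\<close>
    define \<sigma> where "\<sigma> m = (fst (the (snd (from_nat m :: agrp \<times> (nat \<times> bool \<times> bool) option))),
      orb N (fst (lab m)) (snd (lab m)))" for m
    \<comment> \<open>The factors with index \<open>None\<close> are trivial here, so they are sent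
      to 1.\<close>
    define e where "e m g = (case snd (from_nat m :: agrp \<times> (nat \<times> bool \<times> bool) option) of
      None \<Rightarrow> \<one>\<^bsub>UU\<^esub> | Some _ \<Rightarrow> g)" for m and g :: "nat word set"
    let ?U = "\<lambda>_ :: nat \<times> (agrp \<times> bool \<times> bool) set. UU"
    let ?F = "fp UNIV ?U"
    interpret U: fp_family UNIV ?U by (rule fp_family.intro) (rule group_UU)
    interpret FF: group ?F by (rule U.group_fp)
    define \<theta> where "\<theta> = fp_lift ?F (\<lambda>m g. fp_in ?U (\<sigma> m) (e m g))"
    have E: "(\<lambda>g. fp_in ?U (\<sigma> m) (e m g)) \<in> hom (HH m) ?F" if "m \<in> JJ" for m
    proof -
      interpret u: group_hom UU ?F "fp_in ?U (\<sigma> m)" by (rule U.fp_in_hom) simp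
      show ?thesis
        by (rule homI) (auto simp: e_def HH_def split: option.splits)
    qed
    have \<theta>: "group_hom WW ?F \<theta>" unfolding \<theta>_def by (intro F.fp_lift_hom FF.group_axioms E)
    interpret \<theta>: group_hom WW ?F \<theta> by fact
    have \<theta>d: "\<theta> (\<delta> x (cls S R (gen i))) = \<one>\<^bsub>?F\<^esub>" if "x \<in> carrier AG" "i \<in> S" for x i
    proof -
      have "\<rho> (cls S R (gen i)) \<in> carrier QQ"
        using cls_gen_closed that(2) group_hom.hom_closed[OF \<rho>(1)] by auto
      then have "\<rho> (cls S R (gen i)) = \<one>\<^bsub>QQ\<^esub>" using assms by blast
      then show ?thesis
        using monoid.one_closed[OF group.is_monoid[OF group_QQ]] group_hom.hom_one[OF U.fp_in_hom]
          F.fp_lift_in[OF FF.group_axioms E JJ_mem(1)[OF that(1)], of "\<one>\<^bsub>QQ\<^esub>"]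
        by (simp add: \<theta>_def \<delta>_def e_def)
    qed
    have \<theta>u: "\<theta> (\<upsilon> x i \<beta>) = fp_in ?U (i, orb N (rep x) \<beta>) u0" if "x \<in> carrier AG" "i \<in> S" for x i \<beta>
      using F.fp_lift_in[OF FF.group_axioms E JJ_mem(2)[OF that, of \<beta>], of u0]
      by (simp add: \<theta>_def \<upsilon>_def e_def \<sigma>_def lab_def)
    \<comment> \<open>By normality of N a shift on the right of \<pi> k is also one on its left, so
      invariance for g survives the twist in the cocycle rule.\<close>
    have shift: "\<theta> (fst (\<Phi> g) (\<pi> k \<otimes>\<^bsub>AG\<^esub> (n \<otimes>\<^bsub>AG\<^esub> q))) = \<theta> (fst (\<Phi> g) (\<pi> k \<otimes>\<^bsub>AG\<^esub> q))"
      if "\<forall>n\<in>N. \<forall>q\<in>carrier AG. \<theta> (fst (\<Phi> g) (n \<otimes>\<^bsub>AG\<^esub> q)) = \<theta> (fst (\<Phi> g) q)"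
        and k: "k \<in> carrier QG" and n: "n \<in> N" "q \<in> carrier AG" for g k n q
    proof -
      have "inv\<^bsub>AG\<^esub> \<pi> k \<otimes>\<^bsub>AG\<^esub> (\<pi> k \<otimes>\<^bsub>AG\<^esub> q) = q"
        using n \<pi>.hom_closed[OF k] by (simp add: A.m_assoc[symmetric])
      then have "\<pi> k \<otimes>\<^bsub>AG\<^esub> (n \<otimes>\<^bsub>AG\<^esub> q) = \<pi> k \<otimes>\<^bsub>AG\<^esub> n \<otimes>\<^bsub>AG\<^esub> inv\<^bsub>AG\<^esub> \<pi> k \<otimes>\<^bsub>AG\<^esub> (\<pi> k \<otimes>\<^bsub>AG\<^esub> q)"
        using k n \<pi>.hom_closed[OF k] N.mem_carrier[OF n(1)]
        by (simp add: A.m_assoc)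
      moreover have "\<pi> k \<otimes>\<^bsub>AG\<^esub> n \<otimes>\<^bsub>AG\<^esub> inv\<^bsub>AG\<^esub> \<pi> k \<in> N"
        using N.inv_op_closed2[OF \<pi>.hom_closed[OF k] n(1)] .
      ultimately show ?thesis using that(1) n(2) \<pi>.hom_closed[OF k] by simp
    qed
    have gens: "t \<in> carrier QG \<and> (\<forall>n\<in>N. \<forall>q\<in>carrier AG. \<theta> (fst (\<Phi> t) (n \<otimes>\<^bsub>AG\<^esub> q)) = \<theta> (fst (\<Phi> t) q))"
      if "t \<in> \<gamma> ` S'" for t
    proof (intro conjI ballI)
      obtain k where k: "t = \<gamma> k" "k \<in> S'" using \<open>t \<in> \<gamma> ` S'\<close> by blast
      show "t \<in> carrier QG" using p.cls_gen_closed k by (auto simp: \<gamma>_abs)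
      fix n q assume n: "n \<in> N" and q: "q \<in> carrier AG"
      have nq: "n \<otimes>\<^bsub>AG\<^esub> q \<in> carrier AG" using n q N.mem_carrier by simp
      consider "k < 8" | i where "i \<in> S" "k = dgen i" | i \<beta> where "i \<in> S" "k = ugen i \<beta>"
        using k(2) by (auto simp: S'_def)
      then show "\<theta> (fst (\<Phi> t) (n \<otimes>\<^bsub>AG\<^esub> q)) = \<theta> (fst (\<Phi> t) q)"
      proof cases
        case 1
        then show ?thesis using \<Phi>(3)[OF k(2)] k(1) q nq by (simp add: wgen_def assign_simps)
      next
        case (2 i)
        then show ?thesis
          using \<Phi>(3)[OF k(2)] k(1) q nq \<theta>d rep(1) by (simp add: wgen_def assign_simps)
      next
        case (3 i \<beta>)
        have u: "\<theta> (fst (\<Phi> t) q) = fp_in ?U (i, orb N (inv\<^bsub>AG\<^esub> q) \<beta>) u0" if q: "q \<in> carrier AG" for q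
        proof -
          define x where "x = rep (inv\<^bsub>AG\<^esub> q)"
          define c where "c = cpart (inv\<^bsub>AG\<^esub> q)"
          note r = rep[OF A.inv_closed[OF q], folded x_def c_def]
          have rx: "rep x = x" unfolding x_def by (rule rep_rep) (use q in simp)
          have dc: "\<delta> x (cls S R (gen i)) \<in> carrier WW"
            using group_hom.hom_closed[OF \<delta>_hom[OF r(1)]] cls_gen_closed 3(1) by auto
          have "\<theta> (fst (\<Phi> t) q) = \<theta> (\<upsilon> x i (snd (act c) \<otimes>\<^bsub>bits\<^esub> \<beta>) \<otimes>\<^bsub>WW\<^esub> \<delta> x (cls S R (gen i)) [^]\<^bsub>WW\<^esub> fst (act c) \<beta>)"
            using \<Phi>(3)[OF k(2)] q k(1) 3 by (simp add: wgen_def assign_simps x_def[symmetric] c_def[symmetric] Let_def)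
          also have "\<dots> = fp_in ?U (i, orb N x (snd (act c) \<otimes>\<^bsub>bits\<^esub> \<beta>)) u0"
            using \<upsilon>_closed[OF r(1) 3(1)] dc \<theta>.hom_int_pow[OF dc] \<theta>d[OF r(1) 3(1)] \<theta>u[OF r(1) 3(1)]
              U.fp_in_closed[of _ u0] by (simp add: rx)
          also have "orb N x (snd (act c) \<otimes>\<^bsub>bits\<^esub> \<beta>) = orb N (inv\<^bsub>AG\<^esub> q) \<beta>"
            using orb_diag[OF N(1) r(1,2), of \<beta>] r(3) by simp
          finally show ?thesis .
        qed
        have "inv\<^bsub>AG\<^esub> (n \<otimes>\<^bsub>AG\<^esub> q) = inv\<^bsub>AG\<^esub> q \<otimes>\<^bsub>AG\<^esub> inv\<^bsub>AG\<^esub> n \<otimes>\<^bsub>AG\<^esub> q \<otimes>\<^bsub>AG\<^esub> inv\<^bsub>AG\<^esub> q"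
          using q N.mem_carrier[OF n] by (simp add: A.inv_mult_group A.m_assoc)
        moreover have "inv\<^bsub>AG\<^esub> q \<otimes>\<^bsub>AG\<^esub> inv\<^bsub>AG\<^esub> n \<otimes>\<^bsub>AG\<^esub> q \<in> N"
          using N.inv_op_closed1[OF q N.m_inv_closed[OF n]] .
        ultimately have "orb N (inv\<^bsub>AG\<^esub> (n \<otimes>\<^bsub>AG\<^esub> q)) \<beta> = orb N (inv\<^bsub>AG\<^esub> q) \<beta>"
          using orb_normal[OF N(1) A.inv_closed[OF q]] by simp
        then show ?thesis using u[OF q] u[OF nq] by simp
      qed
    qed
    have inv: "g \<in> carrier QG \<and> (\<forall>n\<in>N. \<forall>q\<in>carrier AG. \<theta> (fst (\<Phi> g) (n \<otimes>\<^bsub>AG\<^esub> q)) = \<theta> (fst (\<Phi> g) q))"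
      if "g \<in> carrier QG" for g
    proof -
      have "g \<in> generate QG (\<gamma> ` S')" using that p.generate_gens by (simp add: \<gamma>_abs)
      then show ?thesis
      proof (induction rule: generate.induct)
        case one
        then show ?case using \<Phi>.hom_one N.mem_carrier by (simp add: one_wr)
      next
        case (incl t)
        then show ?case using gens by blast
      next
        case (inv t)
        then obtain k where k: "t = \<gamma> k" "k \<in> S'" by blast
        have t: "t \<in> carrier QG" using inv gens by blast
        have "\<theta> (fst (\<Phi> (inv\<^bsub>QG\<^esub> t)) q) = inv\<^bsub>?F\<^esub> \<theta> (fst (\<Phi> t) (\<pi> (inv\<^bsub>QG\<^esub> t) \<otimes>\<^bsub>AG\<^esub> q))"
          if "q \<in> carrier AG" for q
        proof -
          have c: "fst (\<Phi> t) (\<pi> (inv\<^bsub>QG\<^esub> t) \<otimes>\<^bsub>AG\<^esub> q) \<in> carrier WW" "fst (\<Phi> (inv\<^bsub>QG\<^esub> t)) q \<in> carrier WW"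
            using wc[OF t A.m_closed[OF \<pi>.hom_closed[OF m.K.inv_closed[OF t]] that]]
              wc[OF m.K.inv_closed[OF t] that] by simp_all
          have "fst (\<Phi> t) (\<pi> (inv\<^bsub>QG\<^esub> t) \<otimes>\<^bsub>AG\<^esub> q) \<otimes>\<^bsub>WW\<^esub> fst (\<Phi> (inv\<^bsub>QG\<^esub> t)) q = \<one>\<^bsub>WW\<^esub>"
            using coc[OF t m.K.inv_closed[OF t] that] t that \<Phi>.hom_one by (simp add: one_wr)
          then have "fst (\<Phi> (inv\<^bsub>QG\<^esub> t)) q = inv\<^bsub>WW\<^esub> (fst (\<Phi> t) (\<pi> (inv\<^bsub>QG\<^esub> t) \<otimes>\<^bsub>AG\<^esub> q))"
            using W.inv_equality[OF W.inv_comm] c by simp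
          then show ?thesis using c by simp
        qed
        moreover have "\<theta> (fst (\<Phi> t) (\<pi> (inv\<^bsub>QG\<^esub> t) \<otimes>\<^bsub>AG\<^esub> (n \<otimes>\<^bsub>AG\<^esub> q))) =
            \<theta> (fst (\<Phi> t) (\<pi> (inv\<^bsub>QG\<^esub> t) \<otimes>\<^bsub>AG\<^esub> q))" if "n \<in> N" "q \<in> carrier AG" for n q
          using t that gens[OF inv] by (intro shift m.K.inv_closed) blast+
        ultimately show ?case using t N.mem_carrier by simp
      next
        case (eng t k)
        then have tk: "t \<in> carrier QG" "k \<in> carrier QG" by blast+
        have "\<theta> (fst (\<Phi> t) (\<pi> k \<otimes>\<^bsub>AG\<^esub> (n \<otimes>\<^bsub>AG\<^esub> q))) = \<theta> (fst (\<Phi> t) (\<pi> k \<otimes>\<^bsub>AG\<^esub> q))"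
          if "n \<in> N" "q \<in> carrier AG" for n q
          using that eng.IH tk by (intro shift) blast+
        then show ?case
          using eng.IH tk wc N.mem_carrier coc \<pi>.hom_closed[OF tk(2)] by simp
      qed
    qed
    \<comment> \<open>On \<open>H0\<close> the twist by \<pi> k is a shift by an element of N, so it
      disappears and the cocycle becomes multiplicative.\<close>
    define H0 where "H0 = {g \<in> carrier QG. \<pi> g \<in> N}"
    have H0: "fin_idx QG H0" unfolding H0_def using fin_idx_preimage[OF \<pi> N(2)] .
    have hom0: "group_hom (QG\<lparr>carrier := H0\<rparr>) ?F (\<lambda>g. \<theta> (fst (\<Phi> g) q))"
      unfolding group_hom_def group_hom_axioms_def
    proof (intro conjI)
      show "group (QG\<lparr>carrier := H0\<rparr>)"
        using subgroup.subgroup_is_group[OF fin_idx_subgroup[OF H0] group_QG] .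
      show "(\<lambda>g. \<theta> (fst (\<Phi> g) q)) \<in> hom (QG\<lparr>carrier := H0\<rparr>) ?F"
      proof (rule homI)
        fix g k assume "g \<in> carrier (QG\<lparr>carrier := H0\<rparr>)" "k \<in> carrier (QG\<lparr>carrier := H0\<rparr>)"
        then have gk: "g \<in> carrier QG" "k \<in> carrier QG" "\<pi> k \<in> N" by (auto simp: H0_def)
        then have "\<theta> (fst (\<Phi> g) (\<pi> k \<otimes>\<^bsub>AG\<^esub> q)) = \<theta> (fst (\<Phi> g) q)" using inv[OF gk(1)] q by blast
        then show "\<theta> (fst (\<Phi> (g \<otimes>\<^bsub>QG\<lparr>carrier := H0\<rparr>\<^esub> k)) q) = \<theta> (fst (\<Phi> g) q) \<otimes>\<^bsub>?F\<^esub> \<theta> (fst (\<Phi> k) q)"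
          using coc[OF gk(1,2) q] wc gk q \<pi>.hom_closed[OF gk(2)] by simp
      qed (use wc q in \<open>simp add: H0_def\<close>)
    qed (rule FF.group_axioms)
    have h0: "h \<in> FRn (QG\<lparr>carrier := H0\<rparr>) 1"
      using FR_fin_idx[OF group_QG H0] h(1) by auto
    have "rdepth_le 1 ?F" using U.rdepth_le_fp_1 rdepth_le_UU by blast
    from rdepth_le_hom[OF this hom0 h0] have 1: "\<theta> w = \<one>\<^bsub>?F\<^esub>" unfolding w_def .
    \<comment> \<open>By the choice of N no two letters of w are identified, so the substituted word
      is still reduced.\<close>
    have inj: "inj_on \<sigma> (fst ` set w)"
    proof (rule inj_onI)
      fix m m' assume mm: "m \<in> fst ` set w" "m' \<in> fst ` set w" and eq: "\<sigma> m = \<sigma> m'"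
      then have lL: "lab m \<in> L" "lab m' \<in> L" by (auto simp: L_def)
      obtain x x' :: agrp and i i' :: nat and \<beta> \<beta>' :: "bool \<times> bool" where m: "m = to_nat (x, Some (i, \<beta>))" "m' = to_nat (x', Some (i', \<beta>'))"
        "x' \<in> rep ` carrier AG" "x \<in> rep ` carrier AG"
      proof -
        obtain g g' where "(m, g) \<in> set w" "(m', g') \<in> set w" using mm by auto
        from letter[OF this(1)] letter[OF this(2)] show ?thesis using that by blast
      qed
      then have l: "lab m = (x, \<beta>)" "lab m' = (x', \<beta>')" by (simp_all add: lab_def)
      have "x' \<in> carrier AG" using m(3) rep(1) by auto
      then have "(x', \<beta>') \<in> orb N x \<beta>" "i = i'"
        using eq orb_self[OF N(1), of x' \<beta>'] l m by (auto simp: \<sigma>_def)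
      then have "(x, \<beta>) = (x', \<beta>')" using N(3)[OF lL] l by auto
      then show "m = m'" using m \<open>i = i'\<close> by simp
    qed
    have "fp_reduced UNIV ?U (map (\<lambda>(m, g). (\<sigma> m, e m g)) w)"
      unfolding fp_reduced_def
    proof
      have "map fst (map (\<lambda>(m, g). (\<sigma> m, e m g)) w) = map \<sigma> (map fst w)" by auto
      moreover have "distinct_adj (map fst w)" using w(2) by (simp add: fp_reduced_def)
      ultimately show "distinct_adj (map fst (map (\<lambda>(m, g). (\<sigma> m, e m g)) w))"
        using distinct_adj_map_iff[of \<sigma> "map fst w"] inj by (simp only: set_map)
      have "e m g \<in> carrier UU \<and> e m g \<noteq> \<one>\<^bsub>UU\<^esub>" if "(m, g) \<in> set w" for m g
        using letter[OF that] by (auto simp: e_def)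
      then show "\<forall>(i, g)\<in>set (map (\<lambda>(m, g). (\<sigma> m, e m g)) w). i \<in> UNIV \<and> g \<in> carrier UU \<and> g \<noteq> \<one>\<^bsub>UU\<^esub>"
        by auto
    qed
    from fp_lift_map[OF U.fp_family_axioms this] have "\<theta> w = map (\<lambda>(m, g). (\<sigma> m, e m g)) w"
      unfolding \<theta>_def .
    then show False using 1 w(1) by (simp add: one_fp)
  qed
  moreover have "\<pi> h = \<one>\<^bsub>AG\<^esub>" using rdepth_le_hom[OF rdepth_le_AG \<pi> h(3)] .
  moreover have "fst (\<Phi> h) \<in> extensional (carrier AG)"
    using \<Phi>.hom_closed[OF h(2)] by (auto simp: carrier_wr PiE_def)
  ultimately have "\<Phi> h = \<one>\<^bsub>wr WW AG\<^esub>"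
    unfolding one_wr \<pi>_def by (intro prod_eqI) (auto intro!: extensionalityI[of _ "carrier AG"])
  then show "h = \<one>\<^bsub>QG\<^esub>"
    using \<Phi>(2) h(2) \<Phi>.hom_one by (metis inj_onD m.K.one_closed)
qed

section \<open>The induction\<close>

lemma (in central_step) step':
  "central_step S' R' (ren f) (Suc n)"
proof -
  interpret p: presentation S' R' by (rule presentation')
  have "rdepth_le (Suc n) QG"
  proof (cases "n = 0")
    case True
    then have "carrier QQ = {\<one>\<^bsub>QQ\<^esub>}" using quotient by (simp add: rdepth_le_def)
    then show ?thesis using rdepth_le_1_QG True by simp
  qed (use rdepth_le_QG[OF _ quotient] in simp)
  then show ?thesis
    by unfold_locales
      (use finite_S' finite_R' ren_closed[OF f] central' involution' nontrivial' in_FRn' in auto)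
qed

text \<open>For the group of order 2 everything is read off the presentation: adding the generator
  as a relator gives the trivial group, where already \<open>FRn\<close> at 0 is trivial.\<close>

lemma central_step_0: "central_step {0} {[(0, True), (0, True)]} (gen 0) 0"
proof -
  let ?R = "{[(0 :: nat, True), (0, True)]}"
  let ?P = "presented_group {0} ?R"
  have c: "?R \<subseteq> carrier (free_group {0})" by (simp add: carrier_free_group reduced_def inv_letter_def)
  interpret p: presentation "{0}" ?R using c by (rule presentation.intro)
  interpret F: group "free_group {0 :: nat}" by (rule group_free_group)
  interpret P: group ?P by (rule p.group_presented)
  interpret h: group_hom "free_group {0}" ?P "cls {0} ?R" by (rule p.cls_hom)
  have g: "gen (0 :: nat) \<in> carrier (free_group {0})" by (rule gen_closed) simp
  then have gc: "cls {0} ?R (gen 0) \<in> carrier ?P" by simp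
  show ?thesis
  proof unfold_locales
    show "gen (0 :: nat) \<in> carrier (free_group {0})" by (rule g)
    show "cls {0} ?R (gen 0) \<otimes>\<^bsub>?P\<^esub> x = x \<otimes>\<^bsub>?P\<^esub> cls {0} ?R (gen 0)" if "x \<in> carrier ?P" for x
      using p.commute_gens[OF gc _ that] by simp
    have "gen (0 :: nat) \<otimes>\<^bsub>free_group {0}\<^esub> gen 0 = [(0, True), (0, True)]"
      by (simp add: free_group_def inv_letter_def)
    then show "cls {0} ?R (gen 0) \<otimes>\<^bsub>?P\<^esub> cls {0} ?R (gen 0) = \<one>\<^bsub>?P\<^esub>"
      using h.hom_mult[OF g g] p.cls_relator by simp
    show "cls {0} ?R (gen 0) \<noteq> \<one>\<^bsub>?P\<^esub>"
    proof
      assume *: "cls {0} ?R (gen 0) = \<one>\<^bsub>?P\<^esub>"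
      \<comment> \<open>Any group with an involution shows that the generator is nontrivial; the
        group of bits is at hand.\<close>
      obtain h where "group_hom ?P bits h" "h (cls {0} ?R (gen 0)) = (True, False)"
        using p.presented_lift[OF group_bits, of "\<lambda>_. (True, False)"] by (auto simp: word_eval_Cons)
      then show False using * group_hom.hom_one by fastforce
    qed
    show "cls {0} ?R (gen 0) \<in> FRn ?P 0" using gc by simp
    have "insert (gen 0) ?R \<subseteq> carrier (free_group {0})" using c g by simp
    then interpret q: presentation "{0}" "insert (gen 0) ?R" by (rule presentation.intro)
    interpret Q: group "presented_group {0} (insert (gen 0) ?R)" by (rule q.group_presented)
    have "cls {0} (insert (gen 0) ?R) (gen 0) = \<one>\<^bsub>presented_group {0} (insert (gen 0) ?R)\<^esub>"
      by (rule q.cls_relator) simp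
    then have "carrier (presented_group {0} (insert (gen 0) ?R)) = {\<one>\<^bsub>presented_group {0} (insert (gen 0) ?R)\<^esub>}"
      using q.generate_gens Q.generate_one by simp
    then show "rdepth_le 0 (presented_group {0} (insert (gen 0) ?R))"
      by (simp add: rdepth_le_def Q.group_axioms)
  qed (use c in auto)
qed

lemma central_step_exists: "\<exists>S R f. central_step S R f n"
proof (induction n)
  case 0
  then show ?case using central_step_0 by blast
next
  case (Suc n)
  then show ?case using central_step.step' by blast
qed

context central_step
begin

text \<open>As f is a central involution, 1 and f form a normal subgroup. The quotient by it
  satisfies the relators of \<open>QQ\<close>, so \<open>QQ\<close> maps to it and no more than this
  subgroup is killed.\<close>

lemma kernel_\<rho>: "x \<in> carrier DD \<Longrightarrow> \<rho> x = \<one>\<^bsub>QQ\<^esub> \<Longrightarrow> x \<in> {\<one>\<^bsub>DD\<^esub>, cls S R f}"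
proof -
  assume x: "x \<in> carrier DD" "\<rho> x = \<one>\<^bsub>QQ\<^esub>"
  interpret D: group DD by (rule group_presented)
  interpret q: presentation S "insert f R" by (rule presentation_QQ)
  let ?Z = "{\<one>\<^bsub>DD\<^esub>, cls S R f}"
  have "inv\<^bsub>DD\<^esub> (cls S R f) = cls S R f"
    using involution cls_f_closed D.inv_equality by blast
  then have "subgroup ?Z DD"
    using involution cls_f_closed by (intro D.subgroupI) auto
  moreover have "x \<otimes>\<^bsub>DD\<^esub> cls S R f \<otimes>\<^bsub>DD\<^esub> inv\<^bsub>DD\<^esub> x = cls S R f" if "x \<in> carrier DD" for x
    using central[OF that] that cls_f_closed by (metis D.inv_solve_right' D.m_closed)
  ultimately have N: "?Z \<lhd> DD" by (auto simp: D.normal_inv_iff)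
  interpret Z: normal ?Z DD by (rule N)
  have hZ: "group_hom DD (DD Mod ?Z) (\<lambda>x. ?Z #>\<^bsub>DD\<^esub> x)"
    using Z.r_coset_hom_Mod Z.factorgroup_is_group
    by (simp add: group_hom_def group_hom_axioms_def D.group_axioms)
  have ev: "word_eval (DD Mod ?Z) (\<lambda>i. ?Z #>\<^bsub>DD\<^esub> cls S R (gen i)) w = ?Z #>\<^bsub>DD\<^esub> cls S R w"
    if "w \<in> carrier (free_group S)" for w
    using word_eval_comp[OF hZ cls_gen_closed, of w] cls_eq_word_eval[OF that] that by (simp add: carrier_free_group)
  have gens: "(\<lambda>i. ?Z #>\<^bsub>DD\<^esub> cls S R (gen i)) \<in> S \<rightarrow> carrier (DD Mod ?Z)"
    using cls_gen_closed group_hom.hom_closed[OF hZ] by auto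
  have rel: "word_eval (DD Mod ?Z) (\<lambda>i. ?Z #>\<^bsub>DD\<^esub> cls S R (gen i)) r = \<one>\<^bsub>DD Mod ?Z\<^esub>" if "r \<in> insert f R" for r
  proof -
    have "cls S R r \<in> ?Z" "r \<in> carrier (free_group S)" using that cls_relator[of r] f R by auto
    moreover from this have "cls S R r \<in> carrier DD" using Z.mem_carrier by blast
    ultimately show ?thesis
      using ev[of r] D.coset_join2[OF _ Z.is_subgroup, of "cls S R r"] by simp
  qed
  obtain h where h: "group_hom QQ (DD Mod ?Z) h"
    "\<And>w. w \<in> carrier (free_group S) \<Longrightarrow> h (cls S (insert f R) w) = ?Z #>\<^bsub>DD\<^esub> cls S R w"
    using q.presented_lift[OF Z.factorgroup_is_group gens rel] ev by metis
  obtain w where w: "w \<in> carrier (free_group S)" "x = cls S R w" using x(1) by (auto simp: carrier_presented)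
  then have "?Z #>\<^bsub>DD\<^esub> x = ?Z"
    using h(2)[OF w(1)] x(2) \<rho>(2)[OF w(1)] group_hom.hom_one[OF h(1)] by simp
  then show "x \<in> ?Z" using D.rcos_self[OF x(1) Z.is_subgroup] by simp
qed

lemma FRn_DD: "FRn DD n = {\<one>\<^bsub>DD\<^esub>, cls S R f}"
proof
  show "FRn DD n \<subseteq> {\<one>\<^bsub>DD\<^esub>, cls S R f}"
  proof
    fix x assume x: "x \<in> FRn DD n"
    then have "\<rho> x = \<one>\<^bsub>QQ\<^esub>" by (rule rdepth_le_hom[OF quotient \<rho>(1)])
    moreover have "x \<in> carrier DD" using x FRn_antimono[of 0 n DD] by auto
    ultimately show "x \<in> {\<one>\<^bsub>DD\<^esub>, cls S R f}" using kernel_\<rho> by blast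
  qed
  show "{\<one>\<^bsub>DD\<^esub>, cls S R f} \<subseteq> FRn DD n" using in_FRn FRn_one_closed[OF group_presented] by simp
qed

text \<open>The map from D to \<open>QQ\<close> has fibres of at most two elements. If
  \<open>FRn QQ k\<close> were finite, so would be \<open>FRn DD k\<close>, and a finite group has
  trivial finite residual; but f lies in the next iterate.\<close>

lemma FRn_QQ_infinite:
  assumes "n = Suc k"
  shows "infinite (FRn QQ k)"
proof
  assume fin: "finite (FRn QQ k)"
  interpret r: group_hom DD QQ \<rho> by (rule \<rho>)
  have sub: "FRn DD k \<subseteq> carrier DD" using FRn_antimono[of 0 k DD] by simp
  have "finite {x \<in> carrier DD. \<rho> x = y}" for y
  proof (cases "\<exists>x. x \<in> carrier DD \<and> \<rho> x = y")
    case True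
    then obtain x where x: "x \<in> carrier DD" "\<rho> x = y" by blast
    have "z \<in> {x, cls S R f \<otimes>\<^bsub>DD\<^esub> x}" if z: "z \<in> carrier DD" "\<rho> z = y" for z
    proof -
      have "z \<otimes>\<^bsub>DD\<^esub> inv\<^bsub>DD\<^esub> x \<in> {\<one>\<^bsub>DD\<^esub>, cls S R f}"
        using x z r.hom_closed[OF x(1)] by (intro kernel_\<rho>) simp_all
      then have "z \<otimes>\<^bsub>DD\<^esub> inv\<^bsub>DD\<^esub> x \<otimes>\<^bsub>DD\<^esub> x \<in> {x, cls S R f \<otimes>\<^bsub>DD\<^esub> x}" using x(1) by auto
      then show ?thesis using x z by (simp add: r.G.m_assoc)
    qed
    then have "{z \<in> carrier DD. \<rho> z = y} \<subseteq> {x, cls S R f \<otimes>\<^bsub>DD\<^esub> x}" by blast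
    then show ?thesis by (rule finite_subset) simp
  next
    case False
    then have "{x \<in> carrier DD. \<rho> x = y} = {}" by blast
    then show ?thesis by (simp only: finite.emptyI)
  qed
  then have "finite (\<Union>y\<in>FRn QQ k. {x \<in> carrier DD. \<rho> x = y})" using fin by blast
  moreover have "FRn DD k \<subseteq> (\<Union>y\<in>FRn QQ k. {x \<in> carrier DD. \<rho> x = y})"
    using FRn_hom[OF \<rho>(1)] sub by blast
  ultimately have "finite (FRn DD k)" by (rule rev_finite_subset)
  then have "rdepth_le 1 (DD\<lparr>carrier := FRn DD k\<rparr>)"
    using FRn_group[OF group_presented] by (intro rdepth_le_finite) simp_all
  then have "FRn DD (Suc k) = {\<one>\<^bsub>DD\<^esub>}" by (simp add: rdepth_le_def)
  then show False using in_FRn nontrivial assms by simp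
qed

end

theorem theorem1:
  fixes n :: nat
  assumes "n > 0"
  shows "(\<exists>\<Gamma> :: nat word set monoid. group \<Gamma> \<and> finitely_presented \<Gamma> \<and>
            has_RF_depth \<Gamma> (ord_times natLeq (natLeq_on n))) \<and>
         (\<exists>M :: nat word set monoid. group M \<and> finitely_presented M \<and>
            has_RF_depth M (ord_plus (ord_times natLeq (natLeq_on n)) (natLeq_on 1)))"
proof -
  obtain k where k: "n = Suc k" using assms not0_implies_Suc by blast
  obtain S R f where "central_step S R f n" using central_step_exists by blast
  then interpret central_step S R f n .
  have fp: "finitely_presented DD" "finitely_presented QQ"
    unfolding finitely_presented_def using finS finR R f by (metis iso_refl, metis finite_insert insert_subset iso_refl)
  have "countable S" using finS by (rule countable_finite)
  then have c: "countable (carrier DD)" "countable (carrier QQ)"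
    using countable_presented presentation.countable_presented[OF presentation_QQ] by blast+
  have inf: "infinite (FRn QQ k)" using FRn_QQ_infinite[OF k] .
  have "FRn QQ n = {\<one>\<^bsub>QQ\<^esub>}" using quotient by (simp add: rdepth_le_def)
  then have "has_RF_depth QQ (ord_times natLeq (natLeq_on n))"
    using has_RF_depth_omn[OF group_QQ c(2) _ inf k] by blast
  moreover have "infinite (FRn DD k)"
  proof
    assume fin: "finite (FRn DD k)"
    then have "rdepth_le 1 (DD\<lparr>carrier := FRn DD k\<rparr>)"
      using FRn_group[OF group_presented] by (intro rdepth_le_finite) simp_all
    then have "FRn DD (Suc k) = {\<one>\<^bsub>DD\<^esub>}" by (simp add: rdepth_le_def)
    then show False using in_FRn nontrivial k by simp
  qed
  then have "has_RF_depth DD (ord_plus (ord_times natLeq (natLeq_on n)) (natLeq_on 1))"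
    using has_RF_depth_omn_plus_1[OF group_presented c(1) _ _ _ k] nontrivial by (simp add: FRn_DD)
  ultimately show ?thesis using fp group_presented group_QQ by blast
qed

end
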